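(* Let $N>1$, $G=\mathrm{SL}(N,\mathbf{R})$, and let $\mu$ be a Siegel measure supported on $\mathcal{M}_N^e$. There exists a sequence $R_n\to\infty$ such that for $\mu$-a.e. $\nu$ $$\lim_{n\to\infty}g^{-1}\nu_{R_n}(B)=c(\mu)\frac{\sigma_N}N\qquad(\text{for all }g\in G)$$ and $$\lim_{n\to\infty}\nu_{R_n}=c(\mu)\,m,$$ where convergence in the second line is in the $C_c(\mathbf{R}^N)$ topology, i.e. $\int\psi\,d\nu_{R_n}\to c(\mu)\int\psi\,dm$ for all $\psi\in C_c(\mathbf{R}^N)$.
   Context: $\mathcal{M}_N$ is the set of Borel measures $\nu$ on $\mathbf{R}^N$ with $\sup_{R>0}\nu(B(0,R))/R^N<\infty$, where $B(0,R)$ is the open ball of radius $R$ about $0$, endowed with the $C_c(\mathbf{R}^N)$ weak-$*$ topology and its Borel $\sigma$-algebra; $\mathcal{M}_N^e$ is the subset of $\nu$ with $\nu(-U)=\nu(U)$ for all Borel $U$. $G$ acts on $\mathcal{M}_N$ by $(g\nu)(E)=\nu(g^{-1}E)$, so $g^{-1}\nu(E)=\nu(gE)$. A Siegel measure is a Borel probability measure on $\mathcal{M}_N$ invariant and ergodic for this action. For a Siegel measure $\mu$, $c(\mu)<\infty$ is the constant (which exists for every Siegel measure) such that $\int_{\mathcal{M}_N}\left(\int\psi\,d\nu\right)\mu(d\nu)=c(\mu)\int\psi\,dm$ for all Borel $\psi\in L^1(\mathbf{R}^N,m)$, $m$ being Lebesgue measure. For $R>0$, $\nu_R(U)=R^{-N}\nu(RU)$.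 $B=B(0,1)$, and $\sigma_N$ is the area of the unit sphere in $\mathbf{R}^N$. *)

theory Defs
  imports "HOL-Probability.Probability"
begin

text \<open>
  The space of Borel measures of at most volume growth.  The supremum runs over all
  \<open>R > 0\<close>, so that small radii are constrained as well.
\<close>

definition growth_measures :: "(real ^ 'n::finite) measure set" where
  "growth_measures =
     {\<nu>. sets \<nu> = sets borel \<and>
         (SUP R\<in>{0<..}. emeasure \<nu> (ball 0 R) / ennreal (R ^ CARD('n))) < \<infinity>}"

definition even_growth_measures :: "(real ^ 'n::finite) measure set" where
  "even_growth_measures =
     {\<nu> \<in> growth_measures. \<forall>U\<in>sets borel. emeasure \<nu> (uminus ` U) = emeasure \<nu> U}"

definition Cc :: "(real ^ 'n::finite \<Rightarrow> real) set" where
  "Cc = {\<psi>. continuous_on UNIV \<psi> \<and> compact (closure {x. \<psi> x \<noteq> 0})}"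

definition weak_star_topology :: "(real ^ 'n::finite) measure topology" where
  "weak_star_topology = topology_generated_by
     {{\<nu> \<in> growth_measures. (\<integral>x. \<psi> x \<partial>\<nu>) \<in> V} | \<psi> V. \<psi> \<in> Cc \<and> open V}"

definition borel_growth_measures :: "(real ^ 'n::finite) measure measure" where
  "borel_growth_measures = sigma growth_measures {U. openin weak_star_topology U}"

definition SL :: "(real ^ 'n::finite ^ 'n) set" where
  "SL = {g. det g = 1}"

text \<open>The action \<open>(g \<nu>)(E) = \<nu>(g\<inverse> E)\<close> is push-forward along \<open>g\<close>.\<close>

definition act :: "real ^ 'n::finite ^ 'n \<Rightarrow> (real ^ 'n) measure \<Rightarrow> (real ^ 'n) measure" where
  "act g \<nu> = distr \<nu> borel (\<lambda>x. g *v x)"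

text \<open>For \<open>R > 0\<close> this is the measure \<open>U \<mapsto> R\<^sup>-\<^sup>N \<nu>(R U)\<close>.\<close>

definition rescale :: "real \<Rightarrow> (real ^ 'n::finite) measure \<Rightarrow> (real ^ 'n) measure" where
  "rescale R \<nu> =
     scale_measure (ennreal (1 / R ^ CARD('n))) (distr \<nu> borel (\<lambda>x. (1 / R) *\<^sub>R x))"

definition siegel_measure :: "(real ^ 'n::finite) measure measure \<Rightarrow> bool" where
  "siegel_measure \<mu> \<longleftrightarrow>
     prob_space \<mu> \<and> sets \<mu> = sets borel_growth_measures \<and>
     (\<forall>g\<in>SL. distr \<mu> borel_growth_measures (act g) = \<mu>) \<and>
     (\<forall>E\<in>sets \<mu>. (\<forall>g\<in>SL. act g ` E = E) \<longrightarrow> measure \<mu> E = 0 \<or> measure \<mu> E = 1)"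

text \<open>
  The defining property of \<open>c(\<mu>)\<close>.  Since the Bochner integral of a non-integrable function is
  \<open>0\<close> by convention, the well-definedness of both integrals on the left is spelled out.
\<close>

definition siegel_formula :: "(real ^ 'n::finite) measure measure \<Rightarrow> real \<Rightarrow> bool" where
  "siegel_formula \<mu> c \<longleftrightarrow>
     (\<forall>\<psi> :: real ^ 'n \<Rightarrow> real. \<psi> \<in> borel_measurable borel \<and> integrable lborel \<psi> \<longrightarrow>
        (AE \<nu> in \<mu>. integrable \<nu> \<psi>) \<and> integrable \<mu> (\<lambda>\<nu>. \<integral>x. \<psi> x \<partial>\<nu>) \<and>
        (\<integral>\<nu>. (\<integral>x. \<psi> x \<partial>\<nu>) \<partial>\<mu>) = c * (\<integral>x. \<psi> x \<partial>lborel))"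

definition siegel_constant :: "(real ^ 'n::finite) measure measure \<Rightarrow> real" where
  "siegel_constant \<mu> = (THE c. siegel_formula \<mu> c)"

text \<open>
  Area of a hypersurface as its Minkowski content of codimension one; on compact smooth
  hypersurfaces this is the usual area.  For the unit sphere the familiar value
  \<open>2 \<pi>\<^sup>N\<^sup>/\<^sup>2 / \<Gamma>(N/2)\<close> is derived below.
\<close>

definition surface_area :: "'a::euclidean_space set \<Rightarrow> real" where
  "surface_area S = Lim (at_right 0) (\<lambda>e. measure lborel {x. infdist x S < e} / (2 * e))"

lemma surface_area_unit_sphere:
  "surface_area (sphere (0::'a::euclidean_space) 1) =
     2 * pi powr (DIM('a) / 2) / Gamma (DIM('a) / 2)"
proof -
  let ?S = "sphere (0::'a) 1" and ?N = "DIM('a)" and ?w = "unit_ball_vol (DIM('a))"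
  have inf: "infdist x ?S = \<bar>norm x - 1\<bar>" for x :: 'a
  proof (rule antisym)
    obtain y where y: "y \<in> ?S" "dist x y = \<bar>norm x - 1\<bar>"
    proof (cases "x = 0")
      case True
      obtain b :: 'a where "b \<in> Basis" using nonempty_Basis by blast
      then show ?thesis using that[of b] True by (simp add: dist_norm)
    next
      case False
      have "x - x /\<^sub>R norm x = (1 - 1 / norm x) *\<^sub>R x"
        by (simp add: algebra_simps divide_inverse)
      then have "dist x (x /\<^sub>R norm x) = \<bar>1 - 1 / norm x\<bar> * norm x"
        by (simp add: dist_norm)
      also have "\<dots> = \<bar>(1 - 1 / norm x) * norm x\<bar>"
        by (simp add: abs_mult)
      also have "(1 - 1 / norm x) * norm x = norm x - 1"
        using False by (simp add: field_simps)
      finally have "dist x (x /\<^sub>R norm x) = \<bar>norm x - 1\<bar>" .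
      then show ?thesis using that[of "x /\<^sub>R norm x"] False by simp
    qed
    show "infdist x ?S \<le> \<bar>norm x - 1\<bar>"
      using infdist_le[OF y(1), of x] y(2) by simp
    show "\<bar>norm x - 1\<bar> \<le> infdist x ?S"
    proof -
      have "\<bar>norm x - 1\<bar> \<le> dist x z" if "z \<in> ?S" for z
        using that norm_triangle_ineq3[of x z] by (simp add: dist_norm)
      moreover have "?S \<noteq> {}" using y by blast
      ultimately show ?thesis by (auto simp: infdist_notempty intro!: cINF_greatest)
    qed
  qed
  have vol: "measure lborel {x. infdist x ?S < e} = ?w * ((1 + e) ^ ?N - (1 - e) ^ ?N)"
    if e: "0 < e" "e < 1" for e
  proof -
    have "{x. infdist x ?S < e} = ball 0 (1 + e) - cball 0 (1 - e)"
      unfolding inf by auto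
    also have "measure lborel \<dots> = measure lborel (ball (0::'a) (1 + e)) - measure lborel (cball (0::'a) (1 - e))"
      using e by (intro measure_Diff) (auto simp: emeasure_ball)
    finally show ?thesis
      using e content_ball[of "1 + e" "0::'a"] content_cball[of "1 - e" "0::'a"]
      by (simp add: right_diff_distrib)
  qed
  let ?f = "\<lambda>e::real. (1 + e) ^ ?N - (1 - e) ^ ?N"
  have "(?f has_field_derivative 2 * real ?N) (at 0)"
    by (auto intro!: derivative_eq_intros)
  then have "((\<lambda>e. (?f e - ?f 0) / (e - 0)) \<longlongrightarrow> 2 * real ?N) (at 0)"
    by (simp add: has_field_derivative_iff)
  then have "((\<lambda>e. ?f e / e) \<longlongrightarrow> 2 * real ?N) (at_right 0)"
    by (auto intro: filterlim_mono[OF _ order_refl at_le])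
  then have "((\<lambda>e. ?w / 2 * (?f e / e)) \<longlongrightarrow> ?w / 2 * (2 * real ?N)) (at_right 0)"
    by (intro tendsto_intros)
  moreover have "eventually (\<lambda>e. ?w / 2 * (?f e / e) =
      measure lborel {x. infdist x ?S < e} / (2 * e)) (at_right 0)"
    using eventually_at_right_less[of "0::real"] eventually_at_right_real[of 0 "1::real", OF zero_less_one]
    by eventually_elim (simp add: vol)
  ultimately have "((\<lambda>e. measure lborel {x. infdist x ?S < e} / (2 * e))
      \<longlongrightarrow> ?w / 2 * (2 * real ?N)) (at_right 0)"
    by (rule Lim_transform_eventually)
  then have "surface_area ?S = ?w / 2 * (2 * real ?N)"
    unfolding surface_area_def by (intro tendsto_Lim) auto
  also have "\<dots> = 2 * pi powr (?N / 2) / Gamma (?N / 2)"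
  proof -
    have pos: "real ?N / 2 > 0" by simp
    then have "real ?N / 2 \<notin> \<int>\<^sub>\<le>\<^sub>0"
      by (meson linorder_not_le nonpos_Ints_nonpos)
    then have "Gamma (real ?N / 2 + 1) = real ?N / 2 * Gamma (real ?N / 2)"
      by (rule Gamma_plus1)
    then show ?thesis
      using pos by (simp add: unit_ball_vol_def)
  qed
  finally show ?thesis .
qed

end

theory Submission
  imports Defs
begin

text \<open>Fix two coordinates \<open>p \<noteq> q\<close>. The shears \<open>u\<^sub>t\<close>, which add \<open>t x\<^sub>p\<close> to \<open>x\<^sub>q\<close>, form a
  one-parameter group, and \<open>dil q R\<close> is the matrix of determinant one that divides all
  coordinates but \<open>x\<^sub>q\<close> by \<open>R\<close>. The theorem rests on one computation. For a suitable test
  function \<open>\<psi>\<close> supported in \<open>x\<^sub>p > 0\<close>, averaging \<open>\<integral> \<psi> d(u\<^sub>t (dil q R) \<nu>)\<close> over the times \<open>t\<close>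
  between \<open>0\<close> and \<open>\<beta> R\<^sup>N\<close> gives exactly the integral against \<open>rescale R \<nu>\<close> of a function \<open>\<Phi>\<close>
  that depends on \<open>R\<close>, and these functions converge in mean, as \<open>R\<close> grows, to a fixed profile
  \<open>\<Psi>\<close> (\<open>shear_average\<close>, \<open>\<Phi>_L1\<close>). So long averages along the shear flow see the measure at a
  large scale.

  The flow averages are controlled by the mean ergodic theorem for \<open>u\<^sub>t\<close> (\<open>mean_ergodic\<close>). It is
  only assumed that the whole group acts ergodically; that the limit of the averages is
  invariant under the group and not just under \<open>u\<^sub>t\<close> is the Mautner phenomenon (\<open>mautner\<close>).
  Since \<open>\<mu>\<close> is invariant under \<open>dil q R\<close>, the averages at \<open>(dil q R) \<nu>\<close> converge in \<open>L\<^sup>1(\<mu>)\<close> as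
  well, to the constant \<open>\<integral>\<integral> \<psi> d\<nu> \<mu>(d\<nu>) = c(\<mu>) \<integral> \<psi> dm = c(\<mu>) \<integral> \<Psi> dm\<close>. Replacing \<open>\<Phi>\<close> by \<open>\<Psi>\<close> costs
  \<open>c(\<mu>)\<close> times an \<open>L\<^sup>1(m)\<close> distance, again by the formula that defines \<open>c(\<mu>)\<close>. Hence
  \<open>\<integral> \<Psi> d(rescale R \<nu>) \<longlongrightarrow> c(\<mu>) \<integral> \<Psi> dm\<close> in \<open>L\<^sup>1(\<mu>)\<close>.

  The functions \<open>f\<close> with this last property (\<open>mean_conv f\<close>) form a linear space that is
  invariant under the special linear group and, by the same formula, closed in \<open>L\<^sup>1(m)\<close>. The
  profiles generate the indicators of enough cells to reach, by a Dynkin argument, the indicator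
  of every Borel set of finite volume (\<open>mean_conv_indicator\<close>). Convergence in mean becomes
  convergence almost everywhere along a sparse sequence \<open>R\<^sub>n\<close>, simultaneously for countably many
  sets. The cells of all grids together with the balls of integer radius are enough to force
  vague convergence of \<open>rescale (R\<^sub>n) \<nu>\<close> (\<open>vague_convergence_of_grid\<close>). The unit ball is then
  squeezed between continuous functions, and a matrix \<open>g\<close> in front changes nothing, since vague
  convergence to a multiple of Lebesgue measure is preserved by it.

  One more fact is needed: the constant \<open>c(\<mu>)\<close> is introduced by a definite description, so the
  formula that defines it has to be proved. The intensity \<open>A \<mapsto> \<integral> \<nu>(A) \<mu>(d\<nu>)\<close> is invariant under
  the special linear group and has no mass at the origin. It is locally finite away from
  hyperplanes because, by the mean ergodic theorem, the mean of every truncation of \<open>\<nu> \<mapsto> \<integral> \<psi> d\<nu>\<close>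
  is at most the growth constant of a single typical measure, up to a factor (\<open>hat_integrable\<close>).
  Such an invariant measure is a multiple of Lebesgue measure (\<open>SL_invariant_unique\<close>).\<close>

section \<open>Transvections and the special linear group\<close>

text \<open>The elementary matrix that adds \<open>s\<close> times the \<open>j\<close>-th coordinate to the \<open>i\<close>-th one; for
  \<open>i = j\<close> it multiplies that coordinate by \<open>1 + s\<close>.\<close>

definition transv :: "'n::finite \<Rightarrow> 'n \<Rightarrow> real \<Rightarrow> real^'n^'n" where
  "transv i j s = matrix (\<lambda>x. \<chi> k. if k = i then x $ i + s * x $ j else x $ k)"

definition diagm :: "('n::finite \<Rightarrow> real) \<Rightarrow> real^'n^'n" where
  "diagm d = (\<chi> i j. if i = j then d i else 0)"

lemma transv_mult_vec:
  fixes x :: "real^'n::finite"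
  shows "transv i j s *v x = (\<chi> k. if k = i then x $ i + s * x $ j else x $ k)"
proof -
  have "linear (\<lambda>x :: real^'n. \<chi> k. if k = i then x $ i + s * x $ j else x $ k)"
    by (rule linearI) (auto simp: vec_eq_iff algebra_simps)
  then show ?thesis unfolding transv_def by (simp add: matrix_works)
qed

lemma transv_nth: "(transv i j s *v x) $ k = (if k = i then x $ i + s * x $ j else x $ k)"
  by (simp add: transv_mult_vec)

lemma diagm_nth: "(diagm d *v x) $ k = d k * x $ k"
proof -
  have "(diagm d *v x) $ k = (\<Sum>j\<in>UNIV. (if k = j then d k else 0) * x $ j)"
    by (simp add: diagm_def matrix_vector_mult_def)
  also have "\<dots> = (\<Sum>j\<in>UNIV. if j = k then d k * x $ k else 0)"
    by (rule sum.cong) auto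
  finally show ?thesis by simp
qed

lemma det_transv: "i \<noteq> j \<Longrightarrow> det (transv i j s) = 1"
proof -
  assume ij: "i \<noteq> j"
  have "transv i j s = (\<chi> k. if k = i then row i (mat 1) + s *s row j (mat 1) else row k (mat 1))"
    using ij unfolding transv_def matrix_def
    by (auto simp: vec_eq_iff row_def mat_def axis_def)
  then show ?thesis using det_row_operation[OF ij, of "mat 1" s] by simp
qed

lemma transv_SL: "i \<noteq> j \<Longrightarrow> transv i j s \<in> SL"
  by (simp add: SL_def det_transv)

lemma mat1_SL: "mat 1 \<in> SL"
  by (simp add: SL_def)

lemma SL_mult: "g \<in> SL \<Longrightarrow> h \<in> SL \<Longrightarrow> g ** h \<in> SL"
  by (simp add: SL_def det_mul)

lemma diagm_SL: "prod d UNIV = 1 \<Longrightarrow> diagm d \<in> SL"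
  unfolding SL_def by (simp add: diagm_def det_diagonal)

lemma SL_inv:
  assumes "g \<in> SL"
  shows "matrix_inv g \<in> SL" "g ** matrix_inv g = mat 1" "matrix_inv g ** g = mat 1"
proof -
  have i: "invertible g" using assms by (simp add: SL_def invertible_det_nz)
  show a: "g ** matrix_inv g = mat 1" "matrix_inv g ** g = mat 1"
    using someI_ex[OF i[unfolded invertible_def]] unfolding matrix_inv_def by auto
  have "det g * det (matrix_inv g) = 1" by (metis a(1) det_I det_mul)
  then show "matrix_inv g \<in> SL" using assms by (simp add: SL_def)
qed

lemma matrix_mult_eqI:
  fixes A B :: "real^'n::finite^'n"
  assumes "\<And>x k. (A *v x) $ k = (B *v x) $ k" shows "A = B"
  using assms by (simp add: matrix_eq vec_eq_iff)

lemma transv_cancel: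
  fixes A :: "real^'n::finite^'n"
  assumes "i \<noteq> j" shows "transv i j (- s) ** (transv i j s ** A) = A"
  by (rule matrix_mult_eqI) (use assms in \<open>simp add: matrix_vector_mul_assoc[symmetric] transv_nth\<close>)

lemma transv_0: "transv i j 0 = (mat 1 :: real^'n::finite^'n)"
  by (rule matrix_mult_eqI) (simp add: transv_nth)

lemma transv_add:
  fixes i j :: "'n::finite"
  assumes "i \<noteq> j" shows "transv i j s ** transv i j t = transv i j (s + t)"
  by (rule matrix_mult_eqI) (use assms in \<open>simp add: matrix_vector_mul_assoc[symmetric] transv_nth algebra_simps\<close>)

lemma column_transv:
  "column l (transv i j s ** A) $ k = (if k = i then column l A $ i + s * column l A $ j else column l A $ k)"
proof -
  have "column l (transv i j s ** A) = transv i j s *v column l A"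
    by (metis matrix_vector_mul_assoc matrix_vector_mult_basis)
  then show ?thesis by (simp add: transv_nth)
qed

text \<open>Gaussian elimination with row operations of type "add a multiple of a row to another row"
  only. The columns are cleared one after the other. A pivot becomes one by adding a multiple of
  another row whose entry in that column does not vanish, so no rescaling is used; if the pivot
  is the last column left, the determinant makes it one.\<close>

lemma SL_transv_induct:
  fixes P :: "real^'n::finite^'n \<Rightarrow> bool"
  assumes one: "P (mat 1)"
    and step: "\<And>i j s A. i \<noteq> j \<Longrightarrow> A \<in> SL \<Longrightarrow> P A \<Longrightarrow> P (transv i j s ** A)"
    and A: "A \<in> SL"
  shows "P A"
proof -
  \<comment> \<open>Row operations are invertible, so it is enough to reduce a matrix to the identity.\<close>
  have undo: "P A" if "i \<noteq> j" "A \<in> SL" "P (transv i j s ** A)" for i j s A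
  proof -
    have "P (transv i j (- s) ** (transv i j s ** A))"
      by (rule step[OF that(1) SL_mult[OF transv_SL[OF that(1)] that(2)] that(3)])
    then show ?thesis using transv_cancel[OF that(1)] by simp
  qed
  \<comment> \<open>\<open>T\<close> is the set of columns that have not been cleared yet.\<close>
  have gen: "\<forall>A\<in>SL. (\<forall>j. j \<notin> T \<longrightarrow> column j A = axis j 1) \<longrightarrow> P A" if "finite T" for T
    using that
  proof (induction T rule: finite_induct)
    case empty
    show ?case
    proof safe
      fix A :: "real^'n^'n" assume "\<forall>j. j \<notin> {} \<longrightarrow> column j A = axis j 1"
      then have "A = mat 1" by (auto simp: vec_eq_iff column_def axis_def mat_def)
      then show "P A" using one by simp
    qed
  next
    case (insert k T)
    define C where "C A \<longleftrightarrow> A \<in> SL \<and> (\<forall>j. j \<notin> insert k T \<longrightarrow> column j A = axis j 1)" for A :: "real^'n^'n"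
    have C_step: "C (transv i j s ** A)" if "C A" "i \<noteq> j" "j \<in> insert k T" for i j s A
      using that unfolding C_def
      by (auto simp: SL_mult transv_SL vec_eq_iff column_transv axis_def)
    \<comment> \<open>The pivot is one: clear the other entries of the column, \<open>R\<close> being those left.\<close>
    have c1: "\<forall>A. C A \<and> column k A $ k = 1 \<and> (\<forall>a. a \<noteq> k \<and> column k A $ a \<noteq> 0 \<longrightarrow> a \<in> R) \<longrightarrow> P A"
      if "finite R" for R
      using that
    proof (induction R rule: finite_induct)
      case empty
      show ?case
      proof safe
        fix A assume *: "C A" "column k A $ k = 1" "\<forall>a. a \<noteq> k \<and> column k A $ a \<noteq> 0 \<longrightarrow> a \<in> {}"
        have "column k A = axis k 1" using * by (auto simp: vec_eq_iff axis_def)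
        then show "P A" using insert.IH * unfolding C_def by auto
      qed
    next
      case (insert r R)
      show ?case
      proof safe
        fix A assume *: "C A" "column k A $ k = 1" "\<forall>a. a \<noteq> k \<and> column k A $ a \<noteq> 0 \<longrightarrow> a \<in> insert r R"
        show "P A"
        proof (cases "r = k")
          case True then show ?thesis using * insert.IH by auto
        next
          case False
          let ?s = "- column k A $ r"
          have "P (transv r k ?s ** A)"
          proof (rule insert.IH[rule_format], intro conjI allI impI)
            show "C (transv r k ?s ** A)" using False * C_step by auto
            show "column k (transv r k ?s ** A) $ k = 1" using False * by (simp add: column_transv)
            fix a assume "a \<noteq> k \<and> column k (transv r k ?s ** A) $ a \<noteq> 0"
            then show "a \<in> R" using * by (auto simp: column_transv split: if_splits)
          qed
          then show ?thesis using undo False *(1) unfolding C_def by blast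
        qed
      qed
    qed
    have c1': "P A" if "C A" "column k A $ k = 1" for A
      using c1[of UNIV] that by auto
    \<comment> \<open>An entry of the column in an uncleared row makes the pivot equal to one.\<close>
    have c2: "P A" if "C A" "i \<in> T" "column k A $ i \<noteq> 0" for A i
    proof -
      have ik: "i \<noteq> k" using that insert.hyps by auto
      have "P (transv k i ((1 - column k A $ k) / column k A $ i) ** A)"
        using that ik C_step by (intro c1') (auto simp: column_transv)
      then show ?thesis using undo[of k i A] ik that(1) unfolding C_def by blast
    qed
    show ?case
    proof safe
      fix A assume A: "A \<in> SL" "\<forall>j. j \<notin> insert k T \<longrightarrow> column j A = axis j 1"
      then have CA: "C A" by (simp add: C_def)
      define v where "v = column k A"
      show "P A"
      proof (cases "\<exists>i\<in>T. v $ i \<noteq> 0")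
        case True then show ?thesis using c2 CA v_def by auto
      next
        case False
        show ?thesis
        proof (cases "T = {}")
          case True
          have "A = (\<chi> i j. if j = k then ((mat 1 :: real^'n^'n) *v v) $ i else (mat 1 :: real^'n^'n) $ i $ j)"
            using A(2) True unfolding matrix_vector_mul_lid by (auto simp: vec_eq_iff v_def column_def axis_def mat_def)
          then have "det A = v $ k * det (mat 1 :: real^'n^'n)"
            using cramer_lemma[of k "mat 1 :: real^'n^'n" v] by simp
          then show ?thesis using A c1' CA by (simp add: SL_def v_def)
        next
          case nT: False
          then obtain i where i: "i \<in> T" by blast
          have ik: "i \<noteq> k" using i insert.hyps by auto
          \<comment> \<open>Otherwise column \<open>k\<close> is a combination of cleared columns, and \<open>A\<close> is singular.\<close>
          have vk: "v $ k \<noteq> 0"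
          proof
            assume v0: "v $ k = 0"
            define w :: "real^'n" where "w = (\<chi> j. if j = k then 1 else if j \<in> T then 0 else - v $ j)"
            have "A *v w = (\<Sum>j\<in>UNIV. w $ j *s column j A)"
              by (simp add: matrix_mult_sum)
            also have "\<dots> = (\<Sum>j\<in>UNIV. if j = k then v else - (v $ j) *s axis j 1)"
            proof (rule sum.cong)
              fix j show "w $ j *s column j A = (if j = k then v else - (v $ j) *s axis j 1)"
                using A(2) False by (auto simp: w_def v_def)
            qed simp
            also have "\<dots> = v + (\<Sum>j\<in>UNIV - {k}. - (v $ j) *s axis j 1)"
              by (simp add: sum.remove[where x = k])
            also have "\<dots> = v + (\<Sum>j\<in>UNIV. - (v $ j) *s axis j 1)"
              using v0 by (simp add: sum.remove[of UNIV k])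
            also have "\<dots> = 0"
              by (simp add: sum_negf basis_expansion)
            finally have "A *v w = 0" .
            then have "w = 0"
              using A(1) by (metis SL_inv(3) matrix_vector_mul_assoc matrix_vector_mul_lid matrix_vector_mult_0_right)
            then show False by (auto simp: w_def vec_eq_iff split: if_splits)
          qed
          \<comment> \<open>Adding row \<open>k\<close> to an uncleared row \<open>i\<close> produces the entry that the pivot step
            needs.\<close>
          have "P (transv i k 1 ** A)"
          proof (rule c2)
            show "C (transv i k 1 ** A)" using C_step CA ik by auto
            show "column k (transv i k 1 ** A) $ i \<noteq> 0"
              using vk False i by (simp add: column_transv v_def)
          qed (rule i)
          then show ?thesis using undo ik CA unfolding C_def by blast
        qed
      qed
    qed
  qed
  show ?thesis using gen[of UNIV] A by auto
qed

text \<open>Continuity in the parameter follows from this formula without looking at entries.\<close>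

lemma transv_affine: "transv i j s = (mat 1 :: real^'n::finite^'n) + s *\<^sub>R (transv i j 1 - mat 1)"
  by (rule matrix_mult_eqI)
     (simp add: matrix_vector_mult_add_rdistrib matrix_vector_mult_diff_rdistrib
       scaleR_matrix_vector_assoc[symmetric] transv_nth)

lemma tendsto_transv:
  fixes i :: "'n::finite"
  assumes "(c \<longlongrightarrow> 0) F"
  shows "((\<lambda>n. transv i j (c n)) \<longlongrightarrow> mat 1) F"
proof -
  have "((\<lambda>n. mat 1 + c n *\<^sub>R (transv i j 1 - mat 1 :: real^'n^'n)) \<longlongrightarrow> mat 1 + 0 *\<^sub>R (transv i j 1 - mat 1)) F"
    by (intro tendsto_intros assms)
  then show ?thesis by (subst transv_affine) simp
qed

lemma continuous_on_transv:
  "continuous_on S c \<Longrightarrow> continuous_on S (\<lambda>x. transv i j (c x) :: real^'n::finite^'n)"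
  by (subst transv_affine) (intro continuous_intros)

lemma continuous_on_matrix_mult:
  fixes f g :: "'a::topological_space \<Rightarrow> real^'n::finite^'n"
  assumes "continuous_on S f" "continuous_on S g"
  shows "continuous_on S (\<lambda>x. f x ** g x)"
  unfolding matrix_matrix_mult_def
  by (intro continuous_on_vec_lambda continuous_intros assms)

text \<open>The Mautner phenomenon, for a continuous seminorm-like function \<open>D\<close>; in the application
  \<open>D g\<close> is the \<open>L\<^sup>1\<close> distance of a function to its translate by \<open>g\<close>. If \<open>D\<close> vanishes on one
  group of transvections it vanishes on the diagonal matrices with entries \<open>a\<close> and \<open>1 / a\<close> in
  the same two coordinates, because such a matrix is a product of these transvections and of
  opposite ones that are arbitrarily small. Conjugating by the diagonal matrices shrinks every
  other transvection that involves one of the two coordinates, and the remaining transvections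
  are commutators of these.\<close>

lemma mautner:
  fixes D :: "real^'n::finite^'n \<Rightarrow> real"
  assumes pq: "p \<noteq> q"
    and nonneg: "\<And>g. g \<in> SL \<Longrightarrow> 0 \<le> D g"
    and sub: "\<And>g h. g \<in> SL \<Longrightarrow> h \<in> SL \<Longrightarrow> D (g ** h) \<le> D g + D h"
    and cont: "\<And>g. (\<And>n::nat. g n \<in> SL) \<Longrightarrow> g \<longlonglongrightarrow> mat 1 \<Longrightarrow> (\<lambda>n. D (g n)) \<longlonglongrightarrow> 0"
    and u: "\<And>t. D (transv q p t) = 0"
    and g: "g \<in> SL"
  shows "D g = 0"
proof -
  have D0I: "D g = 0" if "g \<in> SL" "\<And>n::nat. D g \<le> a n" "a \<longlonglongrightarrow> 0" for g a
    using that(2,3) nonneg[OF that(1)]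
    by (meson LIMSEQ_le_const order_antisym)
  have small: "(\<lambda>n. D (transv i j (c n))) \<longlonglongrightarrow> 0" if "c \<longlonglongrightarrow> 0" "i \<noteq> j" for c i j
    using that by (intro cont transv_SL tendsto_transv)
  define dg where "dg a = diagm (\<lambda>i. if i = p then a else if i = q then 1 / a else (1::real))" for a
  have dgSL: "dg a \<in> SL" if "a > 0" for a
  proof -
    have "(\<Prod>i\<in>UNIV. if i = p then a else if i = q then 1 / a else 1)
       = (\<Prod>i\<in>{p,q}. if i = p then a else if i = q then 1 / a else 1)"
      by (rule prod.mono_neutral_right) auto
    also have "\<dots> = 1" using pq that by simp
    finally show ?thesis unfolding dg_def by (rule diagm_SL)
  qed
  have dg0: "D (dg a) = 0" if a: "a > 0" for a
  proof (rule D0I[OF dgSL[OF a]])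
    fix n :: nat
    define c where "c n = 1 / real (Suc n)" for n
    have c: "c n > 0" by (simp add: c_def)
    \<comment> \<open>The parameters of the two factors \<open>transv p q\<close> tend to zero; the others are free for \<open>D\<close>.\<close>
    have eq: "dg a = ((transv q p ((1 / a - 1) / c n) ** transv p q (c n)) ** transv q p ((a - 1) / c n))
        ** transv p q (- c n / a)" (is "_ = ((?u ** ?l) ** ?v) ** ?m")
      using pq a c
      by (intro matrix_mult_eqI)
         (simp add: matrix_vector_mul_assoc[symmetric] transv_nth dg_def diagm_nth field_simps)
    have "D (dg a) \<le> ((D ?u + D ?l) + D ?v) + D ?m"
      unfolding eq using pq
      by (intro order_trans[OF sub] add_mono order_refl SL_mult transv_SL) auto
    also have "\<dots> = D ?l + D ?m" by (simp add: u)
    finally show "D (dg a) \<le> D (transv p q (1 / real (Suc n))) + D (transv p q (- (1 / real (Suc n)) / a))"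
      by (simp add: c_def)
  next
    have "(\<lambda>n. 1 / real (Suc n)) \<longlonglongrightarrow> 0" by (rule LIMSEQ_Suc[OF lim_1_over_n])
    from small[OF this pq] small[OF tendsto_divide_zero[OF tendsto_minus[OF this, simplified minus_zero]] pq, of a]
    show "(\<lambda>n. D (transv p q (1 / real (Suc n))) + D (transv p q (- (1 / real (Suc n)) / a))) \<longlonglongrightarrow> 0"
      using tendsto_add_zero by blast
  qed
  \<comment> \<open>Conjugation by \<open>dg a\<close> multiplies the parameter of a transvection by \<open>d i / d j\<close>.\<close>
  have conj: "D (transv i j s) \<le> D (transv i j (s * (d i / d j)))"
    if "i \<noteq> j" "a > 0" "d = (\<lambda>i. if i = p then a else if i = q then 1 / a else 1)" for i j s a d
  proof -
    have d: "d k \<noteq> 0" for k using that by auto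
    have dd: "dg a = diagm d" "dg (1 / a) = diagm (\<lambda>i. 1 / d i)"
      using that(3) by (auto simp: dg_def intro!: arg_cong[where f = diagm])
    have eq: "transv i j s = (dg (1 / a) ** transv i j (s * (d i / d j))) ** dg a"
      unfolding dd using that(1) d
      by (intro matrix_mult_eqI)
         (simp add: matrix_vector_mul_assoc[symmetric] transv_nth diagm_nth field_simps)
    have "D (transv i j s) \<le> (D (dg (1/a)) + D (transv i j (s * (d i / d j)))) + D (dg a)"
      by (subst eq, intro order_trans[OF sub] add_mono order_refl SL_mult transv_SL)
         (use that dgSL in auto)
    then show ?thesis using dg0 that(2) by simp
  qed
  have near: "D (transv i j s) = 0" if ij: "i \<noteq> j" "i \<in> {p,q} \<or> j \<in> {p,q}" for i j s
  proof -
    define e where "e a = (\<lambda>i. if i = p then a else if i = q then 1 / a else (1::real))" for a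
    have i0: "(\<lambda>n. 1 / real (Suc n)) \<longlonglongrightarrow> 0" by (rule LIMSEQ_Suc[OF lim_1_over_n])
    have iflim: "(\<lambda>n. s * (if P then x n else y n)) \<longlonglongrightarrow> 0" if "x \<longlonglongrightarrow> 0" "y \<longlonglongrightarrow> 0" for P x y
      using tendsto_mult_right_zero[OF that(1)] tendsto_mult_right_zero[OF that(2)] by (cases P) auto
    \<comment> \<open>Let \<open>a\<close> tend to infinity or to zero, whichever makes the parameter small.\<close>
    have "\<exists>a::nat\<Rightarrow>real. (\<forall>n. a n > 0) \<and> (\<lambda>n. s * (e (a n) i / e (a n) j)) \<longlonglongrightarrow> 0"
    proof (cases "i = q \<or> (i \<noteq> p \<and> j = p)")
      case True
      have "(\<lambda>n. s * (e (real (Suc n)) i / e (real (Suc n)) j))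
          = (\<lambda>n. s * (if i = q \<and> j = p then (1 / real (Suc n)) * (1 / real (Suc n)) else 1 / real (Suc n)))"
        using True ij pq unfolding e_def by auto
      moreover have "\<dots> \<longlonglongrightarrow> 0"
        by (rule iflim[OF tendsto_mult_zero[OF i0 i0] i0])
      ultimately show ?thesis by (intro exI[of _ "\<lambda>n. real (Suc n)"]) simp
    next
      case False
      have "(\<lambda>n. s * (e (1 / real (Suc n)) i / e (1 / real (Suc n)) j))
          = (\<lambda>n. s * (if i = p \<and> j = q then (1 / real (Suc n)) * (1 / real (Suc n)) else 1 / real (Suc n)))"
        using False ij pq unfolding e_def by auto
      moreover have "\<dots> \<longlonglongrightarrow> 0"
        by (rule iflim[OF tendsto_mult_zero[OF i0 i0] i0])
      ultimately show ?thesis by (intro exI[of _ "\<lambda>n. 1 / real (Suc n)"]) simp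
    qed
    then obtain a :: "nat \<Rightarrow> real" where a: "\<And>n. a n > 0" "(\<lambda>n. s * (e (a n) i / e (a n) j)) \<longlonglongrightarrow> 0"
      by blast
    have "D (transv i j s) \<le> D (transv i j (s * (e (a n) i / e (a n) j)))" for n
      by (rule conj[OF ij(1) a(1)[of n], where d = "e (a n)"]) (simp add: e_def)
    then show ?thesis
      by (rule D0I[OF transv_SL[OF ij(1)] _ small[OF a(2) ij(1)]])
  qed
  have all: "D (transv i j s) = 0" if ij: "i \<noteq> j" for i j s
  proof (cases "i \<in> {p,q} \<or> j \<in> {p,q}")
    case False
    \<comment> \<open>A transvection away from \<open>p\<close> and \<open>q\<close> is the commutator of two that pass through \<open>p\<close>.\<close>
    have eq: "transv i j s = ((transv i p s ** transv p j 1) ** transv i p (- s)) ** transv p j (- 1)"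
      using False ij
      by (intro matrix_mult_eqI)
         (auto simp: matrix_vector_mul_assoc[symmetric] transv_nth algebra_simps)
    have "D (transv i j s) \<le> ((D (transv i p s) + D (transv p j 1)) + D (transv i p (- s))) + D (transv p j (- 1))"
      by (subst eq, intro order_trans[OF sub] add_mono order_refl SL_mult transv_SL)
         (use False in auto)
    also have "\<dots> = 0" using False near[of i p] near[of p j] by auto
    finally show ?thesis using nonneg[OF transv_SL[OF ij]] by (simp add: order_antisym)
  qed (use near ij in blast)
  show ?thesis
  proof (rule SL_transv_induct[OF _ _ g])
    show "D (mat 1) = 0" using u[of 0] by (simp add: transv_0)
    show "D (transv i j s ** A) = 0" if "i \<noteq> j" "A \<in> SL" "D A = 0" for i j s A
      using sub[OF transv_SL[OF that(1)] that(2), of s] nonneg[OF SL_mult[OF transv_SL[OF that(1)] that(2)], of s]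
        all[OF that(1)] that(3) by (simp add: order_antisym)
  qed
qed

section \<open>Time averages and summable deviations\<close>

text \<open>A function that is continuous in one variable and measurable in the other is the pointwise
  limit of functions in which the first variable takes finitely many values.\<close>

lemma caratheodory_measurable:
  fixes F :: "'p::{metric_space, second_countable_topology} \<Rightarrow> 'b \<Rightarrow> real"
  assumes "open \<Omega>" and F[measurable]: "\<And>a. a \<in> \<Omega> \<Longrightarrow> F a \<in> borel_measurable M"
    and cont: "\<And>x. x \<in> space M \<Longrightarrow> continuous_on \<Omega> (\<lambda>a. F a x)"
  shows "(\<lambda>(a, x). if a \<in> \<Omega> then F a x else 0) \<in> borel_measurable (borel \<Otimes>\<^sub>M M)"
proof -
  have \<Omega>[measurable]: "\<Omega> \<in> sets borel" using assms by auto
  obtain s :: "nat \<Rightarrow> 'p \<Rightarrow> 'p" where s: "\<And>i. simple_function borel (s i)" "\<And>x. (\<lambda>i. s i x) \<longlonglongrightarrow> x"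
    using borel_measurable_implies_sequence_metric[of "\<lambda>x::'p. x" borel undefined] by auto
  define G where "G i w = (if fst w \<in> \<Omega> \<and> s i (fst w) \<in> \<Omega> then F (s i (fst w)) (snd w) else 0)"
    for i and w :: "'p \<times> 'b"
  have G: "G i \<in> borel_measurable (borel \<Otimes>\<^sub>M M)" for i
  proof -
    have fin: "finite (range (s i))" using simple_functionD(1)[OF s(1)[of i]] by simp
    have "(\<lambda>w :: 'p \<times> 'b. (\<lambda>a w. if fst w \<in> \<Omega> \<and> a \<in> \<Omega> then F a (snd w) else 0) (s i (fst w)) w)
        \<in> borel_measurable (borel \<Otimes>\<^sub>M M)"
    proof (rule measurable_compose_countable'[where I = "range (s i)"])
      show "(\<lambda>w. if fst w \<in> \<Omega> \<and> a \<in> \<Omega> then F a (snd w) else 0) \<in> borel_measurable (borel \<Otimes>\<^sub>M M)" for a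
        by (cases "a \<in> \<Omega>") simp_all
      have "s i \<in> measurable borel (count_space (range (s i)))"
        using simple_functionD(2)[OF s(1)[of i]] by (simp add: measurable_count_space_eq2[OF fin])
      then show "(\<lambda>w. s i (fst w)) \<in> measurable (borel \<Otimes>\<^sub>M M) (count_space (range (s i)))"
        by (rule measurable_compose[OF measurable_fst])
    qed (use fin countable_finite in auto)
    moreover have "G i = (\<lambda>w :: 'p \<times> 'b. if fst w \<in> \<Omega> \<and> s i (fst w) \<in> \<Omega> then F (s i (fst w)) (snd w) else 0)"
      by (simp add: G_def[abs_def])
    ultimately show ?thesis by simp
  qed
  show ?thesis
  proof (rule borel_measurable_LIMSEQ_metric[OF G])
    fix w :: "'p \<times> 'b" assume w: "w \<in> space (borel \<Otimes>\<^sub>M M)"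
    obtain a x where ax: "w = (a, x)" "x \<in> space M" using w by (auto simp: space_pair_measure)
    show "(\<lambda>i. G i w) \<longlonglongrightarrow> (case w of (a, x) \<Rightarrow> if a \<in> \<Omega> then F a x else 0)"
    proof (cases "a \<in> \<Omega>")
      case True
      have "eventually (\<lambda>i. s i a \<in> \<Omega>) sequentially"
        using s(2)[of a] \<open>open \<Omega>\<close> True topological_tendstoD by blast
      then have ev: "eventually (\<lambda>i. F (s i a) x = G i w) sequentially"
        by eventually_elim (simp add: G_def ax True)
      have "isCont (\<lambda>a. F a x) a"
        using cont[OF ax(2)] True \<open>open \<Omega>\<close> by (simp add: continuous_on_eq_continuous_at)
      then have "(\<lambda>i. F (s i a) x) \<longlonglongrightarrow> F a x"
        by (rule isCont_tendsto_compose[OF _ s(2)])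
      from Lim_transform_eventually[OF this ev] show ?thesis by (simp add: True ax)
    qed (simp add: G_def ax)
  qed
qed

text \<open>An average over the times \<open>[0, s]\<close> is written as an integral over \<open>t \<in> [0, 1]\<close> at the
  times \<open>s t\<close>, so that one probability space serves all lengths of the time window.\<close>

definition unit_unif :: "real measure" where
  "unit_unif = density lborel (\<lambda>t. ennreal (indicator {0..1} t))"

lemma sets_unit_unif[simp, measurable_cong]: "sets unit_unif = sets borel"
  by (simp add: unit_unif_def)

lemma space_unit_unif[simp]: "space unit_unif = UNIV"
  by (simp add: unit_unif_def)

lemma prob_space_unit_unif: "prob_space unit_unif"
proof
  have "(\<lambda>t::real. ennreal (indicator {0..1} t)) = indicator {0..1}"
    by (auto simp: indicator_def)
  then show "emeasure unit_unif (space unit_unif) = 1"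
    by (simp add: unit_unif_def emeasure_density)
qed

lemma measure_unit_unif_UNIV[simp]: "measure unit_unif UNIV = 1"
  using prob_space.prob_space[OF prob_space_unit_unif] by simp

lemma integral_unit_unif:
  fixes f :: "real \<Rightarrow> real"
  assumes "f \<in> borel_measurable borel"
  shows "(\<integral>t. f t \<partial>unit_unif) = (\<integral>t. indicator {0..1} t * f t \<partial>lborel)"
  unfolding unit_unif_def using assms by (subst integral_density) auto

lemma AE_unit_unif: "AE t in unit_unif. t \<in> {0..1}"
proof -
  have "AE t in lborel. 0 < ennreal (indicator {0..1} t) \<longrightarrow> t \<in> {0..1::real}"
    by (auto simp: indicator_def)
  then show ?thesis unfolding unit_unif_def by (subst AE_density) auto
qed

lemma (in prob_space) integral_bounds:
  fixes f :: "'a \<Rightarrow> real"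
  assumes "f \<in> borel_measurable M" "AE x in M. \<bar>f x\<bar> \<le> B"
  shows "integrable M f" "\<bar>\<integral>x. f x \<partial>M\<bar> \<le> B"
proof -
  show i: "integrable M f" using assms by (intro integrable_const_bound[of _ B]) auto
  have "\<bar>\<integral>x. f x \<partial>M\<bar> \<le> (\<integral>x. \<bar>f x\<bar> \<partial>M)" by (rule integral_abs_bound)
  also have "\<dots> \<le> (\<integral>x. B \<partial>M)" using i assms by (intro integral_mono_AE) auto
  finally show "\<bar>\<integral>x. f x \<partial>M\<bar> \<le> B" by (simp add: prob_space)
qed

text \<open>Translating the time window by \<open>r\<close> only changes its two ends, which have length \<open>\<bar>r\<bar> / s\<close>
  each after normalisation.\<close>

lemma unit_unif_shift:
  fixes \<phi> :: "real \<Rightarrow> real"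
  assumes [measurable]: "\<phi> \<in> borel_measurable borel" and K: "\<And>t. \<bar>\<phi> t\<bar> \<le> K" and s: "s > 0"
  shows "\<bar>(\<integral>t. \<phi> (s * t + r) \<partial>unit_unif) - (\<integral>t. \<phi> (s * t) \<partial>unit_unif)\<bar> \<le> 2 * K * \<bar>r\<bar> / s"
proof -
  define d where "d = r / s"
  have K0: "0 \<le> K" using K[of 0] by linarith
  let ?I = "indicator {0..1::real} :: real \<Rightarrow> real"
  \<comment> \<open>After the substitution \<open>t \<mapsto> t - d\<close> the two integrals differ only by their indicators.\<close>
  have shift_ind: "\<bar>?I (t - d) - ?I t\<bar> \<le> indicator {min 0 d..max 0 d} t + indicator {min 1 (1+d)..max 1 (1+d)} t" for t
    by (cases "0 \<le> d"; cases "0 \<le> t"; cases "t \<le> 1"; cases "d \<le> t"; cases "t \<le> 1 + d") (simp_all add: indicator_def)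
  have int: "integrable lborel (\<lambda>t. ?I (t - d) * \<phi> (s * t))" for d
  proof (rule Bochner_Integration.integrable_bound[of _ "\<lambda>t. K * indicator {d..1+d} t"])
    show "integrable lborel (\<lambda>t. K * indicator {d..1+d} t)" by simp
    show "AE t in lborel. norm (?I (t - d) * \<phi> (s * t)) \<le> norm (K * indicator {d..1+d} t)"
    proof (rule AE_I2)
      fix t
      have "?I (t - d) = indicator {d..1+d} t" by (auto simp: indicator_def)
      then show "norm (?I (t - d) * \<phi> (s * t)) \<le> norm (K * indicator {d..1+d} t)"
        using K[of "s * t"] K0 by (simp add: abs_mult mult.commute mult_right_mono)
    qed
  qed simp
  have "(\<integral>t. \<phi> (s * t + r) \<partial>unit_unif) = (\<integral>t. ?I t * \<phi> (s * t + r) \<partial>lborel)"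
    by (simp add: integral_unit_unif)
  also have "\<dots> = (\<integral>t. ?I (t - d) * \<phi> (s * t) \<partial>lborel)"
    using lborel_integral_real_affine[of 1 "\<lambda>t. ?I (t - d) * \<phi> (s * t)" d] s
    by (simp add: d_def algebra_simps)
  finally have "(\<integral>t. \<phi> (s * t + r) \<partial>unit_unif) - (\<integral>t. \<phi> (s * t) \<partial>unit_unif)
      = (\<integral>t. ?I (t - d) * \<phi> (s * t) \<partial>lborel) - (\<integral>t. ?I (t - 0) * \<phi> (s * t) \<partial>lborel)"
    by (simp add: integral_unit_unif)
  also have "\<dots> = (\<integral>t. ?I (t - d) * \<phi> (s * t) - ?I (t - 0) * \<phi> (s * t) \<partial>lborel)"
    by (rule Bochner_Integration.integral_diff[OF int int, symmetric])
  finally have "\<bar>(\<integral>t. \<phi> (s * t + r) \<partial>unit_unif) - (\<integral>t. \<phi> (s * t) \<partial>unit_unif)\<bar>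
      \<le> (\<integral>t. \<bar>?I (t - d) * \<phi> (s * t) - ?I (t - 0) * \<phi> (s * t)\<bar> \<partial>lborel)"
    by (simp only: integral_abs_bound)
  also have "\<dots> \<le> (\<integral>t. K * indicator {min 0 d..max 0 d} t + K * indicator {min 1 (1+d)..max 1 (1+d)} t \<partial>lborel)"
  proof (rule integral_mono)
    show "integrable lborel (\<lambda>t. \<bar>?I (t - d) * \<phi> (s * t) - ?I (t - 0) * \<phi> (s * t)\<bar>)"
      by (intro integrable_abs Bochner_Integration.integrable_diff int)
    fix t
    have "\<bar>?I (t - d) * \<phi> (s * t) - ?I (t - 0) * \<phi> (s * t)\<bar> = \<bar>\<phi> (s * t)\<bar> * \<bar>?I (t - d) - ?I t\<bar>"
      by (simp add: abs_mult[symmetric] algebra_simps)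
    also have "\<dots> \<le> K * (indicator {min 0 d..max 0 d} t + indicator {min 1 (1+d)..max 1 (1+d)} t)"
      using K[of "s * t"] K0
      by (intro mult_mono shift_ind) auto
    finally show "\<bar>?I (t - d) * \<phi> (s * t) - ?I (t - 0) * \<phi> (s * t)\<bar>
        \<le> K * indicator {min 0 d..max 0 d} t + K * indicator {min 1 (1+d)..max 1 (1+d)} t"
      by (simp add: distrib_left)
  qed simp
  also have "\<dots> = K * (max 0 d - min 0 d) + K * (max 1 (1+d) - min 1 (1+d))"
    by simp
  also have "\<dots> = 2 * K * \<bar>d\<bar>"
    by (cases "d \<ge> 0") (auto simp: max_def min_def algebra_simps)
  also have "\<dots> = 2 * K * \<bar>r\<bar> / s" using s by (simp add: d_def)
  finally show ?thesis .
qed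

text \<open>The sum of the functions \<open>\<bar>h n\<bar>\<close> has a finite integral, so it is finite almost everywhere.\<close>

lemma AE_summable_of_L1_geometric:
  fixes h :: "nat \<Rightarrow> 'a \<Rightarrow> real"
  assumes int: "\<And>n. integrable M (h n)" and le: "\<And>n. (\<integral>x. \<bar>h n x\<bar> \<partial>M) \<le> (1/2) ^ n"
  shows "AE x in M. summable (\<lambda>n. \<bar>h n x\<bar>)"
proof -
  have [measurable]: "h n \<in> borel_measurable M" for n using int by auto
  have "(\<integral>\<^sup>+x. (\<Sum>n. ennreal \<bar>h n x\<bar>) \<partial>M) = (\<Sum>n. \<integral>\<^sup>+x. ennreal \<bar>h n x\<bar> \<partial>M)"
    by (rule nn_integral_suminf) simp
  also have "\<dots> \<le> (\<Sum>n. ennreal ((1/2) ^ n))"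
  proof (rule suminf_le)
    fix n
    have "(\<integral>\<^sup>+x. ennreal \<bar>h n x\<bar> \<partial>M) = ennreal (\<integral>x. \<bar>h n x\<bar> \<partial>M)"
      by (rule nn_integral_eq_integral) (use int in auto)
    then show "(\<integral>\<^sup>+x. ennreal \<bar>h n x\<bar> \<partial>M) \<le> ennreal ((1/2) ^ n)"
      using le[of n] by (simp add: ennreal_leI)
  qed auto
  also have "\<dots> < top"
    by (subst suminf_ennreal2) (auto intro!: summable_geometric)
  finally have "AE x in M. (\<Sum>n. ennreal \<bar>h n x\<bar>) \<noteq> \<infinity>"
    by (intro nn_integral_noteq_infinite) auto
  then show ?thesis
    by eventually_elim (auto intro: summable_suminf_not_top)
qed

lemma convergent_of_summable_diff:
  fixes X :: "nat \<Rightarrow> real"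
  assumes "summable (\<lambda>n. \<bar>X (Suc n) - X n\<bar>)"
  shows "convergent X"
proof -
  have "summable (\<lambda>n. X (Suc n) - X n)" by (rule summable_rabs_cancel[OF assms])
  then have "(\<lambda>n. \<Sum>k<n. X (Suc k) - X k) \<longlonglongrightarrow> (\<Sum>k. X (Suc k) - X k)"
    by (rule summable_LIMSEQ)
  then have "(\<lambda>n. (X n - X 0) + X 0) \<longlonglongrightarrow> (\<Sum>k. X (Suc k) - X k) + X 0"
    unfolding sum_lessThan_telescope by (intro tendsto_intros)
  then show ?thesis by (auto simp: convergent_def)
qed

section \<open>Mean ergodic theorem for a transvection flow\<close>

text \<open>A measure preserving action in which ergodicity is only demanded of sets that are
  invariant everywhere, not up to null sets, in accordance with the notion of a Siegel measure.
  The passage from almost invariant functions to such sets is made in \<open>invariant_imp_const\<close>.\<close>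

locale sl_action = prob_space M for M :: "'a measure" +
  fixes T :: "real^'n::finite^'n \<Rightarrow> 'a \<Rightarrow> 'a"
  assumes T_meas: "\<And>g. g \<in> SL \<Longrightarrow> T g \<in> measurable M M"
    and T_pres: "\<And>g. g \<in> SL \<Longrightarrow> distr M M (T g) = M"
    and T_mult: "\<And>g h x. g \<in> SL \<Longrightarrow> h \<in> SL \<Longrightarrow> x \<in> space M \<Longrightarrow> T g (T h x) = T (g ** h) x"
    and T_one: "\<And>x. x \<in> space M \<Longrightarrow> T (mat 1) x = x"
    and ergodic: "\<And>E. E \<in> sets M \<Longrightarrow> (\<forall>g\<in>SL. T g ` E = E) \<Longrightarrow> measure M E = 0 \<or> measure M E = 1"
begin

text \<open>Continuity along orbits gives joint measurability in the point and in the parameter of a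
  continuous family of group elements (\<open>orbit_measurable\<close>), as Fubini requires, and it survives
  averaging.\<close>

definition orbit_cont :: "('a \<Rightarrow> real) \<Rightarrow> bool" where
  "orbit_cont F \<longleftrightarrow> F \<in> borel_measurable M \<and> (\<forall>x\<in>space M. continuous_on SL (\<lambda>g. F (T g x)))"

lemma T_space: "g \<in> SL \<Longrightarrow> x \<in> space M \<Longrightarrow> T g x \<in> space M"
  using T_meas by (rule measurable_space)

lemma integral_T:
  fixes f :: "'a \<Rightarrow> real"
  shows "g \<in> SL \<Longrightarrow> f \<in> borel_measurable M \<Longrightarrow> (\<integral>x. f (T g x) \<partial>M) = (\<integral>x. f x \<partial>M)"
  using integral_distr[OF T_meas, of g f] by (simp add: T_pres)

lemma integrable_T:
  fixes f :: "'a \<Rightarrow> real"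
  shows "g \<in> SL \<Longrightarrow> integrable M f \<Longrightarrow> integrable M (\<lambda>x. f (T g x))"
  using integrable_distr[OF T_meas, of g f] by (simp add: T_pres)

lemma orbit_measurable:
  fixes \<gamma> :: "'p::{metric_space, second_countable_topology} \<Rightarrow> real^'n^'n"
  assumes F: "orbit_cont F" and \<Omega>: "open \<Omega>" and \<gamma>: "continuous_on \<Omega> \<gamma>" "\<And>a. a \<in> \<Omega> \<Longrightarrow> \<gamma> a \<in> SL"
  shows "(\<lambda>(a, x). if a \<in> \<Omega> then F (T (\<gamma> a) x) else 0) \<in> borel_measurable (borel \<Otimes>\<^sub>M M)"
proof (rule caratheodory_measurable[OF \<Omega>])
  show "(\<lambda>x. F (T (\<gamma> a) x)) \<in> borel_measurable M" if "a \<in> \<Omega>" for a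
    using F measurable_compose[OF T_meas[OF \<gamma>(2)[OF that]]] unfolding orbit_cont_def by auto
  show "continuous_on \<Omega> (\<lambda>a. F (T (\<gamma> a) x))" if "x \<in> space M" for x
    using F that \<gamma> unfolding orbit_cont_def
    by (intro continuous_on_compose2[of SL "\<lambda>g. F (T g x)" \<Omega> \<gamma>]) auto
qed

definition avg :: "'n \<Rightarrow> 'n \<Rightarrow> ('a \<Rightarrow> real) \<Rightarrow> real \<Rightarrow> 'a \<Rightarrow> real" where
  "avg i j F s x = (\<integral>t. F (T (transv i j (s * t)) x) \<partial>unit_unif)"

sublocale U: prob_space unit_unif by (rule prob_space_unit_unif)
sublocale MU: pair_prob_space M unit_unif ..
sublocale UU: pair_prob_space unit_unif unit_unif ..

context
  fixes i j :: 'n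
  assumes ij: "i \<noteq> j"
begin

lemma flow_measurable:
  assumes "orbit_cont F"
  shows "(\<lambda>(x, t). F (T (transv i j (s * t)) x)) \<in> borel_measurable (M \<Otimes>\<^sub>M unit_unif)"
proof -
  have "(\<lambda>(t::real, x). if t \<in> UNIV then F (T (transv i j (s * t)) x) else 0) \<in> borel_measurable (borel \<Otimes>\<^sub>M M)"
    by (rule orbit_measurable[OF assms]) (use ij in \<open>auto intro!: continuous_on_transv continuous_intros transv_SL\<close>)
  from measurable_pair_swap[OF this] show ?thesis by simp
qed

lemma flow_continuous:
  assumes "orbit_cont F" "x \<in> space M"
  shows "continuous_on UNIV (\<lambda>t. F (T (transv i j t) x))"
  using assms unfolding orbit_cont_def
  by (intro continuous_on_compose2[of SL "\<lambda>g. F (T g x)" UNIV "transv i j"])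
     (use ij in \<open>auto intro!: continuous_on_transv continuous_intros transv_SL\<close>)

lemma flow_borel:
  assumes "orbit_cont F" "x \<in> space M"
  shows "(\<lambda>t. F (T (transv i j t) x)) \<in> borel_measurable borel"
  by (rule borel_measurable_continuous_onI[OF flow_continuous[OF assms]])

lemma flow_borel_scaled:
  assumes "orbit_cont F" "x \<in> space M"
  shows "(\<lambda>t. F (T (transv i j (s * t)) x)) \<in> borel_measurable borel"
  using measurable_compose[of "\<lambda>t. s * t" borel borel, OF _ flow_borel[OF assms]] by simp

lemma flow_add:
  "x \<in> space M \<Longrightarrow> T (transv i j s) (T (transv i j t) x) = T (transv i j (s + t)) x"
  using ij by (simp add: T_mult transv_SL transv_add)

context
  fixes F :: "'a \<Rightarrow> real" and K :: real
  assumes F: "orbit_cont F" and K_bound: "\<forall>x\<in>space M. \<bar>F x\<bar> \<le> K"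
begin

private lemma K: "x \<in> space M \<Longrightarrow> \<bar>F x\<bar> \<le> K"
  using K_bound by blast

lemma F_flow_le: "x \<in> space M \<Longrightarrow> \<bar>F (T (transv i j t) x)\<bar> \<le> K"
  using ij by (intro K T_space transv_SL) auto

lemma avg_le:
  assumes x: "x \<in> space M" shows "\<bar>avg i j F s x\<bar> \<le> K"
  unfolding avg_def
proof (rule U.integral_bounds(2))
  show "(\<lambda>t. F (T (transv i j (s * t)) x)) \<in> borel_measurable unit_unif"
    using flow_borel_scaled[OF F x] by simp
qed (simp add: F_flow_le x)

lemma K_nonneg: "0 \<le> K"
proof -
  obtain x where "x \<in> space M" using not_empty by blast
  from K[OF this] show ?thesis by linarith
qed

lemma avg_orbit_cont: "orbit_cont (avg i j F s)"
  unfolding orbit_cont_def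
proof (intro conjI ballI)
  show "avg i j F s \<in> borel_measurable M"
    unfolding avg_def[abs_def]
    by (rule U.borel_measurable_lebesgue_integral[OF flow_measurable[OF F]])
next
  fix x assume x: "x \<in> space M"
  show "continuous_on SL (\<lambda>g. avg i j F s (T g x))"
    unfolding continuous_on_sequentially comp_def
  proof (intro allI impI ballI, elim conjE)
    fix g a assume a: "a \<in> SL" and g: "\<forall>n. g n \<in> (SL :: (real^'n^'n) set)" and lim: "g \<longlonglongrightarrow> a"
    show "(\<lambda>n. avg i j F s (T (g n) x)) \<longlonglongrightarrow> avg i j F s (T a x)"
      unfolding avg_def
    proof (rule integral_dominated_convergence[where w = "\<lambda>_. K"])
      show "AE t in unit_unif. (\<lambda>n. F (T (transv i j (s * t)) (T (g n) x))) \<longlonglongrightarrow> F (T (transv i j (s * t)) (T a x))"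
      proof (rule AE_I2)
        fix t
        have c1: "continuous_on SL (\<lambda>g. F (T g x))"
          using F x unfolding orbit_cont_def by blast
        have c2: "continuous_on SL (\<lambda>g. transv i j (s * t) ** g)"
          by (intro continuous_on_matrix_mult continuous_intros)
        have "continuous_on SL (\<lambda>g. F (T (transv i j (s * t) ** g) x))"
          by (rule continuous_on_compose2[OF c1 c2]) (use ij in \<open>auto intro!: SL_mult transv_SL\<close>)
        then have "(\<lambda>n. F (T (transv i j (s * t) ** g n) x)) \<longlonglongrightarrow> F (T (transv i j (s * t) ** a) x)"
          using a g lim unfolding continuous_on_sequentially comp_def by blast
        then show "(\<lambda>n. F (T (transv i j (s * t)) (T (g n) x))) \<longlonglongrightarrow> F (T (transv i j (s * t)) (T a x))"
          using a g x ij by (simp add: T_mult transv_SL)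
      qed
      show "AE t in unit_unif. norm (F (T (transv i j (s * t)) (T (g n) x))) \<le> K" for n
        using g x ij by (auto intro!: K T_space transv_SL)
    next
      show "(\<lambda>t. F (T (transv i j (s * t)) (T a x))) \<in> borel_measurable unit_unif"
        using flow_borel_scaled[OF F T_space[OF a x]] by simp
      show "(\<lambda>t. F (T (transv i j (s * t)) (T (g n) x))) \<in> borel_measurable unit_unif" for n
        using flow_borel_scaled[OF F T_space[OF g[rule_format] x]] by simp
    qed simp
  qed
qed

lemma avg_meas: "avg i j F s \<in> borel_measurable M"
  using avg_orbit_cont by (simp add: orbit_cont_def)

text \<open>The two averages run over time windows of length \<open>s\<close> that are translated by \<open>r\<close>.\<close>

lemma avg_shift:
  assumes "x \<in> space M" "s > 0"
  shows "\<bar>avg i j F s (T (transv i j r) x) - avg i j F s x\<bar> \<le> 2 * K * \<bar>r\<bar> / s"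
  using unit_unif_shift[OF flow_borel[OF F assms(1)] _ assms(2), of K r] assms(1) ij
  by (simp add: avg_def flow_add K T_space transv_SL)

text \<open>By Fubini the iterated average is an average of averages over translated time windows,
  with translations of size at most \<open>a\<close>.\<close>

lemma avg_avg:
  assumes x: "x \<in> space M" and a: "a > 0" and s: "s > 0"
  shows "\<bar>avg i j (avg i j F a) s x - avg i j F s x\<bar> \<le> 2 * K * a / s"
proof -
  define \<phi> where "\<phi> t = F (T (transv i j t) x)" for t
  have [measurable]: "\<phi> \<in> borel_measurable borel"
    unfolding \<phi>_def[abs_def] by (rule flow_borel[OF F x])
  have \<phi>K: "\<bar>\<phi> t\<bar> \<le> K" for t
    unfolding \<phi>_def using x ij by (intro K T_space transv_SL) auto
  have int: "integrable (unit_unif \<Otimes>\<^sub>M unit_unif) (\<lambda>(t, r). \<phi> (s * t + a * r))"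
    by (rule UU.integral_bounds[of _ K]) (auto intro!: AE_I2 \<phi>K simp: split_beta')
  have "avg i j (avg i j F a) s x = (\<integral>t. (\<integral>r. \<phi> (s * t + a * r) \<partial>unit_unif) \<partial>unit_unif)"
    unfolding avg_def \<phi>_def using x by (simp add: flow_add add.commute)
  also have "\<dots> = (\<integral>r. (\<integral>t. \<phi> (s * t + a * r) \<partial>unit_unif) \<partial>unit_unif)"
    using UU.Fubini_integral[OF int] by simp
  finally have 1: "avg i j (avg i j F a) s x = \<dots>" .
  have 2: "avg i j F s x = (\<integral>t. \<phi> (s * t) \<partial>unit_unif)"
    unfolding avg_def \<phi>_def ..
  have m: "(\<lambda>r. \<integral>t. \<phi> (s * t + a * r) \<partial>unit_unif) \<in> borel_measurable unit_unif"
    by measurable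
  have int1: "integrable unit_unif (\<lambda>r. \<integral>t. \<phi> (s * t + a * r) \<partial>unit_unif)"
    using UU.integrable_snd[OF int] by simp
  have "\<bar>(\<integral>r. (\<integral>t. \<phi> (s * t + a * r) \<partial>unit_unif) - (\<integral>t. \<phi> (s * t) \<partial>unit_unif) \<partial>unit_unif)\<bar> \<le> 2 * K * a / s"
  proof (rule U.integral_bounds)
    show "AE r in unit_unif. \<bar>(\<integral>t. \<phi> (s * t + a * r) \<partial>unit_unif) - (\<integral>t. \<phi> (s * t) \<partial>unit_unif)\<bar> \<le> 2 * K * a / s"
      using AE_unit_unif
    proof eventually_elim
      case (elim r)
      have "\<bar>a * r\<bar> \<le> a" using elim a by (simp add: abs_mult mult_left_le)
      then have "2 * K * \<bar>a * r\<bar> / s \<le> 2 * K * a / s"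
        using K_nonneg s by (intro divide_right_mono mult_left_mono) auto
      then show ?case
        using unit_unif_shift[where \<phi> = \<phi> and r = "a * r", OF _ \<phi>K s] by simp
    qed
  qed (use m in measurable)
  also have "(\<integral>r. (\<integral>t. \<phi> (s * t + a * r) \<partial>unit_unif) - (\<integral>t. \<phi> (s * t) \<partial>unit_unif) \<partial>unit_unif)
     = avg i j (avg i j F a) s x - avg i j F s x"
    unfolding 1 2
    by (subst Bochner_Integration.integral_diff)
       (use int1 in simp_all)
  finally show ?thesis .
qed

text \<open>Jensen's inequality in the time variable (the variance is nonnegative), then invariance of
  the measure.\<close>

lemma avg_contract: "(\<integral>x. (avg i j F s x)\<^sup>2 \<partial>M) \<le> (\<integral>x. (F x)\<^sup>2 \<partial>M)"
proof -
  have F2: "F \<in> borel_measurable M" using F by (simp add: orbit_cont_def)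
  have sq: "\<bar>y\<^sup>2\<bar> \<le> K\<^sup>2" if "\<bar>y\<bar> \<le> K" for y :: real
    using that by (simp add: power2_le_iff_abs_le abs_le_square_iff)
  note fm = flow_measurable[OF F, of s]
  note FK = F_flow_le
  have int: "integrable (M \<Otimes>\<^sub>M unit_unif) (\<lambda>(x, t). (F (T (transv i j (s * t)) x))\<^sup>2)"
  proof (rule MU.integral_bounds)
    show "(\<lambda>(x, t). (F (T (transv i j (s * t)) x))\<^sup>2) \<in> borel_measurable (M \<Otimes>\<^sub>M unit_unif)"
      using borel_measurable_power[OF fm, of 2] by (simp add: split_beta')
    show "AE z in M \<Otimes>\<^sub>M unit_unif. \<bar>case z of (x, t) \<Rightarrow> (F (T (transv i j (s * t)) x))\<^sup>2\<bar> \<le> K\<^sup>2"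
      using FK by (intro AE_I2) (auto simp: space_pair_measure intro!: sq)
  qed
  have "(\<integral>x. (avg i j F s x)\<^sup>2 \<partial>M) \<le> (\<integral>x. (\<integral>t. (F (T (transv i j (s * t)) x))\<^sup>2 \<partial>unit_unif) \<partial>M)"
  proof (rule integral_mono_AE)
    show "integrable M (\<lambda>x. (avg i j F s x)\<^sup>2)"
      using avg_meas[of s] avg_le
      by (intro integral_bounds[of _ "K\<^sup>2"] AE_I2 sq) auto
    show "integrable M (\<lambda>x. \<integral>t. (F (T (transv i j (s * t)) x))\<^sup>2 \<partial>unit_unif)"
      by (rule MU.integrable_fst[OF int])
    show "AE x in M. (avg i j F s x)\<^sup>2 \<le> (\<integral>t. (F (T (transv i j (s * t)) x))\<^sup>2 \<partial>unit_unif)"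
    proof (rule AE_I2)
      fix x assume x: "x \<in> space M"
      define Y where "Y t = F (T (transv i j (s * t)) x)" for t
      have [measurable]: "Y \<in> borel_measurable borel"
        unfolding Y_def[abs_def] by (rule flow_borel_scaled[OF F x])
      have YK: "\<bar>Y t\<bar> \<le> K" for t unfolding Y_def by (rule FK[OF x])
      have i1: "integrable unit_unif Y" "integrable unit_unif (\<lambda>t. (Y t)\<^sup>2)"
        by (rule U.integral_bounds[of _ K], simp, simp add: YK)
           (rule U.integral_bounds[of _ "K\<^sup>2"], simp, rule AE_I2, rule sq[OF YK])
      have "0 \<le> (\<integral>t. (Y t - (\<integral>t. Y t \<partial>unit_unif))\<^sup>2 \<partial>unit_unif)" by simp
      also have "\<dots> = (\<integral>t. (Y t)\<^sup>2 \<partial>unit_unif) - (\<integral>t. Y t \<partial>unit_unif)\<^sup>2"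
        by (rule U.variance_eq[OF i1])
      finally show "(avg i j F s x)\<^sup>2 \<le> (\<integral>t. (F (T (transv i j (s * t)) x))\<^sup>2 \<partial>unit_unif)"
        unfolding avg_def Y_def by simp
    qed
  qed
  also have "\<dots> = (\<integral>t. (\<integral>x. (F (T (transv i j (s * t)) x))\<^sup>2 \<partial>M) \<partial>unit_unif)"
    using MU.Fubini_integral[OF int] by simp
  also have "\<dots> = (\<integral>t. (\<integral>x. (F x)\<^sup>2 \<partial>M) \<partial>unit_unif)"
    using F2 ij by (subst integral_T[where f = "\<lambda>x. (F x)\<^sup>2"]) (auto intro: transv_SL)
  also have "\<dots> = (\<integral>x. (F x)\<^sup>2 \<partial>M)" by simp
  finally show ?thesis .
qed

lemma avg_integral: "(\<integral>x. avg i j F s x \<partial>M) = (\<integral>x. F x \<partial>M)"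
proof -
  have F2: "F \<in> borel_measurable M" using F by (simp add: orbit_cont_def)
  have int: "integrable (M \<Otimes>\<^sub>M unit_unif) (\<lambda>(x, t). F (T (transv i j (s * t)) x))"
    using ij by (intro MU.integral_bounds[OF flow_measurable[OF F]] AE_I2)
      (auto simp: space_pair_measure intro!: K T_space transv_SL)
  have "(\<integral>x. avg i j F s x \<partial>M) = (\<integral>t. (\<integral>x. F (T (transv i j (s * t)) x) \<partial>M) \<partial>unit_unif)"
    unfolding avg_def using MU.Fubini_integral[OF int] by simp
  also have "\<dots> = (\<integral>x. F x \<partial>M)"
    using F2 ij by (subst integral_T[where f = F]) (auto intro: transv_SL)
  finally show ?thesis .
qed

end

end

end

section \<open>Convergence of the averages and constancy of the limit\<close>

lemma matrix_right_mult_linear: "linear (\<lambda>A :: real^'n::finite^'n. A ** h)"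
  by (rule linearI)
     (simp_all add: vec_eq_iff matrix_matrix_mult_def distrib_right sum.distrib sum_distrib_left mult.assoc)

lemma AE_lborel_right_mult:
  fixes P :: "real^'n::finite^'n \<Rightarrow> bool"
  assumes P: "AE A in lborel. P A" and h: "h \<in> SL"
  shows "AE A in lborel. P (A ** h)"
proof -
  obtain N where N: "{A. \<not> P A} \<subseteq> N" "N \<in> null_sets lborel"
    using P by (auto simp: eventually_ae_filter)
  have "negligible N"
    using N(2) by (simp add: negligible_iff_null_sets null_sets_completionI)
  then have "negligible ((\<lambda>A. A ** matrix_inv h) ` N)"
    by (intro negligible_differentiable_image_negligible linear_imp_differentiable_on
        matrix_right_mult_linear) simp
  moreover have "{A. \<not> P (A ** h)} \<subseteq> (\<lambda>A. A ** matrix_inv h) ` N"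
  proof
    fix A assume "A \<in> {A. \<not> P (A ** h)}"
    then have "A ** h \<in> N" using N by auto
    moreover have "A = (A ** h) ** matrix_inv h"
      using SL_inv[OF h] by (simp add: matrix_mul_assoc[symmetric])
    ultimately show "A \<in> (\<lambda>A. A ** matrix_inv h) ` N" by blast
  qed
  ultimately have "negligible {A. \<not> P (A ** h)}" by (rule negligible_subset)
  then have "AE A in lebesgue. P (A ** h)"
    by (simp add: negligible_iff_null_sets AE_iff_null_sets eventually_ae_filter) blast
  then show ?thesis by (simp add: AE_completion_iff)
qed

text \<open>A retraction of the open set of matrices of positive determinant onto the special linear
  group. It makes Lebesgue measure on the space of matrices available as a replacement for Haar
  measure, of which only the null sets matter here.\<close>

definition sl :: "real^'n::finite^'n \<Rightarrow> real^'n^'n" where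
  "sl A = (1 / root CARD('n) (det A)) *\<^sub>R A"

lemma det_scaleR: "det (c *\<^sub>R A) = c ^ CARD('n) * det (A :: real^'n::finite^'n)"
proof -
  have "c *\<^sub>R A = (\<chi> i. c *s A $ i)" by (simp add: vec_eq_iff)
  then show ?thesis using det_rows_mul[of "\<lambda>_. c" "\<lambda>i. A $ i"] by simp
qed

lemma sl_SL: "det A > 0 \<Longrightarrow> sl A \<in> SL"
  by (simp add: SL_def sl_def det_scaleR power_divide)

lemma sl_mult: "h \<in> SL \<Longrightarrow> sl (A ** h) = sl A ** h"
  by (simp add: sl_def SL_def det_mul scalar_matrix_assoc)

lemma continuous_on_det:
  "continuous_on S (det :: real^'n::finite^'n \<Rightarrow> real)"
  unfolding det_def by (intro continuous_intros)

lemma open_det_pos: "open {A :: real^'n::finite^'n. det A > 0}"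
  using continuous_on_det[of UNIV] by (intro open_Collect_less) auto

lemma continuous_on_sl: "continuous_on {A :: real^'n::finite^'n. det A > 0} sl"
  unfolding sl_def[abs_def]
  by (intro continuous_intros continuous_on_det) auto

lemma det_pos_not_null: "\<not> (AE A in lborel. \<not> det (A :: real^'n::finite^'n) > 0)"
proof
  assume *: "AE A in lborel. \<not> det (A :: real^'n^'n) > 0"
  have "{A :: real^'n^'n. det A > 0} \<in> null_sets lborel"
    using * open_det_pos[where 'n = 'n, THEN borel_open] by (subst AE_iff_null_sets) auto
  then have "negligible {A :: real^'n^'n. det A > 0}"
    by (simp add: negligible_iff_null_sets null_sets_completionI)
  then have "{A :: real^'n^'n. det A > 0} = {}"
    using open_det_pos open_not_negligible by blast
  moreover have "mat 1 \<in> {A :: real^'n^'n. det A > 0}" by simp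
  ultimately show False by blast
qed

context sl_action begin

text \<open>The arithmetic-geometric mean inequality \<open>\<bar>h\<bar> \<le> e / 2 + h\<^sup>2 / (2 e)\<close> replaces the
  Cauchy-Schwarz inequality.\<close>

lemma abs_le_of_square:
  fixes h :: "'a \<Rightarrow> real"
  assumes "integrable M h" "integrable M (\<lambda>x. (h x)\<^sup>2)" "(\<integral>x. (h x)\<^sup>2 \<partial>M) \<le> e\<^sup>2" "e > 0"
  shows "(\<integral>x. \<bar>h x\<bar> \<partial>M) \<le> e"
proof -
  have "(\<integral>x. \<bar>h x\<bar> \<partial>M) \<le> (\<integral>x. e / 2 + (h x)\<^sup>2 / (2 * e) \<partial>M)"
  proof (rule integral_mono)
    fix x
    have "0 \<le> (\<bar>h x\<bar> - e)\<^sup>2" by simp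
    then have "2 * e * \<bar>h x\<bar> \<le> e\<^sup>2 + (h x)\<^sup>2" by (simp add: power2_diff algebra_simps)
    then show "\<bar>h x\<bar> \<le> e / 2 + (h x)\<^sup>2 / (2 * e)"
      using \<open>e > 0\<close> by (simp add: field_simps power2_eq_square)
  qed (use assms in auto)
  also have "\<dots> = e / 2 + (\<integral>x. (h x)\<^sup>2 \<partial>M) / (2 * e)"
    using assms by (simp add: prob_space)
  also have "\<dots> \<le> e / 2 + e\<^sup>2 / (2 * e)"
    using assms by (intro add_left_mono divide_right_mono) auto
  also have "\<dots> = e" using \<open>e > 0\<close> by (simp add: power2_eq_square)
  finally show ?thesis .
qed

context
  fixes i j :: 'n and F :: "'a \<Rightarrow> real" and K :: real
  assumes ij: "i \<noteq> j" and F: "orbit_cont F" and K: "\<forall>x\<in>space M. \<bar>F x\<bar> \<le> K"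
begin

private abbreviation "A \<equiv> avg i j F"

lemma A_meas[measurable]: "A s \<in> borel_measurable M"
  by (rule avg_meas[OF ij F K])

lemma A_le: "x \<in> space M \<Longrightarrow> \<bar>A s x\<bar> \<le> K"
  by (rule avg_le[OF ij F K])

lemma bounded_square: "\<bar>y\<bar> \<le> B \<Longrightarrow> \<bar>y\<^sup>2\<bar> \<le> B\<^sup>2" for y B :: real
  by (simp add: power2_le_iff_abs_le abs_le_square_iff)

text \<open>The argument of von Neumann and Riesz, without Hilbert space theory. Let \<open>d\<close> be the
  infimum of the squared norms of the means \<open>(A a + A b) / 2\<close> of two averages. Averaging a
  nearly optimal mean over a long window \<open>s\<close> does not increase its norm and gives almost \<open>A s\<close>;
  so the squared norm of \<open>A s\<close> is at most \<open>d + e / 4\<close> for all large \<open>s\<close>. By the parallelogram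
  law two such averages are close, since their mean has squared norm at least \<open>d\<close>.\<close>

lemma avg_L2_Cauchy:
  assumes e: "e > 0"
  shows "\<exists>S. \<forall>s\<ge>S. \<forall>s'\<ge>S. (\<integral>x. (A s x - A s' x)\<^sup>2 \<partial>M) \<le> e"
proof -
  have K0: "0 \<le> K" by (rule K_nonneg[OF ij F K])
  define H where "H a b x = (A a x + A b x) / 2" for a b x
  define N where "N h = (\<integral>x. (h x)\<^sup>2 \<partial>M)" for h :: "'a \<Rightarrow> real"
  have H_oc: "orbit_cont (H a b)" for a b
    using avg_orbit_cont[OF ij F K, of a] avg_orbit_cont[OF ij F K, of b]
    unfolding orbit_cont_def H_def[abs_def] by (auto intro!: continuous_intros)
  then have H_meas[measurable]: "H a b \<in> borel_measurable M" for a b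
    by (simp add: orbit_cont_def)
  have H_le: "\<bar>H a b x\<bar> \<le> K" if "x \<in> space M" for a b x
    using A_le[OF that, of a] A_le[OF that, of b] unfolding H_def by (simp add: abs_le_iff)
  have int2: "integrable M (\<lambda>x. (h x)\<^sup>2)" if "h \<in> borel_measurable M" "\<And>x. x \<in> space M \<Longrightarrow> \<bar>h x\<bar> \<le> B" for h :: "'a \<Rightarrow> real" and B
    using that by (intro integral_bounds[of _ "B\<^sup>2"] AE_I2 bounded_square) auto
  have N0: "0 \<le> N h" for h unfolding N_def by simp
  define S where "S = {N (H a b) | a b. a > 0 \<and> b > 0}"
  define d where "d = Inf S"
  have bdd: "bdd_below S" unfolding S_def using N0 by (auto intro!: bdd_belowI[of _ 0])
  have d_le: "d \<le> N (H a b)" if "a > 0" "b > 0" for a b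
    unfolding d_def using that by (intro cInf_lower bdd) (auto simp: S_def)
  have "N (H 1 1) \<in> S" unfolding S_def using zero_less_one by blast
  then have "S \<noteq> {}" by blast
  then obtain a b where ab: "a > 0" "b > 0" "N (H a b) < d + e / 8"
    using cInf_lessD[of S "d + e / 8"] e unfolding d_def S_def by auto
  define m where "m = max a b"
  have m: "m > 0" "a \<le> m" "b \<le> m" using ab by (auto simp: m_def)
  have small: "N (A s) \<le> d + e / 8 + 4 * K\<^sup>2 * m / s" if s: "s > 0" for s
  proof -
    have H_oc': "orbit_cont (H a b)" and H_le': "\<forall>x\<in>space M. \<bar>H a b x\<bar> \<le> K"
      using H_oc H_le by auto
    define G where "G = avg i j (H a b) s"
    have G_meas[measurable]: "G \<in> borel_measurable M"
      unfolding G_def by (rule avg_meas[OF ij H_oc' H_le'])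
    have G_le: "\<bar>G x\<bar> \<le> K" if "x \<in> space M" for x
      unfolding G_def using that by (rule avg_le[OF ij H_oc' H_le'])
    have G_eq: "G x = (avg i j (A a) s x + avg i j (A b) s x) / 2" if "x \<in> space M" for x
    proof -
      have "integrable unit_unif (\<lambda>t. A a (T (transv i j (s * t)) x))" for a
        using flow_borel_scaled[OF ij avg_orbit_cont[OF ij F K] that, of a s] ij that
        by (intro U.integral_bounds[of _ K] AE_I2 A_le T_space transv_SL) auto
      then show ?thesis unfolding G_def avg_def[of i j "H a b"] avg_def[of i j "A a"] avg_def[of i j "A b"] H_def
        by simp
    qed
    have close: "\<bar>G x - A s x\<bar> \<le> 2 * K * m / s" if "x \<in> space M" for x
    proof -
      have "2 * K * a / s \<le> 2 * K * m / s" "2 * K * b / s \<le> 2 * K * m / s"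
        using m K0 s by (auto intro!: divide_right_mono mult_left_mono)
      then have "\<bar>avg i j (A a) s x - A s x\<bar> \<le> 2 * K * m / s" "\<bar>avg i j (A b) s x - A s x\<bar> \<le> 2 * K * m / s"
        using order_trans[OF avg_avg[OF ij F K that ab(1) s]] order_trans[OF avg_avg[OF ij F K that ab(2) s]]
        by blast+
      moreover have "\<bar>(u + v) / 2\<bar> \<le> w" if "\<bar>u\<bar> \<le> w" "\<bar>v\<bar> \<le> w" for u v w :: real
        using that by (simp add: abs_le_iff)
      ultimately have "\<bar>((avg i j (A a) s x - A s x) + (avg i j (A b) s x - A s x)) / 2\<bar> \<le> 2 * K * m / s"
        by blast
      moreover have "((avg i j (A a) s x - A s x) + (avg i j (A b) s x - A s x)) / 2 = G x - A s x"
        unfolding G_eq[OF that] by (simp add: field_simps)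
      ultimately show ?thesis by simp
    qed
    have "N (A s) - N G = (\<integral>x. (A s x)\<^sup>2 - (G x)\<^sup>2 \<partial>M)"
      unfolding N_def by (rule Bochner_Integration.integral_diff[symmetric]) (auto intro!: int2 A_le G_le)
    also have "\<dots> \<le> 4 * K\<^sup>2 * m / s"
    proof -
      have "\<bar>\<integral>x. (A s x)\<^sup>2 - (G x)\<^sup>2 \<partial>M\<bar> \<le> 4 * K\<^sup>2 * m / s"
      proof (rule integral_bounds)
        show "AE x in M. \<bar>(A s x)\<^sup>2 - (G x)\<^sup>2\<bar> \<le> 4 * K\<^sup>2 * m / s"
        proof (rule AE_I2)
          fix x assume x: "x \<in> space M"
          have "\<bar>(A s x)\<^sup>2 - (G x)\<^sup>2\<bar> = \<bar>A s x + G x\<bar> * \<bar>G x - A s x\<bar>"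
            by (simp add: abs_mult[symmetric] power2_eq_square algebra_simps abs_minus_commute)
          also have "\<dots> \<le> (2 * K) * (2 * K * m / s)"
            using close[OF x] A_le[OF x, of s] G_le[OF x] K0 by (intro mult_mono) auto
          finally show "\<bar>(A s x)\<^sup>2 - (G x)\<^sup>2\<bar> \<le> 4 * K\<^sup>2 * m / s"
            by (simp add: power2_eq_square)
        qed
      qed simp
      then show ?thesis by linarith
    qed
    finally have "N (A s) \<le> N G + 4 * K\<^sup>2 * m / s" by simp
    moreover have "N G \<le> N (H a b)"
      unfolding G_def N_def by (rule avg_contract[OF ij H_oc' H_le'])
    ultimately show ?thesis using ab by linarith
  qed
  \<comment> \<open>From here on the error term \<open>4 K\<^sup>2 m / s\<close> is at most \<open>e / 8\<close>.\<close>
  define S0 where "S0 = max 1 (32 * K\<^sup>2 * m / e)"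
  have small': "N (A s) \<le> d + e / 4" if "s \<ge> S0" for s
  proof -
    have s: "s > 0" "32 * K\<^sup>2 * m / e \<le> s" using that unfolding S0_def by auto
    then have "4 * K\<^sup>2 * m / s \<le> e / 8" using e by (simp add: field_simps)
    then show ?thesis using small[OF s(1)] by linarith
  qed
  show ?thesis
  proof (intro exI[of _ S0] allI impI)
    fix s s' assume s: "s \<ge> S0" "s' \<ge> S0"
    then have pos: "s > 0" "s' > 0" unfolding S0_def by auto
    have "(\<integral>x. (A s x - A s' x)\<^sup>2 \<partial>M) = (\<integral>x. 2 * (A s x)\<^sup>2 + 2 * (A s' x)\<^sup>2 - 4 * (H s s' x)\<^sup>2 \<partial>M)"
      by (rule Bochner_Integration.integral_cong) (simp_all add: H_def power2_eq_square field_simps)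
    also have "\<dots> = 2 * N (A s) + 2 * N (A s') - 4 * N (H s s')"
      unfolding N_def using int2[OF A_meas A_le] int2[OF H_meas H_le] by simp
    also have "\<dots> \<le> e" using small'[OF s(1)] small'[OF s(2)] d_le[OF pos] by linarith
    finally show "(\<integral>x. (A s x - A s' x)\<^sup>2 \<partial>M) \<le> e" .
  qed
qed

lemma diff_L1:
  assumes "e > 0" "(\<integral>x. (A s x - A s' x)\<^sup>2 \<partial>M) \<le> e\<^sup>2"
  shows "(\<integral>x. \<bar>A s x - A s' x\<bar> \<partial>M) \<le> e"
proof (rule abs_le_of_square[OF _ _ assms(2,1)])
  have le: "\<bar>A s x - A s' x\<bar> \<le> 2 * K" if "x \<in> space M" for x
    using A_le[OF that, of s] A_le[OF that, of s'] by linarith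
  show "integrable M (\<lambda>x. A s x - A s' x)" "integrable M (\<lambda>x. (A s x - A s' x)\<^sup>2)"
    by (intro integral_bounds[of _ "2 * K"] integral_bounds[of _ "(2 * K)\<^sup>2"] AE_I2 bounded_square le; simp)+
qed

text \<open>A sequence along which consecutive averages differ by at most \<open>(1/2)\<^sup>k\<close> in mean.\<close>

lemma avg_AE_convergent:
  obtains r :: "nat \<Rightarrow> real" where "filterlim r at_top sequentially" "AE x in M. convergent (\<lambda>k. A (r k) x)"
proof -
  have "\<exists>S. \<forall>k. \<forall>s\<ge>S k. \<forall>s'\<ge>S k. (\<integral>x. (A s x - A s' x)\<^sup>2 \<partial>M) \<le> ((1/2)^k)\<^sup>2"
    by (intro choice allI avg_L2_Cauchy) simp
  then obtain S where S: "\<And>k s s'. s \<ge> S k \<Longrightarrow> s' \<ge> S k \<Longrightarrow> (\<integral>x. (A s x - A s' x)\<^sup>2 \<partial>M) \<le> ((1/2::real)^k)\<^sup>2"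
    by blast
  define r where "r k = (\<Sum>i\<le>k. \<bar>S i\<bar>) + real k" for k
  have r_Suc: "r k \<le> r (Suc k)" for k by (simp add: r_def)
  have r_ge: "S k \<le> r k" for k
  proof -
    have "\<bar>S k\<bar> \<le> (\<Sum>i\<le>k. \<bar>S i\<bar>)" by (rule member_le_sum) auto
    then show ?thesis unfolding r_def by linarith
  qed
  have "(\<integral>x. \<bar>A (r (Suc k)) x - A (r k) x\<bar> \<partial>M) \<le> (1/2)^k" for k
    using r_ge[of k] r_Suc[of k] by (intro diff_L1 S) auto
  moreover have "integrable M (\<lambda>x. A (r (Suc k)) x - A (r k) x)" for k
    using A_le by (intro Bochner_Integration.integrable_diff integral_bounds[of _ K] AE_I2) auto
  ultimately have "AE x in M. summable (\<lambda>k. \<bar>A (r (Suc k)) x - A (r k) x\<bar>)"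
    by (intro AE_summable_of_L1_geometric)
  then have "AE x in M. convergent (\<lambda>k. A (r k) x)"
    by eventually_elim (rule convergent_of_summable_diff)
  moreover have "filterlim r at_top sequentially"
    by (rule filterlim_at_top_mono[OF filterlim_real_sequentially])
       (auto simp: r_def intro!: always_eventually sum_nonneg)
  ultimately show thesis using that by blast
qed

end

sublocale LM: pair_sigma_finite "lborel :: (real^'n^'n) measure" M ..

text \<open>Let \<open>f\<close> be invariant under every group element up to a null set that depends on the
  element. The set \<open>E\<close> of the points \<open>x\<close> such that \<open>f (T (sl A) x) \<le> a\<close> for Lebesgue almost
  every matrix \<open>A\<close> is invariant everywhere, because right multiplication by a group element
  preserves null sets of matrices. By Fubini it agrees with \<open>{f \<le> a}\<close> up to a null set. So
  ergodicity gives a zero-one law for all sublevel sets. The second hypothesis supplies the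
  measurability that Fubini needs.\<close>

lemma invariant_imp_const:
  fixes f :: "'a \<Rightarrow> real"
  assumes f: "integrable M f"
    and J: "(\<lambda>(A, x). if A \<in> {A. det A > 0} then f (T (sl A) x) else 0) \<in> borel_measurable (borel \<Otimes>\<^sub>M M)"
    and inv: "\<And>g. g \<in> SL \<Longrightarrow> AE x in M. f (T g x) = f x"
  shows "AE x in M. f x = (\<integral>x. f x \<partial>M)"
proof -
  define J where "J w = (if det (fst w) > 0 then f (T (sl (fst w)) (snd w)) else 0)" for w :: "(real^'n^'n) \<times> 'a"
  have J_meas[measurable]: "J \<in> borel_measurable (borel \<Otimes>\<^sub>M M)"
    using J by (simp add: J_def[abs_def] split_beta')
  have f_meas[measurable]: "f \<in> borel_measurable M" using f by simp
  have [measurable]: "(det :: real^'n^'n \<Rightarrow> real) \<in> borel_measurable borel"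
    by (rule borel_measurable_continuous_onI[OF continuous_on_det])
  have ae: "AE x in M. AE A in lborel. det A > 0 \<longrightarrow> f (T (sl A) x) = f x"
  proof -
    have "AE A in lborel. AE x in M. det A > 0 \<longrightarrow> J (A, x) = f x"
    proof (rule AE_I2)
      fix A :: "real^'n^'n"
      show "AE x in M. det A > 0 \<longrightarrow> J (A, x) = f x"
      proof (cases "det A > 0")
        case True
        from inv[OF sl_SL[OF True]] show ?thesis by eventually_elim (simp add: J_def True)
      qed simp
    qed
    moreover have "{w \<in> space (lborel \<Otimes>\<^sub>M M). det (fst w) > 0 \<longrightarrow> J (fst w, snd w) = f (snd w)} \<in> sets (lborel \<Otimes>\<^sub>M M)"
      by measurable
    ultimately have "AE x in M. AE A in lborel. det A > 0 \<longrightarrow> J (A, x) = f x"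
      using LM.AE_commute[of "\<lambda>A x. det A > 0 \<longrightarrow> J (A, x) = f x"] by simp
    then show ?thesis by (simp add: J_def cong: conj_cong imp_cong)
  qed
  have zero_one: "measure M {x \<in> space M. f x \<le> a} = 0 \<or> measure M {x \<in> space M. f x \<le> a} = 1" for a
  proof -
    define E where "E = {x \<in> space M. AE A in lborel. det A > 0 \<longrightarrow> f (T (sl A) x) \<le> a}"
    define Q where "Q = {w \<in> space (M \<Otimes>\<^sub>M lborel). det (snd w) > 0 \<and> J (snd w, fst w) > a}"
    have Q[measurable]: "Q \<in> sets (M \<Otimes>\<^sub>M lborel)" unfolding Q_def by measurable
    have "E = {x \<in> space M. emeasure lborel (Pair x -` Q) = 0}"
      unfolding E_def
    proof (intro Collect_cong conj_cong refl)
      fix x assume x: "x \<in> space M"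
      have "Pair x -` Q \<in> sets lborel" using sets_Pair1[OF Q] .
      moreover have "{A \<in> space lborel. \<not> (det A > 0 \<longrightarrow> f (T (sl A) x) \<le> a)} = Pair x -` Q"
        using x by (auto simp: Q_def J_def space_pair_measure)
      ultimately show "(AE A in lborel. det A > 0 \<longrightarrow> f (T (sl A) x) \<le> a) = (emeasure lborel (Pair x -` Q) = 0)"
        by (rule AE_iff_measurable)
    qed
    moreover have "(\<lambda>x. emeasure lborel (Pair x -` Q)) \<in> borel_measurable M"
      by (rule lborel.measurable_emeasure_Pair[OF Q])
    ultimately have E: "E \<in> sets M" by simp
    have step: "T h x \<in> E" if h: "h \<in> SL" and x: "x \<in> E" for h x
    proof -
      have xs: "x \<in> space M" using x by (simp add: E_def)
      have "AE A in lborel. det A > 0 \<longrightarrow> f (T (sl A) x) \<le> a" using x by (simp add: E_def)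
      from AE_lborel_right_mult[OF this h]
      have "AE A in lborel. det A > 0 \<longrightarrow> f (T (sl A) (T h x)) \<le> a"
      proof eventually_elim
        case (elim A)
        show ?case
        proof
          assume A: "det A > 0"
          then have "det (A ** h) > 0" using h by (simp add: det_mul SL_def)
          then show "f (T (sl A) (T h x)) \<le> a"
            using elim sl_mult[OF h] T_mult[OF sl_SL[OF A] h xs] by simp
        qed
      qed
      then show ?thesis using T_space[OF h xs] by (simp add: E_def)
    qed
    have "\<forall>h\<in>SL. T h ` E = E"
    proof (intro ballI equalityI subsetI)
      fix h x assume h: "h \<in> (SL :: (real^'n^'n) set)" and x: "x \<in> E"
      have "x \<in> space M" using x by (simp add: E_def)
      then have "x = T h (T (matrix_inv h) x)"
        using SL_inv[OF h] h by (simp add: T_mult T_one)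
      then show "x \<in> T h ` E" using step[OF SL_inv(1)[OF h] x] by blast
    qed (use step in auto)
    then have "measure M E = 0 \<or> measure M E = 1" by (rule ergodic[OF E])
    moreover have "measure M E = measure M {x \<in> space M. f x \<le> a}"
    proof (rule measure_eq_AE)
      show "AE x in M. (x \<in> E) = (x \<in> {x \<in> space M. f x \<le> a})"
        using ae AE_space
      proof eventually_elim
        case (elim x)
        show ?case
        proof (cases "f x \<le> a")
          case True
          have "AE A in lborel. det A > 0 \<longrightarrow> f (T (sl A) x) \<le> a"
            using elim(1) by eventually_elim (simp add: True)
          then show ?thesis using True elim by (simp add: E_def)
        next
          case False
          have "\<not> (AE A in lborel. det A > 0 \<longrightarrow> f (T (sl A) x) \<le> a)"
          proof
            assume "AE A in lborel. det A > 0 \<longrightarrow> f (T (sl A) x) \<le> a"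
            with elim(1) have "AE A in lborel. \<not> det (A :: real^'n^'n) > 0"
              by eventually_elim (use False in auto)
            then show False using det_pos_not_null by blast
          qed
          then show ?thesis using False by (simp add: E_def)
        qed
      qed
    qed (use E in measurable)
    ultimately show ?thesis by simp
  qed
  let ?e = "\<integral>x. f x \<partial>M"
  \<comment> \<open>A sublevel set below the mean cannot have full measure, so it is null.\<close>
  have gt: "AE x in M. f x > a" if a: "a < ?e" for a
  proof -
    have "measure M {x \<in> space M. f x \<le> a} \<noteq> 1"
    proof
      assume "measure M {x \<in> space M. f x \<le> a} = 1"
      then have "AE x in M. f x \<le> a" using prob_Collect_eq_1[of "\<lambda>x. f x \<le> a"] by simp
      then have "?e \<le> (\<integral>x. a \<partial>M)" using f by (intro integral_mono_AE) auto
      then show False using a by (simp add: prob_space)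
    qed
    then have "measure M {x \<in> space M. f x \<le> a} = 0" using zero_one by blast
    then have "AE x in M. \<not> f x \<le> a" using prob_Collect_eq_0[of "\<lambda>x. f x \<le> a"] by simp
    then show ?thesis by (simp add: not_le)
  qed
  have "AE x in M. \<forall>n. f x > ?e - 1 / real (Suc n)"
    by (subst AE_all_countable) (use gt in auto)
  then have ge: "AE x in M. 0 \<le> f x - ?e"
  proof eventually_elim
    case (elim x)
    have "(\<lambda>n. ?e - 1 / real (Suc n)) \<longlonglongrightarrow> ?e - 0"
      by (intro tendsto_diff tendsto_const LIMSEQ_Suc[OF lim_1_over_n])
    then have "?e - 0 \<le> f x" by (rule LIMSEQ_le_const2) (use elim less_imp_le in blast)
    then show ?case by simp
  qed
  have "(\<integral>x. f x - ?e \<partial>M) = 0" using f by (simp add: prob_space)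
  then have "AE x in M. f x - ?e = 0"
    using integral_nonneg_eq_0_iff_AE[OF _ ge] f by simp
  then show ?thesis by simp
qed

text \<open>The averages are Cauchy in mean; let \<open>f\<close> be their limit, chosen as a pointwise limit along
  a subsequence so that it is measurable along orbits. The distance \<open>D g\<close> of \<open>f\<close> to its
  translate by \<open>g\<close> is continuous at the identity, because the averages are continuous along
  orbits, and vanishes for the flow itself by \<open>avg_shift\<close>. So \<open>mautner\<close> shows that \<open>f\<close> is
  invariant under the whole group, and \<open>invariant_imp_const\<close> that it is constant.\<close>

theorem mean_ergodic_bounded:
  assumes ij: "i \<noteq> j" and F: "orbit_cont F" and K: "\<forall>x\<in>space M. \<bar>F x\<bar> \<le> K"
  shows "((\<lambda>s. \<integral>x. \<bar>avg i j F s x - (\<integral>x. F x \<partial>M)\<bar> \<partial>M) \<longlongrightarrow> 0) at_top"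
proof -
  let ?A = "avg i j F"
  note A_meas[measurable] = A_meas[OF ij F K]
  note A_le = A_le[OF ij F K]
  have A_int: "integrable M (?A s)" for s
    by (rule integral_bounds[of _ K]) (auto intro!: A_le AE_I2)
  obtain r :: "nat \<Rightarrow> real" where r: "filterlim r at_top sequentially" "AE x in M. convergent (\<lambda>k. ?A (r k) x)"
    using avg_AE_convergent[OF ij F K] by blast
  define f where "f x = lim (\<lambda>k. ?A (r k) x)" for x
  have f_meas[measurable]: "f \<in> borel_measurable M"
    unfolding f_def[abs_def] by measurable
  have conv: "AE x in M. (\<lambda>k. ?A (r k) x) \<longlonglongrightarrow> f x"
    using r(2) by eventually_elim (simp add: f_def convergent_LIMSEQ_iff)
  have f_le: "AE x in M. \<bar>f x\<bar> \<le> K"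
    using conv AE_space
  proof eventually_elim
    case (elim x)
    have "(\<lambda>k. \<bar>?A (r k) x\<bar>) \<longlonglongrightarrow> \<bar>f x\<bar>" using elim(1) by (rule tendsto_rabs)
    then show ?case by (rule LIMSEQ_le_const2) (use A_le elim in blast)
  qed
  have f_int: "integrable M f" by (rule integral_bounds[OF f_meas f_le])
  define L where "L s = (\<integral>x. \<bar>?A s x - f x\<bar> \<partial>M)" for s
  have L0: "0 \<le> L s" for s unfolding L_def by simp
  have "(\<lambda>k. L (r k)) \<longlonglongrightarrow> (\<integral>x. 0 \<partial>M)"
    unfolding L_def
  proof (rule integral_dominated_convergence[where w = "\<lambda>_. 2 * K"])
    show "AE x in M. (\<lambda>k. \<bar>?A (r k) x - f x\<bar>) \<longlonglongrightarrow> 0"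
      using conv by eventually_elim (auto intro!: tendsto_rabs_zero simp: LIM_zero)
    show "AE x in M. norm \<bar>?A (r k) x - f x\<bar> \<le> 2 * K" for k
      using f_le AE_space
    proof eventually_elim
      case (elim x)
      then show ?case using A_le[of x "r k"] by simp
    qed
  qed auto
  then have Lr: "(\<lambda>k. L (r k)) \<longlonglongrightarrow> 0" by simp
  have L_lim: "(L \<longlongrightarrow> 0) at_top"
  proof (rule tendstoI)
    fix e :: real assume e: "e > 0"
    obtain S where S: "\<And>s s'. s \<ge> S \<Longrightarrow> s' \<ge> S \<Longrightarrow> (\<integral>x. (?A s x - ?A s' x)\<^sup>2 \<partial>M) \<le> (e/4)\<^sup>2"
      using avg_L2_Cauchy[OF ij F K, of "(e/4)\<^sup>2"] e by auto
    have "eventually (\<lambda>k. r k \<ge> S) sequentially" using r(1) by (simp add: filterlim_at_top)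
    moreover have "eventually (\<lambda>k. L (r k) < e / 2) sequentially"
      using order_tendstoD(2)[OF Lr, of "e/2"] e by simp
    ultimately have "eventually (\<lambda>k. r k \<ge> S \<and> L (r k) < e / 2) sequentially" by eventually_elim simp
    then obtain k where k: "r k \<ge> S" "L (r k) < e / 2" using eventually_happens' sequentially_bot by blast
    have "L s < e" if s: "s \<ge> S" for s
    proof -
      have "L s \<le> (\<integral>x. \<bar>?A s x - ?A (r k) x\<bar> + \<bar>?A (r k) x - f x\<bar> \<partial>M)"
        unfolding L_def using A_int f_int
        by (intro integral_mono Bochner_Integration.integrable_add integrable_abs Bochner_Integration.integrable_diff) auto
      also have "\<dots> = (\<integral>x. \<bar>?A s x - ?A (r k) x\<bar> \<partial>M) + L (r k)"
        unfolding L_def using A_int f_int by simp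
      also have "(\<integral>x. \<bar>?A s x - ?A (r k) x\<bar> \<partial>M) \<le> e / 4"
        using e by (intro diff_L1[OF ij F K] S s k) auto
      finally show ?thesis using k(2) e by linarith
    qed
    then show "eventually (\<lambda>s. dist (L s) 0 < e) at_top"
      using L0 by (auto simp: eventually_at_top_linorder intro!: exI[of _ S])
  qed
  define D where "D g = (\<integral>x. \<bar>f (T g x) - f x\<bar> \<partial>M)" for g
  have fT_int: "integrable M (\<lambda>x. f (T g x))" if "g \<in> SL" for g
    by (rule integrable_T[OF that f_int])
  have AT_int: "integrable M (\<lambda>x. ?A s (T g x))" if "g \<in> SL" for g s
    by (rule integrable_T[OF that A_int])
  have AT_L: "(\<integral>x. \<bar>?A s (T g x) - f (T g x)\<bar> \<partial>M) = L s" if "g \<in> SL" for g s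
    unfolding L_def by (rule integral_T[OF that, of "\<lambda>x. \<bar>?A s x - f x\<bar>"]) simp
  have D_le: "D g \<le> 2 * L s + (\<integral>x. \<bar>?A s (T g x) - ?A s x\<bar> \<partial>M)" if g: "g \<in> SL" for g s
  proof -
    have "D g \<le> (\<integral>x. (\<bar>?A s (T g x) - f (T g x)\<bar> + \<bar>?A s x - f x\<bar>) + \<bar>?A s (T g x) - ?A s x\<bar> \<partial>M)"
      unfolding D_def using A_int f_int fT_int[OF g] AT_int[OF g]
      by (intro integral_mono Bochner_Integration.integrable_add integrable_abs Bochner_Integration.integrable_diff) auto
    also have "\<dots> = ((\<integral>x. \<bar>?A s (T g x) - f (T g x)\<bar> \<partial>M) + L s) + (\<integral>x. \<bar>?A s (T g x) - ?A s x\<bar> \<partial>M)"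
      unfolding L_def using A_int f_int fT_int[OF g] AT_int[OF g] by simp
    finally show ?thesis using AT_L[OF g] by simp
  qed
  have D0: "D g = 0" if "g \<in> SL" for g
  \<comment> \<open>The flow adds coordinate \<open>j\<close> to coordinate \<open>i\<close>, hence the order of the indices.\<close>
  proof (rule mautner[of j i D, OF ij[symmetric] _ _ _ _ that])
    show "0 \<le> D g" for g unfolding D_def by simp
    show "D (g ** h) \<le> D g + D h" if g: "g \<in> SL" and h: "h \<in> SL" for g h
    proof -
      have gh: "g ** h \<in> SL" by (rule SL_mult[OF g h])
      have int: "integrable M (\<lambda>x. f (T g (T h x)))"
        by (rule integrable_T[OF h fT_int[OF g]])
      have "D (g ** h) = (\<integral>x. \<bar>f (T g (T h x)) - f x\<bar> \<partial>M)"
        unfolding D_def using T_mult[OF g h] by (intro Bochner_Integration.integral_cong) auto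
      also have "\<dots> \<le> (\<integral>x. \<bar>f (T g (T h x)) - f (T h x)\<bar> + \<bar>f (T h x) - f x\<bar> \<partial>M)"
        using f_int fT_int[OF h] int
        by (intro integral_mono Bochner_Integration.integrable_add integrable_abs Bochner_Integration.integrable_diff) auto
      also have "\<dots> = (\<integral>x. \<bar>f (T g (T h x)) - f (T h x)\<bar> \<partial>M) + D h"
        unfolding D_def using f_int fT_int[OF h] int by simp
      also have "(\<integral>x. \<bar>f (T g (T h x)) - f (T h x)\<bar> \<partial>M) = D g"
        unfolding D_def using fT_int[OF g] by (intro integral_T[OF h, of "\<lambda>x. \<bar>f (T g x) - f x\<bar>"]) auto
      finally show ?thesis .
    qed
    show "(\<lambda>n. D (g n)) \<longlonglongrightarrow> 0" if g: "\<And>n::nat. g n \<in> SL" and lim: "g \<longlonglongrightarrow> mat 1" for g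
    proof (rule tendstoI)
      fix e :: real assume e: "e > 0"
      obtain s where s: "L s < e / 4"
        using order_tendstoD(2)[OF L_lim, of "e/4"] e eventually_happens'[OF trivial_limit_at_top_linorder] by auto
      have "(\<lambda>n. \<integral>x. \<bar>?A s (T (g n) x) - ?A s x\<bar> \<partial>M) \<longlonglongrightarrow> (\<integral>x. 0 \<partial>M)"
      proof (rule integral_dominated_convergence[where w = "\<lambda>_. 2 * K"])
        show "AE x in M. (\<lambda>n. \<bar>?A s (T (g n) x) - ?A s x\<bar>) \<longlonglongrightarrow> 0"
        proof (rule AE_I2)
          fix x assume x: "x \<in> space M"
          have "continuous_on SL (\<lambda>g. ?A s (T g x))"
            using avg_orbit_cont[OF ij F K] x unfolding orbit_cont_def by blast
          then have "(\<lambda>n. ?A s (T (g n) x)) \<longlonglongrightarrow> ?A s (T (mat 1) x)"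
            using g lim mat1_SL unfolding continuous_on_sequentially comp_def by blast
          then have "(\<lambda>n. ?A s (T (g n) x)) \<longlonglongrightarrow> ?A s x" by (simp add: T_one x)
          then show "(\<lambda>n. \<bar>?A s (T (g n) x) - ?A s x\<bar>) \<longlonglongrightarrow> 0"
            by (intro tendsto_rabs_zero LIM_zero)
        qed
        show "AE x in M. norm \<bar>?A s (T (g n) x) - ?A s x\<bar> \<le> 2 * K" for n
        proof (rule AE_I2)
          fix x assume x: "x \<in> space M"
          show "norm \<bar>?A s (T (g n) x) - ?A s x\<bar> \<le> 2 * K"
            using A_le[OF x, of s] A_le[OF T_space[OF g x], of s n] by simp
        qed
      qed (use A_int AT_int[OF g] in auto)
      then have "eventually (\<lambda>n. (\<integral>x. \<bar>?A s (T (g n) x) - ?A s x\<bar> \<partial>M) < e / 2) sequentially"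
        using order_tendstoD(2)[of _ 0 sequentially "e/2"] e by simp
      then show "eventually (\<lambda>n. dist (D (g n)) 0 < e) sequentially"
      proof eventually_elim
        case (elim n)
        have "0 \<le> D (g n)" unfolding D_def by simp
        then show ?case using D_le[OF g, of n s] s elim e by simp
      qed
    qed
    show "D (transv i j t) = 0" for t
    proof -
      have u: "transv i j t \<in> SL" using ij by (rule transv_SL)
      have "D (transv i j t) \<le> 2 * L s + 2 * K * \<bar>t\<bar> / s" if s: "s > 0" for s
      proof -
        have "(\<integral>x. \<bar>?A s (T (transv i j t) x) - ?A s x\<bar> \<partial>M) \<le> (\<integral>x. 2 * K * \<bar>t\<bar> / s \<partial>M)"
          using A_int AT_int[OF u] avg_shift[OF ij F K _ s] by (intro integral_mono) auto
        then show ?thesis using D_le[OF u, of s] by (simp add: prob_space)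
      qed
      then have ev: "eventually (\<lambda>s. D (transv i j t) \<le> 2 * L s + 2 * K * \<bar>t\<bar> / s) at_top"
        using eventually_gt_at_top[of 0] by (rule eventually_mono[rotated]) auto
      have "((\<lambda>s. 2 * L s + 2 * K * \<bar>t\<bar> / s) \<longlongrightarrow> 2 * 0 + 0) at_top"
        by (intro tendsto_add tendsto_mult tendsto_const L_lim tendsto_divide_0[OF tendsto_const] filterlim_at_top_imp_at_infinity filterlim_ident)
      from tendsto_lowerbound[OF this ev] have "D (transv i j t) \<le> 0" by simp
      moreover have "0 \<le> D (transv i j t)" unfolding D_def by simp
      ultimately show ?thesis by simp
    qed
  qed
  have inv: "AE x in M. f (T g x) = f x" if g: "g \<in> SL" for g
  proof -
    have "AE x in M. \<bar>f (T g x) - f x\<bar> = 0"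
      using D0[OF g] f_int fT_int[OF g] unfolding D_def
      by (subst (asm) integral_nonneg_eq_0_iff_AE) auto
    then show ?thesis by eventually_elim simp
  qed
  \<comment> \<open>As a pointwise limit, \<open>f\<close> inherits joint measurability from the averages.\<close>
  have const: "AE x in M. f x = (\<integral>x. f x \<partial>M)"
  proof (rule invariant_imp_const[OF f_int _ inv])
    let ?\<Omega> = "{A :: real^'n^'n. det A > 0}"
    have *: "(\<lambda>(A, x). if A \<in> ?\<Omega> then ?A (r k) (T (sl A) x) else 0) \<in> borel_measurable (borel \<Otimes>\<^sub>M M)" for k
      by (rule orbit_measurable[OF avg_orbit_cont[OF ij F K] open_det_pos continuous_on_sl]) (simp add: sl_SL)
    have "(\<lambda>w. lim (\<lambda>k. case w of (A, x) \<Rightarrow> if A \<in> ?\<Omega> then ?A (r k) (T (sl A) x) else 0)) \<in> borel_measurable (borel \<Otimes>\<^sub>M M)"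
      by (rule borel_measurable_lim_metric[OF *])
    moreover have "(\<lambda>w. lim (\<lambda>k. case w of (A, x) \<Rightarrow> if A \<in> ?\<Omega> then ?A (r k) (T (sl A) x) else 0))
      = (\<lambda>(A, x). if A \<in> ?\<Omega> then f (T (sl A) x) else 0)"
      by (auto simp: fun_eq_iff f_def)
    ultimately show "(\<lambda>(A, x). if A \<in> ?\<Omega> then f (T (sl A) x) else 0) \<in> borel_measurable (borel \<Otimes>\<^sub>M M)"
      by simp
  qed
  have F_eq: "(\<integral>x. f x \<partial>M) = (\<integral>x. F x \<partial>M)"
  proof -
    have "\<bar>(\<integral>x. F x \<partial>M) - (\<integral>x. f x \<partial>M)\<bar> \<le> L s" for s
    proof -
      have "(\<integral>x. F x \<partial>M) - (\<integral>x. f x \<partial>M) = (\<integral>x. ?A s x - f x \<partial>M)"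
        using A_int f_int avg_integral[OF ij F K, of s] by simp
      then show ?thesis unfolding L_def by (simp only: integral_abs_bound)
    qed
    then have "\<bar>(\<integral>x. F x \<partial>M) - (\<integral>x. f x \<partial>M)\<bar> \<le> 0"
      by (intro tendsto_lowerbound[OF L_lim] always_eventually) auto
    then show ?thesis by simp
  qed
  have "L = (\<lambda>s. \<integral>x. \<bar>avg i j F s x - (\<integral>x. F x \<partial>M)\<bar> \<partial>M)"
    unfolding L_def using const by (intro ext integral_cong_AE) (auto simp: F_eq)
  then show ?thesis using L_lim by simp
qed

lemma flow_integrable:
  assumes ij: "i \<noteq> j" and H: "orbit_cont H" and x: "x \<in> space M"
  shows "integrable unit_unif (\<lambda>t. H (T (transv i j (s * t)) x))"
proof -
  let ?\<phi> = "\<lambda>t. H (T (transv i j (s * t)) x)"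
  have c: "continuous_on UNIV (\<lambda>t. H (T (transv i j t) x))" by (rule flow_continuous[OF ij H x])
  have "continuous_on {0..1} ?\<phi>"
    by (rule continuous_on_compose2[OF c]) (auto intro!: continuous_intros)
  then have "bounded (?\<phi> ` {0..1})"
    by (intro compact_imp_bounded compact_continuous_image) auto
  then obtain B where B: "\<forall>t\<in>{0..1}. \<bar>?\<phi> t\<bar> \<le> B" by (auto simp: bounded_iff)
  have "AE t in unit_unif. \<bar>?\<phi> t\<bar> \<le> B" using AE_unit_unif by eventually_elim (use B in auto)
  then show ?thesis
    using flow_borel_scaled[OF ij H x, of s] by (intro U.integral_bounds[of _ B]) simp_all
qed

text \<open>Truncate \<open>F\<close> at height \<open>k\<close>. Averaging is a contraction in mean, so the average of what is
  cut off is small uniformly in \<open>s\<close>. The nonnegative integral is used because the average of an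
  unbounded function is not known to be integrable beforehand.\<close>

theorem mean_ergodic:
  assumes ij: "i \<noteq> j" and F: "orbit_cont F" and F0: "\<And>x. x \<in> space M \<Longrightarrow> 0 \<le> F x" and Fi: "integrable M F"
  shows "((\<lambda>s. \<integral>\<^sup>+x. ennreal \<bar>avg i j F s x - (\<integral>x. F x \<partial>M)\<bar> \<partial>M) \<longlongrightarrow> 0) at_top"
proof -
  have F_meas[measurable]: "F \<in> borel_measurable M" using Fi by simp
  define G where "G k x = min (F x) (real k)" for k x
  have G_oc: "orbit_cont (G k)" for k
    using F unfolding orbit_cont_def G_def[abs_def] by (auto intro!: continuous_intros)
  have G_meas[measurable]: "G k \<in> borel_measurable M" for k using G_oc by (simp add: orbit_cont_def)
  have G_bd: "\<forall>x\<in>space M. \<bar>G k x\<bar> \<le> real k" for k using F0 by (auto simp: G_def)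
  have G_int: "integrable M (G k)" for k
    using G_bd by (intro integral_bounds[of _ "real k"] AE_I2) auto
  have G_lim: "(\<lambda>k. \<integral>x. G k x \<partial>M) \<longlonglongrightarrow> (\<integral>x. F x \<partial>M)"
  proof (rule integral_dominated_convergence[where w = F])
    show "AE x in M. (\<lambda>k. G k x) \<longlonglongrightarrow> F x"
    proof (rule AE_I2)
      fix x
      obtain n where n: "F x \<le> real n" using real_arch_simple by blast
      have "eventually (\<lambda>k. F x = G k x) sequentially"
        using eventually_ge_at_top[of n] by eventually_elim (use n in \<open>auto simp: G_def\<close>)
      from Lim_transform_eventually[OF tendsto_const this] show "(\<lambda>k. G k x) \<longlonglongrightarrow> F x" .
    qed
    show "AE x in M. norm (G k x) \<le> F x" for k
      using F0 by (intro AE_I2) (auto simp: G_def)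
  qed (use Fi in auto)
  have tail: "(\<integral>\<^sup>+x. ennreal \<bar>avg i j F s x - avg i j (G k) s x\<bar> \<partial>M) \<le> ennreal ((\<integral>x. F x \<partial>M) - (\<integral>x. G k x \<partial>M))" for s k
  proof -
    define h where "h x = F x - G k x" for x
    have h0: "0 \<le> h x" for x by (simp add: h_def G_def)
    have h_oc: "orbit_cont h"
      using F G_oc[of k] unfolding orbit_cont_def h_def[abs_def] by (auto intro!: continuous_intros)
    have h_int: "integrable M h" unfolding h_def[abs_def] using Fi G_int by simp
    have h_meas[measurable]: "h \<in> borel_measurable M" using h_int by simp
    have hm: "(\<lambda>(x, t). ennreal (h (T (transv i j (s * t)) x))) \<in> borel_measurable (M \<Otimes>\<^sub>M unit_unif)"
      using measurable_compose[OF flow_measurable[OF ij h_oc, of s] measurable_ennreal]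
      by (simp add: split_beta' comp_def)
    have "(\<integral>\<^sup>+x. ennreal \<bar>avg i j F s x - avg i j (G k) s x\<bar> \<partial>M)
        \<le> (\<integral>\<^sup>+x. (\<integral>\<^sup>+t. ennreal (h (T (transv i j (s * t)) x)) \<partial>unit_unif) \<partial>M)"
    proof (rule nn_integral_mono)
      fix x assume x: "x \<in> space M"
      note int = flow_integrable[OF ij _ x, of _ s]
      have "avg i j F s x - avg i j (G k) s x = (\<integral>t. h (T (transv i j (s * t)) x) \<partial>unit_unif)"
        unfolding avg_def h_def using int[OF F] int[OF G_oc] by simp
      moreover have "0 \<le> (\<integral>t. h (T (transv i j (s * t)) x) \<partial>unit_unif)" by (simp add: h0)
      moreover have "(\<integral>\<^sup>+t. ennreal (h (T (transv i j (s * t)) x)) \<partial>unit_unif) = ennreal (\<integral>t. h (T (transv i j (s * t)) x) \<partial>unit_unif)"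
        by (rule nn_integral_eq_integral[OF int[OF h_oc]]) (simp add: h0)
      ultimately show "ennreal \<bar>avg i j F s x - avg i j (G k) s x\<bar> \<le> (\<integral>\<^sup>+t. ennreal (h (T (transv i j (s * t)) x)) \<partial>unit_unif)"
        by simp
    qed
    also have "\<dots> = (\<integral>\<^sup>+t. (\<integral>\<^sup>+x. ennreal (h (T (transv i j (s * t)) x)) \<partial>M) \<partial>unit_unif)"
      using MU.Fubini'[OF hm] by simp
    also have "\<dots> = (\<integral>\<^sup>+t. (\<integral>\<^sup>+x. ennreal (h x) \<partial>M) \<partial>unit_unif)"
    proof (rule nn_integral_cong)
      fix t
      have g: "transv i j (s * t) \<in> SL" using ij by (rule transv_SL)
      show "(\<integral>\<^sup>+x. ennreal (h (T (transv i j (s * t)) x)) \<partial>M) = (\<integral>\<^sup>+x. ennreal (h x) \<partial>M)"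
        using nn_integral_distr[OF T_meas[OF g], of "\<lambda>x. ennreal (h x)"] by (simp add: T_pres[OF g])
    qed
    also have "\<dots> = (\<integral>\<^sup>+x. ennreal (h x) \<partial>M)" using U.emeasure_space_1 by simp
    also have "\<dots> = ennreal (\<integral>x. h x \<partial>M)"
      by (rule nn_integral_eq_integral[OF h_int]) (simp add: h0)
    also have "(\<integral>x. h x \<partial>M) = (\<integral>x. F x \<partial>M) - (\<integral>x. G k x \<partial>M)"
      unfolding h_def using Fi G_int by simp
    finally show ?thesis .
  qed
  have bound: "(\<integral>\<^sup>+x. ennreal \<bar>avg i j F s x - (\<integral>x. F x \<partial>M)\<bar> \<partial>M)
     \<le> ennreal (2 * ((\<integral>x. F x \<partial>M) - (\<integral>x. G k x \<partial>M)) + (\<integral>x. \<bar>avg i j (G k) s x - (\<integral>x. G k x \<partial>M)\<bar> \<partial>M))" for s k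
  proof -
    let ?F = "\<integral>x. F x \<partial>M" and ?G = "\<integral>x. G k x \<partial>M"
    have FG: "?G \<le> ?F" using Fi G_int by (intro integral_mono) (auto simp: G_def)
    have Am[measurable]: "avg i j (G k) s \<in> borel_measurable M" by (rule avg_meas[OF ij G_oc G_bd])
    have Fm[measurable]: "avg i j F s \<in> borel_measurable M"
      unfolding avg_def[abs_def] by (rule U.borel_measurable_lebesgue_integral[OF flow_measurable[OF ij F]])
    have Ai: "integrable M (avg i j (G k) s)"
      using avg_le[OF ij G_oc G_bd] by (intro integral_bounds[of _ "real k"] AE_I2) auto
    have "(\<integral>\<^sup>+x. ennreal \<bar>avg i j F s x - ?F\<bar> \<partial>M)
      \<le> (\<integral>\<^sup>+x. ennreal \<bar>avg i j F s x - avg i j (G k) s x\<bar> + ennreal \<bar>avg i j (G k) s x - ?G\<bar> + ennreal (?F - ?G) \<partial>M)"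
    proof (rule nn_integral_mono)
      fix x
      have "\<bar>avg i j F s x - ?F\<bar> \<le> \<bar>avg i j F s x - avg i j (G k) s x\<bar> + \<bar>avg i j (G k) s x - ?G\<bar> + (?F - ?G)"
        using FG by linarith
      then show "ennreal \<bar>avg i j F s x - ?F\<bar>
        \<le> ennreal \<bar>avg i j F s x - avg i j (G k) s x\<bar> + ennreal \<bar>avg i j (G k) s x - ?G\<bar> + ennreal (?F - ?G)"
        using FG by (simp add: ennreal_plus[symmetric] ennreal_leI del: ennreal_plus)
    qed
    also have "\<dots> = (\<integral>\<^sup>+x. ennreal \<bar>avg i j F s x - avg i j (G k) s x\<bar> \<partial>M) + (\<integral>\<^sup>+x. ennreal \<bar>avg i j (G k) s x - ?G\<bar> \<partial>M) + ennreal (?F - ?G)"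
      by (simp add: nn_integral_add emeasure_space_1)
    also have "(\<integral>\<^sup>+x. ennreal \<bar>avg i j (G k) s x - ?G\<bar> \<partial>M) = ennreal (\<integral>x. \<bar>avg i j (G k) s x - ?G\<bar> \<partial>M)"
      by (rule nn_integral_eq_integral) (use Ai in auto)
    also have "(\<integral>\<^sup>+x. ennreal \<bar>avg i j F s x - avg i j (G k) s x\<bar> \<partial>M) + ennreal (\<integral>x. \<bar>avg i j (G k) s x - ?G\<bar> \<partial>M) + ennreal (?F - ?G)
      \<le> ennreal (?F - ?G) + ennreal (\<integral>x. \<bar>avg i j (G k) s x - ?G\<bar> \<partial>M) + ennreal (?F - ?G)"
      by (intro add_right_mono tail)
    also have "\<dots> = ennreal (2 * (?F - ?G) + (\<integral>x. \<bar>avg i j (G k) s x - ?G\<bar> \<partial>M))"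
    proof -
      have *: "ennreal a + ennreal b + ennreal a = ennreal (2 * a + b)" if "0 \<le> a" "0 \<le> b" for a b
        using that by (simp add: ennreal_plus[symmetric] del: ennreal_plus)
      show ?thesis by (rule *) (use FG in auto)
    qed
    finally show ?thesis .
  qed
  show ?thesis
  proof (rule order_tendstoI)
    fix e :: ennreal assume "0 < e"
    then obtain e' where e': "0 < e'" "e' < e" using dense by blast
    then obtain d where d: "0 < d" "ennreal d < e" by (cases e') auto
    have "eventually (\<lambda>k. (\<integral>x. G k x \<partial>M) > (\<integral>x. F x \<partial>M) - d / 4) sequentially"
      using d by (intro order_tendstoD[OF G_lim]) simp
    then obtain k where k: "(\<integral>x. G k x \<partial>M) > (\<integral>x. F x \<partial>M) - d / 4"
      using eventually_happens' sequentially_bot by blast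
    have "eventually (\<lambda>s. (\<integral>x. \<bar>avg i j (G k) s x - (\<integral>x. G k x \<partial>M)\<bar> \<partial>M) < d / 2) at_top"
      using d by (intro order_tendstoD[OF mean_ergodic_bounded[OF ij G_oc G_bd]]) simp
    then show "eventually (\<lambda>s. (\<integral>\<^sup>+x. ennreal \<bar>avg i j F s x - (\<integral>x. F x \<partial>M)\<bar> \<partial>M) < e) at_top"
    proof eventually_elim
      case (elim s)
      have lin: "2 * (a - b) + c \<le> d" if "c < d / 2" "a - d / 4 < b" for a b c d :: real
        using that by (simp add: field_simps)
      have "2 * ((\<integral>x. F x \<partial>M) - (\<integral>x. G k x \<partial>M)) + (\<integral>x. \<bar>avg i j (G k) s x - (\<integral>x. G k x \<partial>M)\<bar> \<partial>M) \<le> d"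
        by (rule lin[OF elim k])
      then show ?case using bound[of s k] d(2) by (meson ennreal_leI order_le_less_trans)
    qed
  qed simp
qed

end

section \<open>Measures of at most volume growth\<close>

lemma growth_sets: "\<nu> \<in> growth_measures \<Longrightarrow> sets \<nu> = sets borel"
  by (simp add: growth_measures_def)

lemma growth_space: "\<nu> \<in> growth_measures \<Longrightarrow> space \<nu> = UNIV"
  using sets_eq_imp_space_eq[OF growth_sets, of \<nu>] by simp

lemma growth_measurable: "\<nu> \<in> growth_measures \<Longrightarrow> f \<in> borel_measurable borel \<Longrightarrow> f \<in> borel_measurable \<nu>"
  using measurable_cong_sets[OF growth_sets refl] by blast

lemma growth_bound:
  fixes \<nu> :: "(real^'n::finite) measure"
  assumes "\<nu> \<in> growth_measures"
  obtains C where "0 \<le> C" "\<And>R. R > 0 \<Longrightarrow> emeasure \<nu> (ball 0 R) \<le> ennreal (C * R ^ CARD('n))"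
proof -
  define S where "S = (SUP R\<in>{0<..}. emeasure \<nu> (ball 0 R) / ennreal (R ^ CARD('n)))"
  have S: "S < \<infinity>" using assms by (simp add: S_def growth_measures_def)
  show thesis
  proof
    fix R :: real assume R: "R > 0"
    have "emeasure \<nu> (ball 0 R) / ennreal (R ^ CARD('n)) \<le> S"
      unfolding S_def using R by (intro SUP_upper) auto
    then have "emeasure \<nu> (ball 0 R) / ennreal (R ^ CARD('n)) * ennreal (R ^ CARD('n)) \<le> S * ennreal (R ^ CARD('n))"
      by (rule mult_right_mono) simp
    also have "emeasure \<nu> (ball 0 R) / ennreal (R ^ CARD('n)) * ennreal (R ^ CARD('n)) = emeasure \<nu> (ball 0 R)"
    proof -
      have "a / b * b = a" if "b \<noteq> 0" "b \<noteq> top" for a b :: ennreal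
        using that mult_divide_eq_ennreal[of b a] by (simp add: ennreal_times_divide mult.commute)
      then show ?thesis using R by simp
    qed
    also have "S * ennreal (R ^ CARD('n)) = ennreal (enn2real S * R ^ CARD('n))"
      using S R by (simp add: ennreal_mult less_top)
    finally show "emeasure \<nu> (ball 0 R) \<le> ennreal (enn2real S * R ^ CARD('n))" .
  qed simp
qed

lemma growth_measuresI:
  fixes \<nu> :: "(real^'n::finite) measure"
  assumes "sets \<nu> = sets borel" "\<And>R. R > 0 \<Longrightarrow> emeasure \<nu> (ball 0 R) \<le> ennreal (C * R ^ CARD('n))"
  shows "\<nu> \<in> growth_measures"
proof -
  have "(SUP R\<in>{0<..}. emeasure \<nu> (ball 0 R) / ennreal (R ^ CARD('n))) \<le> ennreal C"
  proof (rule SUP_least)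
    fix R :: real assume "R \<in> {0<..}"
    then have R: "R > 0" by simp
    have "emeasure \<nu> (ball 0 R) \<le> ennreal (R ^ CARD('n)) * ennreal C"
      using assms(2)[OF R] R by (simp add: ennreal_mult'' mult.commute)
    then show "emeasure \<nu> (ball 0 R) / ennreal (R ^ CARD('n)) \<le> ennreal C"
      using R by (intro divide_le_posI_ennreal) auto
  qed
  then show ?thesis using assms(1) unfolding growth_measures_def
    by (auto intro: le_less_trans)
qed

lemma growth_ball_finite:
  fixes \<nu> :: "(real^'n::finite) measure"
  assumes "\<nu> \<in> growth_measures" shows "emeasure \<nu> (ball 0 R) < \<infinity>"
proof (cases "R > 0")
  case True
  then show ?thesis using growth_bound[OF assms] by (metis ennreal_less_top infinity_ennreal_def le_less_trans)
next
  case False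
  then have "ball (0::real^'n) R = {}" by (simp add: ball_eq_empty)
  then show ?thesis by (simp only: emeasure_empty) simp
qed

lemma Cc_bound:
  fixes \<psi> :: "real^'n::finite \<Rightarrow> real"
  assumes "\<psi> \<in> Cc"
  obtains B R where "0 < B" "0 < R" "\<And>x. \<bar>\<psi> x\<bar> \<le> B * indicator (ball 0 R) x"
proof -
  let ?K = "closure {x. \<psi> x \<noteq> 0}"
  have c: "continuous_on UNIV \<psi>" and K: "compact ?K" using assms by (auto simp: Cc_def)
  have "compact (\<psi> ` ?K)" using c K by (intro compact_continuous_image) (auto intro: continuous_on_subset)
  then obtain B where B: "\<forall>x\<in>?K. \<bar>\<psi> x\<bar> \<le> B" using compact_imp_bounded by (fastforce simp: bounded_iff)
  obtain R where R: "R > 0" "?K \<subseteq> ball 0 R"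
    using K compact_imp_bounded bounded_subset_ballD by blast
  show thesis
  proof (rule that[of "\<bar>B\<bar> + 1" R])
    fix x show "\<bar>\<psi> x\<bar> \<le> (\<bar>B\<bar> + 1) * indicator (ball 0 R) x"
    proof (cases "\<psi> x = 0")
      case False
      then have "x \<in> ?K" using closure_subset by fastforce
      then show ?thesis using B R by (auto simp: indicator_def split: if_splits)
    qed auto
  qed (use R in auto)
qed

lemma Cc_borel: "\<psi> \<in> Cc \<Longrightarrow> \<psi> \<in> borel_measurable borel"
  by (auto simp: Cc_def intro: borel_measurable_continuous_onI)

lemma bounded_support_integrable:
  fixes \<psi> :: "real^'n::finite \<Rightarrow> real"
  assumes "\<nu> \<in> growth_measures" "\<psi> \<in> borel_measurable borel" "\<And>x. \<bar>\<psi> x\<bar> \<le> B * indicator (ball 0 R) x"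
  shows "integrable \<nu> \<psi>"
proof (rule Bochner_Integration.integrable_bound)
  show "integrable \<nu> (\<lambda>x. B * indicator (ball 0 R) x)"
    using growth_ball_finite[OF assms(1)] growth_sets[OF assms(1)] by (intro integrable_mult_right) auto
  show "\<psi> \<in> borel_measurable \<nu>" by (rule growth_measurable[OF assms(1,2)])
  show "AE x in \<nu>. norm (\<psi> x) \<le> norm (B * indicator (ball 0 R) x)"
    using assms(3) by (intro AE_I2) (smt (verit) real_norm_def)
qed

lemma Cc_integrable: "\<nu> \<in> growth_measures \<Longrightarrow> \<psi> \<in> Cc \<Longrightarrow> integrable \<nu> \<psi>"
  by (metis Cc_bound Cc_borel bounded_support_integrable)

text \<open>Clip multiples of the distance to the complement.\<close>

lemma open_approx_Cc:
  fixes U :: "(real^'n::finite) set"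
  assumes "open U" "bounded U"
  obtains \<psi> where "\<And>k::nat. \<psi> k \<in> Cc" "\<And>k x. 0 \<le> \<psi> k x" "\<And>k x. \<psi> k x \<le> indicator U x"
    "\<And>x. (\<lambda>k. \<psi> k x) \<longlonglongrightarrow> indicator U x"
proof -
  define \<psi> where "\<psi> k x = min 1 (real k * infdist x (- U))" for k x
  have ne: "- U \<noteq> {}" using assms(2) by (metis Compl_empty_eq boolean_algebra.compl_zero not_bounded_UNIV double_compl)
  have zero: "infdist x (- U) = 0 \<longleftrightarrow> x \<notin> U" for x
    using in_closed_iff_infdist_zero[OF _ ne, of x] assms(1) by auto
  show thesis
  proof
    show le: "\<psi> k x \<le> indicator U x" for k x
      using zero[of x] by (cases "x \<in> U") (auto simp: \<psi>_def)
    show "0 \<le> \<psi> k x" for k x by (simp add: \<psi>_def infdist_nonneg)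
    show "\<psi> k \<in> Cc" for k
    proof -
      have "\<psi> k x = 0" if "x \<notin> U" for x using zero[of x] that by (simp add: \<psi>_def)
      then have "{x. \<psi> k x \<noteq> 0} \<subseteq> U" by blast
      then have "bounded (closure {x. \<psi> k x \<noteq> 0})" using assms(2) bounded_closure bounded_subset by blast
      moreover have "continuous_on UNIV (\<psi> k)" unfolding \<psi>_def[abs_def] by (intro continuous_intros)
      ultimately show ?thesis by (simp add: Cc_def compact_eq_bounded_closed)
    qed
    show "(\<lambda>k. \<psi> k x) \<longlonglongrightarrow> indicator U x" for x
    proof (cases "x \<in> U")
      case True
      then have pos: "infdist x (- U) > 0" using zero[of x] infdist_nonneg[of x "- U"] by auto
      obtain n where n: "1 / infdist x (- U) \<le> real n" using real_arch_simple by blast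
      have "eventually (\<lambda>k. 1 = \<psi> k x) sequentially"
        using eventually_ge_at_top[of n]
      proof eventually_elim
        case (elim k)
        have "1 / infdist x (- U) \<le> real k" using n elim by linarith
        then show ?case using pos by (simp add: \<psi>_def field_simps)
      qed
      from Lim_transform_eventually[OF tendsto_const this] show ?thesis using True by simp
    next
      case False then show ?thesis using zero[of x] by (simp add: \<psi>_def)
    qed
  qed
qed

lemma weak_star_subset: "openin weak_star_topology U \<Longrightarrow> U \<subseteq> growth_measures"
  unfolding weak_star_topology_def openin_topology_generated_by_iff
  by (induction rule: generate_topology_on.induct) blast+

lemma space_BG: "space borel_growth_measures = growth_measures"
  unfolding borel_growth_measures_def using weak_star_subset by (intro space_measure_of) auto

lemma sets_BG: "sets borel_growth_measures = sigma_sets growth_measures {U. openin weak_star_topology U}"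
  unfolding borel_growth_measures_def using weak_star_subset by (intro sets_measure_of) auto

lemma weak_star_subbase:
  "\<psi> \<in> Cc \<Longrightarrow> open V \<Longrightarrow> openin weak_star_topology {\<nu> \<in> growth_measures. (\<integral>x. \<psi> x \<partial>\<nu>) \<in> V}"
  unfolding weak_star_topology_def by (rule topology_generated_by_Basis) blast

lemma measurable_Cc: "\<psi> \<in> Cc \<Longrightarrow> (\<lambda>\<nu>. \<integral>x. \<psi> x \<partial>\<nu>) \<in> borel_measurable borel_growth_measures"
proof (rule borel_measurableI)
  fix V :: "real set" assume "\<psi> \<in> Cc" "open V"
  then have "{\<nu> \<in> growth_measures. (\<integral>x. \<psi> x \<partial>\<nu>) \<in> V} \<in> sets borel_growth_measures"
    unfolding sets_BG by (intro sigma_sets.Basic) (simp add: weak_star_subbase)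
  moreover have "(\<lambda>\<nu>. \<integral>x. \<psi> x \<partial>\<nu>) -` V \<inter> space borel_growth_measures = {\<nu> \<in> growth_measures. (\<integral>x. \<psi> x \<partial>\<nu>) \<in> V}"
    by (auto simp: space_BG)
  ultimately show "(\<lambda>\<nu>. \<integral>x. \<psi> x \<partial>\<nu>) -` V \<inter> space borel_growth_measures \<in> sets borel_growth_measures" by simp
qed

lemma measurable_emeasure_open:
  fixes U :: "(real^'n::finite) set"
  assumes "open U" "bounded U"
  shows "(\<lambda>\<nu>. emeasure \<nu> U) \<in> borel_measurable borel_growth_measures"
proof -
  obtain \<psi> where \<psi>: "\<And>k::nat. \<psi> k \<in> Cc" "\<And>k x. 0 \<le> \<psi> k x" "\<And>k x. \<psi> k x \<le> indicator U x"
    "\<And>x. (\<lambda>k. \<psi> k x) \<longlonglongrightarrow> indicator U x"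
    using open_approx_Cc[OF assms] by blast
  obtain R where R: "U \<subseteq> ball 0 R" using assms(2) bounded_subset_ballD by blast
  have fin: "emeasure \<nu> U < \<infinity>" if "\<nu> \<in> growth_measures" for \<nu>
    using growth_ball_finite[OF that, of R] emeasure_mono[OF R, of \<nu>] growth_sets[OF that]
    by (auto intro: le_less_trans)
  have "(\<lambda>\<nu>. measure \<nu> U) \<in> borel_measurable borel_growth_measures"
  proof (rule borel_measurable_LIMSEQ_metric[OF measurable_Cc[OF \<psi>(1)]])
    fix \<nu> :: "(real^'n) measure" assume "\<nu> \<in> space borel_growth_measures"
    then have \<nu>: "\<nu> \<in> growth_measures" by (simp add: space_BG)
    have U: "U \<in> sets \<nu>" using assms growth_sets[OF \<nu>] by simp
    have "(\<lambda>k. \<integral>x. \<psi> k x \<partial>\<nu>) \<longlonglongrightarrow> (\<integral>x. indicator U x \<partial>\<nu>)"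
    proof (rule integral_dominated_convergence[where w = "indicator U"])
      show "integrable \<nu> (indicator U :: _ \<Rightarrow> real)" using fin[OF \<nu>] U by simp
      show "AE x in \<nu>. norm (\<psi> k x) \<le> indicator U x" for k using \<psi> by (intro AE_I2) simp
    next
      show "\<psi> k \<in> borel_measurable \<nu>" for k by (rule growth_measurable[OF \<nu> Cc_borel[OF \<psi>(1)]])
    qed (use \<psi>(4) U in auto)
    then show "(\<lambda>k. \<integral>x. \<psi> k x \<partial>\<nu>) \<longlonglongrightarrow> measure \<nu> U"
      using U growth_space[OF \<nu>] by simp
  qed
  then have "(\<lambda>\<nu>. ennreal (measure \<nu> U)) \<in> borel_measurable borel_growth_measures" by measurable
  then show ?thesis
    by (rule measurable_cong[THEN iffD1, rotated])
       (use fin in \<open>auto simp: space_BG emeasure_eq_ennreal_measure less_top\<close>)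
qed

text \<open>Evaluation at an open bounded set is a limit of evaluations at continuous functions; a
  Dynkin argument within a ball extends this to Borel sets. The intersection with a ball keeps
  all masses finite, so that complements can be subtracted.\<close>

lemma growth_measurable_emeasure:
  fixes A :: "(real^'n::finite) set"
  assumes "A \<in> sets borel"
  shows "(\<lambda>\<nu>. emeasure \<nu> A) \<in> borel_measurable borel_growth_measures"
proof -
  have loc: "(\<lambda>\<nu>. emeasure \<nu> (A \<inter> ball 0 r)) \<in> borel_measurable borel_growth_measures" for r :: real
  proof -
    have "Int_stable {S :: (real^'n) set. open S}" "{S :: (real^'n) set. open S} \<subseteq> Pow UNIV"
      by (auto simp: Int_stable_def)
    moreover have "A \<in> sigma_sets UNIV {S. open S}" using assms by (simp add: borel_def)
    ultimately show ?thesis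
    proof (induction rule: sigma_sets_induct_disjoint)
      case (basic A)
      then show ?case by (intro measurable_emeasure_open) (auto intro: bounded_subset[OF bounded_ball])
    next
      case (compl A)
      have A: "A \<in> sets borel" using compl by (simp add: borel_def)
      have "(\<lambda>\<nu>. emeasure \<nu> (ball 0 r) - emeasure \<nu> (A \<inter> ball 0 r)) \<in> borel_measurable borel_growth_measures"
        using compl measurable_emeasure_open[of "ball (0::real^'n) r"] by measurable
      then show ?case
      proof (rule measurable_cong[THEN iffD1, rotated])
        fix \<nu> :: "(real^'n) measure" assume "\<nu> \<in> space borel_growth_measures"
        then have \<nu>: "\<nu> \<in> growth_measures" by (simp add: space_BG)
        have m: "A \<inter> ball 0 r \<in> sets \<nu>" "ball 0 r \<in> sets \<nu>" using A growth_sets[OF \<nu>] by auto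
        have "emeasure \<nu> (A \<inter> ball 0 r) \<le> emeasure \<nu> (ball 0 r)" using m by (intro emeasure_mono) auto
        then have "emeasure \<nu> (A \<inter> ball 0 r) \<noteq> \<infinity>" using growth_ball_finite[OF \<nu>, of r] by (auto simp: top_unique)
        then have "emeasure \<nu> (ball 0 r - A \<inter> ball 0 r) = emeasure \<nu> (ball 0 r) - emeasure \<nu> (A \<inter> ball 0 r)"
          using m by (intro emeasure_Diff) auto
        moreover have "ball 0 r - A \<inter> ball 0 r = (UNIV - A) \<inter> ball 0 r" by auto
        ultimately show "emeasure \<nu> (ball 0 r) - emeasure \<nu> (A \<inter> ball 0 r) = emeasure \<nu> ((UNIV - A) \<inter> ball 0 r)" by simp
      qed
    next
      case (union A)
      have A: "A i \<in> sets borel" for i using union by (auto simp: borel_def)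
      have "(\<lambda>\<nu>. \<Sum>i. emeasure \<nu> (A i \<inter> ball 0 r)) \<in> borel_measurable borel_growth_measures"
        using union by measurable
      then show ?case
      proof (rule measurable_cong[THEN iffD1, rotated])
        fix \<nu> :: "(real^'n) measure" assume "\<nu> \<in> space borel_growth_measures"
        then have \<nu>: "\<nu> \<in> growth_measures" by (simp add: space_BG)
        have "(\<Sum>i. emeasure \<nu> (A i \<inter> ball 0 r)) = emeasure \<nu> (\<Union>i. A i \<inter> ball 0 r)"
          using A growth_sets[OF \<nu>] union(1)
          by (intro suminf_emeasure disjoint_family_on_bisimulation[OF union(1)]) auto
        then show "(\<Sum>i. emeasure \<nu> (A i \<inter> ball 0 r)) = emeasure \<nu> (\<Union> (range A) \<inter> ball 0 r)"
          by simp
      qed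
    qed simp
  qed
  have "(\<lambda>\<nu>. SUP k. emeasure \<nu> (A \<inter> ball 0 (real k))) \<in> borel_measurable borel_growth_measures"
    using loc by measurable
  then show ?thesis
  proof (rule measurable_cong[THEN iffD1, rotated])
    fix \<nu> :: "(real^'n) measure" assume "\<nu> \<in> space borel_growth_measures"
    then have \<nu>: "\<nu> \<in> growth_measures" by (simp add: space_BG)
    have "(SUP k. emeasure \<nu> (A \<inter> ball 0 (real k))) = emeasure \<nu> (\<Union>k. A \<inter> ball 0 (real k))"
    proof (rule SUP_emeasure_incseq)
      show "range (\<lambda>k. A \<inter> ball 0 (real k)) \<subseteq> sets \<nu>"
        unfolding growth_sets[OF \<nu>] using sets.Int[OF assms borel_open[OF open_ball]] by blast
      show "incseq (\<lambda>k. A \<inter> ball 0 (real k))"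
        unfolding incseq_def using subset_ball[of "real _" "real _" "0 :: real^'n"] by auto
    qed
    also have "(\<Union>k. A \<inter> ball 0 (real k)) = A"
    proof -
      have "\<exists>k. x \<in> ball 0 (real k)" for x :: "real^'n"
        using reals_Archimedean2[of "norm x"] by simp
      then show ?thesis by blast
    qed
    finally show "(SUP k. emeasure \<nu> (A \<inter> ball 0 (real k))) = emeasure \<nu> A" .
  qed
qed

lemma growth_measurable_nn_integral:
  fixes f :: "real^'n::finite \<Rightarrow> ennreal"
  assumes "f \<in> borel_measurable borel"
  shows "(\<lambda>\<nu>. \<integral>\<^sup>+x. f x \<partial>\<nu>) \<in> borel_measurable borel_growth_measures"
  using assms
proof (induction rule: borel_measurable_induct)
  case (cong f g)
  then show ?case by (simp add: fun_eq_iff[symmetric])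
next
  case (set A)
  then show ?case
    using growth_measurable_emeasure[OF set]
    by (rule_tac measurable_cong[THEN iffD1, rotated]) (auto simp: space_BG growth_sets)
next
  case (mult u c)
  have "(\<lambda>\<nu>. c * (\<integral>\<^sup>+x. u x \<partial>\<nu>)) \<in> borel_measurable borel_growth_measures" using mult by measurable
  then show ?case
    by (rule measurable_cong[THEN iffD1, rotated])
       (use mult in \<open>auto simp: space_BG nn_integral_cmult growth_measurable\<close>)
next
  case (add u v)
  have "(\<lambda>\<nu>. (\<integral>\<^sup>+x. v x \<partial>\<nu>) + (\<integral>\<^sup>+x. u x \<partial>\<nu>)) \<in> borel_measurable borel_growth_measures" using add by measurable
  then show ?case
    by (rule measurable_cong[THEN iffD1, rotated])
       (use add in \<open>auto simp: space_BG nn_integral_add growth_measurable\<close>)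
next
  case (seq U)
  have "(\<lambda>\<nu>. SUP i. (\<integral>\<^sup>+x. U i x \<partial>\<nu>)) \<in> borel_measurable borel_growth_measures" using seq by measurable
  then show ?case
    by (rule measurable_cong[THEN iffD1, rotated])
       (use seq in \<open>auto simp: space_BG nn_integral_monotone_convergence_SUP growth_measurable image_comp\<close>)
qed

lemma growth_measurable_integral:
  fixes f :: "real^'n::finite \<Rightarrow> real"
  assumes [measurable]: "f \<in> borel_measurable borel"
  shows "(\<lambda>\<nu>. \<integral>x. f x \<partial>\<nu>) \<in> borel_measurable borel_growth_measures"
proof -
  note [measurable] = growth_measurable_nn_integral
  \<comment> \<open>The Bochner integral is zero by convention where \<open>f\<close> is not integrable.\<close>
  have "(\<lambda>\<nu>. if (\<integral>\<^sup>+x. ennreal \<bar>f x\<bar> \<partial>\<nu>) < \<infinity>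
      then enn2real (\<integral>\<^sup>+x. ennreal (f x) \<partial>\<nu>) - enn2real (\<integral>\<^sup>+x. ennreal (- f x) \<partial>\<nu>) else 0)
    \<in> borel_measurable borel_growth_measures"
    by measurable
  then show ?thesis
  proof (rule measurable_cong[THEN iffD1, rotated])
    fix \<nu> :: "(real^'n) measure" assume "\<nu> \<in> space borel_growth_measures"
    then have \<nu>: "\<nu> \<in> growth_measures" by (simp add: space_BG)
    have f: "f \<in> borel_measurable \<nu>" by (rule growth_measurable[OF \<nu> assms])
    show "(if (\<integral>\<^sup>+x. ennreal \<bar>f x\<bar> \<partial>\<nu>) < \<infinity>
      then enn2real (\<integral>\<^sup>+x. ennreal (f x) \<partial>\<nu>) - enn2real (\<integral>\<^sup>+x. ennreal (- f x) \<partial>\<nu>) else 0) = (\<integral>x. f x \<partial>\<nu>)"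
    proof (cases "integrable \<nu> f")
      case True
      then show ?thesis using real_lebesgue_integral_def[OF True] by (simp add: integrable_iff_bounded)
    next
      case False
      then show ?thesis using f by (simp add: integrable_iff_bounded not_integrable_integral_eq)
    qed
  qed
qed

section \<open>The action on measures\<close>

lemma matrix_vector_borel: "(\<lambda>x. g *v x) \<in> borel_measurable borel" for g :: "real^'n::finite^'n"
  by (intro borel_measurable_continuous_onI) (rule linear_continuous_on[OF matrix_vector_mul_bounded_linear])

lemma SL_expand_bound:
  fixes g :: "real^'n::finite^'n"
  assumes "g \<in> SL"
  obtains B where "B > 0" "\<And>x. norm x \<le> B * norm (g *v x)"
proof -
  obtain B where B: "B > 0" "\<And>x. norm (matrix_inv g *v x) \<le> B * norm x"
    using bounded_linear.pos_bounded[OF matrix_vector_mul_bounded_linear[of "matrix_inv g"]]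
    by (auto simp: mult.commute)
  have "norm x \<le> B * norm (g *v x)" for x
    using B(2)[of "g *v x"] SL_inv(3)[OF assms] by (simp add: matrix_vector_mul_assoc)
  then show thesis using B(1) that by blast
qed

lemma sets_act[simp]: "sets (act g \<nu>) = sets borel"
  by (simp add: act_def)

lemma emeasure_act:
  assumes "\<nu> \<in> growth_measures" "A \<in> sets borel"
  shows "emeasure (act g \<nu>) A = emeasure \<nu> {x. g *v x \<in> A}"
proof -
  have "emeasure (act g \<nu>) A = emeasure \<nu> ((\<lambda>x. g *v x) -` A \<inter> space \<nu>)"
    unfolding act_def
    by (rule emeasure_distr) (use assms growth_measurable[OF assms(1) matrix_vector_borel] in auto)
  then show ?thesis by (simp add: growth_space[OF assms(1)] vimage_def)
qed

lemma integral_act: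
  fixes f :: "real^'n::finite \<Rightarrow> real"
  assumes "\<nu> \<in> growth_measures" "f \<in> borel_measurable borel"
  shows "(\<integral>x. f x \<partial>(act g \<nu>)) = (\<integral>x. f (g *v x) \<partial>\<nu>)"
  unfolding act_def
  by (rule integral_distr) (use assms growth_measurable[OF assms(1) matrix_vector_borel] in auto)

lemma act_growth:
  fixes \<nu> :: "(real^'n::finite) measure"
  assumes g: "g \<in> SL" and \<nu>: "\<nu> \<in> growth_measures"
  shows "act g \<nu> \<in> growth_measures"
proof -
  obtain B where B: "B > 0" "\<And>x. norm x \<le> B * norm (g *v x)" using SL_expand_bound[OF g] by blast
  obtain C where C: "0 \<le> C" "\<And>R. R > 0 \<Longrightarrow> emeasure \<nu> (ball 0 R) \<le> ennreal (C * R ^ CARD('n))"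
    using growth_bound[OF \<nu>] by blast
  show ?thesis
  proof (rule growth_measuresI[where C = "C * B ^ CARD('n)"])
    fix R :: real assume R: "R > 0"
    have "{x. g *v x \<in> ball 0 R} \<subseteq> ball 0 (B * R)"
    proof
      fix x assume "x \<in> {x. g *v x \<in> ball 0 R}"
      then have "norm (g *v x) < R" by simp
      then have "B * norm (g *v x) < B * R" using B by simp
      then show "x \<in> ball 0 (B * R)" using B(2)[of x] by simp
    qed
    then have "emeasure \<nu> {x. g *v x \<in> ball 0 R} \<le> emeasure \<nu> (ball 0 (B * R))"
      by (intro emeasure_mono) (simp_all add: growth_sets[OF \<nu>])
    also have "\<dots> \<le> ennreal (C * (B * R) ^ CARD('n))" using B R by (intro C) simp
    finally show "emeasure (act g \<nu>) (ball 0 R) \<le> ennreal (C * B ^ CARD('n) * R ^ CARD('n))"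
      by (simp add: emeasure_act[OF \<nu>] power_mult_distrib mult.assoc)
  qed simp
qed

lemma Cc_SL:
  fixes \<psi> :: "real^'n::finite \<Rightarrow> real"
  assumes g: "g \<in> SL" and \<psi>: "\<psi> \<in> Cc"
  shows "(\<lambda>x. \<psi> (g *v x)) \<in> Cc"
proof -
  obtain B where B: "B > 0" "\<And>x. norm x \<le> B * norm (g *v x)" using SL_expand_bound[OF g] by blast
  obtain M R where R: "\<And>x. \<bar>\<psi> x\<bar> \<le> M * indicator (ball 0 R) x" using Cc_bound[OF \<psi>] by blast
  have "{x. \<psi> (g *v x) \<noteq> 0} \<subseteq> ball 0 (B * R)"
  proof
    fix x assume "x \<in> {x. \<psi> (g *v x) \<noteq> 0}"
    then have "norm (g *v x) < R" using R[of "g *v x"] by (cases "norm (g *v x) < R") auto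
    then have "B * norm (g *v x) < B * R" using B by simp
    then show "x \<in> ball 0 (B * R)" using B(2)[of x] by simp
  qed
  then have "bounded {x. \<psi> (g *v x) \<noteq> 0}" by (rule bounded_subset[OF bounded_ball])
  moreover have "continuous_on UNIV (\<lambda>x. \<psi> (g *v x))"
    using \<psi> unfolding Cc_def
    by (intro continuous_on_compose2[of UNIV \<psi> UNIV "\<lambda>x. g *v x"])
       (auto intro: linear_continuous_on[OF matrix_vector_mul_bounded_linear])
  ultimately show ?thesis by (simp add: Cc_def compact_eq_bounded_closed bounded_closure)
qed

lemma act_measurable:
  fixes g :: "real^'n::finite^'n"
  assumes g: "g \<in> SL"
  shows "act g \<in> measurable borel_growth_measures borel_growth_measures"
proof -
  have pre: "openin weak_star_topology {\<nu> \<in> growth_measures. act g \<nu> \<in> U}" if "openin weak_star_topology U" for U :: "(real^'n) measure set"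
    using that[unfolded weak_star_topology_def openin_topology_generated_by_iff]
  proof (induction rule: generate_topology_on.induct)
    case Empty
    then show ?case by simp
  next
    case (Int a b)
    have "{\<nu> \<in> growth_measures. act g \<nu> \<in> a \<inter> b} = {\<nu> \<in> growth_measures. act g \<nu> \<in> a} \<inter> {\<nu> \<in> growth_measures. act g \<nu> \<in> b}"
      by auto
    then show ?case using openin_Int[OF Int.IH] by simp
  next
    case (UN K)
    have "{\<nu> \<in> growth_measures. act g \<nu> \<in> \<Union> K} = (\<Union>k\<in>K. {\<nu> \<in> growth_measures. act g \<nu> \<in> k})"
      by auto
    then show ?case using UN by (auto intro!: openin_Union)
  next
    case (Basis s)
    then obtain \<psi> V where s: "s = {\<nu> \<in> growth_measures. (\<integral>x. \<psi> x \<partial>\<nu>) \<in> V}" "\<psi> \<in> Cc" "open V" by blast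
    have "{\<nu> \<in> growth_measures. act g \<nu> \<in> s} = {\<nu> \<in> growth_measures. (\<integral>x. \<psi> (g *v x) \<partial>\<nu>) \<in> V}"
      unfolding s(1) using act_growth[OF g] by (auto simp: integral_act Cc_borel[OF s(2)])
    then show ?case using weak_star_subbase[OF Cc_SL[OF g s(2)] s(3)] by simp
  qed
  have "act g \<in> measurable borel_growth_measures (measure_of growth_measures {U. openin weak_star_topology U} (\<lambda>_. 0))"
  proof (rule measurable_measure_of)
    show "{U. openin weak_star_topology U} \<subseteq> Pow growth_measures" using weak_star_subset by auto
    show "act g \<in> space borel_growth_measures \<rightarrow> growth_measures" using act_growth[OF g] by (auto simp: space_BG)
    fix U :: "(real^'n) measure set" assume "U \<in> {U. openin weak_star_topology U}"
    then have "{\<nu> \<in> growth_measures. act g \<nu> \<in> U} \<in> sets borel_growth_measures"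
      unfolding sets_BG by (intro sigma_sets.Basic) (simp add: pre)
    moreover have "act g -` U \<inter> space borel_growth_measures = {\<nu> \<in> growth_measures. act g \<nu> \<in> U}"
      by (auto simp: space_BG)
    ultimately show "act g -` U \<inter> space borel_growth_measures \<in> sets borel_growth_measures" by simp
  qed
  then show ?thesis unfolding borel_growth_measures_def by simp
qed

lemma act_mult:
  fixes \<nu> :: "(real^'n::finite) measure"
  assumes "\<nu> \<in> growth_measures"
  shows "act g (act h \<nu>) = act (g ** h) \<nu>"
proof -
  have "distr (distr \<nu> borel (\<lambda>x. h *v x)) borel (\<lambda>x. g *v x) = distr \<nu> borel ((\<lambda>x. g *v x) \<circ> (\<lambda>x. h *v x))"
    by (rule distr_distr) (auto intro: matrix_vector_borel growth_measurable[OF assms])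
  then show ?thesis by (simp add: act_def comp_def matrix_vector_mul_assoc)
qed

lemma siegel_sets: "siegel_measure \<mu> \<Longrightarrow> sets \<mu> = sets borel_growth_measures"
  by (simp add: siegel_measure_def)

lemma siegel_space: "siegel_measure \<mu> \<Longrightarrow> space \<mu> = growth_measures"
  using sets_eq_imp_space_eq[OF siegel_sets] space_BG by metis

lemma siegel_measurable:
  assumes "siegel_measure \<mu>" "f \<in> measurable borel_growth_measures N"
  shows "f \<in> measurable \<mu> N"
  using assms(2) measurable_cong_sets[OF siegel_sets[OF assms(1)] refl] by blast

lemma siegel_sl_action:
  fixes \<mu> :: "(real^'n::finite) measure measure"
  assumes \<mu>: "siegel_measure \<mu>"
  shows "sl_action \<mu> act"
proof -
  interpret prob_space \<mu> using \<mu> by (simp add: siegel_measure_def)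
  note sets = siegel_sets[OF \<mu>]
  show ?thesis
  proof
    show "act g \<in> measurable \<mu> \<mu>" if "g \<in> SL" for g
      using act_measurable[OF that] measurable_cong_sets[OF sets sets] by blast
    show "distr \<mu> \<mu> (act g) = \<mu>" if "g \<in> SL" for g
    proof -
      have "distr \<mu> \<mu> (act g) = distr \<mu> borel_growth_measures (act g)"
        by (rule distr_cong) (use sets in auto)
      then show ?thesis using \<mu> that by (simp add: siegel_measure_def)
    qed
    show "act g (act h \<nu>) = act (g ** h) \<nu>" if "\<nu> \<in> space \<mu>" for g h \<nu>
      using that by (simp add: act_mult siegel_space[OF \<mu>])
    show "act (mat 1) \<nu> = \<nu>" if "\<nu> \<in> space \<mu>" for \<nu>
      using that distr_id2[of borel \<nu>] by (simp add: act_def siegel_space[OF \<mu>] growth_sets)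
    show "measure \<mu> E = 0 \<or> measure \<mu> E = 1" if "E \<in> sets \<mu>" "\<forall>g\<in>SL. act g ` E = E" for E
      using \<mu> that by (auto simp: siegel_measure_def)
  qed
qed

text \<open>For \<open>g\<close> close to \<open>a\<close> the functions \<open>\<psi> \<circ> g\<close> are supported in a common ball, so dominated
  convergence applies.\<close>

lemma continuous_on_orbit_Cc:
  fixes \<nu> :: "(real^'n::finite) measure"
  assumes \<nu>: "\<nu> \<in> growth_measures" and \<psi>: "\<psi> \<in> Cc"
  shows "continuous_on SL (\<lambda>g. \<integral>x. \<psi> x \<partial>(act g \<nu>))"
  unfolding continuous_on_sequentially comp_def
proof (intro allI impI ballI, elim conjE)
  fix g a assume a: "a \<in> (SL :: (real^'n^'n) set)" and g: "\<forall>n. g n \<in> SL" and lim: "g \<longlonglongrightarrow> a"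
  obtain B where B: "B > 0" "\<And>x. norm x \<le> B * norm (a *v x)" using SL_expand_bound[OF a] by blast
  obtain M R where R: "0 < M" "\<And>x. \<bar>\<psi> x\<bar> \<le> M * indicator (ball 0 R) x" using Cc_bound[OF \<psi>] by metis
  have cont: "continuous_on UNIV \<psi>" using \<psi> by (simp add: Cc_def)
  have lin: "(\<lambda>n. g n *v x) \<longlonglongrightarrow> a *v x" for x
    unfolding matrix_vector_mult_def using lim
    by (intro vec_tendstoI) (auto intro!: tendsto_intros tendsto_vec_nth)
  \<comment> \<open>Convergence of the entries implies convergence in operator norm.\<close>
  have conv0: "(\<lambda>n. onorm (\<lambda>x. (g n - a) *v x)) \<longlonglongrightarrow> 0"
  proof (rule tendsto_sandwich[OF _ _ tendsto_const])
    show "eventually (\<lambda>n. 0 \<le> onorm (\<lambda>x. (g n - a) *v x)) sequentially"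
      by (intro always_eventually allI onorm_pos_le matrix_vector_mul_bounded_linear)
    show "eventually (\<lambda>n. onorm (\<lambda>x. (g n - a) *v x) \<le> (\<Sum>i\<in>UNIV. \<Sum>j\<in>UNIV. \<bar>g n $ i $ j - a $ i $ j\<bar>)) sequentially"
    proof (intro always_eventually allI onorm_le)
      fix n x
      have "norm ((g n - a) *v x) \<le> (\<Sum>i\<in>UNIV. \<bar>((g n - a) *v x) $ i\<bar>)" by (rule norm_le_l1_cart)
      also have "\<dots> \<le> (\<Sum>i\<in>UNIV. (\<Sum>j\<in>UNIV. \<bar>g n $ i $ j - a $ i $ j\<bar>) * norm x)"
      proof (rule sum_mono)
        fix i
        have "\<bar>((g n - a) *v x) $ i\<bar> \<le> (\<Sum>j\<in>UNIV. \<bar>(g n $ i $ j - a $ i $ j) * x $ j\<bar>)"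
          by (simp add: matrix_vector_mult_def sum_abs)
        also have "\<dots> \<le> (\<Sum>j\<in>UNIV. \<bar>g n $ i $ j - a $ i $ j\<bar> * norm x)"
          by (intro sum_mono) (auto simp: abs_mult intro!: mult_left_mono component_le_norm_cart)
        finally show "\<bar>((g n - a) *v x) $ i\<bar> \<le> (\<Sum>j\<in>UNIV. \<bar>g n $ i $ j - a $ i $ j\<bar>) * norm x"
          by (simp add: sum_distrib_right)
      qed
      finally show "norm ((g n - a) *v x) \<le> (\<Sum>i\<in>UNIV. \<Sum>j\<in>UNIV. \<bar>g n $ i $ j - a $ i $ j\<bar>) * norm x"
        by (simp add: sum_distrib_right)
    qed
    have "(\<lambda>n. \<Sum>i\<in>UNIV. \<Sum>j\<in>UNIV. \<bar>g n $ i $ j - a $ i $ j\<bar>) \<longlonglongrightarrow> (\<Sum>i\<in>UNIV. \<Sum>j\<in>UNIV. \<bar>a $ i $ j - a $ i $ j\<bar>)"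
      by (intro tendsto_intros tendsto_vec_nth lim)
    then show "(\<lambda>n. \<Sum>i\<in>UNIV. \<Sum>j\<in>UNIV. \<bar>g n $ i $ j - a $ i $ j\<bar>) \<longlonglongrightarrow> 0" by simp
  qed
  have "eventually (\<lambda>n. onorm (\<lambda>x. (g n - a) *v x) < 1 / (2 * B)) sequentially"
    using B by (intro order_tendstoD[OF conv0]) simp
  then obtain n0 where n0: "\<And>n. n \<ge> n0 \<Longrightarrow> onorm (\<lambda>x. (g n - a) *v x) < 1 / (2 * B)"
    by (auto simp: eventually_sequentially)
  have bd: "\<bar>\<psi> (g (n + n0) *v x)\<bar> \<le> M * indicator (ball 0 (2 * B * R)) x" for n x
  proof (cases "g (n + n0) *v x \<in> ball 0 R")
    case True
    let ?h = "g (n + n0)"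
    have "norm ((?h - a) *v x) \<le> onorm (\<lambda>x. (?h - a) *v x) * norm x"
      by (rule onorm[OF matrix_vector_mul_bounded_linear])
    also have "\<dots> \<le> 1 / (2 * B) * norm x" using n0[of "n + n0"] by (intro mult_right_mono) auto
    finally have 1: "norm ((?h - a) *v x) \<le> norm x / (2 * B)" by simp
    have "a *v x = ?h *v x - (?h - a) *v x" by (simp add: matrix_vector_mult_diff_rdistrib)
    then have "norm (a *v x) \<le> norm (?h *v x) + norm ((?h - a) *v x)" by (metis norm_triangle_ineq4)
    then have "norm (a *v x) < R + norm x / (2 * B)" using True 1 by simp
    then have "B * norm (a *v x) < B * (R + norm x / (2 * B))" using B by simp
    then have "norm x < B * (R + norm x / (2 * B))" using B(2)[of x] by linarith
    also have "\<dots> = B * R + norm x / 2" using B by (simp add: field_simps)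
    finally have "norm x < 2 * B * R" by (simp add: field_simps)
    then show ?thesis using R(2)[of "?h *v x"] True by simp
  next
    case False
    then have "\<psi> (g (n + n0) *v x) = 0" using R(2)[of "g (n + n0) *v x"] by simp
    then show ?thesis using R by simp
  qed
  have "(\<lambda>n. \<integral>x. \<psi> (g (n + n0) *v x) \<partial>\<nu>) \<longlonglongrightarrow> (\<integral>x. \<psi> (a *v x) \<partial>\<nu>)"
  proof (rule integral_dominated_convergence[where w = "\<lambda>x. M * indicator (ball 0 (2 * B * R)) x"])
    show "integrable \<nu> (\<lambda>x. M * indicator (ball 0 (2 * B * R)) x)"
    proof (rule bounded_support_integrable[OF \<nu>])
      show "(\<lambda>x. M * indicator (ball 0 (2 * B * R)) x) \<in> borel_measurable borel"
        by (intro borel_measurable_times borel_measurable_indicator borel_open open_ball) simp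
      show "\<bar>M * indicator (ball 0 (2 * B * R)) x\<bar> \<le> M * indicator (ball 0 (2 * B * R)) x" for x
        using R(1) by (simp add: abs_mult)
    qed
    show "AE x in \<nu>. (\<lambda>n. \<psi> (g (n + n0) *v x)) \<longlonglongrightarrow> \<psi> (a *v x)"
    proof (rule AE_I2)
      fix x
      have "isCont \<psi> (a *v x)" using cont by (simp add: continuous_on_eq_continuous_at)
      from isCont_tendsto_compose[OF this LIMSEQ_ignore_initial_segment[OF lin]]
      show "(\<lambda>n. \<psi> (g (n + n0) *v x)) \<longlonglongrightarrow> \<psi> (a *v x)" .
    qed
    show "AE x in \<nu>. norm (\<psi> (g (n + n0) *v x)) \<le> M * indicator (ball 0 (2 * B * R)) x" for n
      using bd by (intro AE_I2) simp
    show "(\<lambda>x. \<psi> (a *v x)) \<in> borel_measurable \<nu>" "(\<lambda>x. \<psi> (g (n + n0) *v x)) \<in> borel_measurable \<nu>" for n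
      by (intro growth_measurable[OF \<nu>] Cc_borel Cc_SL \<psi> a g[rule_format])+
  qed
  then have "(\<lambda>n. \<integral>x. \<psi> x \<partial>(act (g (n + n0)) \<nu>)) \<longlonglongrightarrow> (\<integral>x. \<psi> x \<partial>(act a \<nu>))"
    by (simp add: integral_act[OF \<nu> Cc_borel[OF \<psi>]])
  then show "(\<lambda>n. \<integral>x. \<psi> x \<partial>(act (g n) \<nu>)) \<longlonglongrightarrow> (\<integral>x. \<psi> x \<partial>(act a \<nu>))"
    by (rule LIMSEQ_offset)
qed

lemma lborel_growth: "(lborel :: (real^'n::finite) measure) \<in> growth_measures"
  by (rule growth_measuresI[where C = "unit_ball_vol (real CARD('n))"]) (simp_all add: emeasure_ball)

lemma growth_sigma_finite:
  fixes \<nu> :: "(real^'n::finite) measure"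
  assumes "\<nu> \<in> growth_measures"
  shows "sigma_finite_measure \<nu>"
proof
  let ?A = "range (\<lambda>k. ball (0 :: real^'n) (real k))"
  show "\<exists>A. countable A \<and> A \<subseteq> sets \<nu> \<and> \<Union> A = space \<nu> \<and> (\<forall>a\<in>A. emeasure \<nu> a \<noteq> \<infinity>)"
  proof (intro exI[of _ ?A] conjI ballI)
    show "?A \<subseteq> sets \<nu>" unfolding growth_sets[OF assms] using borel_open[OF open_ball] by blast
    have "\<exists>k. x \<in> ball 0 (real k)" for x :: "real^'n"
      using reals_Archimedean2[of "norm x"] by simp
    then show "\<Union> ?A = space \<nu>" unfolding growth_space[OF assms] by blast
    show "emeasure \<nu> a \<noteq> \<infinity>" if "a \<in> ?A" for a
      using that growth_ball_finite[OF assms] by (metis imageE less_irrefl)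
  qed simp
qed

text \<open>Average the mass of \<open>A\<close> translated by \<open>w\<close> over \<open>w\<close> in a set \<open>Q\<close> of volume one, and
  exchange the two integrations.\<close>

lemma translation_invariant_eq_lborel:
  fixes M :: "'a::euclidean_space measure"
  assumes sf: "sigma_finite_measure M" and M[measurable_cong]: "sets M = sets borel"
    and inv: "\<And>w. distr M borel (\<lambda>x. x + w) = M"
    and Q: "Q \<in> sets borel" "emeasure lborel Q = 1" and A: "A \<in> sets borel"
  shows "emeasure M A = emeasure M (uminus -` Q) * emeasure lborel A"
proof -
  interpret M: sigma_finite_measure M by (rule sf)
  interpret P: pair_sigma_finite lborel M ..
  note [measurable] = Q(1) A
  have [simp]: "space M = UNIV" using sets_eq_imp_space_eq[OF M] by simp
  have tr: "emeasure M {x. x + w \<in> S} = emeasure M S" if "S \<in> sets borel" for w S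
  proof -
    have "emeasure M S = emeasure (distr M borel (\<lambda>x. x + w)) S" by (simp add: inv)
    also have "\<dots> = emeasure M ((\<lambda>x. x + w) -` S \<inter> space M)"
      by (rule emeasure_distr) (use that in simp_all)
    finally show ?thesis by (simp add: vimage_def)
  qed
  have "emeasure M A = emeasure M A * emeasure lborel Q" by (simp add: Q)
  also have "\<dots> = (\<integral>\<^sup>+w. indicator Q w * emeasure M A \<partial>lborel)"
    by (simp add: nn_integral_multc mult.commute)
  also have "\<dots> = (\<integral>\<^sup>+w. (\<integral>\<^sup>+x. indicator Q w * indicator A (x + w) \<partial>M) \<partial>lborel)"
  proof (rule nn_integral_cong)
    fix w :: 'a
    have "(\<integral>\<^sup>+x. indicator A (x + w) \<partial>M) = (\<integral>\<^sup>+x. indicator {x. x + w \<in> A} x \<partial>M)"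
      by (intro nn_integral_cong) (simp add: indicator_def)
    also have "\<dots> = emeasure M {x. x + w \<in> A}" by (rule nn_integral_indicator) simp
    finally show "indicator Q w * emeasure M A = (\<integral>\<^sup>+x. indicator Q w * indicator A (x + w) \<partial>M)"
      by (simp add: nn_integral_cmult tr[OF A])
  qed
  also have "\<dots> = (\<integral>\<^sup>+x. (\<integral>\<^sup>+w. indicator Q w * indicator A (x + w) \<partial>lborel) \<partial>M)"
    by (rule P.Fubini'[symmetric]) simp
  also have "\<dots> = (\<integral>\<^sup>+x. (\<integral>\<^sup>+w. indicator Q (w - x) * indicator A w \<partial>lborel) \<partial>M)"
  proof (rule nn_integral_cong)
    fix x :: 'a
    have "(\<integral>\<^sup>+w. indicator Q (w - x) * indicator A w \<partial>lborel)
        = (\<integral>\<^sup>+w. indicator Q (w - x) * indicator A w \<partial>distr lborel borel (\<lambda>w. x + w))"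
      by (simp add: lborel_distr_plus)
    also have "\<dots> = (\<integral>\<^sup>+w. indicator Q (x + w - x) * indicator A (x + w) \<partial>lborel)"
      by (rule nn_integral_distr) simp_all
    finally show "(\<integral>\<^sup>+w. indicator Q w * indicator A (x + w) \<partial>lborel)
        = (\<integral>\<^sup>+w. indicator Q (w - x) * indicator A w \<partial>lborel)" by simp
  qed
  also have "\<dots> = (\<integral>\<^sup>+w. (\<integral>\<^sup>+x. indicator Q (w - x) * indicator A w \<partial>M) \<partial>lborel)"
    by (rule P.Fubini') simp
  also have "\<dots> = (\<integral>\<^sup>+w. emeasure M (uminus -` Q) * indicator A w \<partial>lborel)"
  proof (rule nn_integral_cong)
    fix w :: 'a
    have Q': "uminus -` Q \<in> sets borel" using measurable_sets[of uminus borel borel Q] by simp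
    have "(\<integral>\<^sup>+x. indicator Q (w - x) \<partial>M) = (\<integral>\<^sup>+x. indicator {x. x + - w \<in> uminus -` Q} x \<partial>M)"
      by (intro nn_integral_cong) (simp add: indicator_def)
    also have "\<dots> = emeasure M {x. x + - w \<in> uminus -` Q}"
      by (rule nn_integral_indicator) (use Q' in measurable)
    also have "\<dots> = emeasure M (uminus -` Q)" by (rule tr[OF Q'])
    finally show "(\<integral>\<^sup>+x. indicator Q (w - x) * indicator A w \<partial>M) = emeasure M (uminus -` Q) * indicator A w"
      by (simp add: nn_integral_multc)
  qed
  also have "\<dots> = emeasure M (uminus -` Q) * emeasure lborel A" by (simp add: nn_integral_cmult_indicator)
  finally show ?thesis .
qed

text \<open>By \<open>translation_invariant_eq_lborel\<close> the image of Lebesgue measure under \<open>g\<close> is a multiple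
  \<open>k g\<close> of it, and \<open>k\<close> is multiplicative. A transvection is conjugate to its own fourth power,
  so \<open>k\<close> is one there, and transvections generate the group.\<close>

lemma lborel_SL_invariant:
  fixes g :: "real^'n::finite^'n"
  assumes g: "g \<in> SL"
  shows "act g lborel = lborel"
proof -
  let ?L = "lborel :: (real^'n) measure"
  note LG = lborel_growth[where 'n = 'n]
  define Q :: "(real^'n) set" where "Q = box 0 One"
  define k where "k g = emeasure (act g ?L) (uminus -` Q)" for g
  have Q: "Q \<in> sets borel" "emeasure lborel Q = 1"
    by (simp_all add: Q_def emeasure_lborel_box)
  have vim: "{x. h *v x \<in> A} \<in> sets borel" if "A \<in> sets borel" for h :: "real^'n^'n" and A
    using measurable_sets[OF matrix_vector_borel[of h] that] by (simp add: vimage_def)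
  have k: "emeasure (act g ?L) A = k g * emeasure lborel A" if g: "g \<in> SL" and A: "A \<in> sets borel" for g A
    unfolding k_def
  proof (rule translation_invariant_eq_lborel[OF growth_sigma_finite[OF act_growth[OF g LG]] _ _ Q A])
    fix w :: "real^'n"
    define v where "v = matrix_inv g *v w"
    have gv: "g *v v = w" unfolding v_def using SL_inv[OF g] by (simp add: matrix_vector_mul_assoc)
    have "distr (act g ?L) borel (\<lambda>x. x + w) = distr ?L borel ((\<lambda>x. x + w) \<circ> (\<lambda>x. g *v x))"
      unfolding act_def by (rule distr_distr) (use matrix_vector_borel[of g] in simp_all)
    also have "(\<lambda>x. x + w) \<circ> (\<lambda>x. g *v x) = (\<lambda>x. g *v x) \<circ> (\<lambda>x. v + x)"
      by (simp add: fun_eq_iff matrix_vector_right_distrib gv add.commute)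
    also have "distr ?L borel \<dots> = distr (distr ?L borel (\<lambda>x. v + x)) borel (\<lambda>x. g *v x)"
      by (rule distr_distr[symmetric]) (use matrix_vector_borel[of g] in simp_all)
    also have "\<dots> = act g ?L" by (simp add: lborel_distr_plus act_def)
    finally show "distr (act g ?L) borel (\<lambda>x. x + w) = act g ?L" .
  qed simp
  have k_mult: "k (g ** h) = k g * k h" if g: "g \<in> SL" and h: "h \<in> SL" for g h
  proof -
    have "k (g ** h) = emeasure (act (g ** h) ?L) Q" using k[OF SL_mult[OF g h] Q(1)] by (simp add: Q(2))
    also have "\<dots> = emeasure (act h ?L) {x. g *v x \<in> Q}"
      unfolding act_mult[OF LG, symmetric] by (rule emeasure_act[OF act_growth[OF h LG] Q(1)])
    also have "\<dots> = k h * emeasure ?L {x. g *v x \<in> Q}" by (rule k[OF h vim[OF Q(1)]])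
    also have "emeasure ?L {x. g *v x \<in> Q} = emeasure (act g ?L) Q" by (rule emeasure_act[OF LG Q(1), symmetric])
    also have "\<dots> = k g" using k[OF g Q(1)] by (simp add: Q(2))
    finally show ?thesis by (simp add: mult.commute)
  qed
  have k1: "k (mat 1) = 1"
    using k[OF mat1_SL Q(1)] emeasure_act[OF LG Q(1), of "mat 1"] by (simp add: Q(2))
  have kt: "k (transv i j s) = 1" if ij: "i \<noteq> j" for i j s
  proof -
    define d where "d a = diagm (\<lambda>l. if l = i then a else if l = j then 1 / a else (1::real))" for a
    have dSL: "d a \<in> SL" if "a > 0" for a
    proof -
      have "(\<Prod>l\<in>UNIV. if l = i then a else if l = j then 1 / a else 1)
         = (\<Prod>l\<in>{i,j}. if l = i then a else if l = j then 1 / a else 1)"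
        by (rule prod.mono_neutral_right) auto
      also have "\<dots> = 1" using ij that by simp
      finally show ?thesis unfolding d_def by (rule diagm_SL)
    qed
    note t = transv_SL[OF ij] SL_mult dSL
    have dd: "d 2 ** d (1/2) = mat 1"
      by (rule matrix_mult_eqI) (simp add: d_def matrix_vector_mul_assoc[symmetric] diagm_nth)
    \<comment> \<open>Conjugation by the diagonal matrix with entries \<open>2\<close> and \<open>1/2\<close> multiplies the parameter by
      four.\<close>
    have eq: "transv i j (4 * s) = (d 2 ** transv i j s) ** d (1/2)"
      by (rule matrix_mult_eqI)
         (use ij in \<open>simp add: d_def matrix_vector_mul_assoc[symmetric] diagm_nth transv_nth\<close>)
    have "k (transv i j (4 * s)) = k (d 2) * k (transv i j s) * k (d (1/2))"
      unfolding eq by (simp add: k_mult t)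
    also have "\<dots> = k (transv i j s) * (k (d 2) * k (d (1/2)))" by (simp add: mult.assoc mult.left_commute)
    also have "k (d 2) * k (d (1/2)) = 1" using k_mult[of "d 2" "d (1/2)"] dd k1 by (simp add: t)
    finally have 1: "k (transv i j (4 * s)) = k (transv i j s)" by simp
    have "transv i j (4 * s) = (transv i j s ** transv i j s) ** (transv i j s ** transv i j s)"
      by (simp add: transv_add[OF ij])
    then have 2: "k (transv i j (4 * s)) = (k (transv i j s) * k (transv i j s)) * (k (transv i j s) * k (transv i j s))"
      by (simp add: k_mult t)
    have 3: "k (transv i j s) * k (transv i j (- s)) = 1"
      using k_mult[OF t(1) t(1), of s "- s"] k1 by (simp add: transv_add[OF ij] transv_0)
    have fin: "k (transv i j s) \<noteq> top"
    proof
      assume "k (transv i j s) = top"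
      then have "top * k (transv i j (- s)) = 1" using 3 by simp
      then show False by (cases "k (transv i j (- s)) = 0") (auto simp: ennreal_top_mult)
    qed
    then obtain r where r: "0 \<le> r" "k (transv i j s) = ennreal r" by (cases "k (transv i j s)") auto
    have "r \<noteq> 0" using 3 r by auto
    have "ennreal r = ennreal (r * r * (r * r))" using 1 2 r by (simp add: ennreal_mult)
    then have "r = r * r * (r * r)" using r by (simp add: ennreal_inj)
    then have "r ^ 3 = 1" using \<open>r \<noteq> 0\<close> by (simp add: power3_eq_cube)
    then have "r = 1" using r(1) power_eq_1_iff[of r 3] by auto
    then show ?thesis using r by simp
  qed
  have "k g = 1"
  proof (rule SL_transv_induct[where P = "\<lambda>A. k A = 1", OF k1 _ g])
    show "k (transv i j s ** A) = 1" if "i \<noteq> j" "A \<in> SL" "k A = 1" for i j s A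
      using that by (simp add: k_mult transv_SL kt)
  qed
  then show ?thesis by (intro measure_eqI) (simp_all add: k[OF g])
qed

section \<open>Shear averages see the measure at a large scale\<close>

lemma borel_measurable_vec_nth[measurable (raw)]:
  fixes f :: "'a \<Rightarrow> real^'n::finite"
  assumes "f \<in> borel_measurable M" shows "(\<lambda>x. f x $ i) \<in> borel_measurable M"
proof -
  have "(\<lambda>y :: real^'n. y $ i) \<in> borel_measurable borel"
    by (intro borel_measurable_continuous_onI continuous_intros)
  then show ?thesis using measurable_compose[OF assms] by blast
qed

lemma borel_measurable_vecI:
  fixes f :: "real^'m::finite \<Rightarrow> real^'n::finite"
  assumes "\<And>i. (\<lambda>x. f x $ i) \<in> borel_measurable borel"
  shows "f \<in> borel_measurable borel"
  using assms by (subst borel_measurable_euclidean_space) (auto simp: Basis_vec_def inner_axis)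

definition tent :: "real \<Rightarrow> real" where
  "tent w = max 0 (2 - \<bar>w\<bar>)"

lemma tent_nonneg: "0 \<le> tent w" and tent_zero: "2 \<le> \<bar>w\<bar> \<Longrightarrow> tent w = 0" and tent_ge1: "\<bar>w\<bar> \<le> 1 \<Longrightarrow> 1 \<le> tent w"
  and tent_le2: "tent w \<le> 2"
  by (auto simp: tent_def)

lemma continuous_on_tent[continuous_intros]:
  "continuous_on S f \<Longrightarrow> continuous_on S (\<lambda>x. tent (f x))"
  unfolding tent_def by (intro continuous_intros)

lemma borel_tent[measurable]: "tent \<in> borel_measurable borel"
  by (rule borel_measurable_continuous_onI) (intro continuous_intros)

definition tent_mass :: real where "tent_mass = (\<integral>w. tent w \<partial>lborel)"

lemma integrable_tent_on: "A \<in> sets borel \<Longrightarrow> integrable lborel (\<lambda>w. tent w * indicator A w)"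
proof (rule Bochner_Integration.integrable_bound[of _ "\<lambda>w. 2 * indicator {-2..2} w"])
  show "integrable lborel (\<lambda>w. 2 * indicator {-2..2::real} w :: real)" by simp
  show "AE w in lborel. norm (tent w * indicator A w) \<le> norm (2 * indicator {- 2..2} w :: real)"
  proof (rule AE_I2)
    fix w
    show "norm (tent w * indicator A w) \<le> norm (2 * indicator {- 2..2} w :: real)"
      using tent_nonneg[of w] tent_le2[of w] tent_zero[of w]
      by (cases "\<bar>w\<bar> \<le> 2") (auto simp: indicator_def abs_mult)
  qed
qed simp

lemma tent_mass_pos: "tent_mass > 0"
proof -
  have "(\<integral>w. indicator {-1..1::real} w \<partial>lborel) \<le> tent_mass"
    unfolding tent_mass_def
  proof (rule integral_mono)
    show "integrable lborel tent" using integrable_tent_on[of UNIV] by simp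
    show "indicator {-1..1} w \<le> tent w" for w :: real
      using tent_nonneg[of w] tent_ge1[of w] by (auto simp: indicator_def)
  qed simp
  then show ?thesis by simp
qed

text \<open>The mass that the tent puts on an interval. A shear average runs through an interval that
  either covers the tent or misses it, once the scale is large.\<close>

definition tent_int :: "real \<Rightarrow> real \<Rightarrow> real" where
  "tent_int a b = (\<integral>w. tent w * indicator {a..b} w \<partial>lborel)"

lemma tent_int_nonneg: "0 \<le> tent_int a b"
  unfolding tent_int_def by (rule Bochner_Integration.integral_nonneg) (simp add: tent_nonneg)

lemma tent_int_le: "tent_int a b \<le> tent_mass"
  unfolding tent_int_def tent_mass_def
proof (rule integral_mono)
  show "integrable lborel tent" using integrable_tent_on[of UNIV] by simp
  show "tent w * indicator {a..b} w \<le> tent w" for w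
    using tent_nonneg[of w] by (simp add: indicator_def)
qed (simp add: integrable_tent_on)

lemma tent_int_zero: "2 \<le> a \<or> b \<le> -2 \<Longrightarrow> tent_int a b = 0"
proof -
  assume "2 \<le> a \<or> b \<le> -2"
  then have "tent w * indicator {a..b} w = 0" for w using tent_zero[of w] by (auto simp: indicator_def)
  then show ?thesis unfolding tent_int_def by (simp only: Bochner_Integration.integral_zero)
qed

lemma tent_int_full: "a \<le> -2 \<Longrightarrow> 2 \<le> b \<Longrightarrow> tent_int a b = tent_mass"
proof -
  assume *: "a \<le> -2" "2 \<le> b"
  have "tent w * indicator {a..b} w = tent w" for w
    using tent_zero[of w] * by (cases "\<bar>w\<bar> \<le> 2") (auto simp: indicator_def)
  then show ?thesis unfolding tent_int_def tent_mass_def by (simp only:)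
qed

lemma tent_int_affine:
  assumes c: "c > 0"
  shows "c * (\<integral>t. tent (a + c * t) \<partial>unit_unif) = tent_int a (a + c)"
proof -
  have "(\<integral>t. tent (a + c * t) \<partial>unit_unif) = (\<integral>t. indicator {0..1} t * tent (a + c * t) \<partial>lborel)"
    by (rule integral_unit_unif) simp
  also have "\<dots> = (\<integral>t. tent (a + c * t) * indicator {a..a + c} (a + c * t) \<partial>lborel)"
  proof (rule Bochner_Integration.integral_cong)
    fix t :: real
    have "(a + c * t \<in> {a..a + c}) = (t \<in> {0..1})"
      using c by (auto simp: zero_le_mult_iff)
    then show "indicator {0..1} t * tent (a + c * t) = tent (a + c * t) * indicator {a..a + c} (a + c * t)"
      by (simp add: indicator_def)
  qed simp
  also have "c * \<dots> = tent_int a (a + c)"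
    using lborel_integral_real_affine[of c "\<lambda>w. tent w * indicator {a..a+c} w" a] c by (simp add: tent_int_def)
  finally show ?thesis .
qed

text \<open>The exponent makes the determinant one.\<close>

definition dil :: "'n::finite \<Rightarrow> real \<Rightarrow> real^'n^'n" where
  "dil q R = diagm (\<lambda>k. if k = q then R ^ (CARD('n) - 1) else 1 / R)"

lemma dil_SL:
  assumes "R > 0" shows "(dil q R :: real^'n::finite^'n) \<in> SL"
  unfolding dil_def
proof (rule diagm_SL)
  have "(\<Prod>k\<in>UNIV. if k = q then R ^ (CARD('n) - 1) else 1 / R)
      = R ^ (CARD('n) - 1) * (\<Prod>k\<in>UNIV - {q}. if k = q then R ^ (CARD('n) - 1) else 1 / R)"
    by (simp add: prod.remove[of UNIV q])
  also have "(\<Prod>k\<in>UNIV - {q}. if k = q then R ^ (CARD('n) - 1) else 1 / R) = (\<Prod>k\<in>UNIV - {q}. 1 / R)"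
    by (rule prod.cong) auto
  also have "R ^ (CARD('n) - 1) * (\<Prod>k\<in>UNIV - {q}. 1 / R) = 1"
    using assms by (simp add: card_Diff_singleton power_one_over)
  finally show "(\<Prod>k\<in>UNIV. if k = q then R ^ (CARD('n) - 1) else 1 / R) = 1" .
qed

text \<open>The test function at scale \<open>R\<close>, normalised so that Lebesgue measure does not see the
  scale.\<close>

lemma integral_dilate:
  fixes f :: "real^'n::finite \<Rightarrow> real"
  assumes f: "f \<in> borel_measurable borel" "integrable lborel f" and R: "R > 0"
  shows "integrable lborel (\<lambda>x. f ((1 / R) *\<^sub>R x) / R ^ CARD('n))"
    "(\<integral>x. f ((1 / R) *\<^sub>R x) / R ^ CARD('n) \<partial>lborel) = (\<integral>x. f x \<partial>lborel)"
proof -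
  let ?D = "density (distr lborel borel (\<lambda>x :: real^'n. 0 + R *\<^sub>R x)) (\<lambda>_. ennreal (\<bar>R\<bar> ^ DIM(real^'n)))"
  have D: "lborel = ?D" using R by (intro lborel_affine) simp
  have "integrable ?D (\<lambda>x. f ((1 / R) *\<^sub>R x) / R ^ CARD('n))"
    using f R by (simp add: integrable_density integrable_distr_eq)
  then show "integrable lborel (\<lambda>x. f ((1 / R) *\<^sub>R x) / R ^ CARD('n))" using D by (simp only:)
  have "(\<integral>x. f ((1 / R) *\<^sub>R x) / R ^ CARD('n) \<partial>?D) = (\<integral>x. f x \<partial>lborel)"
    using f R by (simp add: integral_density integral_distr)
  then show "(\<integral>x. f ((1 / R) *\<^sub>R x) / R ^ CARD('n) \<partial>lborel) = (\<integral>x. f x \<partial>lborel)" using D by (simp only:)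
qed

lemma AE_hyperplane:
  fixes a :: "real^'n::finite" assumes "a \<noteq> 0" shows "AE x in lborel. a \<bullet> x \<noteq> 0"
proof -
  have "negligible {x. a \<bullet> x = 0}" using assms by (intro negligible_hyperplane) simp
  then have "{x. a \<bullet> x = 0} \<in> null_sets lebesgue" by (simp add: negligible_iff_null_sets)
  then have "{x. a \<bullet> x = 0} \<in> null_sets lborel"
    by (auto simp: null_sets_def emeasure_completion intro: borel_closed closed_hyperplane)
  from AE_not_in[OF this] show ?thesis by simp
qed

text \<open>The weight \<open>\<xi>\<close> does not depend on \<open>x\<^sub>q\<close>, the coordinate that the shears move, and it is
  supported in \<open>x\<^sub>p \<ge> \<epsilon>\<close>, where they move it to the right. The length of the time window is
  governed by \<open>\<beta>\<close>.\<close>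

locale shear_kernel =
  fixes p q :: "'n::finite" and \<xi> :: "real^'n \<Rightarrow> real" and \<epsilon> C B \<beta> :: real
  assumes pq: "p \<noteq> q"
    and cont: "continuous_on UNIV \<xi>"
    and nonneg: "\<And>x. 0 \<le> \<xi> x" and le: "\<And>x. \<xi> x \<le> B"
    and indep: "\<And>x y. (\<And>k. k \<noteq> q \<Longrightarrow> x $ k = y $ k) \<Longrightarrow> \<xi> x = \<xi> y"
    and supp: "\<And>x. \<xi> x \<noteq> 0 \<Longrightarrow> \<epsilon> \<le> x $ p" "\<And>x k. \<xi> x \<noteq> 0 \<Longrightarrow> k \<noteq> q \<Longrightarrow> \<bar>x $ k\<bar> \<le> C"
    and pos: "\<epsilon> > 0" "C > 0" "\<beta> > 0"
begin

text \<open>The factor \<open>x\<^sub>p\<close> cancels the speed at which the shear moves the coordinate \<open>x\<^sub>q\<close>.\<close>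

definition \<psi> :: "real^'n \<Rightarrow> real" where "\<psi> x = x $ p * \<xi> x * tent (x $ q)"

text \<open>The shear average of \<open>\<psi>\<close> in the coordinates \<open>z = x / R\<close>, with \<open>m = R\<^sup>N\<close>; see
  \<open>shear_average\<close>.\<close>

definition \<Phi> :: "real \<Rightarrow> real^'n \<Rightarrow> real" where
  "\<Phi> m z = m * (\<integral>t. z $ p * \<xi> z * tent (m * (z $ q + \<beta> * t * z $ p)) \<partial>unit_unif)"

text \<open>The points with \<open>-\<beta> x\<^sub>p < x\<^sub>q < 0\<close> are those whose coordinate \<open>x\<^sub>q\<close> changes sign during
  the time window.\<close>

definition \<Psi> :: "real^'n \<Rightarrow> real" where
  "\<Psi> z = tent_mass / \<beta> * \<xi> z * indicator {z. z $ q < 0 \<and> 0 < z $ q + \<beta> * z $ p} z"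

text \<open>The radius of a ball that contains the supports of all functions above.\<close>

definition \<rho> :: real where "\<rho> = real CARD('n) * (C + 2 + \<beta> * C) + 1"

lemma borel_\<xi>[measurable]: "\<xi> \<in> borel_measurable borel"
  by (rule borel_measurable_continuous_onI[OF cont])

lemma norm_less_\<rho>:
  fixes z :: "real^'n"
  assumes "\<And>k. \<bar>z $ k\<bar> \<le> C + 2 + \<beta> * C" shows "norm z < \<rho>"
proof -
  have "norm z \<le> (\<Sum>k\<in>UNIV. \<bar>z $ k\<bar>)" by (rule norm_le_l1_cart)
  also have "\<dots> \<le> (\<Sum>k\<in>(UNIV :: 'n set). C + 2 + \<beta> * C)" by (rule sum_mono) (rule assms)
  finally show ?thesis by (simp add: \<rho>_def)
qed

lemma \<psi>_nonneg: "0 \<le> \<psi> x"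
proof (cases "\<xi> x = 0")
  case False
  then have "0 \<le> x $ p" using supp(1)[of x] pos by simp
  then show ?thesis by (simp add: \<psi>_def nonneg tent_nonneg)
qed (simp add: \<psi>_def)

lemma \<psi>_Cc: "\<psi> \<in> Cc"
proof -
  have "{x. \<psi> x \<noteq> 0} \<subseteq> ball 0 \<rho>"
  proof
    fix x assume "x \<in> {x. \<psi> x \<noteq> 0}"
    then have x: "\<xi> x \<noteq> 0" "tent (x $ q) \<noteq> 0" by (auto simp: \<psi>_def)
    have "\<bar>x $ k\<bar> \<le> C + 2 + \<beta> * C" for k
    proof (cases "k = q")
      case True
      have "0 < \<beta> * C" using pos by simp
      moreover have "\<bar>x $ q\<bar> < 2" using tent_zero[of "x $ q"] x by linarith
      ultimately show ?thesis unfolding True using pos(2) by linarith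
    next
      case False
      have "0 < \<beta> * C" using pos by simp
      then show ?thesis using supp(2)[OF x(1) False] by simp
    qed
    then show "x \<in> ball 0 \<rho>" using norm_less_\<rho>[of x] by simp
  qed
  then have "bounded {x. \<psi> x \<noteq> 0}" by (rule bounded_subset[OF bounded_ball])
  moreover have "continuous_on UNIV \<psi>"
    unfolding \<psi>_def[abs_def] by (intro continuous_intros cont)
  ultimately show ?thesis by (simp add: Cc_def compact_eq_bounded_closed bounded_closure)
qed

text \<open>Substitution in the time integral; this is where the factor \<open>x\<^sub>p\<close> of \<open>\<psi>\<close> is used up.\<close>

lemma \<Phi>_eq:
  assumes m: "m > 0"
  shows "\<Phi> m z = \<xi> z / \<beta> * tent_int (m * z $ q) (m * (z $ q + \<beta> * z $ p))"
proof (cases "\<xi> z = 0")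
  case False
  then have zp: "z $ p > 0" using supp(1)[of z] pos by simp
  let ?c = "m * \<beta> * z $ p"
  have c: "?c > 0" using m zp pos by simp
  have "(\<integral>t. z $ p * \<xi> z * tent (m * (z $ q + \<beta> * t * z $ p)) \<partial>unit_unif)
      = z $ p * \<xi> z * (\<integral>t. tent (m * z $ q + ?c * t) \<partial>unit_unif)"
    by (simp add: algebra_simps)
  then have "\<Phi> m z = \<xi> z / \<beta> * (?c * (\<integral>t. tent (m * z $ q + ?c * t) \<partial>unit_unif))"
    using pos by (simp add: \<Phi>_def)
  then show ?thesis unfolding tent_int_affine[OF c] by (simp add: algebra_simps)
qed (simp add: \<Phi>_def)

lemma \<Phi>_nonneg: "m > 0 \<Longrightarrow> 0 \<le> \<Phi> m z"
  using pos by (simp add: \<Phi>_eq nonneg tent_int_nonneg)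

lemma \<Phi>_bound:
  assumes m: "m \<ge> 1"
  shows "\<Phi> m z \<le> B * tent_mass / \<beta> * indicator (ball 0 \<rho>) z"
proof (cases "\<Phi> m z = 0")
  case True
  have "0 \<le> B" using nonneg[of 0] le[of 0] by linarith
  then show ?thesis using True pos tent_mass_pos by (simp add: indicator_def)
next
  case False
  have m0: "m > 0" using m by simp
  from False have x: "\<xi> z \<noteq> 0" and K: "tent_int (m * z $ q) (m * (z $ q + \<beta> * z $ p)) \<noteq> 0"
    by (auto simp: \<Phi>_eq[OF m0])
  have "\<not> (2 \<le> m * z $ q \<or> m * (z $ q + \<beta> * z $ p) \<le> - 2)" using tent_int_zero K by blast
  then have zq: "m * z $ q < 2" "- 2 < m * (z $ q + \<beta> * z $ p)" by auto
  have bC: "0 < \<beta> * C" using pos by simp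
  have "z $ q \<le> 2"
  proof (rule ccontr)
    assume "\<not> z $ q \<le> 2"
    then have "1 * 2 < m * z $ q" using m by (intro mult_le_less_imp_less) auto
    then show False using zq by simp
  qed
  moreover have "- 2 \<le> z $ q + \<beta> * z $ p"
  proof (rule ccontr)
    assume "\<not> - 2 \<le> z $ q + \<beta> * z $ p"
    then have "1 * 2 < m * (- (z $ q + \<beta> * z $ p))" using m by (intro mult_le_less_imp_less) auto
    then show False unfolding mult_minus_right using zq by linarith
  qed
  moreover have "\<beta> * z $ p \<le> \<beta> * C" using supp(2)[OF x pq] pos by (intro mult_left_mono) auto
  ultimately have "\<bar>z $ q\<bar> \<le> 2 + \<beta> * C" using bC by linarith
  then have "\<bar>z $ k\<bar> \<le> C + 2 + \<beta> * C" for k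
    using supp(2)[OF x, of k] bC pos by (cases "k = q") auto
  then have "z \<in> ball 0 \<rho>" using norm_less_\<rho>[of z] by simp
  moreover have "\<Phi> m z \<le> B / \<beta> * tent_mass"
    unfolding \<Phi>_eq[OF m0] using le nonneg pos order_trans[OF nonneg le]
    by (intro mult_mono divide_right_mono tent_int_le tent_int_nonneg divide_nonneg_nonneg) auto
  ultimately show ?thesis by simp
qed

lemma \<Phi>_borel[measurable]: "\<Phi> m \<in> borel_measurable borel"
proof -
  interpret U: prob_space unit_unif by (rule prob_space_unit_unif)
  show ?thesis unfolding \<Phi>_def[abs_def] by measurable
qed

lemma \<Psi>_borel[measurable]: "\<Psi> \<in> borel_measurable borel"
  unfolding \<Psi>_def[abs_def] by measurable

text \<open>Outside two hyperplanes the interval of \<open>\<Phi>_eq\<close> eventually misses the support of the tent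
  or covers it, so the sequence is even eventually constant.\<close>

lemma \<Phi>_tendsto:
  assumes z: "z $ q \<noteq> 0" "z $ q + \<beta> * z $ p \<noteq> 0"
  shows "((\<lambda>m. \<Phi> m z) \<longlongrightarrow> \<Psi> z) at_top"
proof (rule tendsto_eventually)
  let ?b = "z $ q + \<beta> * z $ p"
  define m0 where "m0 = max 1 (max (2 / \<bar>z $ q\<bar>) (2 / \<bar>?b\<bar>))"
  show "eventually (\<lambda>m. \<Phi> m z = \<Psi> z) at_top"
    using eventually_ge_at_top[of m0]
  proof eventually_elim
    case (elim m)
    then have m: "m > 0" "2 / \<bar>z $ q\<bar> \<le> m" "2 / \<bar>?b\<bar> \<le> m" by (auto simp: m0_def)
    then have big: "2 \<le> m * \<bar>z $ q\<bar>" "2 \<le> m * \<bar>?b\<bar>" using z by (simp_all add: divide_le_eq)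
    show ?case
    proof (cases "\<xi> z = 0")
      case True then show ?thesis by (simp add: \<Phi>_eq[OF m(1)] \<Psi>_def)
    next
      case False
      then have "z $ p > 0" using supp(1)[of z] pos by simp
      then have "\<beta> * z $ p > 0" using pos by simp
      then consider "z $ q > 0" | "?b < 0" | "z $ q < 0" "?b > 0" using z by linarith
      then show ?thesis
      proof cases
        case 1
        then have "tent_int (m * z $ q) (m * ?b) = 0" using big by (intro tent_int_zero) simp
        then show ?thesis using 1 by (simp add: \<Phi>_eq[OF m(1)] \<Psi>_def)
      next
        case 2
        then have "m * ?b = - (m * \<bar>?b\<bar>)" by (simp only: abs_of_neg mult_minus_right minus_minus)
        then have "tent_int (m * z $ q) (m * ?b) = 0" using big(2) by (intro tent_int_zero) linarith
        then show ?thesis using 2 by (simp add: \<Phi>_eq[OF m(1)] \<Psi>_def)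
      next
        case 3
        then have "tent_int (m * z $ q) (m * ?b) = tent_mass" using big by (intro tent_int_full) simp_all
        then show ?thesis using 3 by (simp add: \<Phi>_eq[OF m(1)] \<Psi>_def)
      qed
    qed
  qed
qed

lemma AE_\<Phi>_tendsto: "AE z in lborel. ((\<lambda>m. \<Phi> m z) \<longlongrightarrow> \<Psi> z) at_top"
proof -
  have "AE z :: real^'n in lborel. axis q 1 \<bullet> z \<noteq> 0" by (rule AE_hyperplane) simp
  moreover have "AE z :: real^'n in lborel. (axis q 1 + \<beta> *\<^sub>R axis p 1) \<bullet> z \<noteq> 0"
  proof (rule AE_hyperplane)
    have "(axis q 1 + \<beta> *\<^sub>R axis p 1 :: real^'n) $ q = 1" using pq by (simp add: axis_def)
    then show "(axis q 1 + \<beta> *\<^sub>R axis p 1 :: real^'n) \<noteq> 0" by (metis zero_index zero_neq_one)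
  qed
  ultimately show ?thesis
    by eventually_elim (rule \<Phi>_tendsto; simp add: inner_add_left inner_axis')
qed

lemma \<Phi>_L1: "((\<lambda>m. \<integral>z. \<bar>\<Phi> m z - \<Psi> z\<bar> \<partial>lborel) \<longlongrightarrow> 0) at_top"
  and \<Phi>_integral: "((\<lambda>m. \<integral>z. \<Phi> m z \<partial>lborel) \<longlongrightarrow> (\<integral>z. \<Psi> z \<partial>lborel)) at_top"
  and \<Psi>_integrable: "integrable lborel \<Psi>"
  and \<Phi>_integrable: "m \<ge> 1 \<Longrightarrow> integrable lborel (\<Phi> m)"
proof -
  let ?w = "\<lambda>z :: real^'n. B * tent_mass / \<beta> * indicator (ball 0 \<rho>) z"
  have B0: "0 \<le> B" using nonneg[of 0] le[of 0] by linarith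
  have w: "integrable lborel ?w"
  proof (rule bounded_support_integrable[OF lborel_growth])
    show "?w \<in> borel_measurable borel"
      by (intro borel_measurable_times borel_measurable_indicator borel_open open_ball) simp
    show "\<bar>?w x\<bar> \<le> B * tent_mass / \<beta> * indicator (ball 0 \<rho>) x" for x
      using B0 pos tent_mass_pos by (simp add: abs_mult)
  qed
  have ev: "eventually (\<lambda>m. AE z in lborel. norm (\<Phi> m z) \<le> ?w z) at_top"
    using eventually_ge_at_top[of 1]
    by eventually_elim (use \<Phi>_bound \<Phi>_nonneg in \<open>auto intro!: AE_I2\<close>)
  have \<Psi>_le: "AE z in lborel. norm (\<Psi> z) \<le> ?w z"
    using AE_\<Phi>_tendsto
  proof eventually_elim
    case (elim z)
    have "\<Psi> z \<le> ?w z"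
      by (rule tendsto_upperbound[OF elim eventually_mono[OF eventually_ge_at_top[of 1]]]) (use \<Phi>_bound in auto)
    moreover have "0 \<le> \<Psi> z" using pos nonneg tent_mass_pos by (simp add: \<Psi>_def indicator_def)
    ultimately show ?case by simp
  qed
  show \<Psi>i: "integrable lborel \<Psi>"
  proof (rule Bochner_Integration.integrable_bound[OF w])
    show "AE z in lborel. norm (\<Psi> z) \<le> norm (?w z)"
      using \<Psi>_le
    proof eventually_elim
      case (elim z)
      then show ?case unfolding real_norm_def by (rule order_trans[OF _ abs_ge_self])
    qed
  qed simp
  show "integrable lborel (\<Phi> m)" if "m \<ge> 1" for m
  proof (rule Bochner_Integration.integrable_bound[OF w])
    show "AE z in lborel. norm (\<Phi> m z) \<le> norm (?w z)"
    proof (rule AE_I2)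
      fix z
      have "norm (\<Phi> m z) \<le> ?w z" using \<Phi>_bound[OF that, of z] \<Phi>_nonneg[of m z] that by simp
      then show "norm (\<Phi> m z) \<le> norm (?w z)" unfolding real_norm_def by (rule order_trans[OF _ abs_ge_self])
    qed
  qed simp
  show "((\<lambda>m. \<integral>z. \<Phi> m z \<partial>lborel) \<longlongrightarrow> (\<integral>z. \<Psi> z \<partial>lborel)) at_top"
    by (rule integral_dominated_convergence_at_top[OF _ _ w AE_\<Phi>_tendsto ev]) simp_all
  have "((\<lambda>m. \<integral>z. \<bar>\<Phi> m z - \<Psi> z\<bar> \<partial>lborel) \<longlongrightarrow> (\<integral>z. 0 \<partial>(lborel :: (real^'n) measure))) at_top"
  proof (rule integral_dominated_convergence_at_top[where w = "\<lambda>z. 2 * ?w z"])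
    show "AE z in lborel. ((\<lambda>m. \<bar>\<Phi> m z - \<Psi> z\<bar>) \<longlongrightarrow> 0) at_top"
      using AE_\<Phi>_tendsto by eventually_elim (intro tendsto_rabs_zero LIM_zero)
    show "eventually (\<lambda>m. AE z in lborel. norm \<bar>\<Phi> m z - \<Psi> z\<bar> \<le> 2 * ?w z) at_top"
      using ev
    proof eventually_elim
      case (elim m)
      from elim \<Psi>_le show ?case by eventually_elim (simp add: abs_le_iff)
    qed
    show "integrable lborel (\<lambda>z. 2 * ?w z)" by (rule integrable_mult_right[OF w])
  qed simp_all
  then show "((\<lambda>m. \<integral>z. \<bar>\<Phi> m z - \<Psi> z\<bar> \<partial>lborel) \<longlongrightarrow> 0) at_top" by simp
qed

lemma \<psi>_shear_dil:
  assumes R: "R > 0"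
  shows "\<psi> ((transv q p (\<beta> * R ^ CARD('n) * t) ** dil q R) *v x)
     = ((1 / R) *\<^sub>R x) $ p * \<xi> ((1 / R) *\<^sub>R x) * tent (R ^ CARD('n) * (((1 / R) *\<^sub>R x) $ q + \<beta> * t * ((1 / R) *\<^sub>R x) $ p))"
proof -
  let ?y = "(transv q p (\<beta> * R ^ CARD('n) * t) ** dil q R) *v x"
  obtain k where k: "CARD('n) = Suc k" using zero_less_card_finite[where 'a = 'n] gr0_implies_Suc by blast
  have y: "?y $ l = (if l = q then R ^ CARD('n) * (((1 / R) *\<^sub>R x) $ q + \<beta> * t * ((1 / R) *\<^sub>R x) $ p) else ((1 / R) *\<^sub>R x) $ l)" for l
    using pq R by (simp add: matrix_vector_mul_assoc[symmetric] transv_nth dil_def diagm_nth k field_simps)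
  have "\<xi> ?y = \<xi> ((1 / R) *\<^sub>R x)" by (rule indep) (simp add: y)
  moreover have "?y $ p = ((1 / R) *\<^sub>R x) $ p" "?y $ q = R ^ CARD('n) * (((1 / R) *\<^sub>R x) $ q + \<beta> * t * ((1 / R) *\<^sub>R x) $ p)"
    using pq y by auto
  ultimately show ?thesis by (simp only: \<psi>_def)
qed

text \<open>By Fubini: the matrix \<open>dil q R\<close> divides the coordinates other than \<open>x\<^sub>q\<close> by \<open>R\<close>, and it
  multiplies \<open>x\<^sub>q\<close> by \<open>R\<^sup>N / R\<close>, so in the coordinates \<open>x / R\<close> it only stretches one axis, and a
  shear by \<open>\<beta> R\<^sup>N t\<close> becomes a shear by \<open>\<beta> t\<close> before stretching.\<close>

lemma shear_average:
  assumes \<nu>: "\<nu> \<in> growth_measures" and R: "R > 0"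
  shows "(\<integral>t. (\<integral>x. \<psi> x \<partial>(act (transv q p (\<beta> * R ^ CARD('n) * t)) (act (dil q R) \<nu>))) \<partial>unit_unif)
       = (\<integral>x. \<Phi> (R ^ CARD('n)) ((1 / R) *\<^sub>R x) / R ^ CARD('n) \<partial>\<nu>)"
proof -
  interpret \<nu>: sigma_finite_measure \<nu> by (rule growth_sigma_finite[OF \<nu>])
  interpret U: prob_space unit_unif by (rule prob_space_unit_unif)
  interpret P: pair_sigma_finite unit_unif \<nu> ..
  note [measurable_cong] = growth_sets[OF \<nu>]
  let ?g = "\<lambda>t. transv q p (\<beta> * R ^ CARD('n) * t) ** dil q R"
  define k where "k t x = \<psi> (?g t *v x)" for t x
  have gSL: "?g t \<in> SL" for t using pq R by (intro SL_mult transv_SL dil_SL) auto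
  have k_eq: "k t x = ((1 / R) *\<^sub>R x) $ p * \<xi> ((1 / R) *\<^sub>R x) * tent (R ^ CARD('n) * (((1 / R) *\<^sub>R x) $ q + \<beta> * t * ((1 / R) *\<^sub>R x) $ p))" for t x
    unfolding k_def by (rule \<psi>_shear_dil[OF R])
  have k0: "0 \<le> k t x" for t x unfolding k_def by (rule \<psi>_nonneg)
  have km[measurable]: "(\<lambda>(t, x). k t x) \<in> borel_measurable (unit_unif \<Otimes>\<^sub>M \<nu>)"
    unfolding k_eq by measurable
  have inner: "(\<integral>x. \<psi> x \<partial>(act (transv q p (\<beta> * R ^ CARD('n) * t)) (act (dil q R) \<nu>))) = (\<integral>x. k t x \<partial>\<nu>)" for t
    unfolding k_def act_mult[OF \<nu>] by (rule integral_act[OF \<nu> Cc_borel[OF \<psi>_Cc]])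
  have "(\<integral>t. (\<integral>x. k t x \<partial>\<nu>) \<partial>unit_unif) = enn2real (\<integral>\<^sup>+t. ennreal (\<integral>x. k t x \<partial>\<nu>) \<partial>unit_unif)"
    by (rule integral_eq_nn_integral) (simp_all add: k0)
  also have "(\<integral>\<^sup>+t. ennreal (\<integral>x. k t x \<partial>\<nu>) \<partial>unit_unif) = (\<integral>\<^sup>+t. (\<integral>\<^sup>+x. ennreal (k t x) \<partial>\<nu>) \<partial>unit_unif)"
  proof (rule nn_integral_cong)
    fix t
    have "integrable \<nu> (k t)"
      unfolding k_def[abs_def] by (rule Cc_integrable[OF \<nu> Cc_SL[OF gSL \<psi>_Cc]])
    from nn_integral_eq_integral[OF this] show "ennreal (\<integral>x. k t x \<partial>\<nu>) = (\<integral>\<^sup>+x. ennreal (k t x) \<partial>\<nu>)"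
      by (simp add: k0)
  qed
  also have "\<dots> = (\<integral>\<^sup>+x. (\<integral>\<^sup>+t. ennreal (k t x) \<partial>unit_unif) \<partial>\<nu>)"
    by (rule P.Fubini'[symmetric]) simp
  also have "\<dots> = (\<integral>\<^sup>+x. ennreal (\<Phi> (R ^ CARD('n)) ((1 / R) *\<^sub>R x) / R ^ CARD('n)) \<partial>\<nu>)"
  proof (rule nn_integral_cong)
    fix x :: "real^'n"
    let ?z = "(1 / R) *\<^sub>R x"
    have m: "k t x \<le> \<bar>?z $ p * \<xi> ?z\<bar> * 2" for t
      unfolding k_eq using tent_nonneg tent_le2 by (intro mult_mono abs_ge_self) auto
    have "integrable unit_unif (\<lambda>t. k t x)"
    proof (rule U.integral_bounds(1))
      show "(\<lambda>t. k t x) \<in> borel_measurable unit_unif" unfolding k_eq by measurable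
      show "AE t in unit_unif. \<bar>k t x\<bar> \<le> \<bar>?z $ p * \<xi> ?z\<bar> * 2"
        unfolding abs_of_nonneg[OF k0] by (intro AE_I2 m)
    qed
    from nn_integral_eq_integral[OF this] have "(\<integral>\<^sup>+t. ennreal (k t x) \<partial>unit_unif) = ennreal (\<integral>t. k t x \<partial>unit_unif)"
      by (simp add: k0)
    also have "(\<integral>t. k t x \<partial>unit_unif) = \<Phi> (R ^ CARD('n)) ?z / R ^ CARD('n)"
      using R by (simp add: \<Phi>_def k_eq)
    finally show "(\<integral>\<^sup>+t. ennreal (k t x) \<partial>unit_unif) = ennreal (\<Phi> (R ^ CARD('n)) ?z / R ^ CARD('n))" .
  qed
  also have "enn2real \<dots> = (\<integral>x. \<Phi> (R ^ CARD('n)) ((1 / R) *\<^sub>R x) / R ^ CARD('n) \<partial>\<nu>)"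
    using R by (intro integral_eq_nn_integral[symmetric]) (auto intro!: divide_nonneg_nonneg \<Phi>_nonneg)
  finally show ?thesis unfolding inner .
qed

text \<open>Apply \<open>shear_average\<close> to Lebesgue measure, which is fixed by all matrices involved, and
  let the scale tend to infinity.\<close>

lemma \<psi>_integral: "(\<integral>x. \<psi> x \<partial>lborel) = (\<integral>x. \<Psi> x \<partial>lborel)"
proof -
  interpret U: prob_space unit_unif by (rule prob_space_unit_unif)
  have "(\<integral>z. \<Phi> (R ^ CARD('n)) z \<partial>lborel) = (\<integral>x. \<psi> x \<partial>lborel)" if R1: "R \<ge> 1" for R
  proof -
    have R: "R > 0" "R ^ CARD('n) \<ge> 1" using R1 by (simp_all add: one_le_power)
    have "(\<integral>x. \<psi> x \<partial>lborel) = (\<integral>x. \<Phi> (R ^ CARD('n)) ((1 / R) *\<^sub>R x) / R ^ CARD('n) \<partial>lborel)"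
      using shear_average[OF lborel_growth R(1)] pq R
      by (simp add: lborel_SL_invariant dil_SL transv_SL)
    then show ?thesis by (simp only: integral_dilate(2)[OF \<Phi>_borel \<Phi>_integrable[OF R(2)] R(1)])
  qed
  then have "eventually (\<lambda>R. (\<integral>z. \<Phi> (R ^ CARD('n)) z \<partial>lborel) = (\<integral>x. \<psi> x \<partial>lborel)) at_top"
    by (intro eventually_mono[OF eventually_ge_at_top[of 1]]) auto
  then have "((\<lambda>R. \<integral>z. \<Phi> (R ^ CARD('n)) z \<partial>lborel) \<longlongrightarrow> (\<integral>x. \<psi> x \<partial>lborel)) at_top"
    by (rule tendsto_eventually)
  moreover have "filterlim (\<lambda>R::real. R ^ CARD('n)) at_top at_top"
    by (rule filterlim_pow_at_top[OF _ filterlim_ident]) simp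
  from filterlim_compose[OF \<Phi>_integral this]
  have "((\<lambda>R. \<integral>z. \<Phi> (R ^ CARD('n)) z \<partial>lborel) \<longlongrightarrow> (\<integral>x. \<Psi> x \<partial>lborel)) at_top" .
  ultimately show ?thesis using tendsto_unique trivial_limit_at_top_linorder by blast
qed

end

section \<open>Invariant measures are multiples of Lebesgue measure\<close>

text \<open>Finiteness is only assumed for bounded sets at a positive distance from the hyperplane
  \<open>x\<^sub>p = 0\<close>; this is what can be proved for the intensity of a Siegel measure before it is known
  to be a multiple of Lebesgue measure.\<close>

locale SL_invariant =
  fixes L :: "(real^'n::finite) measure" and p q :: 'n
  assumes pq: "p \<noteq> q" and sets_L[measurable_cong]: "sets L = sets borel"
    and inv: "\<And>g A. g \<in> SL \<Longrightarrow> A \<in> sets borel \<Longrightarrow> emeasure L {x. g *v x \<in> A} = emeasure L A"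
    and fin: "\<And>C. C \<ge> 1 \<Longrightarrow> emeasure L {x. 1 / C \<le> x $ p \<and> (\<forall>k. \<bar>x $ k\<bar> \<le> C)} < \<infinity>"
begin

lemma space_L[simp]: "space L = UNIV"
  using sets_eq_imp_space_eq[OF sets_L] by simp

text \<open>A box in the coordinates that consist of the height \<open>x\<^sub>p\<close> and the slopes \<open>x\<^sub>i / x\<^sub>p\<close>. In
  these coordinates shears along the axis \<open>p\<close> are translations, and the invariant measure is a
  product.\<close>

definition cone :: "real set \<Rightarrow> ('n \<Rightarrow> real) \<Rightarrow> ('n \<Rightarrow> real) \<Rightarrow> (real^'n) set" where
  "cone I l r = {x. 0 < x $ p \<and> x $ p \<in> I \<and> (\<forall>i. i \<noteq> p \<longrightarrow> l i < x $ i / x $ p \<and> x $ i / x $ p < r i)}"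

lemma cone_borel[measurable]: "I \<in> sets borel \<Longrightarrow> cone I l r \<in> sets borel"
proof -
  assume [measurable]: "I \<in> sets borel"
  have "cone I l r = {x \<in> space borel. 0 < x $ p \<and> x $ p \<in> I \<and> (\<forall>i. i \<noteq> p \<longrightarrow> l i < x $ i / x $ p \<and> x $ i / x $ p < r i)}"
    by (simp add: cone_def)
  also have "\<dots> \<in> sets borel" by measurable
  finally show ?thesis .
qed

text \<open>The transvection that adds \<open>w x\<^sub>p\<close> to \<open>x\<^sub>i\<close> translates the \<open>i\<close>-th slope by \<open>w\<close> and fixes
  the height and the other slopes. So the distribution of that slope is a translation-invariant
  measure on the line.\<close>

lemma cone_slope:
  assumes I: "I \<in> sets borel" "I \<subseteq> {1 / c..c}" and c: "c \<ge> 1" and ip: "i \<noteq> p" and lr: "l i \<le> r i"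
  shows "emeasure L (cone I l r) = ennreal (r i - l i) * emeasure L (cone I (l(i := 0)) (r(i := 1)))"
proof -
  define D where "D = {x. 0 < x $ p \<and> x $ p \<in> I \<and> (\<forall>j. j \<noteq> p \<and> j \<noteq> i \<longrightarrow> l j < x $ j / x $ p \<and> x $ j / x $ p < r j)}"
  have D[measurable]: "D \<in> sets borel"
  proof -
    note I(1)[measurable]
    have "D = {x \<in> space borel. 0 < x $ p \<and> x $ p \<in> I \<and> (\<forall>j. j \<noteq> p \<and> j \<noteq> i \<longrightarrow> l j < x $ j / x $ p \<and> x $ j / x $ p < r j)}"
      by (simp add: D_def)
    also have "\<dots> \<in> sets borel" by measurable
    finally show ?thesis .
  qed
  define M where "M = distr (density L (indicator D)) borel (\<lambda>x. x $ i / x $ p)"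
  have M: "emeasure M A = emeasure L {x \<in> D. x $ i / x $ p \<in> A}" if [measurable]: "A \<in> sets borel" for A
  proof -
    have "emeasure M A = emeasure (density L (indicator D)) ((\<lambda>x. x $ i / x $ p) -` A)"
      unfolding M_def by (subst emeasure_distr) (simp_all add: sets_L space_density)
    also have "\<dots> = (\<integral>\<^sup>+x. indicator D x * indicator ((\<lambda>x. x $ i / x $ p) -` A) x \<partial>L)"
    proof (rule emeasure_density)
      show "(\<lambda>x. x $ i / x $ p) -` A \<in> sets L"
        using measurable_sets[of "\<lambda>x :: real^'n. x $ i / x $ p" borel borel A] by (simp add: sets_L)
    qed (simp add: sets_L)
    also have "\<dots> = (\<integral>\<^sup>+x. indicator {x \<in> D. x $ i / x $ p \<in> A} x \<partial>L)"
      by (intro nn_integral_cong) (simp add: indicator_def)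
    also have "\<dots> = emeasure L {x \<in> D. x $ i / x $ p \<in> A}"
    proof (rule nn_integral_indicator)
      have "{x \<in> D. x $ i / x $ p \<in> A} = {x \<in> space borel. x \<in> D \<and> x $ i / x $ p \<in> A}" by simp
      also have "\<dots> \<in> sets borel" by measurable
      finally show "{x \<in> D. x $ i / x $ p \<in> A} \<in> sets L" by (simp add: sets_L)
    qed
    finally show ?thesis .
  qed
  have sM: "sets M = sets borel" by (simp add: M_def)
  have tr: "distr M borel (\<lambda>t. t + w) = M" for w
  proof (rule measure_eqI)
    fix A assume "A \<in> sets (distr M borel (\<lambda>t. t + w))"
    then have A[measurable]: "A \<in> sets borel" by simp
    have A': "{t. t + w \<in> A} \<in> sets borel"
      using measurable_sets[of "\<lambda>t. t + w" borel borel A] by (simp add: vimage_def)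
    have E: "{x \<in> D. x $ i / x $ p \<in> A} \<in> sets borel"
    proof -
      have "{x \<in> D. x $ i / x $ p \<in> A} = {x \<in> space borel. x \<in> D \<and> x $ i / x $ p \<in> A}" by simp
      also have "\<dots> \<in> sets borel" by measurable
      finally show ?thesis .
    qed
    have "emeasure (distr M borel (\<lambda>t. t + w)) A = emeasure M {t. t + w \<in> A}"
      by (subst emeasure_distr) (use sM sets_eq_imp_space_eq[OF sM] in \<open>simp_all add: vimage_def\<close>)
    also have "\<dots> = emeasure L {x \<in> D. x $ i / x $ p + w \<in> A}" using M[OF A'] by simp
    also have "{x \<in> D. x $ i / x $ p + w \<in> A} = {x. transv i p w *v x \<in> {x \<in> D. x $ i / x $ p \<in> A}}"
      using ip by (auto simp: D_def transv_nth add_divide_distrib)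
    also have "emeasure L \<dots> = emeasure L {x \<in> D. x $ i / x $ p \<in> A}"
      by (rule inv[OF transv_SL[OF ip] E])
    also have "\<dots> = emeasure M A" by (rule M[OF A, symmetric])
    finally show "emeasure (distr M borel (\<lambda>t. t + w)) A = emeasure M A" .
  qed (simp add: sM)
  have Mfin: "emeasure M {- real k..real k} < \<infinity>" for k
  proof -
    define K where "K = 1 + (\<Sum>j\<in>UNIV. \<bar>l j\<bar>) + (\<Sum>j\<in>UNIV. \<bar>r j\<bar>) + real k"
    have K: "1 \<le> K" "\<bar>l j\<bar> \<le> K" "\<bar>r j\<bar> \<le> K" "real k \<le> K" for j
    proof -
      have "\<bar>l j\<bar> \<le> (\<Sum>j\<in>UNIV. \<bar>l j\<bar>)" "\<bar>r j\<bar> \<le> (\<Sum>j\<in>UNIV. \<bar>r j\<bar>)"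
        by (rule member_le_sum; simp)+
      then show "1 \<le> K" "\<bar>l j\<bar> \<le> K" "\<bar>r j\<bar> \<le> K" "real k \<le> K"
        unfolding K_def using abs_ge_zero[of "l j"] abs_ge_zero[of "r j"] of_nat_0_le_iff[of k] by linarith+
    qed
    have cK: "c \<le> c * K" using c K(1) mult_left_mono[of 1 K c] by simp
    then have cK: "c \<le> c * K" "1 \<le> c * K" using c by linarith+
    have "{x \<in> D. x $ i / x $ p \<in> {- real k..real k}} \<subseteq> {x. 1 / (c * K) \<le> x $ p \<and> (\<forall>j. \<bar>x $ j\<bar> \<le> c * K)}"
    proof
      fix x assume x: "x \<in> {x \<in> D. x $ i / x $ p \<in> {- real k..real k}}"
      then have xp: "0 < x $ p" "1 / c \<le> x $ p" "x $ p \<le> c" using I(2) by (auto simp: D_def)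
      have "1 / (c * K) \<le> 1 / c" using c cK by (intro divide_left_mono) auto
      moreover have "\<bar>x $ j\<bar> \<le> c * K" for j
      proof (cases "j = p")
        case True
        show ?thesis unfolding True using xp cK by linarith
      next
        case False
        have s: "\<bar>x $ j / x $ p\<bar> \<le> K"
        proof (cases "j = i")
          case True then show ?thesis using x K(4) by auto
        next
          case ji: False
          then have "l j < x $ j / x $ p" "x $ j / x $ p < r j" using x False by (auto simp: D_def)
          then show ?thesis using K(2,3)[of j] by linarith
        qed
        have "\<bar>x $ j\<bar> = x $ p * \<bar>x $ j / x $ p\<bar>" using xp by (simp add: abs_divide)
        also have "\<dots> \<le> c * K" using s xp c by (intro mult_mono) auto
        finally show ?thesis .
      qed
      ultimately show "x \<in> {x. 1 / (c * K) \<le> x $ p \<and> (\<forall>j. \<bar>x $ j\<bar> \<le> c * K)}" using xp by auto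
    qed
    note sub = this
    have meas: "{x. 1 / (c * K) \<le> x $ p \<and> (\<forall>j. \<bar>x $ j\<bar> \<le> c * K)} \<in> sets L"
    proof -
      have "{x. 1 / (c * K) \<le> x $ p \<and> (\<forall>j. \<bar>x $ j\<bar> \<le> c * K)} = {x \<in> space (borel :: (real^'n) measure). 1 / (c * K) \<le> x $ p \<and> (\<forall>j. \<bar>x $ j\<bar> \<le> c * K)}"
        by simp
      also have "\<dots> \<in> sets borel" by measurable
      finally show ?thesis by (simp add: sets_L)
    qed
    show ?thesis
      unfolding M[OF borel_closed[OF closed_atLeastAtMost]]
      by (rule le_less_trans[OF emeasure_mono[OF sub meas] fin[OF cK(2)]])
  qed
  have sf: "sigma_finite_measure M"
  proof
    let ?A = "range (\<lambda>k. {- real k..real k})"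
    have "\<exists>k. t \<in> {- real k..real k}" for t :: real
    proof -
      obtain k where "\<bar>t\<bar> \<le> real k" using real_arch_simple by blast
      then show ?thesis by (intro exI[of _ k]) auto
    qed
    then have "\<Union> ?A = space M" using sets_eq_imp_space_eq[OF sM] by auto
    then show "\<exists>A. countable A \<and> A \<subseteq> sets M \<and> \<Union> A = space M \<and> (\<forall>a\<in>A. emeasure M a \<noteq> \<infinity>)"
      using Mfin by (intro exI[of _ ?A]) (auto simp: sM less_top[symmetric])
  qed
  have "emeasure M {l i<..<r i} = emeasure M (uminus -` {-1<..<0}) * emeasure lborel {l i<..<r i}"
    by (rule translation_invariant_eq_lborel[OF sf sM tr]) simp_all
  moreover have "uminus -` {-1<..<0::real} = {0<..<1}" by auto
  moreover have "emeasure M {l i<..<r i} = emeasure L (cone I l r)"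
    using ip by (subst M) (auto simp: D_def cone_def intro!: arg_cong[where f = "emeasure L"])
  moreover have "emeasure M {0<..<1} = emeasure L (cone I (l(i := 0)) (r(i := 1)))"
    using ip by (subst M) (auto simp: D_def cone_def intro!: arg_cong[where f = "emeasure L"])
  ultimately show ?thesis using lr by (simp add: mult.commute)
qed

text \<open>The mass of the heights in \<open>I\<close> over the unit cube of slopes. It determines the measure on
  the half space.\<close>

definition h :: "real set \<Rightarrow> ennreal" where
  "h I = emeasure L (cone I (\<lambda>_. 0) (\<lambda>_. 1))"

lemma cone_prod_bounded:
  assumes I: "I \<in> sets borel" "I \<subseteq> {1 / c..c}" and c: "c \<ge> 1" and lr: "\<And>i. l i \<le> r i"
  shows "emeasure L (cone I l r) = ennreal (\<Prod>i\<in>UNIV - {p}. r i - l i) * h I"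
proof -
  have "emeasure L (cone I l r) = ennreal (\<Prod>i\<in>S. r i - l i) * emeasure L (cone I (\<lambda>i. if i \<in> S then 0 else l i) (\<lambda>i. if i \<in> S then 1 else r i))"
    if "finite S" "S \<subseteq> UNIV - {p}" for S
    using that
  proof (induction S rule: finite_induct)
    case empty then show ?case by simp
  next
    case (insert j S)
    let ?l = "\<lambda>i. if i \<in> S then 0 else l i" and ?r = "\<lambda>i. if i \<in> S then 1 else r i"
    have jp: "j \<noteq> p" using insert by auto
    have "emeasure L (cone I ?l ?r) = ennreal (?r j - ?l j) * emeasure L (cone I (?l(j := 0)) (?r(j := 1)))"
      using insert lr by (intro cone_slope[OF I c jp]) auto
    moreover have "?l(j := 0) = (\<lambda>i. if i \<in> insert j S then 0 else l i)" "?r(j := 1) = (\<lambda>i. if i \<in> insert j S then 1 else r i)"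
      by auto
    moreover have "0 \<le> (\<Prod>i\<in>S. r i - l i)" using lr by (intro prod_nonneg) (simp add: le_diff_eq)
    ultimately show ?case
      using insert lr by (simp add: ennreal_mult mult_ac prod_nonneg)
  qed
  from this[of "UNIV - {p}"] have "emeasure L (cone I l r) = ennreal (\<Prod>i\<in>UNIV - {p}. r i - l i)
    * emeasure L (cone I (\<lambda>i. if i \<in> UNIV - {p} then 0 else l i) (\<lambda>i. if i \<in> UNIV - {p} then 1 else r i))" by simp
  also have "cone I (\<lambda>i. if i \<in> UNIV - {p} then 0 else l i) (\<lambda>i. if i \<in> UNIV - {p} then 1 else r i) = cone I (\<lambda>_. 0) (\<lambda>_. 1)"
    by (auto simp: cone_def)
  finally show ?thesis by (simp add: h_def)
qed

lemma cone_SUP: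
  assumes I: "I \<in> sets borel"
  shows "emeasure L (cone I l r) = (SUP k. emeasure L (cone (I \<inter> {1 / real (Suc k)..real (Suc k)}) l r))"
proof -
  have "(SUP k. emeasure L (cone (I \<inter> {1 / real (Suc k)..real (Suc k)}) l r)) = emeasure L (\<Union>k. cone (I \<inter> {1 / real (Suc k)..real (Suc k)}) l r)"
  proof (rule SUP_emeasure_incseq)
    show "range (\<lambda>k. cone (I \<inter> {1 / real (Suc k)..real (Suc k)}) l r) \<subseteq> sets L"
      using I by (auto simp: sets_L)
    show "incseq (\<lambda>k. cone (I \<inter> {1 / real (Suc k)..real (Suc k)}) l r)"
    proof (rule incseq_SucI)
      fix k
      have "1 / real (Suc (Suc k)) \<le> 1 / real (Suc k)" by (intro divide_left_mono) auto
      then show "cone (I \<inter> {1 / real (Suc k)..real (Suc k)}) l r \<subseteq> cone (I \<inter> {1 / real (Suc (Suc k))..real (Suc (Suc k))}) l r"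
        by (auto simp: cone_def)
    qed
  qed
  also have "(\<Union>k. cone (I \<inter> {1 / real (Suc k)..real (Suc k)}) l r) = cone I l r"
  proof (intro equalityI subsetI)
    fix x assume x: "x \<in> cone I l r"
    then have xp: "0 < x $ p" by (simp add: cone_def)
    obtain k where k: "max (x $ p) (1 / x $ p) \<le> real k" using real_arch_simple by blast
    then have "x $ p \<le> real (Suc k)" "1 / x $ p \<le> real (Suc k)" by auto
    then have "x $ p \<in> {1 / real (Suc k)..real (Suc k)}" using xp by (simp add: field_simps)
    then show "x \<in> (\<Union>k. cone (I \<inter> {1 / real (Suc k)..real (Suc k)}) l r)" using x by (auto simp: cone_def)
  qed (auto simp: cone_def)
  finally show ?thesis ..
qed

lemma cone_prod:
  assumes I: "I \<in> sets borel" and lr: "\<And>i. l i \<le> r i"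
  shows "emeasure L (cone I l r) = ennreal (\<Prod>i\<in>UNIV - {p}. r i - l i) * h I"
proof -
  have "emeasure L (cone I l r) = (SUP k. ennreal (\<Prod>i\<in>UNIV - {p}. r i - l i) * h (I \<inter> {1 / real (Suc k)..real (Suc k)}))"
    unfolding cone_SUP[OF I]
    using I by (intro SUP_cong refl cone_prod_bounded[OF _ _ _ lr]) auto
  also have "\<dots> = ennreal (\<Prod>i\<in>UNIV - {p}. r i - l i) * h I"
    unfolding h_def cone_SUP[OF I] by (simp add: SUP_mult_left_ennreal)
  finally show ?thesis .
qed

text \<open>The matrix \<open>dil p R\<close> multiplies the height by \<open>R\<^sup>N\<^sup>-\<^sup>1 = t\<close> and divides the slopes by
  \<open>R\<^sup>N\<close>; by \<open>cone_prod\<close> the enlarged cube of slopes contributes the factor \<open>(R\<^sup>N)\<^sup>N\<^sup>-\<^sup>1 = t\<^sup>N\<close>.\<close>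

lemma h_scale:
  assumes I: "I \<in> sets borel" and t: "t > 0"
  shows "h {s. s / t \<in> I} = ennreal (t ^ CARD('n)) * h I"
proof -
  define N where "N = CARD('n)"
  have "card {p, q} \<le> N" unfolding N_def by (rule card_mono) auto
  then have N: "N \<ge> 2" using pq by simp
  define R where "R = root (N - 1) t"
  have R: "R > 0" "R ^ (N - 1) = t" using N t by (auto simp: R_def)
  have "t ^ N = (R ^ (N - 1)) ^ N" by (simp only: R(2))
  then have tN: "t ^ N = (R ^ N) ^ (N - 1)" by (simp add: power_mult[symmetric] mult.commute)
  have RN: "R ^ N = t * R"
    using R N by (metis One_nat_def Suc_pred less_le_trans mult.commute pos2 power_Suc)
  have I': "{s. s / t \<in> I} \<in> sets borel"
    using measurable_sets[of "\<lambda>s. s / t" borel borel I] I by (simp add: vimage_def)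
  have eq: "{x. dil p R *v x \<in> cone {s. s / t \<in> I} (\<lambda>_. 0) (\<lambda>_. 1)} = cone I (\<lambda>_. 0) (\<lambda>_. R ^ N)"
  proof -
    have "(dil p R *v x) $ p = t * x $ p" for x
      using R by (simp add: dil_def diagm_nth N_def)
    moreover have "(dil p R *v x) $ i / (t * x $ p) = (x $ i / x $ p) / R ^ N" if "i \<noteq> p" for i x
      using R t that by (simp add: dil_def diagm_nth RN)
    ultimately have sl: "(dil p R *v x) $ i / (dil p R *v x) $ p = (x $ i / x $ p) / R ^ N" if "i \<noteq> p" for i x
      using that by simp
    have pp: "(dil p R *v x) $ p = t * x $ p" for x
      using R by (simp add: dil_def diagm_nth N_def)
    have 1: "0 < (dil p R *v x) $ p \<longleftrightarrow> 0 < x $ p" "(dil p R *v x) $ p / t \<in> I \<longleftrightarrow> x $ p \<in> I" for x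
      using t by (simp_all add: pp zero_less_mult_iff)
    have RN0: "0 < R ^ N" using R by simp
    have 2: "0 < y / R ^ N \<longleftrightarrow> 0 < y" "y / R ^ N < 1 \<longleftrightarrow> y < R ^ N" for y
      by (rule zero_less_divide_iff[of y, THEN trans], use RN0 in linarith) (rule divide_less_eq_1_pos[OF RN0])
    show ?thesis
      unfolding cone_def mem_Collect_eq by (simp only: 1 sl 2 not_False_eq_True cong: imp_cong)
  qed
  have "h {s. s / t \<in> I} = emeasure L {x. dil p R *v x \<in> cone {s. s / t \<in> I} (\<lambda>_. 0) (\<lambda>_. 1)}"
    unfolding h_def by (rule inv[symmetric, OF dil_SL[OF R(1)] cone_borel[OF I']])
  also have "\<dots> = ennreal ((R ^ N) ^ (N - 1)) * h I"
    unfolding eq using cone_prod[OF I, of "\<lambda>_. 0" "\<lambda>_. R ^ N"] R by (simp add: N_def card_Diff_singleton)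
  finally show ?thesis unfolding N_def[symmetric] tN .
qed

text \<open>The set function \<open>h\<close> as a measure on the line.\<close>

definition hm :: "real measure" where
  "hm = distr (density L (indicator (cone UNIV (\<lambda>_. 0) (\<lambda>_. 1)))) borel (\<lambda>x. x $ p)"

lemma sets_hm[simp]: "sets hm = sets borel" by (simp add: hm_def)

lemma emeasure_hm: assumes [measurable]: "I \<in> sets borel" shows "emeasure hm I = h I"
proof -
  let ?D = "cone UNIV (\<lambda>_. 0) (\<lambda>_. 1)"
  have "emeasure hm I = emeasure (density L (indicator ?D)) ((\<lambda>x. x $ p) -` I)"
    unfolding hm_def by (subst emeasure_distr) (simp_all add: sets_L space_density)
  also have "\<dots> = (\<integral>\<^sup>+x. indicator ?D x * indicator ((\<lambda>x. x $ p) -` I) x \<partial>L)"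
  proof (rule emeasure_density)
    show "(\<lambda>x. x $ p) -` I \<in> sets L"
      using measurable_sets[of "\<lambda>x :: real^'n. x $ p" borel borel I] by (simp add: sets_L)
  qed (simp add: sets_L)
  also have "\<dots> = (\<integral>\<^sup>+x. indicator (cone I (\<lambda>_. 0) (\<lambda>_. 1)) x \<partial>L)"
  proof -
    have "cone I (\<lambda>_. 0) (\<lambda>_. 1) = {x \<in> ?D. x $ p \<in> I}" unfolding cone_def by blast
    then show ?thesis by (intro nn_integral_cong) (simp add: indicator_def)
  qed
  also have "\<dots> = h I" unfolding h_def by (rule nn_integral_indicator) (simp add: sets_L)
  finally show ?thesis .
qed

definition V :: ennreal where "V = h {..1}"

text \<open>By \<open>h_scale\<close> the masses of the dyadic layers of heights form a geometric series.\<close>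

lemma V_finite: "V < \<infinity>"
proof -
  define J where "J k = {(1/2::real) ^ Suc k<..(1/2) ^ k}" for k
  define N where "N = CARD('n)"
  have N: "N > 0" by (simp add: N_def)
  have J0: "h (J 0) < \<infinity>"
  proof -
    have "cone (J 0) (\<lambda>_. 0) (\<lambda>_. 1) \<subseteq> {x. 1 / 2 \<le> x $ p \<and> (\<forall>k. \<bar>x $ k\<bar> \<le> 2)}"
    proof
      fix x assume x: "x \<in> cone (J 0) (\<lambda>_. 0) (\<lambda>_. 1)"
      then have xp: "0 < x $ p" "1 / 2 < x $ p" "x $ p \<le> 1" by (auto simp: cone_def J_def)
      have "\<bar>x $ k\<bar> \<le> 2" for k
      proof (cases "k = p")
        case False
        then have "0 < x $ k / x $ p" "x $ k / x $ p < 1" using x by (auto simp: cone_def)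
        then have "0 < x $ k" "x $ k < x $ p" using xp by (auto simp: zero_less_divide_iff divide_less_eq)
        then show ?thesis using xp by simp
      qed (use xp in simp)
      then show "x \<in> {x. 1 / 2 \<le> x $ p \<and> (\<forall>k. \<bar>x $ k\<bar> \<le> 2)}" using xp by simp
    qed
    moreover have "{x. 1 / 2 \<le> x $ p \<and> (\<forall>k. \<bar>x $ k\<bar> \<le> 2)} \<in> sets L"
    proof -
      have "{x. 1 / 2 \<le> x $ p \<and> (\<forall>k. \<bar>x $ k\<bar> \<le> 2)} = {x \<in> space (borel :: (real^'n) measure). 1 / 2 \<le> x $ p \<and> (\<forall>k. \<bar>x $ k\<bar> \<le> 2)}"
        by simp
      also have "\<dots> \<in> sets borel" by measurable
      finally show ?thesis by (simp add: sets_L)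
    qed
    ultimately have "h (J 0) \<le> emeasure L {x. 1 / 2 \<le> x $ p \<and> (\<forall>k. \<bar>x $ k\<bar> \<le> 2)}"
      unfolding h_def by (rule emeasure_mono)
    also have "\<dots> < \<infinity>" using fin[of 2] by simp
    finally show ?thesis .
  qed
  have Jk: "h (J k) = ennreal (((1/2) ^ N) ^ k) * h (J 0)" for k
  proof -
    have "J k = {s. s / (1/2) ^ k \<in> J 0}" by (auto simp: J_def field_simps)
    then have "h (J k) = ennreal (((1/2) ^ k) ^ N) * h (J 0)"
      using h_scale[of "J 0" "(1/2) ^ k"] by (simp add: J_def N_def)
    then show ?thesis by (simp add: power_mult[symmetric] mult.commute)
  qed
  have dis: "disjoint_family J"
  proof -
    have "J m \<inter> J n = {}" if "m < n" for m n
    proof -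
      have "(1/2::real) ^ n \<le> (1/2) ^ Suc m" using that by (intro power_decreasing) auto
      then show ?thesis by (auto simp: J_def)
    qed
    then show ?thesis unfolding disjoint_family_on_def by (metis Int_commute linorder_neqE_nat)
  qed
  have "cone {..1} (\<lambda>_. 0) (\<lambda>_. 1) = cone (\<Union>k. J k) (\<lambda>_. 0) (\<lambda>_. 1)"
  proof -
    have "s \<in> (\<Union>k. J k) \<longleftrightarrow> s \<le> 1" if s: "0 < s" for s
    proof
      assume "s \<in> (\<Union>k. J k)"
      then obtain k where "s \<le> (1/2) ^ k" by (auto simp: J_def)
      also have "(1/2::real) ^ k \<le> 1" by (simp add: power_le_one)
      finally show "s \<le> 1" .
    next
      assume s1: "s \<le> 1"
      obtain n where n: "(1/2) ^ n < s" using real_arch_pow_inv[of s "1/2"] s by auto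
      define m where "m = (LEAST n. (1/2) ^ n < s)"
      have m: "(1/2) ^ m < s" unfolding m_def by (rule LeastI[of _ n]) (rule n)
      then have "m \<noteq> 0" using s1 by (intro notI) simp
      then obtain k where k: "m = Suc k" using not0_implies_Suc by blast
      have "\<not> (1/2) ^ k < s" using not_less_Least[of k "\<lambda>n. (1/2) ^ n < s"] k unfolding m_def by simp
      then show "s \<in> (\<Union>k. J k)" using m k by (auto simp: J_def)
    qed
    then show ?thesis unfolding cone_def by auto
  qed
  then have "V = emeasure hm (\<Union>k. J k)" unfolding V_def by (subst emeasure_hm) (auto simp: h_def J_def)
  also have "\<dots> = (\<Sum>k. emeasure hm (J k))"
    by (rule suminf_emeasure[symmetric, OF _ dis]) (auto simp: J_def)
  also have "\<dots> = (\<Sum>k. ennreal (((1/2) ^ N) ^ k) * h (J 0))"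
    using Jk by (simp add: emeasure_hm J_def[abs_def])
  also have "\<dots> = (\<Sum>k. ennreal (((1/2) ^ N) ^ k)) * h (J 0)" by simp
  also have "(\<Sum>k. ennreal (((1/2) ^ N) ^ k)) = ennreal (\<Sum>k. ((1/2) ^ N) ^ k)"
  proof (rule suminf_ennreal2)
    have "(1/2::real) ^ N < 1" using N by (intro power_less_one_iff[THEN iffD2]) auto
    then show "summable (\<lambda>k. ((1/2::real) ^ N) ^ k)" by (intro summable_geometric) simp
  qed simp
  also have "\<dots> * h (J 0) < \<infinity>" using J0 by (simp add: ennreal_mult_less_top)
  finally show ?thesis .
qed

lemma hm_atMost: "emeasure hm {..b} = (if b \<le> 0 then 0 else ennreal (b ^ CARD('n)) * V)"
proof (cases "b \<le> 0")
  case True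
  then have "cone {..b} (\<lambda>_. 0) (\<lambda>_. 1) = {}" by (auto simp: cone_def)
  then show ?thesis using True by (simp add: emeasure_hm h_def)
next
  case False
  have "{..b} = {s. s / b \<in> {..1}}" using False by (auto simp: divide_le_eq)
  then have "h {..b} = ennreal (b ^ CARD('n)) * V" unfolding V_def using False h_scale[of "{..1}" b] by simp
  then show ?thesis using False by (simp add: emeasure_hm)
qed

end

text \<open>By \<open>cone_prod\<close> and \<open>h_scale\<close> the mass of every box in the coordinates height and slopes is
  a multiple of \<open>V\<close>, with a factor that is the same for both measures.\<close>

lemma SL_invariant_half_space:
  fixes L :: "(real^'n::finite) measure"
  assumes L: "SL_invariant L p q" and L': "SL_invariant L' p q"
    and c: "SL_invariant.V L p = ennreal c * SL_invariant.V L' p" and c0: "0 \<le> c"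
    and A: "A \<in> sets borel"
  shows "emeasure L (A \<inter> {x. 0 < x $ p}) = ennreal c * emeasure L' (A \<inter> {x. 0 < x $ p})"
proof -
  interpret L: SL_invariant L p q by (rule L)
  interpret L': SL_invariant L' p q by (rule L')
  have hm: "L.hm = scale_measure (ennreal c) L'.hm"
  proof (rule measure_eqI_generator_eq[where E = "range atMost" and \<Omega> = UNIV and A = "\<lambda>i. {..real i}"])
    show "Int_stable (range (atMost :: real \<Rightarrow> _))" by (auto simp: Int_stable_def)
    show "sets L.hm = sigma_sets UNIV (range atMost)" "sets (scale_measure (ennreal c) L'.hm) = sigma_sets UNIV (range atMost)"
      by (simp_all add: borel_eq_atMost)
    show "(\<Union>i. {..real i}) = UNIV" using real_arch_simple by auto
    fix X assume "X \<in> range (atMost :: real \<Rightarrow> _)"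
    then obtain b where "X = {..b}" by auto
    then show "emeasure L.hm X = emeasure (scale_measure (ennreal c) L'.hm) X"
      by (simp add: L.hm_atMost L'.hm_atMost c mult.left_commute)
  next
    show "emeasure L.hm {..real i} \<noteq> \<infinity>" for i
      using L.V_finite by (auto simp: L.hm_atMost ennreal_mult_eq_top_iff)
  qed auto
  define Z where "Z x = (\<chi> i. if i = p then x $ p else x $ i / x $ p)" for x :: "real^'n"
  define Z' where "Z' z = (\<chi> i. if i = p then z $ p else z $ i * z $ p)" for z :: "real^'n"
  have Z[measurable]: "Z \<in> borel_measurable borel" and Z'[measurable]: "Z' \<in> borel_measurable borel"
  proof -
    show "Z \<in> borel_measurable borel"
    proof (rule borel_measurable_vecI)
      show "(\<lambda>x. Z x $ i) \<in> borel_measurable borel" for i by (cases "i = p") (simp_all add: Z_def)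
    qed
    show "Z' \<in> borel_measurable borel"
    proof (rule borel_measurable_vecI)
      show "(\<lambda>x. Z' x $ i) \<in> borel_measurable borel" for i by (cases "i = p") (simp_all add: Z'_def)
    qed
  qed
  have ZZ: "Z' (Z x) = x" if "0 < x $ p" for x using that by (simp add: Z_def Z'_def vec_eq_iff)
  define X where "X = {x :: real^'n. 0 < x $ p}"
  have X[measurable]: "X \<in> sets borel"
  proof -
    have "X = {x \<in> space borel. 0 < x $ p}" by (simp add: X_def)
    also have "\<dots> \<in> sets borel" by measurable
    finally show ?thesis .
  qed
  \<comment> \<open>The measure on the half space, transported to the coordinates height and slopes.\<close>
  define P where "P M = distr (density M (indicator X)) borel Z" for M :: "(real^'n) measure"
  have P: "emeasure (P M) B = emeasure M {x \<in> X. Z x \<in> B}" if sM[measurable_cong]: "sets M = sets borel" and B[measurable]: "B \<in> sets borel" for M B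
  proof -
    have sp: "space M = UNIV" using sets_eq_imp_space_eq[OF sM] by simp
    have "emeasure (P M) B = emeasure (density M (indicator X)) (Z -` B)"
      unfolding P_def by (subst emeasure_distr) (simp_all add: space_density sp)
    also have "\<dots> = (\<integral>\<^sup>+x. indicator X x * indicator (Z -` B) x \<partial>M)"
    proof (rule emeasure_density)
      show "Z -` B \<in> sets M" using measurable_sets[OF Z B] by (simp add: sM)
    qed (simp add: sM)
    also have "\<dots> = (\<integral>\<^sup>+x. indicator {x \<in> X. Z x \<in> B} x \<partial>M)"
      by (intro nn_integral_cong) (simp add: indicator_def)
    also have "\<dots> = emeasure M {x \<in> X. Z x \<in> B}"
    proof (rule nn_integral_indicator)
      have "{x \<in> X. Z x \<in> B} = {x \<in> space borel. x \<in> X \<and> Z x \<in> B}" by simp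
      also have "\<dots> \<in> sets borel" by measurable
      finally show "{x \<in> X. Z x \<in> B} \<in> sets M" by (simp add: sM)
    qed
    finally show ?thesis .
  qed
  have box: "{x \<in> X. Z x \<in> box a b} = L.cone {a $ p<..<b $ p} (\<lambda>i. a $ i) (\<lambda>i. b $ i)" for a b
    unfolding L.cone_def X_def Z_def by (auto simp: mem_box_cart split: if_splits)
  have P_eq: "P L = scale_measure (ennreal c) (P L')"
  proof (rule measure_eqI_generator_eq[where E = "range (\<lambda>(a, b). box a b)" and \<Omega> = UNIV and A = "\<lambda>i. box (- (real i *\<^sub>R One)) (real i *\<^sub>R One)"])
    show "Int_stable (range (\<lambda>(a, b). box a b :: (real^'n) set))"
      by (auto simp: Int_stable_def box_Int_box)
    show "sets (P L) = sigma_sets UNIV (range (\<lambda>(a, b). box a b))"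
      "sets (scale_measure (ennreal c) (P L')) = sigma_sets UNIV (range (\<lambda>(a, b). box a b))"
      by (simp_all add: P_def borel_eq_box)
    show "(\<Union>i. box (- (real i *\<^sub>R One)) (real i *\<^sub>R One)) = (UNIV :: (real^'n) set)"
      by (rule UN_box_eq_UNIV)
    have eqs: "emeasure (P L) (box a b) = (if \<forall>i. a $ i \<le> b $ i then ennreal (\<Prod>i\<in>UNIV - {p}. b $ i - a $ i) * emeasure L.hm {a $ p<..<b $ p} else 0)"
      "emeasure (P L') (box a b) = (if \<forall>i. a $ i \<le> b $ i then ennreal (\<Prod>i\<in>UNIV - {p}. b $ i - a $ i) * emeasure L'.hm {a $ p<..<b $ p} else 0)" for a b
    proof -
      have e: "{x \<in> X. Z x \<in> box a b} = {}" if "\<not> (\<forall>i. a $ i \<le> b $ i)"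
        using that by (auto simp: mem_box_cart not_le) (meson less_asym less_trans)
      show "emeasure (P L) (box a b) = (if \<forall>i. a $ i \<le> b $ i then ennreal (\<Prod>i\<in>UNIV - {p}. b $ i - a $ i) * emeasure L.hm {a $ p<..<b $ p} else 0)"
      proof (cases "\<forall>i. a $ i \<le> b $ i")
        case True
        have "emeasure L (L.cone {a $ p<..<b $ p} (\<lambda>i. a $ i) (\<lambda>i. b $ i)) = ennreal (\<Prod>i\<in>UNIV - {p}. b $ i - a $ i) * L.h {a $ p<..<b $ p}"
          by (rule L.cone_prod) (use True in auto)
        then show ?thesis
          unfolding P[OF L.sets_L borel_open[OF open_box]] box L.emeasure_hm[OF borel_open[OF open_greaterThanLessThan]]
          by (simp only: True if_True simp_thms)
      next
        case False
        then show ?thesis unfolding P[OF L.sets_L borel_open[OF open_box]] e[OF False] by (simp only: if_False emeasure_empty)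
      qed
      show "emeasure (P L') (box a b) = (if \<forall>i. a $ i \<le> b $ i then ennreal (\<Prod>i\<in>UNIV - {p}. b $ i - a $ i) * emeasure L'.hm {a $ p<..<b $ p} else 0)"
      proof (cases "\<forall>i. a $ i \<le> b $ i")
        case True
        have "emeasure L' (L'.cone {a $ p<..<b $ p} (\<lambda>i. a $ i) (\<lambda>i. b $ i)) = ennreal (\<Prod>i\<in>UNIV - {p}. b $ i - a $ i) * L'.h {a $ p<..<b $ p}"
          by (rule L'.cone_prod) (use True in auto)
        then show ?thesis
          unfolding P[OF L'.sets_L borel_open[OF open_box]] box L'.emeasure_hm[OF borel_open[OF open_greaterThanLessThan]]
          by (simp only: True if_True simp_thms)
      next
        case False
        then show ?thesis unfolding P[OF L'.sets_L borel_open[OF open_box]] e[OF False] by (simp only: if_False emeasure_empty)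
      qed
    qed
    show "emeasure (P L) Y = emeasure (scale_measure (ennreal c) (P L')) Y" if Y_in: "Y \<in> range (\<lambda>(a, b). box a b)" for Y :: "(real^'n) set"
    proof -
      obtain a b where Y: "Y = box a b" using Y_in by auto
      show ?thesis unfolding Y emeasure_scale_measure eqs hm by (simp add: mult.left_commute)
    qed
    show "emeasure (P L) (box (- (real i *\<^sub>R One)) (real i *\<^sub>R One)) \<noteq> \<infinity>" for i
    proof -
      have "emeasure L.hm {x<..<y} \<noteq> top" for x y
      proof -
        have "emeasure L.hm {x<..<y} \<le> emeasure L.hm {..y}" by (intro emeasure_mono) auto
        also have "\<dots> < top" using L.V_finite by (simp add: L.hm_atMost ennreal_mult_less_top)
        finally show ?thesis by simp
      qed
      then show ?thesis by (simp add: eqs ennreal_mult_eq_top_iff)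
    qed
  qed auto
  have AX: "A \<inter> {x. 0 < x $ p} = {x \<in> X. Z x \<in> Z' -` A}" using ZZ by (auto simp: X_def)
  have ZA: "Z' -` A \<in> sets borel" using measurable_sets[OF Z' A] by simp
  have "emeasure L (A \<inter> {x. 0 < x $ p}) = emeasure (P L) (Z' -` A)"
    unfolding AX by (rule P[OF L.sets_L ZA, symmetric])
  also have "\<dots> = ennreal c * emeasure (P L') (Z' -` A)" unfolding P_eq by simp
  also have "emeasure (P L') (Z' -` A) = emeasure L' (A \<inter> {x. 0 < x $ p})"
    unfolding AX by (rule P[OF L'.sets_L ZA])
  finally show ?thesis .
qed

lemma SL_invariant_lborel:
  assumes "p \<noteq> q" shows "SL_invariant (lborel :: (real^'n::finite) measure) p q"
proof
  show "p \<noteq> q" by (rule assms)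
  show "emeasure lborel {x. g *v x \<in> A} = emeasure lborel A" if "g \<in> SL" "A \<in> sets borel" for g A
    using emeasure_act[OF lborel_growth that(2), of g] by (simp add: lborel_SL_invariant[OF that(1)])
  show "emeasure lborel {x :: real^'n. 1 / C \<le> x $ p \<and> (\<forall>k. \<bar>x $ k\<bar> \<le> C)} < \<infinity>" if "C \<ge> 1" for C
  proof -
    have "bounded {x :: real^'n. 1 / C \<le> x $ p \<and> (\<forall>k. \<bar>x $ k\<bar> \<le> C)}"
      by (intro bounded_subset[OF bounded_cbox[of "\<chi> i. - C" "\<chi> i. C"]]) (auto simp: mem_box_cart abs_le_iff minus_le_iff)
    then show ?thesis by (rule emeasure_bounded_finite)
  qed
qed simp

lemma V_lborel_pos:
  assumes "p \<noteq> q" shows "SL_invariant.V (lborel :: (real^'n::finite) measure) p > 0"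
proof -
  interpret SL_invariant "lborel :: (real^'n) measure" p q by (rule SL_invariant_lborel[OF assms])
  define a :: "real^'n" where "a = (\<chi> i. if i = p then 1/2 else 1/8)"
  define b :: "real^'n" where "b = (\<chi> i. if i = p then 1 else 1/4)"
  have sub: "box a b \<subseteq> cone {..1} (\<lambda>_. 0) (\<lambda>_. 1)"
  proof
    fix x assume "x \<in> box a b"
    then have x: "a $ i < x $ i" "x $ i < b $ i" for i by (auto simp: mem_box_cart)
    have xp: "1/2 < x $ p" "x $ p < 1" using x[of p] by (auto simp: a_def b_def)
    have "0 < x $ i / x $ p" "x $ i / x $ p < 1" if "i \<noteq> p" for i
    proof -
      have "1/8 < x $ i" "x $ i < 1/4" using x[of i] that by (auto simp: a_def b_def)
      then show "0 < x $ i / x $ p" "x $ i / x $ p < 1" using xp by (auto simp: divide_less_eq)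
    qed
    then show "x \<in> cone {..1} (\<lambda>_. 0) (\<lambda>_. 1)" using xp by (simp add: cone_def)
  qed
  have "box a b \<noteq> {}"
  proof -
    have "\<forall>i. a $ i < b $ i" by (simp add: a_def b_def)
    then show ?thesis by (simp add: interval_ne_empty_cart)
  qed
  then have "\<not> negligible (box a b)" using open_not_negligible[OF open_box] by blast
  then have "emeasure lborel (box a b) \<noteq> 0"
    by (metis borel_open emeasure_lborel_box_eq lborelD negligible_iff_null_sets null_setsI null_sets_completionI open_box sets_lborel)
  then have "0 < emeasure lborel (box a b)" by (simp add: zero_less_iff_neq_zero)
  also have "\<dots> \<le> V" unfolding V_def h_def by (rule emeasure_mono[OF sub]) (simp add: cone_borel)
  finally show ?thesis .
qed

text \<open>Compare with Lebesgue measure on the two half spaces; they are exchanged by a diagonal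
  matrix with two entries \<open>-1\<close>. A point of the hyperplane \<open>x\<^sub>p = 0\<close> other than the origin is
  moved into the half space by a transvection, so the hyperplane is null for both measures.\<close>

lemma SL_invariant_unique:
  fixes L :: "(real^'n::finite) measure"
  assumes L: "SL_invariant L p q" and zero: "emeasure L {0} = 0"
  obtains c where "0 \<le> c" "\<And>A. A \<in> sets borel \<Longrightarrow> emeasure L A = ennreal c * emeasure lborel A"
proof -
  interpret L: SL_invariant L p q by (rule L)
  have pq: "p \<noteq> q" by (rule L.pq)
  interpret B: SL_invariant "lborel :: (real^'n) measure" p q by (rule SL_invariant_lborel[OF pq])
  define c where "c = enn2real (L.V) / enn2real B.V"
  have c0: "0 \<le> c" by (simp add: c_def)
  have "ennreal c * B.V = L.V"
  proof -
    obtain v where v: "0 \<le> v" "B.V = ennreal v" using B.V_finite by (cases B.V) auto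
    obtain w where w: "0 \<le> w" "L.V = ennreal w" using L.V_finite by (cases L.V) auto
    have "v > 0" using V_lborel_pos[OF pq] v by simp
    then show ?thesis using v w by (simp add: c_def ennreal_mult'[symmetric])
  qed
  then have half: "emeasure L (A \<inter> {x. 0 < x $ p}) = ennreal c * emeasure lborel (A \<inter> {x. 0 < x $ p})" if "A \<in> sets borel" for A
    by (intro SL_invariant_half_space[OF L B.SL_invariant_axioms _ c0 that]) simp
  have half': "emeasure L A = ennreal c * emeasure lborel A" if "A \<in> sets borel" "A \<subseteq> {x. 0 < x $ p}" for A
    using half[OF that(1)] that(2) by (simp add: Int_absorb2)
  have meas: "{x :: real^'n. P (x $ i) (x $ j)} \<in> sets borel" if "{x \<in> space borel. P (x $ i) (x $ j)} \<in> sets (borel :: (real^'n) measure)" for P i j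
    using that by simp
  have set1: "{x. 0 < x $ p} \<in> sets (borel :: (real^'n) measure)" "{x. x $ p < 0} \<in> sets (borel :: (real^'n) measure)"
    "{x. x $ p = 0} \<in> sets (borel :: (real^'n) measure)"
    by (rule meas[of "\<lambda>a b. 0 < a" p p] meas[of "\<lambda>a b. a < 0" p p] meas[of "\<lambda>a b. a = 0" p p]; measurable)+
  define n :: "real^'n^'n" where "n = diagm (\<lambda>i. if i = p \<or> i = q then -1 else 1)"
  have nSL: "n \<in> SL"
    unfolding n_def
  proof (rule diagm_SL)
    have "(\<Prod>i\<in>UNIV. if i = p \<or> i = q then -1 else 1 :: real) = (\<Prod>i\<in>{p,q}. if i = p \<or> i = q then -1 else 1)"
      by (rule prod.mono_neutral_right) auto
    then show "(\<Prod>i\<in>UNIV. if i = p \<or> i = q then -1 else 1 :: real) = 1" using pq by simp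
  qed
  have np: "(n *v x) $ p = - x $ p" for x by (simp add: n_def diagm_nth)
  have neg: "emeasure L (A \<inter> {x. x $ p < 0}) = ennreal c * emeasure lborel (A \<inter> {x. x $ p < 0})" if A: "A \<in> sets borel" for A
  proof -
    have S: "A \<inter> {x. x $ p < 0} \<in> sets borel" using A set1 by auto
    let ?S = "{x. n *v x \<in> A \<inter> {x. x $ p < 0}}"
    have mS: "?S \<in> sets borel"
      using measurable_sets[OF matrix_vector_borel[of n] S] by (simp add: vimage_def)
    have "emeasure L ?S = ennreal c * emeasure lborel ?S" by (rule half'[OF mS]) (auto simp: np)
    then show ?thesis using L.inv[OF nSL S] B.inv[OF nSL S] by simp
  qed
  have null_lborel: "emeasure lborel {x :: real^'n. x $ p = 0} = 0"
  proof -
    have "AE x :: real^'n in lborel. axis p 1 \<bullet> x \<noteq> 0" by (rule AE_hyperplane) simp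
    then have "AE x :: real^'n in lborel. x \<notin> {x. x $ p = 0}" by (simp add: inner_axis')
    then have "{x :: real^'n. x $ p = 0} \<in> null_sets lborel"
      using AE_iff_null_sets[of "{x :: real^'n. x $ p = 0}" lborel] set1(3) by simp
    then show ?thesis by auto
  qed
  have piece: "emeasure L {x. x $ p = 0 \<and> 0 < s * x $ j} = 0" if j: "j \<noteq> p" and s: "s = 1 \<or> s = -1" for j s
  proof -
    let ?A = "{x :: real^'n. x $ p = 0 \<and> 0 < s * x $ j}"
    have A: "?A \<in> sets borel" by (rule meas[of "\<lambda>a b. a = 0 \<and> 0 < s * b" p j]) measurable
    have g: "transv p j (- s) \<in> SL" using j by (intro transv_SL) auto
    let ?S = "{x. transv p j (- s) *v x \<in> ?A}"
    have mS: "?S \<in> sets borel"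
      using measurable_sets[OF matrix_vector_borel[of "transv p j (- s)"] A] by (simp add: vimage_def)
    have sub: "?S \<subseteq> {x. 0 < x $ p}" using j by (auto simp: transv_nth)
    have "emeasure L ?A = emeasure L ?S" by (rule L.inv[OF g A, symmetric])
    also have "\<dots> = ennreal c * emeasure lborel ?S" by (rule half'[OF mS sub])
    also have "emeasure lborel ?S = emeasure lborel ?A" by (rule B.inv[OF g A])
    also have "\<dots> = 0"
      using emeasure_mono[of ?A "{x. x $ p = 0}" lborel] null_lborel set1 by auto
    finally show ?thesis by simp
  qed
  have null_L: "emeasure L {x. x $ p = 0} = 0"
  proof -
    have cover: "{x :: real^'n. x $ p = 0} \<subseteq> {0} \<union> (\<Union>j\<in>UNIV - {p}. {x. x $ p = 0 \<and> 0 < 1 * x $ j} \<union> {x. x $ p = 0 \<and> 0 < -1 * x $ j})"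
      (is "_ \<subseteq> {0} \<union> (\<Union>j\<in>_. ?T j)")
    proof
      fix x :: "real^'n" assume x: "x \<in> {x. x $ p = 0}"
      show "x \<in> {0} \<union> (\<Union>j\<in>UNIV - {p}. ?T j)"
      proof (cases "x = 0")
        case False
        then obtain j where j: "x $ j \<noteq> 0" by (auto simp: vec_eq_iff)
        then have "j \<noteq> p" using x by auto
        then show ?thesis using x j by (auto simp: neq_iff)
      qed simp
    qed
    have T: "?T j \<in> null_sets L" if "j \<in> UNIV - {p}" for j
    proof (rule null_sets.Un)
      have m: "{x :: real^'n. x $ p = 0 \<and> 0 < s * x $ j} \<in> sets L" for s
        unfolding L.sets_L by (rule meas[of "\<lambda>a b. a = 0 \<and> 0 < s * b" p j]) measurable
      show "{x. x $ p = 0 \<and> 0 < 1 * x $ j} \<in> null_sets L" using piece[of j 1] that m[of 1] by (auto intro: null_setsI)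
      show "{x. x $ p = 0 \<and> 0 < - 1 * x $ j} \<in> null_sets L" using piece[of j "-1"] that m[of "-1"] by (auto intro: null_setsI)
    qed
    have "{0} \<union> (\<Union>j\<in>UNIV - {p}. ?T j) \<in> null_sets L"
      using zero T by (intro null_sets.Un null_sets_UN' countable_finite null_setsI) (auto simp: L.sets_L)
    then have "{x. x $ p = 0} \<in> null_sets L" by (rule null_sets_subset) (use cover set1 L.sets_L in auto)
    then show ?thesis by auto
  qed
  show thesis
  proof (rule that[OF c0])
    fix A :: "(real^'n) set" assume A: "A \<in> sets borel"
    have split: "emeasure M A = emeasure M (A \<inter> {x. 0 < x $ p}) + emeasure M (A \<inter> {x. x $ p < 0})"
      if sM: "sets M = sets borel" and n: "emeasure M {x. x $ p = 0} = 0" for M :: "(real^'n) measure"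
    proof -
      have ms: "A \<inter> {x. 0 < x $ p} \<in> sets M" "A \<inter> {x. x $ p < 0} \<in> sets M" "A \<inter> {x. x $ p = 0} \<in> sets M"
        using A set1 by (auto simp: sM)
      have "emeasure M (A \<inter> {x. x $ p = 0}) \<le> emeasure M {x. x $ p = 0}" by (rule emeasure_mono) (use set1 sM in auto)
      then have z: "emeasure M (A \<inter> {x. x $ p = 0}) = 0" using n by simp
      have "A = ((A \<inter> {x. 0 < x $ p}) \<union> (A \<inter> {x. x $ p < 0})) \<union> (A \<inter> {x. x $ p = 0})" by auto
      then have "emeasure M A = emeasure M (((A \<inter> {x. 0 < x $ p}) \<union> (A \<inter> {x. x $ p < 0})) \<union> (A \<inter> {x. x $ p = 0}))" by simp
      also have "\<dots> = emeasure M ((A \<inter> {x. 0 < x $ p}) \<union> (A \<inter> {x. x $ p < 0})) + emeasure M (A \<inter> {x. x $ p = 0})"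
        by (rule plus_emeasure[symmetric]) (use ms in auto)
      also have "emeasure M ((A \<inter> {x. 0 < x $ p}) \<union> (A \<inter> {x. x $ p < 0})) = emeasure M (A \<inter> {x. 0 < x $ p}) + emeasure M (A \<inter> {x. x $ p < 0})"
        by (rule plus_emeasure[symmetric]) (use ms in auto)
      finally show ?thesis by (simp add: z)
    qed
    show "emeasure L A = ennreal c * emeasure lborel A"
      unfolding split[OF L.sets_L null_L] split[OF sets_lborel null_lborel] half[OF A] neg[OF A]
      by (simp add: distrib_left)
  qed
qed

section \<open>Existence of the constant of a Siegel measure\<close>

context shear_kernel begin

text \<open>The function \<open>F \<nu> = \<integral> \<psi> d\<nu>\<close> is unbounded and its integrability is not known beforehand, so
  truncate it. By \<open>shear_average\<close> the flow averages of \<open>F\<close> at \<open>(dil q R) \<nu>\<close> are bounded,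
  uniformly in \<open>R\<close> and in the truncation, by a fixed multiple of the growth constant of \<open>\<nu>\<close>. The
  mean ergodic theorem for bounded functions makes the averages of each truncation tend to its
  mean, almost everywhere along a subsequence. So a single \<open>\<nu>\<close> bounds the means of all
  truncations.\<close>

lemma hat_integrable:
  fixes \<mu> :: "(real^'n) measure measure"
  assumes \<mu>: "siegel_measure \<mu>"
  shows "integrable \<mu> (\<lambda>\<nu>. \<integral>x. \<psi> x \<partial>\<nu>)"
proof -
  interpret sl_action \<mu> act by (rule siegel_sl_action[OF \<mu>])
  define N where "N = CARD('n)"
  have N: "N > 0" by (simp add: N_def)
  define F where "F \<nu> = (\<integral>x. \<psi> x \<partial>\<nu>)" for \<nu> :: "(real^'n) measure"
  define FK where "FK K \<nu> = min (F \<nu>) (real K)" for K \<nu>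
  have F0: "0 \<le> F \<nu>" for \<nu> unfolding F_def by (simp add: \<psi>_nonneg)
  have F_oc: "orbit_cont F"
    unfolding orbit_cont_def F_def[abs_def]
    using siegel_measurable[OF \<mu> measurable_Cc[OF \<psi>_Cc]] continuous_on_orbit_Cc[OF _ \<psi>_Cc] siegel_space[OF \<mu>] by auto
  have F_meas[measurable]: "F \<in> borel_measurable \<mu>" using F_oc by (simp add: orbit_cont_def)
  have FK_oc: "orbit_cont (FK K)" for K
    using F_oc unfolding orbit_cont_def FK_def[abs_def] by (auto intro!: continuous_intros)
  have FK_meas[measurable]: "FK K \<in> borel_measurable \<mu>" for K using FK_oc by (simp add: orbit_cont_def)
  have FK0: "0 \<le> FK K \<nu>" for K \<nu> using F0 by (simp add: FK_def)
  have FK_bd: "\<forall>\<nu>\<in>space \<mu>. \<bar>FK K \<nu>\<bar> \<le> real K" for K using FK0 by (auto simp: FK_def)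
  define s where "s n = \<beta> * real (Suc n) ^ N" for n
  define W where "W K n \<nu> = avg q p (FK K) (s n) (act (dil q (real (Suc n))) \<nu>)" for K n \<nu>
  have qp: "q \<noteq> p" using pq by simp
  have dSL: "dil q (real (Suc n)) \<in> SL" for n by (rule dil_SL) simp
  have s_lim: "filterlim s at_top sequentially"
    unfolding s_def using pos N
    by (intro filterlim_tendsto_pos_mult_at_top[OF tendsto_const] filterlim_pow_at_top
          filterlim_compose[OF filterlim_real_sequentially filterlim_Suc]) auto
  have avg_m: "avg q p (FK K) t \<in> borel_measurable \<mu>" for K t by (rule avg_meas[OF qp FK_oc FK_bd])
  have W_meas: "W K n \<in> borel_measurable \<mu>" for K n
    unfolding W_def[abs_def] by (rule measurable_compose[OF T_meas[OF dSL] avg_m])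
  have W_int: "integrable \<mu> (W K n)" for K n
    unfolding W_def using avg_le[OF qp FK_oc FK_bd] T_space[OF dSL]
    by (intro integral_bounds[of _ "real K"] AE_I2 W_meas[unfolded W_def[abs_def]]) auto
  have lim: "(\<lambda>n. \<integral>\<nu>. norm (W K n \<nu> - (\<integral>\<nu>. FK K \<nu> \<partial>\<mu>)) \<partial>\<mu>) \<longlonglongrightarrow> 0" for K
  proof -
    have "(\<integral>\<nu>. norm (W K n \<nu> - (\<integral>\<nu>. FK K \<nu> \<partial>\<mu>)) \<partial>\<mu>) = (\<integral>\<nu>. \<bar>avg q p (FK K) (s n) \<nu> - (\<integral>\<nu>. FK K \<nu> \<partial>\<mu>)\<bar> \<partial>\<mu>)" for n
      unfolding W_def real_norm_def
      by (rule integral_T[OF dSL, of "\<lambda>\<nu>. \<bar>avg q p (FK K) (s n) \<nu> - (\<integral>\<nu>. FK K \<nu> \<partial>\<mu>)\<bar>"]) (use avg_m in simp)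
    then show ?thesis
      using filterlim_compose[OF mean_ergodic_bounded[OF qp FK_oc FK_bd] s_lim] by simp
  qed
  have W_le: "\<exists>D. \<forall>K n. W K n \<nu> \<le> D" if \<nu>: "\<nu> \<in> space \<mu>" for \<nu>
  proof -
    have \<nu>g: "\<nu> \<in> growth_measures" using \<nu> by (simp add: siegel_space[OF \<mu>])
    obtain G where G: "0 \<le> G" "\<And>R. R > 0 \<Longrightarrow> emeasure \<nu> (ball 0 R) \<le> ennreal (G * R ^ CARD('n))"
      using growth_bound[OF \<nu>g] by blast
    let ?E = "B * tent_mass / \<beta>"
    have E0: "0 \<le> ?E" using order_trans[OF nonneg le] pos tent_mass_pos by (intro divide_nonneg_nonneg mult_nonneg_nonneg) auto
    have \<rho>0: "\<rho> > 0" unfolding \<rho>_def using pos by (intro add_nonneg_pos mult_nonneg_nonneg add_nonneg_nonneg) auto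
    have "W K n \<nu> \<le> ?E * (G * \<rho> ^ N)" for K n
    proof -
      let ?R = "real (Suc n)"
      have R: "?R > 0" "?R ^ N \<ge> 1" by (simp_all add: one_le_power)
      have dn: "act (dil q ?R) \<nu> \<in> space \<mu>" by (rule T_space[OF dSL \<nu>])
      have "W K n \<nu> \<le> avg q p F (s n) (act (dil q ?R) \<nu>)"
        unfolding W_def avg_def
        by (intro integral_mono flow_integrable[OF qp FK_oc dn] flow_integrable[OF qp F_oc dn]) (simp add: FK_def)
      also have "\<dots> = (\<integral>x. \<Phi> (?R ^ CARD('n)) ((1 / ?R) *\<^sub>R x) / ?R ^ CARD('n) \<partial>\<nu>)"
        unfolding avg_def F_def s_def N_def using shear_average[OF \<nu>g R(1)] by simp
      also have "\<dots> \<le> (\<integral>x. ?E / ?R ^ CARD('n) * indicator (ball 0 (\<rho> * ?R)) x \<partial>\<nu>)"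
      proof (rule integral_mono_AE')
        show "integrable \<nu> (\<lambda>x. ?E / ?R ^ CARD('n) * indicator (ball 0 (\<rho> * ?R)) x)"
          using growth_ball_finite[OF \<nu>g, of "\<rho> * ?R"] growth_sets[OF \<nu>g] by (intro integrable_mult_right) simp
        have pw: "\<Phi> (?R ^ CARD('n)) ((1 / ?R) *\<^sub>R x) / ?R ^ CARD('n) \<le> ?E / ?R ^ CARD('n) * indicator (ball 0 (\<rho> * ?R)) x" for x
        proof -
          have "\<Phi> (?R ^ CARD('n)) ((1 / ?R) *\<^sub>R x) \<le> ?E * indicator (ball 0 \<rho>) ((1 / ?R) *\<^sub>R x)"
            by (rule \<Phi>_bound) (use R N_def in simp)
          also have "indicator (ball 0 \<rho>) ((1 / ?R) *\<^sub>R x) = (indicator (ball 0 (\<rho> * ?R)) x :: real)"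
            using R(1) by (simp add: indicator_def divide_less_eq)
          finally have "\<Phi> (?R ^ CARD('n)) ((1 / ?R) *\<^sub>R x) / ?R ^ CARD('n) \<le> ?E * indicator (ball 0 (\<rho> * ?R)) x / ?R ^ CARD('n)"
            using R by (intro divide_right_mono) auto
          then show ?thesis by simp
        qed
        show "AE x in \<nu>. \<Phi> (?R ^ CARD('n)) ((1 / ?R) *\<^sub>R x) / ?R ^ CARD('n) \<le> ?E / ?R ^ CARD('n) * indicator (ball 0 (\<rho> * ?R)) x"
          by (intro AE_I2 pw)
        show "AE x in \<nu>. 0 \<le> ?E / ?R ^ CARD('n) * indicator (ball 0 (\<rho> * ?R)) x"
          by (intro AE_I2 mult_nonneg_nonneg divide_nonneg_nonneg[OF E0]) auto
      qed
      also have "\<dots> = ?E / ?R ^ CARD('n) * measure \<nu> (ball 0 (\<rho> * ?R))"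
        using growth_sets[OF \<nu>g] growth_space[OF \<nu>g] by simp
      also have "\<dots> \<le> ?E / ?R ^ CARD('n) * (G * (\<rho> * ?R) ^ CARD('n))"
      proof (rule mult_left_mono)
        have "measure \<nu> (ball 0 (\<rho> * ?R)) = enn2real (emeasure \<nu> (ball 0 (\<rho> * ?R)))" by (simp add: measure_def)
        also have "\<dots> \<le> enn2real (ennreal (G * (\<rho> * ?R) ^ CARD('n)))"
          using G(2)[of "\<rho> * ?R"] \<rho>0 R by (intro enn2real_mono) auto
        also have "\<dots> = G * (\<rho> * ?R) ^ CARD('n)" using G(1) \<rho>0 R by simp
        finally show "measure \<nu> (ball 0 (\<rho> * ?R)) \<le> G * (\<rho> * ?R) ^ CARD('n)" .
        show "0 \<le> ?E / ?R ^ CARD('n)" by (rule divide_nonneg_nonneg[OF E0]) (use R in simp)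
      qed
      also have "\<dots> = ?E * (G * \<rho> ^ N)" using R by (simp add: power_mult_distrib N_def)
      finally show ?thesis .
    qed
    then show ?thesis by blast
  qed
  \<comment> \<open>The bound \<open>D\<close> is quantified inside, so that one null set serves all truncations and bounds.\<close>
  have "AE \<nu> in \<mu>. \<forall>K. \<forall>D. (\<forall>n. W K n \<nu> \<le> D) \<longrightarrow> (\<integral>\<nu>. FK K \<nu> \<partial>\<mu>) \<le> D"
  proof (subst AE_all_countable, intro allI)
    fix K
    let ?e = "\<integral>\<nu>. FK K \<nu> \<partial>\<mu>"
    have "\<exists>r::nat \<Rightarrow> nat. strict_mono r \<and> (AE \<nu> in \<mu>. (\<lambda>n. W K (r n) \<nu> - ?e) \<longlonglongrightarrow> 0)"
      using tendsto_L1_AE_subseq[of \<mu> "\<lambda>n \<nu>. W K n \<nu> - ?e", OF _ lim] W_int by auto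
    then obtain r where "AE \<nu> in \<mu>. (\<lambda>n. W K (r n) \<nu> - ?e) \<longlonglongrightarrow> 0" by blast
    then show "AE \<nu> in \<mu>. \<forall>D. (\<forall>n. W K n \<nu> \<le> D) \<longrightarrow> ?e \<le> D"
    proof eventually_elim
      case (elim \<nu>)
      show ?case
      proof (intro allI impI)
        fix D assume D: "\<forall>n. W K n \<nu> \<le> D"
        have "(\<lambda>n. W K (r n) \<nu>) \<longlonglongrightarrow> ?e" using elim LIM_zero_iff by blast
        then show "?e \<le> D" by (rule LIMSEQ_le_const2) (use D in blast)
      qed
    qed
  qed
  then have ae: "AE \<nu> in \<mu>. \<nu> \<in> space \<mu> \<and> (\<forall>K. \<forall>D. (\<forall>n. W K n \<nu> \<le> D) \<longrightarrow> (\<integral>\<nu>. FK K \<nu> \<partial>\<mu>) \<le> D)"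
    using AE_space by eventually_elim simp
  obtain \<nu> where "\<nu> \<in> space \<mu>" "\<And>K D. (\<forall>n. W K n \<nu> \<le> D) \<Longrightarrow> (\<integral>\<nu>. FK K \<nu> \<partial>\<mu>) \<le> D"
  proof -
    have "ae_filter \<mu> \<noteq> bot" by (simp add: ae_filter_eq_bot_iff emeasure_space_1)
    from eventually_happens'[OF this ae] show thesis using that by blast
  qed
  then obtain D where D: "\<And>K. (\<integral>\<nu>. FK K \<nu> \<partial>\<mu>) \<le> D" using W_le by metis
  have "(\<lambda>K. \<integral>\<^sup>+\<nu>. ennreal (FK K \<nu>) \<partial>\<mu>) \<longlonglongrightarrow> (\<integral>\<^sup>+\<nu>. ennreal (F \<nu>) \<partial>\<mu>)"
  proof (rule nn_integral_LIMSEQ)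
    show "incseq (\<lambda>K \<nu>. ennreal (FK K \<nu>))"
      by (intro incseq_SucI le_funI ennreal_leI) (simp add: FK_def)
    show "(\<lambda>K. ennreal (FK K \<nu>)) \<longlonglongrightarrow> ennreal (F \<nu>)" for \<nu>
    proof -
      obtain n where n: "F \<nu> \<le> real n" using real_arch_simple by blast
      have ev: "eventually (\<lambda>K. ennreal (F \<nu>) = ennreal (FK K \<nu>)) sequentially"
        using eventually_ge_at_top[of n] by eventually_elim (use n in \<open>auto simp: FK_def\<close>)
      from Lim_transform_eventually[OF tendsto_const ev] show ?thesis .
    qed
  qed simp
  moreover have "(\<integral>\<^sup>+\<nu>. ennreal (FK K \<nu>) \<partial>\<mu>) \<le> ennreal D" for K
  proof -
    have "integrable \<mu> (FK K)" using FK_bd by (intro integral_bounds[of _ "real K"] AE_I2) auto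
    then have "(\<integral>\<^sup>+\<nu>. ennreal (FK K \<nu>) \<partial>\<mu>) = ennreal (\<integral>\<nu>. FK K \<nu> \<partial>\<mu>)"
      by (rule nn_integral_eq_integral) (simp add: FK0)
    then show ?thesis using D[of K] by (simp add: ennreal_leI)
  qed
  ultimately have "(\<integral>\<^sup>+\<nu>. ennreal (F \<nu>) \<partial>\<mu>) \<le> ennreal D" by (intro LIMSEQ_le_const2) auto
  also have "\<dots> < \<infinity>" by simp
  finally have "integrable \<mu> F"
    by (intro integrableI_bounded) (simp_all add: F0)
  then show ?thesis by (simp add: F_def[abs_def])
qed

end

definition intensity :: "(real^'n::finite) measure measure \<Rightarrow> (real^'n) measure" where
  "intensity \<mu> = measure_of UNIV (sets borel) (\<lambda>A. \<integral>\<^sup>+\<nu>. emeasure \<nu> A \<partial>\<mu>)"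

context
  fixes \<mu> :: "(real^'n::finite) measure measure"
  assumes \<mu>: "siegel_measure \<mu>"
begin

interpretation sl_action \<mu> act by (rule siegel_sl_action[OF \<mu>])

lemma sets_intensity[simp, measurable_cong]: "sets (intensity \<mu>) = sets borel"
  using sets.sigma_sets_eq[of "borel :: (real^'n) measure"] by (simp add: intensity_def)

lemma siegel_growth: "\<nu> \<in> space \<mu> \<Longrightarrow> \<nu> \<in> growth_measures"
  by (simp add: siegel_space[OF \<mu>])

lemma emeasure_intensity:
  assumes A: "A \<in> sets borel"
  shows "emeasure (intensity \<mu>) A = (\<integral>\<^sup>+\<nu>. emeasure \<nu> A \<partial>\<mu>)"
  unfolding intensity_def
proof (rule emeasure_measure_of_sigma)
  show "sigma_algebra UNIV (sets (borel :: (real^'n) measure))"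
    using sets.sigma_algebra_axioms[of "borel :: (real^'n) measure"] by simp
  show "positive (sets borel) (\<lambda>A :: (real^'n) set. \<integral>\<^sup>+\<nu>. emeasure \<nu> A \<partial>\<mu>)"
    by (simp add: positive_def)
  show "countably_additive (sets borel) (\<lambda>A :: (real^'n) set. \<integral>\<^sup>+\<nu>. emeasure \<nu> A \<partial>\<mu>)"
  proof (rule countably_additiveI)
    fix A :: "nat \<Rightarrow> (real^'n) set" assume A: "range A \<subseteq> sets borel" "disjoint_family A"
    have "(\<Sum>i. \<integral>\<^sup>+\<nu>. emeasure \<nu> (A i) \<partial>\<mu>) = (\<integral>\<^sup>+\<nu>. (\<Sum>i. emeasure \<nu> (A i)) \<partial>\<mu>)"
    proof (rule nn_integral_suminf[symmetric])
      show "(\<lambda>\<nu>. emeasure \<nu> (A i)) \<in> borel_measurable \<mu>" for i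
        by (rule siegel_measurable[OF \<mu> growth_measurable_emeasure]) (use A(1) in auto)
    qed
    also have "\<dots> = (\<integral>\<^sup>+\<nu>. emeasure \<nu> (\<Union> (range A)) \<partial>\<mu>)"
      using A by (intro nn_integral_cong suminf_emeasure) (auto simp: growth_sets[OF siegel_growth])
    finally show "(\<Sum>i. \<integral>\<^sup>+\<nu>. emeasure \<nu> (A i) \<partial>\<mu>) = (\<integral>\<^sup>+\<nu>. emeasure \<nu> (\<Union> (range A)) \<partial>\<mu>)" .
  qed
qed (rule A)

lemma nn_integral_intensity:
  fixes f :: "real^'n \<Rightarrow> ennreal"
  assumes "f \<in> borel_measurable borel"
  shows "(\<integral>\<^sup>+x. f x \<partial>(intensity \<mu>)) = (\<integral>\<^sup>+\<nu>. (\<integral>\<^sup>+x. f x \<partial>\<nu>) \<partial>\<mu>)"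
  using assms
proof (induction rule: borel_measurable_induct)
  case (cong f g)
  then have "f = g" by (simp add: fun_eq_iff)
  then show ?case using cong by simp
next
  case (set A)
  have "(\<integral>\<^sup>+x. indicator A x \<partial>\<nu>) = emeasure \<nu> A" if "\<nu> \<in> space \<mu>" for \<nu>
    using set growth_sets[OF siegel_growth[OF that]] by simp
  then have "(\<integral>\<^sup>+\<nu>. (\<integral>\<^sup>+x. indicator A x \<partial>\<nu>) \<partial>\<mu>) = (\<integral>\<^sup>+\<nu>. emeasure \<nu> A \<partial>\<mu>)"
    by (intro nn_integral_cong) auto
  then show ?case using set by (simp add: emeasure_intensity)
next
  case (mult u c)
  have "(\<integral>\<^sup>+\<nu>. (\<integral>\<^sup>+x. c * u x \<partial>\<nu>) \<partial>\<mu>) = (\<integral>\<^sup>+\<nu>. c * (\<integral>\<^sup>+x. u x \<partial>\<nu>) \<partial>\<mu>)"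
    by (rule nn_integral_cong) (rule nn_integral_cmult[OF growth_measurable[OF siegel_growth mult(2)]])
  also have "\<dots> = c * (\<integral>\<^sup>+\<nu>. (\<integral>\<^sup>+x. u x \<partial>\<nu>) \<partial>\<mu>)"
    by (rule nn_integral_cmult[OF siegel_measurable[OF \<mu> growth_measurable_nn_integral[OF mult(2)]]])
  finally show ?case using mult by (simp add: nn_integral_cmult)
next
  case (add u v)
  have um: "u \<in> borel_measurable borel" and vm: "v \<in> borel_measurable borel" using add by blast+
  have "(\<integral>\<^sup>+\<nu>. (\<integral>\<^sup>+x. v x + u x \<partial>\<nu>) \<partial>\<mu>) = (\<integral>\<^sup>+\<nu>. (\<integral>\<^sup>+x. v x \<partial>\<nu>) + (\<integral>\<^sup>+x. u x \<partial>\<nu>) \<partial>\<mu>)"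
    by (rule nn_integral_cong)
       (rule nn_integral_add[OF growth_measurable[OF siegel_growth vm] growth_measurable[OF siegel_growth um]])
  also have "\<dots> = (\<integral>\<^sup>+\<nu>. (\<integral>\<^sup>+x. v x \<partial>\<nu>) \<partial>\<mu>) + (\<integral>\<^sup>+\<nu>. (\<integral>\<^sup>+x. u x \<partial>\<nu>) \<partial>\<mu>)"
    by (rule nn_integral_add[OF siegel_measurable[OF \<mu> growth_measurable_nn_integral[OF vm]]
          siegel_measurable[OF \<mu> growth_measurable_nn_integral[OF um]]])
  finally show ?case using add by (simp add: nn_integral_add)
next
  case (seq U)
  have Um: "U i \<in> borel_measurable borel" for i using seq by blast
  have Ui: "incseq U" using seq by blast
  have S: "(SUP i. U i) = (\<lambda>x. SUP i. U i x)" by (simp add: fun_eq_iff image_comp)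
  have inc: "incseq (\<lambda>i \<nu>. \<integral>\<^sup>+x. U i x \<partial>\<nu>)"
    using Ui by (auto simp: incseq_def le_fun_def intro!: nn_integral_mono)
  have "(\<integral>\<^sup>+\<nu>. (\<integral>\<^sup>+x. (SUP i. U i x) \<partial>\<nu>) \<partial>\<mu>) = (\<integral>\<^sup>+\<nu>. (SUP i. \<integral>\<^sup>+x. U i x \<partial>\<nu>) \<partial>\<mu>)"
    by (rule nn_integral_cong)
       (rule nn_integral_monotone_convergence_SUP[OF Ui growth_measurable[OF siegel_growth Um]])
  also have "\<dots> = (SUP i. \<integral>\<^sup>+\<nu>. (\<integral>\<^sup>+x. U i x \<partial>\<nu>) \<partial>\<mu>)"
    by (rule nn_integral_monotone_convergence_SUP[OF inc siegel_measurable[OF \<mu> growth_measurable_nn_integral[OF Um]]])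
  also have "\<dots> = (SUP i. \<integral>\<^sup>+x. U i x \<partial>(intensity \<mu>))" using seq by simp
  also have "\<dots> = (\<integral>\<^sup>+x. (SUP i. U i x) \<partial>(intensity \<mu>))"
    by (rule nn_integral_monotone_convergence_SUP[symmetric, OF Ui]) (use Um in simp)
  finally show ?case unfolding S by simp
qed

lemma intensity_invariant:
  assumes g: "g \<in> SL" and A: "A \<in> sets borel"
  shows "emeasure (intensity \<mu>) {x. g *v x \<in> A} = emeasure (intensity \<mu>) A"
proof -
  have mS: "{x. g *v x \<in> A} \<in> sets borel"
    using measurable_sets[OF matrix_vector_borel[of g] A] by (simp add: vimage_def)
  have em: "(\<lambda>\<nu>. emeasure \<nu> A) \<in> borel_measurable \<mu>" by (rule siegel_measurable[OF \<mu> growth_measurable_emeasure[OF A]])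
  have "emeasure (intensity \<mu>) {x. g *v x \<in> A} = (\<integral>\<^sup>+\<nu>. emeasure (act g \<nu>) A \<partial>\<mu>)"
    unfolding emeasure_intensity[OF mS]
    by (intro nn_integral_cong emeasure_act[symmetric] A siegel_growth)
  also have "\<dots> = (\<integral>\<^sup>+\<nu>. emeasure \<nu> A \<partial>distr \<mu> \<mu> (act g))"
    by (rule nn_integral_distr[symmetric, OF T_meas[OF g]]) (use em in simp)
  also have "\<dots> = emeasure (intensity \<mu>) A" by (simp add: T_pres[OF g] emeasure_intensity[OF A])
  finally show ?thesis .
qed

text \<open>The growth condition for small radii excludes a point mass at the origin.\<close>

lemma intensity_zero: "emeasure (intensity \<mu>) {0} = 0"
proof -
  have "emeasure \<nu> {0} = 0" if "\<nu> \<in> space \<mu>" for \<nu>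
  proof -
    have \<nu>: "\<nu> \<in> growth_measures" by (rule siegel_growth[OF that])
    obtain C where C: "0 \<le> C" "\<And>R. R > 0 \<Longrightarrow> emeasure \<nu> (ball 0 R) \<le> ennreal (C * R ^ CARD('n))"
      using growth_bound[OF \<nu>] by blast
    have le: "emeasure \<nu> {0} \<le> ennreal (C * (1 / real (Suc k)))" for k
    proof -
      have "emeasure \<nu> {0} \<le> emeasure \<nu> (ball 0 (1 / real (Suc k)))"
        by (rule emeasure_mono) (simp_all add: growth_sets[OF \<nu>])
      also have "\<dots> \<le> ennreal (C * (1 / real (Suc k)) ^ CARD('n))" by (rule C(2)) simp
      also have "\<dots> \<le> ennreal (C * (1 / real (Suc k)))"
      proof (intro ennreal_leI mult_left_mono C(1))
        have "(1 / real (Suc k)) ^ CARD('n) \<le> (1 / real (Suc k)) ^ 1"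
          by (rule power_decreasing) (auto simp: Suc_leI)
        then show "(1 / real (Suc k)) ^ CARD('n) \<le> 1 / real (Suc k)" by simp
      qed
      finally show ?thesis .
    qed
    have "(\<lambda>k. ennreal (C * (1 / real (Suc k)))) \<longlonglongrightarrow> ennreal (C * 0)"
      by (intro tendsto_ennrealI tendsto_mult tendsto_const LIMSEQ_Suc[OF lim_1_over_n])
    then have "emeasure \<nu> {0} \<le> ennreal (C * 0)" by (rule LIMSEQ_le_const) (use le in blast)
    then show ?thesis by simp
  qed
  then have "(\<integral>\<^sup>+\<nu>. emeasure \<nu> {0} \<partial>\<mu>) = (\<integral>\<^sup>+\<nu>. 0 \<partial>\<mu>)" by (intro nn_integral_cong) auto
  then show ?thesis by (simp add: emeasure_intensity)
qed

text \<open>A multiple of the function \<open>\<psi>\<close> of a suitable shear kernel dominates the indicator, and its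
  integral against the intensity is finite by \<open>hat_integrable\<close>.\<close>

lemma intensity_finite_slab:
  assumes pq: "p \<noteq> q" and C: "C \<ge> 1"
  shows "emeasure (intensity \<mu>) {x. 1 / C \<le> x $ p \<and> x $ p \<le> C \<and> (\<forall>k. k \<noteq> q \<longrightarrow> \<bar>x $ k\<bar> \<le> C) \<and> \<bar>x $ q\<bar> \<le> 1} < \<infinity>"
    (is "emeasure _ ?S < _")
proof -
  define \<xi> where "\<xi> x = max 0 (min (x $ p - 1 / (2 * C)) (2 * C - x $ p)) * (\<Prod>k\<in>UNIV - {p, q}. max 0 (2 * C - \<bar>x $ k\<bar>))"
    for x :: "real^'n"
  define b where "b = 2 * C * (\<Prod>k\<in>UNIV - {p, q}. 2 * C)"
  have bump_le: "max 0 (min (y - a) (2 * C - y)) \<le> 2 * C" if "0 \<le> a" "1 \<le> C" for y a :: real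
    using that by (cases "y \<le> 2 * C") (auto simp: min_le_iff_disj)
  interpret shear_kernel p q \<xi> "1 / (2 * C)" "2 * C" b 1
  proof
    show "continuous_on UNIV \<xi>" unfolding \<xi>_def[abs_def] by (intro continuous_intros)
    show "0 \<le> \<xi> x" for x unfolding \<xi>_def by (intro mult_nonneg_nonneg prod_nonneg) auto
    show "\<xi> x \<le> b" for x
      unfolding \<xi>_def b_def
    proof (rule mult_mono)
      have "0 \<le> 1 / (2 * C)" using C by simp
      then show "max 0 (min (x $ p - 1 / (2 * C)) (2 * C - x $ p)) \<le> 2 * C"
        using C by (rule bump_le)
      show "(\<Prod>k\<in>UNIV - {p, q}. max 0 (2 * C - \<bar>x $ k\<bar>)) \<le> (\<Prod>k\<in>UNIV - {p, q}. 2 * C)"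
        using C by (intro prod_mono) auto
      show "0 \<le> (\<Prod>k\<in>UNIV - {p, q}. max 0 (2 * C - \<bar>x $ k\<bar>))" by (intro prod_nonneg) auto
    qed (use C in simp)
    show "\<xi> x = \<xi> y" if e: "\<And>k. k \<noteq> q \<Longrightarrow> x $ k = y $ k" for x y
    proof -
      have "(\<Prod>k\<in>UNIV - {p, q}. max 0 (2 * C - \<bar>x $ k\<bar>)) = (\<Prod>k\<in>UNIV - {p, q}. max 0 (2 * C - \<bar>y $ k\<bar>))"
        by (rule prod.cong) (auto simp: e)
      then show ?thesis using e[OF pq] by (simp add: \<xi>_def)
    qed
    show sp: "1 / (2 * C) \<le> x $ p" if "\<xi> x \<noteq> 0" for x
      using that by (auto simp: \<xi>_def max_def split: if_splits)
    show "\<bar>x $ k\<bar> \<le> 2 * C" if x: "\<xi> x \<noteq> 0" and k: "k \<noteq> q" for x k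
    proof (cases "k = p")
      case True
      have "0 < 1 / (2 * C)" using C by simp
      moreover have "x $ p \<le> 2 * C" using x by (auto simp: \<xi>_def max_def split: if_splits)
      ultimately show ?thesis using sp[OF x] unfolding True by linarith
    next
      case False
      have "(\<Prod>k\<in>UNIV - {p, q}. max 0 (2 * C - \<bar>x $ k\<bar>)) \<noteq> 0" using x by (auto simp: \<xi>_def)
      then have "max 0 (2 * C - \<bar>x $ k\<bar>) \<noteq> 0" using k False by (subst (asm) prod_zero_iff) auto
      then show ?thesis by auto
    qed
  qed (use pq C in auto)
  have S: "?S \<in> sets borel"
  proof -
    have "?S = {x \<in> space (borel :: (real^'n) measure). 1 / C \<le> x $ p \<and> x $ p \<le> C \<and> (\<forall>k. k \<noteq> q \<longrightarrow> \<bar>x $ k\<bar> \<le> C) \<and> \<bar>x $ q\<bar> \<le> 1}"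
      by simp
    also have "\<dots> \<in> sets borel" by measurable
    finally show ?thesis .
  qed
  \<comment> \<open>On the slab \<open>x\<^sub>p \<ge> 1 / C\<close>, \<open>\<xi> x \<ge> 1 / (2 C)\<close> and the tent is at least one.\<close>
  define d where "d = 1 / C * (1 / (2 * C))"
  have d: "d > 0" using C by (simp add: d_def)
  have lower: "d \<le> \<psi> x" if x: "x \<in> ?S" for x
  proof -
    have "1 / C = 1 / (2 * C) + 1 / (2 * C)" by (simp add: field_simps)
    then have xp: "1 / (2 * C) \<le> x $ p - 1 / (2 * C)" using x by auto
    have "1 / (2 * C) \<le> 1" using C by simp
    then have "1 / (2 * C) \<le> C" using C by linarith
    then have "1 / (2 * C) \<le> 2 * C - x $ p" using x by auto
    then have 1: "1 / (2 * C) \<le> max 0 (min (x $ p - 1 / (2 * C)) (2 * C - x $ p))" using xp by simp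
    have "(\<Prod>k\<in>UNIV - {p, q}. 1) \<le> (\<Prod>k\<in>UNIV - {p, q}. max 0 (2 * C - \<bar>x $ k\<bar>))"
    proof (rule prod_mono)
      fix k assume "k \<in> UNIV - {p, q}"
      then have "\<bar>x $ k\<bar> \<le> C" using x by auto
      then show "0 \<le> (1::real) \<and> 1 \<le> max 0 (2 * C - \<bar>x $ k\<bar>)" using C by simp
    qed
    then have 2: "1 \<le> (\<Prod>k\<in>UNIV - {p, q}. max 0 (2 * C - \<bar>x $ k\<bar>))" by simp
    have "1 / (2 * C) * 1 \<le> \<xi> x" unfolding \<xi>_def using 1 2 C by (intro mult_mono) auto
    then have 3: "1 / (2 * C) \<le> \<xi> x" by simp
    have 4: "d \<le> x $ p * \<xi> x"
      unfolding d_def using x 3 C by (intro mult_mono) (auto intro: order_trans[of 0 "1 / C"])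
    have 5: "1 \<le> tent (x $ q)" using x by (intro tent_ge1) auto
    have "d * 1 \<le> (x $ p * \<xi> x) * tent (x $ q)" using 4 5 d by (intro mult_mono) auto
    then show ?thesis by (simp add: \<psi>_def)
  qed
  have "emeasure (intensity \<mu>) ?S = (\<integral>\<^sup>+x. indicator ?S x \<partial>(intensity \<mu>))" using S by simp
  also have "\<dots> \<le> (\<integral>\<^sup>+x. ennreal (1 / d) * ennreal (\<psi> x) \<partial>(intensity \<mu>))"
  proof (rule nn_integral_mono)
    fix x
    show "indicator ?S x \<le> ennreal (1 / d) * ennreal (\<psi> x)"
    proof (cases "x \<in> ?S")
      case True
      then have "1 \<le> 1 / d * \<psi> x" using lower[OF True] d by (simp add: field_simps)
      then show ?thesis using True d \<psi>_nonneg by (simp add: ennreal_mult'[symmetric])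
    qed simp
  qed
  also have "\<dots> = ennreal (1 / d) * (\<integral>\<^sup>+x. ennreal (\<psi> x) \<partial>(intensity \<mu>))"
    using Cc_borel[OF \<psi>_Cc] by (intro nn_integral_cmult) simp
  also have "(\<integral>\<^sup>+x. ennreal (\<psi> x) \<partial>(intensity \<mu>)) = (\<integral>\<^sup>+\<nu>. (\<integral>\<^sup>+x. ennreal (\<psi> x) \<partial>\<nu>) \<partial>\<mu>)"
    using Cc_borel[OF \<psi>_Cc] by (intro nn_integral_intensity) simp
  also have "\<dots> = (\<integral>\<^sup>+\<nu>. ennreal (\<integral>x. \<psi> x \<partial>\<nu>) \<partial>\<mu>)"
    by (intro nn_integral_cong nn_integral_eq_integral Cc_integrable[OF siegel_growth \<psi>_Cc]) (simp_all add: \<psi>_nonneg)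
  also have "\<dots> = ennreal (\<integral>\<nu>. (\<integral>x. \<psi> x \<partial>\<nu>) \<partial>\<mu>)"
    by (intro nn_integral_eq_integral hat_integrable[OF \<mu>]) (simp add: \<psi>_nonneg)
  also have "ennreal (1 / d) * \<dots> < \<infinity>" by (simp add: ennreal_mult_less_top)
  finally show ?thesis .
qed

text \<open>The slab is thin in the direction \<open>q\<close>; a matrix \<open>dil q (1 / C)\<close>, which shrinks this
  direction and stretches the others, takes a bounded set with \<open>x\<^sub>p\<close> bounded below by a positive
  number into such a slab.\<close>

lemma intensity_SL_invariant:
  assumes pq: "p \<noteq> q"
  shows "SL_invariant (intensity \<mu>) p q"
proof
  show "emeasure (intensity \<mu>) {x. 1 / C \<le> x $ p \<and> (\<forall>k. \<bar>x $ k\<bar> \<le> C)} < \<infinity>" if C: "C \<ge> 1" for C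
  proof -
    let ?S = "{x :: real^'n. 1 / C \<le> x $ p \<and> (\<forall>k. \<bar>x $ k\<bar> \<le> C)}"
    let ?S' = "{x :: real^'n. 1 / (C * C) \<le> x $ p \<and> x $ p \<le> C * C \<and> (\<forall>k. k \<noteq> q \<longrightarrow> \<bar>x $ k\<bar> \<le> C * C) \<and> \<bar>x $ q\<bar> \<le> 1}"
    have CC: "1 \<le> C * C" using C mult_mono[of 1 C 1 C] by simp
    have g: "dil q (1 / C) \<in> SL" using C by (intro dil_SL) simp
    have N: "CARD('n) \<ge> 2"
    proof -
      have "card {p, q} \<le> CARD('n)" by (rule card_mono) auto
      then show ?thesis using pq by simp
    qed
    have sub: "?S \<subseteq> {x. dil q (1 / C) *v x \<in> ?S'}"
    proof
      fix x assume x: "x \<in> ?S"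
      have k: "(dil q (1 / C) *v x) $ k = C * x $ k" if "k \<noteq> q" for k
        using that C by (simp add: dil_def diagm_nth)
      have qq: "(dil q (1 / C) *v x) $ q = x $ q / C ^ (CARD('n) - 1)"
        using C by (simp add: dil_def diagm_nth power_one_over)
      have "C ^ 1 \<le> C ^ (CARD('n) - 1)" using C N by (intro power_increasing) auto
      then have "\<bar>x $ q\<bar> \<le> C ^ (CARD('n) - 1)" using x by (auto intro: order_trans)
      then have q1: "\<bar>(dil q (1 / C) *v x) $ q\<bar> \<le> 1" unfolding qq using C by (simp add: abs_divide)
      have "1 \<le> C * x $ p" using x C by (simp add: field_simps)
      moreover have "1 / (C * C) \<le> 1" using CC by simp
      ultimately have "1 / (C * C) \<le> C * x $ p" by linarith
      moreover have "x $ p \<le> C" using x by (auto dest: abs_le_D1)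
      moreover have "\<bar>C * x $ k\<bar> \<le> C * C" for k
      proof -
        have "\<bar>x $ k\<bar> \<le> C" using x by blast
        then show ?thesis using C by (simp add: abs_mult mult_left_mono)
      qed
      ultimately show "x \<in> {x. dil q (1 / C) *v x \<in> ?S'}" using q1 C pq by (simp add: k mult_left_mono)
    qed
    have S': "?S' \<in> sets borel"
    proof -
      have "?S' = {x \<in> space (borel :: (real^'n) measure). 1 / (C * C) \<le> x $ p \<and> x $ p \<le> C * C \<and> (\<forall>k. k \<noteq> q \<longrightarrow> \<bar>x $ k\<bar> \<le> C * C) \<and> \<bar>x $ q\<bar> \<le> 1}"
        by simp
      also have "\<dots> \<in> sets borel" by measurable
      finally show ?thesis .
    qed
    have mS: "{x. dil q (1 / C) *v x \<in> ?S'} \<in> sets borel"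
      using measurable_sets[OF matrix_vector_borel[of "dil q (1 / C)"] S'] by (simp add: vimage_def)
    have "emeasure (intensity \<mu>) ?S \<le> emeasure (intensity \<mu>) {x. dil q (1 / C) *v x \<in> ?S'}"
      by (rule emeasure_mono[OF sub]) (use mS in simp)
    also have "\<dots> = emeasure (intensity \<mu>) ?S'" by (rule intensity_invariant[OF g S'])
    also have "\<dots> < \<infinity>" by (rule intensity_finite_slab[OF pq CC])
    finally show ?thesis .
  qed
qed (use pq intensity_invariant in auto)

lemma intensity_eq:
  assumes "CARD('n) > 1"
  obtains c where "0 \<le> c" "\<And>A. A \<in> sets borel \<Longrightarrow> emeasure (intensity \<mu>) A = ennreal c * emeasure lborel A"
proof -
  obtain p q :: 'n where "p \<noteq> q" using assms by (metis (full_types) UNIV_I card_1_singleton_iff is_singletonI' is_singleton_altdef less_irrefl empty_iff)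
  from SL_invariant_unique[OF intensity_SL_invariant[OF this] intensity_zero] that show thesis by blast
qed

lemma siegel_formula_exists:
  assumes "CARD('n) > 1"
  shows "\<exists>c\<ge>0. siegel_formula \<mu> c"
proof -
  obtain c where c: "0 \<le> c" "\<And>A. A \<in> sets borel \<Longrightarrow> emeasure (intensity \<mu>) A = ennreal c * emeasure lborel A"
    using intensity_eq[OF assms] by blast
  have int: "intensity \<mu> = scale_measure (ennreal c) lborel"
    by (rule measure_eqI) (use c in auto)
  have nn: "(\<integral>\<^sup>+\<nu>. (\<integral>\<^sup>+x. f x \<partial>\<nu>) \<partial>\<mu>) = ennreal c * (\<integral>\<^sup>+x. f x \<partial>lborel)" if "f \<in> borel_measurable borel" for f :: "real^'n \<Rightarrow> ennreal"
    using nn_integral_intensity[OF that] that by (simp add: int nn_integral_scale_measure)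
  have AE_int: "AE \<nu> in \<mu>. integrable \<nu> f" and int_int: "integrable \<mu> (\<lambda>\<nu>. \<integral>x. f x \<partial>\<nu>)"
    if f: "f \<in> borel_measurable borel" "integrable lborel f" for f :: "real^'n \<Rightarrow> real"
  proof -
    have fin: "(\<integral>\<^sup>+\<nu>. (\<integral>\<^sup>+x. ennreal \<bar>f x\<bar> \<partial>\<nu>) \<partial>\<mu>) < \<infinity>"
      using f by (subst nn) (auto simp: ennreal_mult_less_top integrable_iff_bounded)
    have m: "(\<lambda>\<nu>. \<integral>\<^sup>+x. ennreal \<bar>f x\<bar> \<partial>\<nu>) \<in> borel_measurable \<mu>"
      using f by (intro siegel_measurable[OF \<mu>] growth_measurable_nn_integral) simp
    have "AE \<nu> in \<mu>. (\<integral>\<^sup>+x. ennreal \<bar>f x\<bar> \<partial>\<nu>) \<noteq> \<infinity>"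
      by (rule nn_integral_noteq_infinite[OF m]) (use fin in auto)
    then show "AE \<nu> in \<mu>. integrable \<nu> f"
      using AE_space
    proof eventually_elim
      case (elim \<nu>)
      then show ?case using growth_measurable[OF siegel_growth f(1)] by (intro integrableI_bounded) (auto simp: less_top)
    qed
    show "integrable \<mu> (\<lambda>\<nu>. \<integral>x. f x \<partial>\<nu>)"
    proof (rule integrableI_bounded)
      show "(\<lambda>\<nu>. \<integral>x. f x \<partial>\<nu>) \<in> borel_measurable \<mu>"
        using f by (intro siegel_measurable[OF \<mu>] growth_measurable_integral) simp
      have "(\<integral>\<^sup>+\<nu>. ennreal (norm (\<integral>x. f x \<partial>\<nu>)) \<partial>\<mu>) \<le> (\<integral>\<^sup>+\<nu>. (\<integral>\<^sup>+x. ennreal \<bar>f x\<bar> \<partial>\<nu>) \<partial>\<mu>)"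
      proof (rule nn_integral_mono)
        fix \<nu>
        show "ennreal (norm (\<integral>x. f x \<partial>\<nu>)) \<le> (\<integral>\<^sup>+x. ennreal \<bar>f x\<bar> \<partial>\<nu>)"
          using integral_norm_bound_ennreal[of \<nu> f]
          by (cases "integrable \<nu> f") (simp_all add: not_integrable_integral_eq)
      qed
      then show "(\<integral>\<^sup>+\<nu>. ennreal (norm (\<integral>x. f x \<partial>\<nu>)) \<partial>\<mu>) < \<infinity>" using fin by (rule le_less_trans)
    qed
  qed
  have val_nonneg: "(\<integral>\<nu>. (\<integral>x. f x \<partial>\<nu>) \<partial>\<mu>) = c * (\<integral>x. f x \<partial>lborel)"
    if f: "f \<in> borel_measurable borel" "integrable lborel f" and f0: "\<And>x. 0 \<le> f x" for f :: "real^'n \<Rightarrow> real"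
  proof -
    have "ennreal (\<integral>\<nu>. (\<integral>x. f x \<partial>\<nu>) \<partial>\<mu>) = (\<integral>\<^sup>+\<nu>. ennreal (\<integral>x. f x \<partial>\<nu>) \<partial>\<mu>)"
      by (rule nn_integral_eq_integral[symmetric, OF int_int[OF f]]) (simp add: f0)
    also have "\<dots> = (\<integral>\<^sup>+\<nu>. (\<integral>\<^sup>+x. ennreal (f x) \<partial>\<nu>) \<partial>\<mu>)"
      using AE_int[OF f] by (intro nn_integral_cong_AE) (auto elim!: eventually_mono simp: nn_integral_eq_integral f0)
    also have "\<dots> = ennreal c * ennreal (\<integral>x. f x \<partial>lborel)"
      using f by (subst nn) (simp_all add: nn_integral_eq_integral f0)
    also have "\<dots> = ennreal (c * (\<integral>x. f x \<partial>lborel))" using c(1) by (simp add: ennreal_mult' f0)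
    finally show ?thesis using c(1) f0 by (simp add: ennreal_inj)
  qed
  have "siegel_formula \<mu> c"
    unfolding siegel_formula_def
  proof (intro allI impI, elim conjE, intro conjI)
    fix f :: "real^'n \<Rightarrow> real" assume f: "f \<in> borel_measurable borel" "integrable lborel f"
    show "AE \<nu> in \<mu>. integrable \<nu> f" by (rule AE_int[OF f])
    show "integrable \<mu> (\<lambda>\<nu>. \<integral>x. f x \<partial>\<nu>)" by (rule int_int[OF f])
    let ?p = "\<lambda>x. max 0 (f x)" and ?m = "\<lambda>x. max 0 (- f x)"
    have pm: "?p \<in> borel_measurable borel" "integrable lborel ?p" "?m \<in> borel_measurable borel" "integrable lborel ?m"
      using f by auto
    have fpm: "f x = ?p x - ?m x" for x by (auto simp: max_def)
    have "(\<integral>\<nu>. (\<integral>x. f x \<partial>\<nu>) \<partial>\<mu>) = (\<integral>\<nu>. (\<integral>x. ?p x \<partial>\<nu>) - (\<integral>x. ?m x \<partial>\<nu>) \<partial>\<mu>)"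
    proof (rule integral_cong_AE)
      show "AE \<nu> in \<mu>. (\<integral>x. f x \<partial>\<nu>) = (\<integral>x. ?p x \<partial>\<nu>) - (\<integral>x. ?m x \<partial>\<nu>)"
        using AE_int[OF pm(1,2)] AE_int[OF pm(3,4)]
      proof eventually_elim
        case (elim \<nu>)
        have "(\<integral>x. f x \<partial>\<nu>) = (\<integral>x. ?p x - ?m x \<partial>\<nu>)" using fpm by (intro Bochner_Integration.integral_cong) auto
        then show ?case using elim by simp
      qed
    qed (use int_int[OF f] int_int[OF pm(1,2)] int_int[OF pm(3,4)] in auto)
    also have "\<dots> = c * (\<integral>x. ?p x \<partial>lborel) - c * (\<integral>x. ?m x \<partial>lborel)"
      using int_int[OF pm(1,2)] int_int[OF pm(3,4)] val_nonneg[OF pm(1,2)] val_nonneg[OF pm(3,4)] by simp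
    also have "\<dots> = c * (\<integral>x. ?p x - ?m x \<partial>lborel)" using pm by (simp add: right_diff_distrib)
    also have "(\<integral>x. ?p x - ?m x \<partial>lborel) = (\<integral>x. f x \<partial>lborel)"
      using fpm by (intro Bochner_Integration.integral_cong) auto
    finally show "(\<integral>\<nu>. (\<integral>x. f x \<partial>\<nu>) \<partial>\<mu>) = c * (\<integral>x. f x \<partial>lborel)" .
  qed
  then show ?thesis using c(1) by blast
qed

text \<open>Existence comes from the intensity, uniqueness from testing with the indicator of a ball.\<close>

lemma siegel_constant:
  assumes "CARD('n) > 1"
  shows "siegel_formula \<mu> (siegel_constant \<mu>)" "0 \<le> siegel_constant \<mu>"
proof -
  obtain c where c: "0 \<le> c" "siegel_formula \<mu> c" using siegel_formula_exists[OF assms] by blast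
  have uniq: "c' = c" if "siegel_formula \<mu> c'" for c'
  proof -
    let ?f = "indicator (ball (0 :: real^'n) 1) :: _ \<Rightarrow> real"
    have f: "?f \<in> borel_measurable borel" "integrable lborel ?f"
      using emeasure_bounded_finite[OF bounded_ball, of "0 :: real^'n" 1]
      by (auto intro!: borel_measurable_indicator borel_open)
    have "(\<integral>x. ?f x \<partial>lborel) = unit_ball_vol (real CARD('n))"
      by (simp add: content_ball)
    moreover have "unit_ball_vol (real CARD('n)) > 0" by (rule unit_ball_vol_pos) simp
    ultimately have "(\<integral>x. ?f x \<partial>lborel) \<noteq> 0" by linarith
    moreover have "c' * (\<integral>x. ?f x \<partial>lborel) = c * (\<integral>x. ?f x \<partial>lborel)"
      using c(2) that f unfolding siegel_formula_def by metis
    ultimately show ?thesis by simp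
  qed
  have "siegel_constant \<mu> = c"
    unfolding siegel_constant_def by (rule the_equality[where P = "siegel_formula \<mu>", OF c(2) uniq])
  then show "siegel_formula \<mu> (siegel_constant \<mu>)" "0 \<le> siegel_constant \<mu>" using c by auto
qed

end

section \<open>Convergence in mean at a large scale\<close>

text \<open>A continuous function that tends to the indicator of the open interval \<open>(l, r)\<close> as \<open>k\<close>
  grows.\<close>

definition bump :: "nat \<Rightarrow> real \<Rightarrow> real \<Rightarrow> real \<Rightarrow> real" where
  "bump k l r z = min 1 (real k * max 0 (min (z - l) (r - z)))"

lemma bump_nonneg: "0 \<le> bump k l r z" and bump_le1: "bump k l r z \<le> 1"
  by (auto simp: bump_def)

lemma bump_zero: "z \<le> l \<or> r \<le> z \<Longrightarrow> bump k l r z = 0"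
proof -
  assume "z \<le> l \<or> r \<le> z"
  then have "min (z - l) (r - z) \<le> 0" by (simp add: min_le_iff_disj)
  then have "max 0 (min (z - l) (r - z)) = 0" by (rule max_absorb1)
  then show ?thesis by (simp add: bump_def)
qed

lemma bump_tendsto: "(\<lambda>k. bump k l r z) \<longlonglongrightarrow> indicator {l<..<r} z"
proof (cases "l < z \<and> z < r")
  case True
  define d where "d = min (z - l) (r - z)"
  have d: "d > 0" using True by (simp add: d_def)
  obtain n where n: "1 / d \<le> real n" using real_arch_simple by blast
  have "eventually (\<lambda>k. 1 = bump k l r z) sequentially"
    using eventually_ge_at_top[of n]
  proof eventually_elim
    case (elim k)
    have "1 / d \<le> real k" using n elim by linarith
    then have "1 \<le> real k * d" using d by (simp add: field_simps)
    then show ?case using d by (simp add: bump_def d_def[symmetric])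
  qed
  from Lim_transform_eventually[OF tendsto_const this] show ?thesis using True by simp
next
  case False
  then have "bump k l r z = 0" for k by (intro bump_zero) auto
  then show ?thesis using False by (auto simp: indicator_def)
qed

locale siegel =
  fixes \<mu> :: "(real^'n::finite) measure measure"
  assumes siegel: "siegel_measure \<mu>" and card: "CARD('n) > 1"
begin

sublocale sl_action \<mu> act by (rule siegel_sl_action[OF siegel])

abbreviation c :: real where "c \<equiv> siegel_constant \<mu>"

lemma c_nonneg: "0 \<le> c" by (rule siegel_constant(2)[OF siegel card])

lemma growth: "\<nu> \<in> space \<mu> \<Longrightarrow> \<nu> \<in> growth_measures" by (rule siegel_growth[OF siegel])

lemma formula:
  assumes "f \<in> borel_measurable borel" "integrable lborel f"
  shows "AE \<nu> in \<mu>. integrable \<nu> f" "integrable \<mu> (\<lambda>\<nu>. \<integral>x. f x \<partial>\<nu>)" "(\<integral>\<nu>. (\<integral>x. f x \<partial>\<nu>) \<partial>\<mu>) = c * (\<integral>x. f x \<partial>lborel)"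
  using siegel_constant(1)[OF siegel card] assms unfolding siegel_formula_def by auto

text \<open>For \<open>\<nu>\<close> of at most volume growth this is the integral of \<open>f\<close> against \<open>rescale R \<nu>\<close>
  (\<open>integral_rescale\<close>).\<close>

definition at_scale :: "real \<Rightarrow> (real^'n \<Rightarrow> real) \<Rightarrow> (real^'n) measure \<Rightarrow> real" where
  "at_scale R f \<nu> = (\<integral>x. f ((1 / R) *\<^sub>R x) / R ^ CARD('n) \<partial>\<nu>)"

definition dev :: "(real^'n \<Rightarrow> real) \<Rightarrow> real \<Rightarrow> ennreal" where
  "dev f R = (\<integral>\<^sup>+\<nu>. ennreal \<bar>at_scale R f \<nu> - c * (\<integral>x. f x \<partial>lborel)\<bar> \<partial>\<mu>)"

definition mean_conv :: "(real^'n \<Rightarrow> real) \<Rightarrow> bool" where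
  "mean_conv f \<longleftrightarrow> f \<in> borel_measurable borel \<and> integrable lborel f \<and> (dev f \<longlongrightarrow> 0) at_top"

lemma dilate_borel: "f \<in> borel_measurable borel \<Longrightarrow> (\<lambda>x. f ((1 / R) *\<^sub>R x) / R ^ CARD('n)) \<in> borel_measurable borel"
  for f :: "real^'n \<Rightarrow> real"
  by (intro borel_measurable_divide measurable_compose[of "\<lambda>x. (1 / R) *\<^sub>R x" borel borel f]) simp_all

lemma at_scale_measurable: "f \<in> borel_measurable borel \<Longrightarrow> at_scale R f \<in> borel_measurable \<mu>"
  unfolding at_scale_def[abs_def]
  by (rule siegel_measurable[OF siegel growth_measurable_integral[OF dilate_borel]])

lemma at_scale_AE:
  assumes "f \<in> borel_measurable borel" "integrable lborel f" "R > 0"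
  shows "AE \<nu> in \<mu>. integrable \<nu> (\<lambda>x. f ((1 / R) *\<^sub>R x) / R ^ CARD('n))"
  by (rule formula(1)[OF dilate_borel[OF assms(1)] integral_dilate(1)[OF assms]])

text \<open>The defining formula of the constant, applied to \<open>\<bar>f - g\<bar>\<close> at scale \<open>R\<close>. The bound does
  not depend on the scale, which is what makes convergence in mean a closed condition.\<close>

lemma at_scale_diff_L1:
  assumes f: "f \<in> borel_measurable borel" "integrable lborel f"
    and g: "g \<in> borel_measurable borel" "integrable lborel g" and R: "R > 0"
  shows "(\<integral>\<^sup>+\<nu>. ennreal \<bar>at_scale R f \<nu> - at_scale R g \<nu>\<bar> \<partial>\<mu>) \<le> ennreal (c * (\<integral>x. \<bar>f x - g x\<bar> \<partial>lborel))"
proof -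
  let ?h = "\<lambda>x. \<bar>f x - g x\<bar>"
  have h: "?h \<in> borel_measurable borel" "integrable lborel ?h" using f g by auto
  have "(\<integral>\<^sup>+\<nu>. ennreal \<bar>at_scale R f \<nu> - at_scale R g \<nu>\<bar> \<partial>\<mu>) \<le> (\<integral>\<^sup>+\<nu>. ennreal (at_scale R ?h \<nu>) \<partial>\<mu>)"
  proof (rule nn_integral_mono_AE)
    show "AE \<nu> in \<mu>. ennreal \<bar>at_scale R f \<nu> - at_scale R g \<nu>\<bar> \<le> ennreal (at_scale R ?h \<nu>)"
      using at_scale_AE[OF f R] at_scale_AE[OF g R]
    proof eventually_elim
      case (elim \<nu>)
      have "at_scale R f \<nu> - at_scale R g \<nu> = (\<integral>x. f ((1 / R) *\<^sub>R x) / R ^ CARD('n) - g ((1 / R) *\<^sub>R x) / R ^ CARD('n) \<partial>\<nu>)"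
        unfolding at_scale_def using elim by simp
      then have "\<bar>at_scale R f \<nu> - at_scale R g \<nu>\<bar> \<le> (\<integral>x. \<bar>f ((1 / R) *\<^sub>R x) / R ^ CARD('n) - g ((1 / R) *\<^sub>R x) / R ^ CARD('n)\<bar> \<partial>\<nu>)"
        by (simp only: integral_abs_bound)
      also have "\<dots> = at_scale R ?h \<nu>"
        unfolding at_scale_def using R
        by (intro Bochner_Integration.integral_cong) (simp_all add: diff_divide_distrib[symmetric])
      finally show ?case by (rule ennreal_leI)
    qed
  qed
  also have "\<dots> = ennreal (\<integral>\<nu>. at_scale R ?h \<nu> \<partial>\<mu>)"
  proof (rule nn_integral_eq_integral)
    show "integrable \<mu> (at_scale R ?h)"
      unfolding at_scale_def by (rule formula(2)[OF dilate_borel[OF h(1)] integral_dilate(1)[OF h R]])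
    show "AE \<nu> in \<mu>. 0 \<le> at_scale R ?h \<nu>" using R by (simp add: at_scale_def)
  qed
  also have "(\<integral>\<nu>. at_scale R ?h \<nu> \<partial>\<mu>) = c * (\<integral>x. ?h x \<partial>lborel)"
    unfolding at_scale_def
    by (simp only: formula(3)[OF dilate_borel[OF h(1)] integral_dilate(1)[OF h R]] integral_dilate(2)[OF h R])
  finally show ?thesis .
qed

lemma dev_le:
  assumes f: "f \<in> borel_measurable borel" "integrable lborel f"
    and g: "g \<in> borel_measurable borel" "integrable lborel g" and R: "R > 0"
  shows "dev f R \<le> dev g R + ennreal (2 * c * (\<integral>x. \<bar>f x - g x\<bar> \<partial>lborel))"
proof -
  note [measurable] = at_scale_measurable[OF f(1)] at_scale_measurable[OF g(1)]
  let ?d = "\<integral>x. \<bar>f x - g x\<bar> \<partial>lborel"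
  have d0: "0 \<le> ?d" by simp
  have "(\<integral>x. f x \<partial>lborel) - (\<integral>x. g x \<partial>lborel) = (\<integral>x. f x - g x \<partial>lborel)" using f g by simp
  then have diff: "\<bar>(\<integral>x. f x \<partial>lborel) - (\<integral>x. g x \<partial>lborel)\<bar> \<le> ?d" by (simp only: integral_abs_bound)
  have "dev f R \<le> (\<integral>\<^sup>+\<nu>. ennreal \<bar>at_scale R g \<nu> - c * (\<integral>x. g x \<partial>lborel)\<bar> + ennreal \<bar>at_scale R f \<nu> - at_scale R g \<nu>\<bar> + ennreal (c * ?d) \<partial>\<mu>)"
    unfolding dev_def
  proof (rule nn_integral_mono)
    fix \<nu>
    have "c * \<bar>(\<integral>x. f x \<partial>lborel) - (\<integral>x. g x \<partial>lborel)\<bar> \<le> c * ?d" by (rule mult_left_mono[OF diff c_nonneg])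
    then have "\<bar>c * (\<integral>x. f x \<partial>lborel) - c * (\<integral>x. g x \<partial>lborel)\<bar> \<le> c * ?d"
      using c_nonneg by (simp add: right_diff_distrib[symmetric] abs_mult)
    then have "\<bar>at_scale R f \<nu> - c * (\<integral>x. f x \<partial>lborel)\<bar>
      \<le> \<bar>at_scale R g \<nu> - c * (\<integral>x. g x \<partial>lborel)\<bar> + \<bar>at_scale R f \<nu> - at_scale R g \<nu>\<bar> + c * ?d" by linarith
    from ennreal_leI[OF this] show "ennreal \<bar>at_scale R f \<nu> - c * (\<integral>x. f x \<partial>lborel)\<bar>
      \<le> ennreal \<bar>at_scale R g \<nu> - c * (\<integral>x. g x \<partial>lborel)\<bar> + ennreal \<bar>at_scale R f \<nu> - at_scale R g \<nu>\<bar> + ennreal (c * ?d)"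
      using c_nonneg d0 by (simp add: ennreal_plus)
  qed
  also have "\<dots> = dev g R + (\<integral>\<^sup>+\<nu>. ennreal \<bar>at_scale R f \<nu> - at_scale R g \<nu>\<bar> \<partial>\<mu>) + ennreal (c * ?d)"
    by (simp add: dev_def nn_integral_add emeasure_space_1)
  also have "\<dots> \<le> dev g R + ennreal (c * ?d) + ennreal (c * ?d)"
    by (intro add_mono order_refl at_scale_diff_L1[OF f g R])
  also have "\<dots> = dev g R + ennreal (2 * c * ?d)"
  proof -
    have "ennreal (c * ?d) + ennreal (c * ?d) = ennreal (c * ?d + c * ?d)"
      using c_nonneg d0 by (intro ennreal_plus[symmetric]) auto
    then show ?thesis by (simp add: add.assoc mult.assoc)
  qed
  finally show ?thesis .
qed

lemma mean_conv_closed: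
  assumes f: "f \<in> borel_measurable borel" "integrable lborel f"
    and k: "\<And>k. mean_conv (fk k)" and lim: "(\<lambda>k. \<integral>x. \<bar>f x - fk k x\<bar> \<partial>lborel) \<longlonglongrightarrow> 0"
  shows "mean_conv f"
  unfolding mean_conv_def
proof (intro conjI f)
  show "(dev f \<longlongrightarrow> 0) at_top"
  proof (rule order_tendstoI)
    fix e :: ennreal assume "0 < e"
    then obtain e' where e': "0 < e'" "e' < e" using dense by blast
    then obtain d where d: "0 < d" "ennreal d < e" by (cases e') auto
    have "(\<lambda>k. 2 * c * (\<integral>x. \<bar>f x - fk k x\<bar> \<partial>lborel)) \<longlonglongrightarrow> 2 * c * 0" by (intro tendsto_intros lim)
    then have "eventually (\<lambda>k. 2 * c * (\<integral>x. \<bar>f x - fk k x\<bar> \<partial>lborel) < d / 2) sequentially"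
      using d by (intro order_tendstoD) auto
    then obtain k where k': "2 * c * (\<integral>x. \<bar>f x - fk k x\<bar> \<partial>lborel) < d / 2"
      using eventually_happens' sequentially_bot by blast
    have "eventually (\<lambda>R. dev (fk k) R < ennreal (d / 2)) at_top"
      using k[of k] d unfolding mean_conv_def by (intro order_tendstoD) auto
    then show "eventually (\<lambda>R. dev f R < e) at_top"
      using eventually_gt_at_top[of 0]
    proof eventually_elim
      case (elim R)
      have "dev f R \<le> dev (fk k) R + ennreal (2 * c * (\<integral>x. \<bar>f x - fk k x\<bar> \<partial>lborel))"
        using k[of k] f elim unfolding mean_conv_def by (intro dev_le) auto
      also have "\<dots> \<le> ennreal (d / 2) + ennreal (d / 2)"
        using elim k' by (intro add_mono ennreal_leI) auto
      also have "\<dots> = ennreal d" using d by (simp add: ennreal_plus[symmetric] del: ennreal_plus)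
      finally show ?case using d by simp
    qed
  qed simp
qed

lemma mean_conv_AE_eq:
  assumes "mean_conv g" "f \<in> borel_measurable borel" "AE x in lborel. f x = g x"
  shows "mean_conv f"
proof -
  have g: "g \<in> borel_measurable borel" "integrable lborel g" using assms(1) by (auto simp: mean_conv_def)
  have f: "integrable lborel f" using integrable_cong_AE[of f lborel g] assms g by auto
  have "(\<integral>x. \<bar>f x - g x\<bar> \<partial>lborel) = (\<integral>x. 0 \<partial>(lborel :: (real^'n) measure))"
    using assms g by (intro integral_cong_AE) auto
  then show ?thesis using mean_conv_closed[OF assms(2) f, of "\<lambda>_. g"] assms(1) by simp
qed

lemma mean_conv_add:
  assumes f: "mean_conv f" and g: "mean_conv g"
  shows "mean_conv (\<lambda>x. f x + g x)"
proof -
  have fm: "f \<in> borel_measurable borel" "integrable lborel f" and fl: "(dev f \<longlongrightarrow> 0) at_top" using f by (auto simp: mean_conv_def)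
  have gm: "g \<in> borel_measurable borel" "integrable lborel g" and gl: "(dev g \<longlongrightarrow> 0) at_top" using g by (auto simp: mean_conv_def)
  note [measurable] = at_scale_measurable[OF fm(1)] at_scale_measurable[OF gm(1)]
  have le: "dev (\<lambda>x. f x + g x) R \<le> dev f R + dev g R" if R: "R > 0" for R
  proof -
    have "dev (\<lambda>x. f x + g x) R \<le> (\<integral>\<^sup>+\<nu>. ennreal \<bar>at_scale R f \<nu> - c * (\<integral>x. f x \<partial>lborel)\<bar> + ennreal \<bar>at_scale R g \<nu> - c * (\<integral>x. g x \<partial>lborel)\<bar> \<partial>\<mu>)"
      unfolding dev_def
    proof (rule nn_integral_mono_AE)
      show "AE \<nu> in \<mu>. ennreal \<bar>at_scale R (\<lambda>x. f x + g x) \<nu> - c * (\<integral>x. f x + g x \<partial>lborel)\<bar>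
        \<le> ennreal \<bar>at_scale R f \<nu> - c * (\<integral>x. f x \<partial>lborel)\<bar> + ennreal \<bar>at_scale R g \<nu> - c * (\<integral>x. g x \<partial>lborel)\<bar>"
        using at_scale_AE[OF fm R] at_scale_AE[OF gm R]
      proof eventually_elim
        case (elim \<nu>)
        have "at_scale R (\<lambda>x. f x + g x) \<nu> = at_scale R f \<nu> + at_scale R g \<nu>"
          unfolding at_scale_def using elim by (simp add: add_divide_distrib)
        moreover have "c * (\<integral>x. f x + g x \<partial>lborel) = c * (\<integral>x. f x \<partial>lborel) + c * (\<integral>x. g x \<partial>lborel)"
          using fm gm by (simp add: distrib_left)
        ultimately have "\<bar>at_scale R (\<lambda>x. f x + g x) \<nu> - c * (\<integral>x. f x + g x \<partial>lborel)\<bar>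
          \<le> \<bar>at_scale R f \<nu> - c * (\<integral>x. f x \<partial>lborel)\<bar> + \<bar>at_scale R g \<nu> - c * (\<integral>x. g x \<partial>lborel)\<bar>" by linarith
        from ennreal_leI[OF this] show ?case by (simp add: ennreal_plus)
      qed
    qed
    also have "\<dots> = dev f R + dev g R" by (simp add: dev_def nn_integral_add)
    finally show ?thesis .
  qed
  have "((\<lambda>R. dev f R + dev g R) \<longlongrightarrow> 0 + 0) at_top" by (intro tendsto_add fl gl)
  then have lim: "((\<lambda>R. dev f R + dev g R) \<longlongrightarrow> 0) at_top" by simp
  have "(dev (\<lambda>x. f x + g x) \<longlongrightarrow> 0) at_top"
    by (rule tendsto_sandwich[OF _ _ tendsto_const lim])
       (use le in \<open>auto intro: eventually_mono[OF eventually_gt_at_top[of 0]]\<close>)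
  then show ?thesis using fm gm by (simp add: mean_conv_def)
qed

lemma mean_conv_scale:
  assumes f: "mean_conv f" shows "mean_conv (\<lambda>x. a * f x)"
proof -
  have fm: "f \<in> borel_measurable borel" "integrable lborel f" and fl: "(dev f \<longlongrightarrow> 0) at_top" using f by (auto simp: mean_conv_def)
  note [measurable] = at_scale_measurable[OF fm(1)]
  have "dev (\<lambda>x. a * f x) R = ennreal \<bar>a\<bar> * dev f R" for R
  proof -
    have "at_scale R (\<lambda>x. a * f x) \<nu> = a * at_scale R f \<nu>" for \<nu>
      by (simp add: at_scale_def flip: times_divide_eq_right)
    then have "\<bar>at_scale R (\<lambda>x. a * f x) \<nu> - c * (\<integral>x. a * f x \<partial>lborel)\<bar> = \<bar>a\<bar> * \<bar>at_scale R f \<nu> - c * (\<integral>x. f x \<partial>lborel)\<bar>" for \<nu>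
      by (simp add: abs_mult[symmetric] algebra_simps)
    then show ?thesis unfolding dev_def by (simp add: ennreal_mult nn_integral_cmult)
  qed
  moreover have "((\<lambda>R. ennreal \<bar>a\<bar> * dev f R) \<longlongrightarrow> ennreal \<bar>a\<bar> * 0) at_top"
    by (intro tendsto_mult_ennreal tendsto_const fl) auto
  ultimately have "((\<lambda>R. dev (\<lambda>x. a * f x) R) \<longlongrightarrow> 0) at_top" by (simp only: mult_zero_right)
  then show ?thesis using fm by (simp add: mean_conv_def)
qed

lemma mean_conv_diff: "mean_conv f \<Longrightarrow> mean_conv g \<Longrightarrow> mean_conv (\<lambda>x. f x - g x)"
  using mean_conv_add[of f "\<lambda>x. -1 * g x"] mean_conv_scale[of g "-1"] by simp

lemma mean_conv_zero: "mean_conv (\<lambda>_. 0)"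
proof -
  have "dev (\<lambda>_. 0) = (\<lambda>R. 0)" by (rule ext) (simp add: dev_def at_scale_def)
  then show ?thesis by (simp add: mean_conv_def)
qed

text \<open>Invariance of \<open>\<mu>\<close>: the deviation of \<open>f \<circ> g\<close> at \<open>\<nu>\<close> is that of \<open>f\<close> at \<open>act g \<nu>\<close>, since
  linear maps commute with scaling.\<close>

lemma mean_conv_SL:
  assumes f: "mean_conv f" and g: "g \<in> SL" shows "mean_conv (\<lambda>x. f (g *v x))"
proof -
  have fm: "f \<in> borel_measurable borel" "integrable lborel f" and fl: "(dev f \<longlongrightarrow> 0) at_top" using f by (auto simp: mean_conv_def)
  note [measurable] = at_scale_measurable[OF fm(1)]
  have gm: "(\<lambda>x. g *v x) \<in> measurable lborel borel" using matrix_vector_borel[of g] by simp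
  have distr: "distr lborel borel (\<lambda>x. g *v x) = lborel" using lborel_SL_invariant[OF g] by (simp add: act_def)
  have int: "integrable lborel (\<lambda>x. f (g *v x))"
    using integrable_distr_eq[OF gm, of f] fm by (simp add: distr)
  have eq: "(\<integral>x. f (g *v x) \<partial>lborel) = (\<integral>x. f x \<partial>lborel)"
    using integral_distr[OF gm, of f] fm by (simp add: distr)
  have "dev (\<lambda>x. f (g *v x)) R = dev f R" for R
  proof -
    have "at_scale R (\<lambda>x. f (g *v x)) \<nu> = at_scale R f (act g \<nu>)" if "\<nu> \<in> space \<mu>" for \<nu>
      unfolding at_scale_def integral_act[OF growth[OF that] dilate_borel[OF fm(1)]]
      by (simp add: matrix_vector_mult_scaleR)
    then have "dev (\<lambda>x. f (g *v x)) R = (\<integral>\<^sup>+\<nu>. ennreal \<bar>at_scale R f (act g \<nu>) - c * (\<integral>x. f x \<partial>lborel)\<bar> \<partial>\<mu>)"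
      unfolding dev_def eq by (intro nn_integral_cong) simp
    also have "\<dots> = (\<integral>\<^sup>+\<nu>. ennreal \<bar>at_scale R f \<nu> - c * (\<integral>x. f x \<partial>lborel)\<bar> \<partial>distr \<mu> \<mu> (act g))"
      by (rule nn_integral_distr[symmetric, OF T_meas[OF g]]) simp
    finally show ?thesis by (simp add: T_pres[OF g] dev_def)
  qed
  then have "dev (\<lambda>x. f (g *v x)) = dev f" by (rule ext)
  moreover have "(\<lambda>x. f (g *v x)) \<in> borel_measurable borel"
    by (rule measurable_compose[OF matrix_vector_borel fm(1)])
  ultimately show ?thesis using fl int by (simp add: mean_conv_def)
qed

text \<open>The integral of \<open>\<Phi>\<close> at scale \<open>R\<close> is a flow average at \<open>act (dil q R) \<nu>\<close>, to which the mean
  ergodic theorem applies because \<open>\<mu>\<close> is invariant under \<open>dil q R\<close>. The length of the time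
  window is \<open>\<beta> R\<^sup>N\<close> and tends to infinity with the scale. Replacing \<open>\<Phi>\<close> by \<open>\<Psi>\<close> is harmless by
  \<open>at_scale_diff_L1\<close>.\<close>

lemma mean_conv_profile:
  assumes "shear_kernel p q \<xi> \<epsilon> C B \<beta>"
  shows "mean_conv (shear_kernel.\<Psi> p q \<xi> \<beta>)"
proof -
  interpret shear_kernel p q \<xi> \<epsilon> C B \<beta> by (rule assms)
  define F where "F \<nu> = (\<integral>x. \<psi> x \<partial>\<nu>)" for \<nu> :: "(real^'n) measure"
  have F_oc: "orbit_cont F"
    unfolding orbit_cont_def F_def[abs_def]
    using siegel_measurable[OF siegel measurable_Cc[OF \<psi>_Cc]] continuous_on_orbit_Cc[OF _ \<psi>_Cc] siegel_space[OF siegel] by auto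
  have F0: "0 \<le> F \<nu>" for \<nu> unfolding F_def by (simp add: \<psi>_nonneg)
  have F_int: "integrable \<mu> F" unfolding F_def[abs_def] by (rule hat_integrable[OF siegel])
  have \<psi>_int: "integrable lborel \<psi>" by (rule Cc_integrable[OF lborel_growth \<psi>_Cc])
  have EF: "(\<integral>\<nu>. F \<nu> \<partial>\<mu>) = c * (\<integral>x. \<Psi> x \<partial>lborel)"
    unfolding F_def using formula(3)[OF Cc_borel[OF \<psi>_Cc] \<psi>_int] by (simp add: \<psi>_integral)
  have qp: "q \<noteq> p" using pq by simp
  define A where "A s = (\<integral>\<^sup>+\<nu>. ennreal \<bar>avg q p F s \<nu> - (\<integral>\<nu>. F \<nu> \<partial>\<mu>)\<bar> \<partial>\<mu>)" for s
  have A_lim: "(A \<longlongrightarrow> 0) at_top"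
    unfolding A_def using mean_ergodic[OF qp F_oc _ F_int] F0 by simp
  have avg_m[measurable]: "avg q p F s \<in> borel_measurable \<mu>" for s
    unfolding avg_def[abs_def] by (rule U.borel_measurable_lebesgue_integral[OF flow_measurable[OF qp F_oc]])
  let ?N = "CARD('n)"
  have pw: "at_scale R (\<Phi> (R ^ ?N)) \<nu> = avg q p F (\<beta> * R ^ ?N) (act (dil q R) \<nu>)" if "R > 0" "\<nu> \<in> space \<mu>" for R \<nu>
    unfolding at_scale_def avg_def F_def using shear_average[OF growth[OF that(2)] that(1)] by simp
  have bound: "dev \<Psi> R \<le> A (\<beta> * R ^ ?N) + ennreal (c * (\<integral>x. \<bar>\<Phi> (R ^ ?N) x - \<Psi> x\<bar> \<partial>lborel))" if R: "R \<ge> 1" for R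
  proof -
    have R0: "R > 0" "R ^ ?N \<ge> 1" using R by (auto simp: one_le_power)
    have dSL: "dil q R \<in> SL" by (rule dil_SL[OF R0(1)])
    note [measurable] = at_scale_measurable[OF \<Psi>_borel] at_scale_measurable[OF \<Phi>_borel]
    have "dev \<Psi> R \<le> (\<integral>\<^sup>+\<nu>. ennreal \<bar>at_scale R (\<Phi> (R ^ ?N)) \<nu> - (\<integral>\<nu>. F \<nu> \<partial>\<mu>)\<bar> + ennreal \<bar>at_scale R (\<Phi> (R ^ ?N)) \<nu> - at_scale R \<Psi> \<nu>\<bar> \<partial>\<mu>)"
      unfolding dev_def EF
    proof (rule nn_integral_mono)
      fix \<nu>
      have "\<bar>at_scale R \<Psi> \<nu> - c * (\<integral>x. \<Psi> x \<partial>lborel)\<bar>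
        \<le> \<bar>at_scale R (\<Phi> (R ^ ?N)) \<nu> - c * (\<integral>x. \<Psi> x \<partial>lborel)\<bar> + \<bar>at_scale R (\<Phi> (R ^ ?N)) \<nu> - at_scale R \<Psi> \<nu>\<bar>" by linarith
      from ennreal_leI[OF this] show "ennreal \<bar>at_scale R \<Psi> \<nu> - c * (\<integral>x. \<Psi> x \<partial>lborel)\<bar>
        \<le> ennreal \<bar>at_scale R (\<Phi> (R ^ ?N)) \<nu> - c * (\<integral>x. \<Psi> x \<partial>lborel)\<bar> + ennreal \<bar>at_scale R (\<Phi> (R ^ ?N)) \<nu> - at_scale R \<Psi> \<nu>\<bar>"
        by (simp add: ennreal_plus)
    qed
    also have "\<dots> = (\<integral>\<^sup>+\<nu>. ennreal \<bar>at_scale R (\<Phi> (R ^ ?N)) \<nu> - (\<integral>\<nu>. F \<nu> \<partial>\<mu>)\<bar> \<partial>\<mu>)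
      + (\<integral>\<^sup>+\<nu>. ennreal \<bar>at_scale R (\<Phi> (R ^ ?N)) \<nu> - at_scale R \<Psi> \<nu>\<bar> \<partial>\<mu>)"
      by (rule nn_integral_add) simp_all
    also have "(\<integral>\<^sup>+\<nu>. ennreal \<bar>at_scale R (\<Phi> (R ^ ?N)) \<nu> - (\<integral>\<nu>. F \<nu> \<partial>\<mu>)\<bar> \<partial>\<mu>)
      = (\<integral>\<^sup>+\<nu>. ennreal \<bar>avg q p F (\<beta> * R ^ ?N) (act (dil q R) \<nu>) - (\<integral>\<nu>. F \<nu> \<partial>\<mu>)\<bar> \<partial>\<mu>)"
      by (rule nn_integral_cong) (simp add: pw[OF R0(1)])
    also have "\<dots> = (\<integral>\<^sup>+\<nu>. ennreal \<bar>avg q p F (\<beta> * R ^ ?N) \<nu> - (\<integral>\<nu>. F \<nu> \<partial>\<mu>)\<bar> \<partial>distr \<mu> \<mu> (act (dil q R)))"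
      by (rule nn_integral_distr[symmetric, OF T_meas[OF dSL]]) simp
    also have "\<dots> = A (\<beta> * R ^ ?N)" by (simp add: T_pres[OF dSL] A_def)
    also have "A (\<beta> * R ^ ?N) + (\<integral>\<^sup>+\<nu>. ennreal \<bar>at_scale R (\<Phi> (R ^ ?N)) \<nu> - at_scale R \<Psi> \<nu>\<bar> \<partial>\<mu>)
      \<le> A (\<beta> * R ^ ?N) + ennreal (c * (\<integral>x. \<bar>\<Phi> (R ^ ?N) x - \<Psi> x\<bar> \<partial>lborel))"
      by (intro add_left_mono at_scale_diff_L1 \<Phi>_borel \<Psi>_borel \<Phi>_integrable \<Psi>_integrable R0)
    finally show ?thesis .
  qed
  have pow: "filterlim (\<lambda>R::real. R ^ ?N) at_top at_top"
    by (rule filterlim_pow_at_top[OF _ filterlim_ident]) simp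
  have "((\<lambda>R. A (\<beta> * R ^ ?N) + ennreal (c * (\<integral>x. \<bar>\<Phi> (R ^ ?N) x - \<Psi> x\<bar> \<partial>lborel))) \<longlongrightarrow> 0 + ennreal (c * 0)) at_top"
  proof (intro tendsto_add tendsto_ennrealI tendsto_mult tendsto_const)
    show "((\<lambda>R. A (\<beta> * R ^ ?N)) \<longlongrightarrow> 0) at_top"
      by (rule filterlim_compose[OF A_lim filterlim_tendsto_pos_mult_at_top[OF tendsto_const pos(3) pow]])
    show "((\<lambda>R. \<integral>x. \<bar>\<Phi> (R ^ ?N) x - \<Psi> x\<bar> \<partial>lborel) \<longlongrightarrow> 0) at_top"
      by (rule filterlim_compose[OF \<Phi>_L1 pow])
  qed
  then have lim: "((\<lambda>R. A (\<beta> * R ^ ?N) + ennreal (c * (\<integral>x. \<bar>\<Phi> (R ^ ?N) x - \<Psi> x\<bar> \<partial>lborel))) \<longlongrightarrow> 0) at_top" by simp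
  have "(dev \<Psi> \<longlongrightarrow> 0) at_top"
    by (rule tendsto_sandwich[OF _ eventually_mono[OF eventually_ge_at_top[of 1]] tendsto_const lim])
       (use bound in auto)
  then show ?thesis by (simp add: mean_conv_def \<Psi>_integrable)
qed

section \<open>From profiles to indicators of Borel sets\<close>

lemma mean_conv_dominated:
  assumes f: "f \<in> borel_measurable borel" and k: "\<And>k. mean_conv (fk k)"
    and lim: "AE x in lborel. (\<lambda>k. fk k x) \<longlonglongrightarrow> f x"
    and w: "integrable lborel w" and le: "\<And>k x. \<bar>fk k x\<bar> \<le> w x" "\<And>x. \<bar>f x\<bar> \<le> w x"
  shows "mean_conv f"
proof (rule mean_conv_closed[OF f _ k])
  have [measurable]: "fk k \<in> borel_measurable borel" for k using k by (simp add: mean_conv_def)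
  note f[measurable]
  show "integrable lborel f"
    by (rule Bochner_Integration.integrable_bound[OF w]) (use le(2) in \<open>auto intro!: AE_I2 intro: order_trans abs_ge_self\<close>)
  have "(\<lambda>k. \<integral>x. \<bar>f x - fk k x\<bar> \<partial>lborel) \<longlonglongrightarrow> (\<integral>x. 0 \<partial>(lborel :: (real^'n) measure))"
  proof (rule integral_dominated_convergence[where w = "\<lambda>x. 2 * w x"])
    show "AE x in lborel. (\<lambda>k. \<bar>f x - fk k x\<bar>) \<longlonglongrightarrow> 0"
      using lim
    proof eventually_elim
      case (elim x)
      have "(\<lambda>k. f x - fk k x) \<longlonglongrightarrow> f x - f x" by (intro tendsto_diff tendsto_const elim)
      then show ?case by (intro tendsto_rabs_zero) simp
    qed
    show "AE x in lborel. norm \<bar>f x - fk k x\<bar> \<le> 2 * w x" for k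
    proof (rule AE_I2)
      fix x
      show "norm \<bar>f x - fk k x\<bar> \<le> 2 * w x"
        using le(1)[of k x] le(2)[of x] by (simp only: real_norm_def abs_abs)
    qed
  qed (use w in simp_all)
  then show "(\<lambda>k. \<integral>x. \<bar>f x - fk k x\<bar> \<partial>lborel) \<longlonglongrightarrow> 0" by simp
qed

lemma mean_conv_sum: "(\<And>i. i \<in> I \<Longrightarrow> mean_conv (f i)) \<Longrightarrow> mean_conv (\<lambda>x. \<Sum>i\<in>I. f i x)"
proof (induction I rule: infinite_finite_induct)
  case (insert i I)
  then show ?case using mean_conv_add[of "f i" "\<lambda>x. \<Sum>i\<in>I. f i x"] by simp
qed (simp_all add: mean_conv_zero)

text \<open>The slope in the direction \<open>q\<close> lies between \<open>-b\<close> and \<open>0\<close>, the shape that shear averages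
  produce. In terms of slopes the cells are boxes with one upper face fixed at zero.\<close>

definition cell :: "'n \<Rightarrow> 'n \<Rightarrow> ('n \<Rightarrow> real) \<Rightarrow> ('n \<Rightarrow> real) \<Rightarrow> real \<Rightarrow> (real^'n) set" where
  "cell p q l r b = {x. l p < x $ p \<and> x $ p < r p \<and> (\<forall>i. i \<noteq> p \<and> i \<noteq> q \<longrightarrow> l i < x $ i / x $ p \<and> x $ i / x $ p < r i)
     \<and> x $ q < 0 \<and> 0 < x $ q + b * x $ p}"

lemma cell_borel[measurable]: "cell p q l r b \<in> sets borel"
proof -
  have "cell p q l r b = {x \<in> space borel. l p < x $ p \<and> x $ p < r p \<and> (\<forall>i. i \<noteq> p \<and> i \<noteq> q \<longrightarrow> l i < x $ i / x $ p \<and> x $ i / x $ p < r i)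
     \<and> x $ q < 0 \<and> 0 < x $ q + b * x $ p}" by (simp add: cell_def)
  also have "\<dots> \<in> sets borel" by measurable
  finally show ?thesis .
qed

text \<open>A cell is the limit of profiles \<open>\<Psi>\<close> whose weight \<open>\<xi>\<close> is a product of bump functions in the
  height and the slopes.\<close>

lemma mean_conv_cell:
  assumes pq: "p \<noteq> q" and lp: "0 < l p"
  shows "mean_conv (indicator (cell p q l r b))"
proof (cases "b > 0 \<and> l p < r p")
  case False
  have "cell p q l r b = {}"
  proof -
    have False if x: "x \<in> cell p q l r b" for x
    proof -
      have *: "l p < x $ p" "x $ p < r p" "x $ q < 0" "0 < x $ q + b * x $ p" using x by (auto simp: cell_def)
      then have "0 < b * x $ p" "0 < x $ p" using lp by linarith+
      then have "b > 0" by (simp add: zero_less_mult_iff)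
      then show False using False * by simp
    qed
    then show ?thesis by blast
  qed
  then have "indicator (cell p q l r b) = (\<lambda>_. 0 :: real)" by (simp add: fun_eq_iff)
  then show ?thesis using mean_conv_zero by (simp only:)
next
  case True
  then have b: "b > 0" and lr: "l p < r p" by auto
  \<comment> \<open>The maximum in the denominator makes the slopes continuous everywhere; it agrees with \<open>x\<^sub>p\<close>
    on the cell.\<close>
  define s where "s i x = (if i = p then x $ p else x $ i / max (x $ p) (l p))" for i and x :: "real^'n"
  define \<xi> where "\<xi> k x = (\<Prod>i\<in>UNIV - {q}. bump k (l i) (r i) (s i x))" for k x
  define C where "C = r p * (1 + (\<Sum>i\<in>UNIV. \<bar>l i\<bar>) + (\<Sum>i\<in>UNIV. \<bar>r i\<bar>))"
  define f :: "real^'n \<Rightarrow> real" where "f = indicator {x. x $ q < 0 \<and> 0 < x $ q + b * x $ p}"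
  have rp: "0 < r p" using lp lr by simp
  have S0: "0 \<le> (\<Sum>i\<in>UNIV. \<bar>l i\<bar>)" "0 \<le> (\<Sum>i\<in>UNIV. \<bar>r i\<bar>)" by (intro sum_nonneg; simp)+
  have C: "0 < C" unfolding C_def using rp S0 by (intro mult_pos_pos add_pos_nonneg) auto
  have pos_on: "l p < x $ p \<and> x $ p < r p \<and> (\<forall>i. i \<noteq> p \<and> i \<noteq> q \<longrightarrow> l i < x $ i / x $ p \<and> x $ i / x $ p < r i)"
    if "\<xi> k x \<noteq> 0" for k x
  proof -
    have "bump k (l i) (r i) (s i x) \<noteq> 0" if "i \<noteq> q" for i
      using \<open>\<xi> k x \<noteq> 0\<close> that unfolding \<xi>_def by (subst (asm) prod_zero_iff) auto
    then have i: "l i < s i x \<and> s i x < r i" if "i \<noteq> q" for i using bump_zero[of "s i x" "l i" "r i" k] that by force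
    then have p: "l p < x $ p" "x $ p < r p" using i[OF pq] by (auto simp: s_def)
    then have m: "max (x $ p) (l p) = x $ p" by simp
    have "l i < x $ i / x $ p \<and> x $ i / x $ p < r i" if "i \<noteq> p" "i \<noteq> q" for i
      using i[OF that(2)] that(1) by (simp add: s_def m)
    then show ?thesis using p by blast
  qed
  have kern: "shear_kernel p q (\<xi> k) (l p) C 1 b" for k
  proof
    show "continuous_on UNIV (\<xi> k)"
    proof -
      have "continuous_on UNIV (s i)" for i
        using lp by (cases "i = p") (auto simp: s_def[abs_def] intro!: continuous_intros)
      then show ?thesis unfolding \<xi>_def[abs_def] bump_def by (intro continuous_intros)
    qed
    show "0 \<le> \<xi> k x" for x unfolding \<xi>_def by (intro prod_nonneg) (simp add: bump_nonneg)
    show "\<xi> k x \<le> 1" for x unfolding \<xi>_def by (intro prod_le_1) (simp add: bump_nonneg bump_le1)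
    show "\<xi> k x = \<xi> k y" if e: "\<And>i. i \<noteq> q \<Longrightarrow> x $ i = y $ i" for x y
    proof -
      have "s i x = s i y" if "i \<noteq> q" for i using e[OF that] e[OF pq] by (simp add: s_def)
      then show ?thesis unfolding \<xi>_def by (intro prod.cong) auto
    qed
    show "l p \<le> x $ p" if "\<xi> k x \<noteq> 0" for x using pos_on[OF that] by simp
    show "\<bar>x $ i\<bar> \<le> C" if x: "\<xi> k x \<noteq> 0" and i: "i \<noteq> q" for x i
    proof (cases "i = p")
      case True
      have "\<bar>x $ p\<bar> \<le> r p * 1" using pos_on[OF x] lp by simp
      also have "\<dots> \<le> C" unfolding C_def using rp S0 by (intro mult_left_mono) auto
      finally show ?thesis using True by simp
    next
      case False
      have xp: "0 < x $ p" "x $ p < r p" using pos_on[OF x] lp by auto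
      have "\<bar>l i\<bar> \<le> (\<Sum>i\<in>UNIV. \<bar>l i\<bar>)" "\<bar>r i\<bar> \<le> (\<Sum>i\<in>UNIV. \<bar>r i\<bar>)" by (rule member_le_sum; simp)+
      moreover have "l i < x $ i / x $ p" "x $ i / x $ p < r i" using pos_on[OF x] False i by auto
      ultimately have sl: "\<bar>x $ i / x $ p\<bar> \<le> 1 + (\<Sum>i\<in>UNIV. \<bar>l i\<bar>) + (\<Sum>i\<in>UNIV. \<bar>r i\<bar>)"
        using S0 by linarith
      have "\<bar>x $ i\<bar> = x $ p * \<bar>x $ i / x $ p\<bar>" using xp by (simp add: abs_divide)
      also have "\<dots> \<le> C" unfolding C_def using sl xp by (intro mult_mono) auto
      finally show ?thesis .
    qed
  qed (use pq lp C b in auto)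
  have prof: "mean_conv (\<lambda>x. \<xi> k x * f x)" for k
  proof -
    have eq: "b / tent_mass * shear_kernel.\<Psi> p q (\<xi> k) b x = \<xi> k x * f x" for x
      using b tent_mass_pos by (simp add: shear_kernel.\<Psi>_def[OF kern] f_def)
    show ?thesis
      using mean_conv_scale[OF mean_conv_profile[OF kern[of k]], of "b / tent_mass"] unfolding eq .
  qed
  let ?I = "indicator (cell p q l r b) :: real^'n \<Rightarrow> real"
  have lim: "(\<lambda>k. \<xi> k x * f x) \<longlonglongrightarrow> ?I x" for x
  proof -
    have "(\<lambda>k. \<xi> k x * f x) \<longlonglongrightarrow> (\<Prod>i\<in>UNIV - {q}. indicator {l i<..<r i} (s i x)) * f x"
      unfolding \<xi>_def by (intro tendsto_mult tendsto_prod bump_tendsto tendsto_const)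
    moreover have "(\<Prod>i\<in>UNIV - {q}. indicator {l i<..<r i} (s i x)) * f x = ?I x"
    proof (cases "l p < x $ p")
      case True
      then have m: "max (x $ p) (l p) = x $ p" by simp
      show ?thesis
      proof (cases "\<forall>i. i \<noteq> q \<longrightarrow> s i x \<in> {l i<..<r i}")
        case all: True
        then have "(\<Prod>i\<in>UNIV - {q}. indicator {l i<..<r i} (s i x)) = (1::real)" by (intro prod.neutral) auto
        moreover have "x \<in> cell p q l r b \<longleftrightarrow> x $ q < 0 \<and> 0 < x $ q + b * x $ p"
        proof -
          have "l p < x $ p \<and> x $ p < r p" using all[rule_format, OF pq] by (simp add: s_def)
          moreover have "l i < x $ i / x $ p \<and> x $ i / x $ p < r i" if "i \<noteq> p" "i \<noteq> q" for i
            using all[rule_format, OF that(2)] that m by (simp add: s_def)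
          ultimately show ?thesis by (auto simp: cell_def)
        qed
        ultimately show ?thesis by (simp add: f_def indicator_def)
      next
        case False
        then obtain i where i: "i \<noteq> q" "s i x \<notin> {l i<..<r i}" by blast
        then have "(\<Prod>i\<in>UNIV - {q}. indicator {l i<..<r i} (s i x)) = (0::real)"
          by (intro prod_zero bexI[of _ i]) auto
        moreover have "x \<notin> cell p q l r b" using i m by (auto simp: cell_def s_def split: if_splits)
        ultimately show ?thesis by simp
      qed
    next
      case False
      have "(\<Prod>i\<in>UNIV - {q}. indicator {l i<..<r i} (s i x)) = (0::real)"
        using pq False by (intro prod_zero bexI[of _ p]) (auto simp: s_def)
      moreover have "x \<notin> cell p q l r b" using False by (auto simp: cell_def)
      ultimately show ?thesis by simp
    qed
    ultimately show ?thesis by simp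
  qed
  have fb[measurable]: "f \<in> borel_measurable borel" unfolding f_def[abs_def] by measurable
  interpret k0: shear_kernel p q "\<xi> 0" "l p" C 1 b by (rule kern)
  have \<xi>b[measurable]: "\<xi> k \<in> borel_measurable borel" for k
    by (rule borel_measurable_continuous_onI[OF shear_kernel.cont[OF kern]])
  have bd: "\<bar>\<xi> k x * f x\<bar> \<le> indicator (ball 0 k0.\<rho>) x" for k x
  proof (cases "\<xi> k x * f x = 0")
    case False
    then have x: "\<xi> k x \<noteq> 0" "x $ q < 0" "0 < x $ q + b * x $ p" by (auto simp: f_def indicator_def split: if_splits)
    have xp: "x $ p \<le> C" using shear_kernel.supp(2)[OF kern x(1) pq] by simp
    have bC: "b * x $ p \<le> b * C" using xp b by simp
    have bC0: "0 < b * C" using b C by simp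
    have "\<bar>x $ i\<bar> \<le> C + 2 + b * C" for i
    proof (cases "i = q")
      case True
      have "\<bar>x $ q\<bar> \<le> b * C" using x bC by linarith
      then show ?thesis using True C by simp
    next
      case False
      then show ?thesis using shear_kernel.supp(2)[OF kern x(1) False] bC0 by linarith
    qed
    then have "x \<in> ball 0 k0.\<rho>" using k0.norm_less_\<rho>[of x] by simp
    moreover have "\<bar>\<xi> k x * f x\<bar> \<le> 1"
      using shear_kernel.nonneg[OF kern] shear_kernel.le[OF kern] by (auto simp: f_def indicator_def)
    ultimately show ?thesis by simp
  next
    case True
    then show ?thesis by (simp only:) simp
  qed
  have ball_int: "integrable lborel (indicator (ball 0 k0.\<rho>) :: real^'n \<Rightarrow> real)"
    by (rule bounded_support_integrable[OF lborel_growth, of _ 1 k0.\<rho>])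
       (auto intro!: borel_measurable_indicator borel_open)
  have I_bd: "\<bar>?I x\<bar> \<le> indicator (ball 0 k0.\<rho>) x" for x
    by (rule LIMSEQ_le_const2[OF tendsto_rabs[OF lim]]) (use bd in blast)
  show ?thesis
    by (rule mean_conv_dominated[OF borel_measurable_indicator[OF cell_borel] prof AE_I2[OF lim] ball_int bd I_bd])
qed

definition quadrant :: "'n \<Rightarrow> 'n \<Rightarrow> (real^'n) set" where
  "quadrant p q = {x. 0 < x $ p \<and> x $ q < 0}"

lemma quadrant_borel[measurable]: "quadrant p q \<in> sets borel"
proof -
  have "quadrant p q = {x \<in> space borel. 0 < x $ p \<and> x $ q < 0}" by (simp add: quadrant_def)
  also have "\<dots> \<in> sets borel" by measurable
  finally show ?thesis .
qed

text \<open>These sets exhaust the quadrant as \<open>n\<close> grows.\<close>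

definition window :: "'n \<Rightarrow> 'n \<Rightarrow> nat \<Rightarrow> (real^'n) set" where
  "window p q n = cell p q (\<lambda>i. if i = p then 1 / real (Suc n) else - real (Suc n)) (\<lambda>_. real (Suc n)) (real (Suc n))"

text \<open>In the coordinates height and slopes the cells inside the window become boxes that are
  unbounded to one side in direction \<open>q\<close>, cut off by the window; such boxes are stable under
  intersection and generate the Borel sets. The differences and disjoint unions of a Dynkin
  argument are covered by linearity and dominated convergence.\<close>

lemma mean_conv_window:
  assumes pq: "p \<noteq> q" and A: "A \<in> sets borel"
  shows "mean_conv (indicator (A \<inter> window p q n))"
proof -
  define m where "m = real (Suc n)"
  have m: "m > 0" by (simp add: m_def)
  let ?W = "window p q n"
  have W: "?W = cell p q (\<lambda>i. if i = p then 1 / m else - m) (\<lambda>_. m) m" by (simp only: window_def m_def)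
  have Wb[measurable]: "?W \<in> sets borel" unfolding W by simp
  have Wpos: "0 < x $ p" if "x \<in> ?W" for x
  proof -
    have "1 / m < x $ p" using that by (simp add: W cell_def)
    moreover have "0 < 1 / m" using m by simp
    ultimately show ?thesis by linarith
  qed
  have Wc: "mean_conv (indicator ?W)" unfolding W using pq m by (intro mean_conv_cell) auto
  then have Wi: "integrable lborel (indicator ?W :: real^'n \<Rightarrow> real)" by (simp add: mean_conv_def)
  define Z where "Z x = (\<chi> i. if i = p then x $ p else x $ i / x $ p)" for x :: "real^'n"
  define Z' where "Z' z = (\<chi> i. if i = p then z $ p else z $ i * z $ p)" for z :: "real^'n"
  have ZZ: "Z' (Z x) = x" if "0 < x $ p" for x using that by (simp add: Z_def Z'_def vec_eq_iff)
  have Z[measurable]: "Z \<in> borel_measurable borel"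
  proof (rule borel_measurable_vecI)
    show "(\<lambda>x. Z x $ i) \<in> borel_measurable borel" for i by (cases "i = p") (simp_all add: Z_def)
  qed
  have Z'[measurable]: "Z' \<in> borel_measurable borel"
  proof (rule borel_measurable_vecI)
    show "(\<lambda>x. Z' x $ i) \<in> borel_measurable borel" for i by (cases "i = p") (simp_all add: Z'_def)
  qed
  have ZW: "{x \<in> ?W. Z x \<in> B} \<in> sets borel" if [measurable]: "B \<in> sets borel" for B
  proof -
    have "{x \<in> ?W. Z x \<in> B} = {x \<in> space borel. x \<in> ?W \<and> Z x \<in> B}" by simp
    also have "\<dots> \<in> sets borel" by measurable
    finally show ?thesis .
  qed
  define G where "G l r = {z :: real^'n. (\<forall>i. i \<noteq> q \<longrightarrow> l i < z $ i \<and> z $ i < r i) \<and> l q < z $ q}" for l r :: "'n \<Rightarrow> real"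
  define E where "E = range (\<lambda>(l, r). G l r)"
  have G_borel: "G l r \<in> sets borel" for l r
  proof -
    have "G l r = {z \<in> space borel. (\<forall>i. i \<noteq> q \<longrightarrow> l i < z $ i \<and> z $ i < r i) \<and> l q < z $ q}" by (simp add: G_def)
    also have "\<dots> \<in> sets borel" by measurable
    finally show ?thesis .
  qed
  have stable: "Int_stable E"
  proof (rule Int_stableI)
    fix a b assume "a \<in> E" "b \<in> E"
    then obtain l r l' r' where ab: "a = G l r" "b = G l' r'" by (auto simp: E_def)
    have "a \<inter> b = G (\<lambda>i. max (l i) (l' i)) (\<lambda>i. min (r i) (r' i))" unfolding ab by (auto simp: G_def)
    then show "a \<inter> b \<in> E" unfolding E_def by (auto intro: range_eqI[of _ _ "(\<lambda>i. max (l i) (l' i), \<lambda>i. min (r i) (r' i))"])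
  qed
  have gen: "sets (borel :: (real^'n) measure) = sigma_sets UNIV E"
  proof
    show "sigma_sets UNIV E \<subseteq> sets borel"
      by (rule sets.sigma_sets_subset'[of E borel UNIV, simplified]) (auto simp: E_def G_borel)
    have half: "{z :: real^'n. a < z $ j} \<in> sigma_sets UNIV E" for a j
    proof -
      define g where "g k = G (\<lambda>i. if i = j then a else - real k) (\<lambda>_. real k)" for k
      have "{z :: real^'n. a < z $ j} = (\<Union>k. g k)"
      proof (intro equalityI subsetI)
        fix z :: "real^'n" assume z: "z \<in> {z. a < z $ j}"
        obtain k where k: "norm z < real k" using reals_Archimedean2 by blast
        have "\<bar>z $ i\<bar> < real k" for i using component_le_norm_cart[of z i] k by linarith
        then have "- real k < z $ i \<and> z $ i < real k" for i by (simp add: abs_less_iff minus_less_iff)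
        then have "z \<in> g k" using z by (auto simp: g_def G_def)
        then show "z \<in> (\<Union>k. g k)" by blast
      next
        fix z assume "z \<in> (\<Union>k. g k)"
        then show "z \<in> {z. a < z $ j}" by (auto simp: g_def G_def split: if_splits)
      qed
      also have "\<dots> \<in> sigma_sets UNIV E"
        by (intro sigma_sets.Union sigma_sets.Basic) (auto simp: g_def E_def)
      finally show ?thesis .
    qed
    have "sets (borel :: (real^'n) measure) = sigma_sets UNIV ((\<lambda>(a, i). {x. a < x \<bullet> i}) ` (UNIV \<times> Basis))"
      by (subst borel_eq_halfspace_greater) simp
    also have "\<dots> \<subseteq> sigma_sets UNIV E"
    proof (rule sigma_sets_mono, safe)
      fix a and i :: "real^'n" assume "i \<in> Basis"
      then obtain j where "i = axis j 1" by (auto simp: Basis_vec_def)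
      then show "{x. a < x \<bullet> i} \<in> sigma_sets UNIV E" using half[of a j] by (simp add: inner_axis)
    qed
    finally show "sets (borel :: (real^'n) measure) \<subseteq> sigma_sets UNIV E" .
  qed
  have main: "mean_conv (indicator {x \<in> ?W. Z x \<in> B})" if "B \<in> sets borel" for B
  proof -
    have "E \<subseteq> Pow UNIV" "B \<in> sigma_sets UNIV E" using that gen by auto
    with stable show ?thesis
    proof (induction rule: sigma_sets_induct_disjoint)
      case (basic B)
      then obtain l r where B: "B = G l r" by (auto simp: E_def)
      have "{x \<in> ?W. Z x \<in> B} = cell p q (\<lambda>i. max (l i) (if i = p then 1 / m else - m)) (\<lambda>i. min (r i) m) (min (- l q) m)"
      proof (intro set_eqI)
        fix x
        show "x \<in> {x \<in> ?W. Z x \<in> B} \<longleftrightarrow> x \<in> cell p q (\<lambda>i. max (l i) (if i = p then 1 / m else - m)) (\<lambda>i. min (r i) m) (min (- l q) m)"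
        proof (cases "1 / m < x $ p")
          case False
          then show ?thesis by (simp add: W cell_def)
        next
          case True
          have xp: "0 < x $ p" using True m by (meson divide_pos_pos less_trans zero_less_one)
          have b: "l q < x $ q / x $ p \<longleftrightarrow> 0 < x $ q + (- l q) * x $ p" using xp by (simp add: less_divide_eq)
          have b2: "(0 < x $ q + (- l q) * x $ p \<and> 0 < x $ q + m * x $ p) \<longleftrightarrow> 0 < x $ q + min (- l q) m * x $ p"
          proof (cases "- l q \<le> m")
            case True
            then have "(- l q) * x $ p \<le> m * x $ p" using xp by (intro mult_right_mono) auto
            then show ?thesis using True by auto
          next
            case False
            then have "m * x $ p \<le> (- l q) * x $ p" using xp by (intro mult_right_mono) auto
            then show ?thesis using False by auto
          qed
          have zq: "l q < Z x $ q \<longleftrightarrow> 0 < x $ q + (- l q) * x $ p" using pq b by (simp add: Z_def)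
          show ?thesis
            unfolding W cell_def B G_def mem_Collect_eq b2[symmetric] zq using pq by (auto simp: Z_def)
        qed
      qed
      moreover have "mean_conv (indicator (cell p q (\<lambda>i. max (l i) (if i = p then 1 / m else - m)) (\<lambda>i. min (r i) m) (min (- l q) m)))"
        using pq m by (intro mean_conv_cell) (auto simp: less_max_iff_disj)
      ultimately show ?case by simp
    next
      case empty
      then show ?case using mean_conv_zero by simp
    next
      case (compl B)
      have "indicator {x \<in> ?W. Z x \<in> UNIV - B} = (\<lambda>x. indicator ?W x - indicator {x \<in> ?W. Z x \<in> B} x :: real)"
        by (auto simp: fun_eq_iff indicator_def)
      then show ?case using mean_conv_diff[OF Wc compl.IH] by simp
    next
      case (union B)
      have Bb: "B i \<in> sets borel" for i using union gen by auto
      let ?f = "\<lambda>i x. indicator {x \<in> ?W. Z x \<in> B i} x :: real"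
      have disj: "B i \<inter> B j = {}" if "i \<noteq> j" for i j using union(1) that by (auto simp: disjoint_family_on_def)
      have sum_eq: "(\<Sum>i<k. ?f i x) = indicator {x \<in> ?W. Z x \<in> (\<Union>i<k. B i)} x" for k x
      proof (induction k)
        case (Suc k)
        have nk: "Z x \<notin> B k" if "Z x \<in> B i" "i < k" for i using disj[of i k] that by auto
        have "indicator {x \<in> ?W. Z x \<in> (\<Union>i<k. B i)} x + ?f k x = indicator {x \<in> ?W. Z x \<in> (\<Union>i<Suc k. B i)} x"
          using nk by (auto simp: indicator_def lessThan_Suc)
        then show ?case by (simp only: sum.lessThan_Suc Suc)
      qed simp
      show ?case
      proof (rule mean_conv_dominated[where fk = "\<lambda>k x. \<Sum>i<k. ?f i x" and w = "indicator ?W"])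
        show "indicator {x \<in> ?W. Z x \<in> \<Union> (range B)} \<in> borel_measurable borel"
          by (intro borel_measurable_indicator ZW) (use Bb in auto)
        show "mean_conv (\<lambda>x. \<Sum>i<k. ?f i x)" for k by (intro mean_conv_sum union.IH)
        show "AE x in lborel. (\<lambda>k. \<Sum>i<k. ?f i x) \<longlonglongrightarrow> indicator {x \<in> ?W. Z x \<in> \<Union> (range B)} x"
        proof (rule AE_I2)
          fix x
          show "(\<lambda>k. \<Sum>i<k. ?f i x) \<longlonglongrightarrow> indicator {x \<in> ?W. Z x \<in> \<Union> (range B)} x"
          proof (cases "x \<in> ?W \<and> Z x \<in> \<Union> (range B)")
            case True
            then obtain j where j: "Z x \<in> B j" "x \<in> ?W" by blast
            have "eventually (\<lambda>k. indicator {x \<in> ?W. Z x \<in> \<Union> (range B)} x = (\<Sum>i<k. ?f i x)) sequentially"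
              using eventually_gt_at_top[of j]
            proof eventually_elim
              case (elim k)
              then have "x \<in> {x \<in> ?W. Z x \<in> (\<Union>i<k. B i)}" using j by auto
              then show ?case unfolding sum_eq using True by simp
            qed
            from Lim_transform_eventually[OF tendsto_const this] show ?thesis .
          next
            case False
            then have "indicator {x \<in> ?W. Z x \<in> (\<Union>i<k. B i)} x = (0::real)" for k by auto
            then show ?thesis unfolding sum_eq using False by (auto simp: indicator_def)
          qed
        qed
        show "integrable lborel (indicator ?W :: real^'n \<Rightarrow> real)" by (rule Wi)
        show "\<bar>\<Sum>i<k. ?f i x\<bar> \<le> indicator ?W x" for k x unfolding sum_eq by (auto simp: indicator_def)
        show "\<bar>indicator {x \<in> ?W. Z x \<in> \<Union> (range B)} x :: real\<bar> \<le> indicator ?W x" for x by (auto simp: indicator_def)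
      qed
    qed
  qed
  have "A \<inter> ?W = {x \<in> ?W. Z x \<in> Z' -` A}" using ZZ Wpos by auto
  moreover have "Z' -` A \<in> sets borel" using measurable_sets[OF Z' A] by simp
  ultimately show ?thesis using main[of "Z' -` A"] by (simp only:)
qed

lemma mean_conv_quadrant:
  assumes pq: "p \<noteq> q" and A: "A \<in> sets borel" "emeasure lborel A < \<infinity>"
  shows "mean_conv (indicator (A \<inter> quadrant p q))"
proof (rule mean_conv_dominated[where fk = "\<lambda>n. indicator (A \<inter> window p q n)" and w = "indicator A"])
  show "indicator (A \<inter> quadrant p q) \<in> borel_measurable borel"
    by (intro borel_measurable_indicator sets.Int A quadrant_borel)
  show "mean_conv (indicator (A \<inter> window p q n))" for n by (rule mean_conv_window[OF pq A(1)])
  show "AE x in lborel. (\<lambda>n. indicator (A \<inter> window p q n) x :: real) \<longlonglongrightarrow> indicator (A \<inter> quadrant p q) x"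
  proof (rule AE_I2)
    fix x :: "real^'n"
    have sub: "window p q n \<subseteq> quadrant p q" for n
    proof
      fix x assume x: "x \<in> window p q n"
      then have "1 / real (Suc n) < x $ p" "x $ q < 0" by (auto simp: window_def cell_def)
      moreover have "0 < 1 / real (Suc n)" by simp
      ultimately have "0 < x $ p \<and> x $ q < 0" by (metis less_trans)
      then show "x \<in> quadrant p q" by (simp add: quadrant_def)
    qed
    show "(\<lambda>n. indicator (A \<inter> window p q n) x :: real) \<longlonglongrightarrow> indicator (A \<inter> quadrant p q) x"
    proof (cases "x \<in> A \<inter> quadrant p q")
      case True
      then have xp: "0 < x $ p" "x $ q < 0" by (auto simp: quadrant_def)
      define K where "K = x $ p + 1 / x $ p + (\<Sum>i\<in>UNIV. \<bar>x $ i / x $ p\<bar>)"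
      obtain k where k: "K < real k" using reals_Archimedean2 by blast
      have sl: "\<bar>x $ i / x $ p\<bar> \<le> (\<Sum>i\<in>UNIV. \<bar>x $ i / x $ p\<bar>)" for i by (rule member_le_sum) auto
      have ip: "0 < 1 / x $ p" using xp by simp
      have S0: "0 \<le> (\<Sum>i\<in>UNIV. \<bar>x $ i / x $ p\<bar>)" by (intro sum_nonneg) simp
      have "eventually (\<lambda>n. 1 = (indicator (A \<inter> window p q n) x :: real)) sequentially"
        using eventually_ge_at_top[of k]
      proof eventually_elim
        case (elim n)
        then have n: "K < real (Suc n)" using k by linarith
        have 1: "x $ p < real (Suc n)" "1 / x $ p < real (Suc n)" "\<bar>x $ i / x $ p\<bar> < real (Suc n)" for i
          using n sl[of i] ip xp S0 unfolding K_def by linarith+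
        have 2: "1 / real (Suc n) < x $ p" using 1(2) xp by (simp add: divide_less_eq mult.commute del: of_nat_Suc)
        have 3: "- real (Suc n) < x $ i / x $ p \<and> x $ i / x $ p < real (Suc n)" for i
          using abs_less_iff[THEN iffD1, OF 1(3)[of i]] by (simp add: minus_less_iff del: of_nat_Suc)
        have 4: "0 < x $ q + real (Suc n) * x $ p"
        proof -
          have "- real (Suc n) * x $ p < x $ q / x $ p * x $ p" using 3[of q] xp by (intro mult_strict_right_mono) auto
          then show ?thesis using xp by (simp del: of_nat_Suc)
        qed
        have "x \<in> window p q n" unfolding window_def cell_def mem_Collect_eq using 1 2 3 4 xp by (simp del: of_nat_Suc)
        then show ?case using True by simp
      qed
      from Lim_transform_eventually[OF tendsto_const this] show ?thesis using True by simp
    next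
      case False
      then have "x \<notin> A \<inter> window p q n" for n using sub by blast
      then show ?thesis using False by simp
    qed
  qed
  show "integrable lborel (indicator A :: real^'n \<Rightarrow> real)" using A by simp
qed (auto simp: indicator_def)

text \<open>The rotation \<open>J\<close> by a right angle in the plane of the coordinates \<open>p, q\<close> is a product of
  transvections. Its powers permute the four sign patterns of these coordinates, so they cut the
  set into four pieces and a null set, and each piece is the image of a set in the quadrant.\<close>

theorem mean_conv_indicator:
  assumes A: "A \<in> sets borel" "emeasure lborel A < \<infinity>"
  shows "mean_conv (indicator A)"
proof -
  obtain p :: 'n where True by blast
  have "\<not> UNIV \<subseteq> {p}"
  proof
    assume "UNIV \<subseteq> {p}"
    then have "CARD('n) \<le> card {p}" by (intro card_mono) auto
    then show False using card by simp
  qed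
  then obtain q where "q \<notin> {p}" by blast
  then have pq: "p \<noteq> q" by simp
  define J where "J = (transv p q 1 ** transv q p (-1)) ** transv p q (1::real)"
  have J: "J \<in> SL" unfolding J_def using pq by (intro SL_mult transv_SL) auto
  have Jp: "(J *v x) $ p = x $ q" and Jq: "(J *v x) $ q = - x $ p" for x
    using pq by (simp_all add: J_def matrix_vector_mul_assoc[symmetric] transv_nth)
  have rot: "mean_conv (indicator (A \<inter> {x. g *v x \<in> quadrant p q}))" if g: "g \<in> SL" for g
  proof -
    let ?A = "{y. matrix_inv g *v y \<in> A}"
    have inv: "matrix_inv g *v (g *v x) = x" for x using SL_inv[OF g] by (simp add: matrix_vector_mul_assoc)
    have mA: "?A \<in> sets borel" using measurable_sets[OF matrix_vector_borel A(1), of "matrix_inv g"] by (simp add: vimage_def)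
    have "emeasure lborel ?A = emeasure lborel A"
      using emeasure_act[OF lborel_growth A(1), of "matrix_inv g"] by (simp add: lborel_SL_invariant[OF SL_inv(1)[OF g]])
    then have "mean_conv (indicator (?A \<inter> quadrant p q))" using A by (intro mean_conv_quadrant pq mA) simp
    from mean_conv_SL[OF this g] have "mean_conv (\<lambda>x. indicator (?A \<inter> quadrant p q) (g *v x))" .
    moreover have "(\<lambda>x. indicator (?A \<inter> quadrant p q) (g *v x) :: real) = indicator (A \<inter> {x. g *v x \<in> quadrant p q})"
      by (simp add: fun_eq_iff indicator_def inv)
    ultimately show ?thesis by (simp only:)
  qed
  let ?g = "\<lambda>n :: nat. if n = 0 then mat 1 else if n = 1 then J else if n = 2 then J ** J else J ** (J ** J) :: real^'n^'n"
  have gSL: "?g n \<in> SL" for n :: nat using J mat1_SL by (auto intro!: SL_mult)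
  have conv: "mean_conv (\<lambda>x. \<Sum>n\<in>{0,1,2,3}. indicator (A \<inter> {x. ?g n *v x \<in> quadrant p q}) x)"
    by (intro mean_conv_sum rot gSL)
  have Ab: "indicator A \<in> borel_measurable (borel :: (real^'n) measure)" using A by simp
  show ?thesis
  proof (rule mean_conv_AE_eq[OF conv Ab])
    have "AE x :: real^'n in lborel. axis p 1 \<bullet> x \<noteq> 0" "AE x :: real^'n in lborel. axis q 1 \<bullet> x \<noteq> 0"
      by (rule AE_hyperplane; simp)+
    then show "AE x in lborel. indicator A x = (\<Sum>n\<in>{0,1,2,3::nat}. indicator (A \<inter> {x. ?g n *v x \<in> quadrant p q}) x :: real)"
    proof eventually_elim
      case (elim x)
      then have x: "x $ p \<noteq> 0" "x $ q \<noteq> 0" by (auto simp: inner_axis')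
      have in0: "?g 0 *v x \<in> quadrant p q \<longleftrightarrow> 0 < x $ p \<and> x $ q < 0" by (simp add: quadrant_def)
      have in1: "?g 1 *v x \<in> quadrant p q \<longleftrightarrow> 0 < x $ q \<and> 0 < x $ p" by (simp add: quadrant_def Jp Jq)
      have in2: "?g 2 *v x \<in> quadrant p q \<longleftrightarrow> x $ p < 0 \<and> 0 < x $ q"
        by (simp add: quadrant_def matrix_vector_mul_assoc[symmetric] Jp Jq)
      have in3: "?g 3 *v x \<in> quadrant p q \<longleftrightarrow> x $ q < 0 \<and> x $ p < 0"
        by (simp add: quadrant_def matrix_vector_mul_assoc[symmetric] Jp Jq)
      have "(\<Sum>n\<in>{0,1,2,3::nat}. indicator (A \<inter> {x. ?g n *v x \<in> quadrant p q}) x :: real)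
        = indicator A x * (of_bool (?g 0 *v x \<in> quadrant p q) + of_bool (?g 1 *v x \<in> quadrant p q)
          + of_bool (?g 2 *v x \<in> quadrant p q) + of_bool (?g 3 *v x \<in> quadrant p q))"
        by (simp add: indicator_def)
      also have "\<dots> = indicator A x"
        unfolding in0 in1 in2 in3 using x by (cases "0 < x $ p"; cases "0 < x $ q") auto
      finally show ?case ..
    qed
  qed
qed

end

section \<open>From countably many sets to vague convergence\<close>

lemma scale_measure_eq_density: "scale_measure r M = density M (\<lambda>_. r)"
  by (rule measure_eqI) (simp_all add: emeasure_density_const)

lemma dilation_borel: "(\<lambda>x :: real^'n::finite. a *\<^sub>R x) \<in> borel_measurable borel"
  by simp

lemma integral_rescale:
  fixes \<psi> :: "real^'n::finite \<Rightarrow> real"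
  assumes \<nu>: "\<nu> \<in> growth_measures" and \<psi>: "\<psi> \<in> borel_measurable borel" and R: "R > 0"
  shows "(\<integral>x. \<psi> x \<partial>(rescale R \<nu>)) = (\<integral>x. \<psi> ((1 / R) *\<^sub>R x) / R ^ CARD('n) \<partial>\<nu>)"
proof -
  have "(\<integral>x. \<psi> x \<partial>(rescale R \<nu>))
      = (\<integral>x. (1 / R ^ CARD('n)) *\<^sub>R \<psi> x \<partial>(distr \<nu> borel (\<lambda>x. (1 / R) *\<^sub>R x)))"
    unfolding rescale_def scale_measure_eq_density
    by (rule integral_density) (use \<psi> R in auto)
  also have "\<dots> = (\<integral>x. (1 / R ^ CARD('n)) *\<^sub>R \<psi> ((1 / R) *\<^sub>R x) \<partial>\<nu>)"
    by (rule integral_distr) (use \<psi> growth_measurable[OF \<nu> dilation_borel] in auto)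
  finally show ?thesis by simp
qed

lemma rescale_growth:
  fixes \<nu> :: "(real^'n::finite) measure"
  assumes \<nu>: "\<nu> \<in> growth_measures" and R: "R > 0"
  shows "rescale R \<nu> \<in> growth_measures"
proof -
  obtain C where C: "0 \<le> C" "\<And>R. R > 0 \<Longrightarrow> emeasure \<nu> (ball 0 R) \<le> ennreal (C * R ^ CARD('n))"
    using growth_bound[OF \<nu>] by blast
  show ?thesis
  proof (rule growth_measuresI[where C = C])
    show "sets (rescale R \<nu>) = sets borel" by (simp add: rescale_def)
    fix r :: real assume r: "r > 0"
    have "emeasure (distr \<nu> borel (\<lambda>x. (1 / R) *\<^sub>R x)) (ball 0 r) = emeasure \<nu> ((\<lambda>x. (1 / R) *\<^sub>R x) -` ball 0 r \<inter> space \<nu>)"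
      by (rule emeasure_distr) (use growth_measurable[OF \<nu> dilation_borel] in auto)
    also have "(\<lambda>x. (1 / R) *\<^sub>R x) -` ball 0 r \<inter> space \<nu> = ball 0 (R * r)"
      using R by (auto simp: growth_space[OF \<nu>] field_simps)
    also have "emeasure \<nu> (ball 0 (R * r)) \<le> ennreal (C * (R * r) ^ CARD('n))" using C(2) R r by simp
    finally have "emeasure (rescale R \<nu>) (ball 0 r) \<le> ennreal (1 / R ^ CARD('n)) * ennreal (C * (R * r) ^ CARD('n))"
      unfolding rescale_def by (simp add: mult_left_mono)
    also have "\<dots> = ennreal (1 / R ^ CARD('n) * (C * (R * r) ^ CARD('n)))"
      using R by (intro ennreal_mult'[symmetric]) simp
    also have "1 / R ^ CARD('n) * (C * (R * r) ^ CARD('n)) = C * r ^ CARD('n)"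
      using R by (simp add: power_mult_distrib)
    finally show "emeasure (rescale R \<nu>) (ball 0 r) \<le> ennreal (C * r ^ CARD('n))" .
  qed
qed

definition grid_index :: "nat \<Rightarrow> real^'n \<Rightarrow> 'n \<Rightarrow> int" where
  "grid_index k x i = \<lfloor>real (Suc k) * x $ i\<rfloor>"

text \<open>The corner of the cell with index \<open>z\<close> in the grid of mesh \<open>1 / (k + 1)\<close>.\<close>

definition grid_point :: "nat \<Rightarrow> ('n \<Rightarrow> int) \<Rightarrow> real^'n::finite" where
  "grid_point k z = (\<chi> i. real_of_int (z i) / real (Suc k))"

definition grid_cell :: "nat \<Rightarrow> ('n \<Rightarrow> int) \<Rightarrow> (real^'n::finite) set" where
  "grid_cell k z = {x. grid_index k x = z}"

lemma grid_cell_borel: "grid_cell k z \<in> sets borel"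
proof -
  have "grid_cell k z = {x \<in> space borel. \<forall>i. \<lfloor>real (Suc k) * x $ i\<rfloor> = z i}"
    by (simp add: grid_cell_def grid_index_def fun_eq_iff)
  also have "\<dots> \<in> sets borel" by measurable
  finally show ?thesis .
qed

lemma grid_point_near:
  fixes x :: "real^'n::finite"
  shows "norm (x - grid_point k (grid_index k x)) \<le> real CARD('n) / real (Suc k)"
proof -
  have "norm (x - grid_point k (grid_index k x)) \<le> (\<Sum>i\<in>UNIV. \<bar>(x - grid_point k (grid_index k x)) $ i\<bar>)"
    by (rule norm_le_l1_cart)
  also have "\<dots> \<le> (\<Sum>i\<in>(UNIV :: 'n set). 1 / real (Suc k))"
  proof (rule sum_mono)
    fix i
    let ?K = "real (Suc k)"
    have K: "?K > 0" by simp
    have "\<bar>?K * x $ i - real_of_int \<lfloor>?K * x $ i\<rfloor>\<bar> \<le> 1" by linarith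
    then have "\<bar>?K * x $ i - real_of_int \<lfloor>?K * x $ i\<rfloor>\<bar> / ?K \<le> 1 / ?K" by (rule divide_right_mono) simp
    moreover have "(x - grid_point k (grid_index k x)) $ i = (?K * x $ i - real_of_int \<lfloor>?K * x $ i\<rfloor>) / ?K"
      using K by (simp add: grid_point_def grid_index_def diff_divide_distrib del: of_nat_Suc)
    ultimately show "\<bar>(x - grid_point k (grid_index k x)) $ i\<bar> \<le> 1 / ?K"
      using K by (simp add: abs_divide del: of_nat_Suc)
  qed
  finally show ?thesis by simp
qed

lemma grid_cell_bounded: "bounded (grid_cell k z :: (real^'n::finite) set)"
proof (rule boundedI)
  fix x :: "real^'n" assume "x \<in> grid_cell k z"
  then have z: "grid_index k x = z" by (simp add: grid_cell_def)
  have "norm x \<le> norm (grid_point k z :: real^'n) + norm (x - grid_point k z)"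
    by (rule norm_triangle_sub)
  also have "\<dots> \<le> norm (grid_point k z :: real^'n) + real CARD('n) / real (Suc k)"
    using grid_point_near[of x k] by (simp add: z del: of_nat_Suc)
  finally show "norm x \<le> norm (grid_point k z :: real^'n) + real CARD('n) / real (Suc k)" .
qed

text \<open>A continuous function with compact support is uniformly close to its values at the grid
  points, which form a finite linear combination of indicators of grid cells. The error is
  supported in a fixed ball, the mass of which stays bounded because it converges.\<close>

lemma vague_convergence_of_grid:
  fixes L :: "nat \<Rightarrow> (real^'n::finite) measure" and \<psi> :: "real^'n \<Rightarrow> real"
  assumes L: "\<And>n. L n \<in> growth_measures" and L0: "L0 \<in> growth_measures"
    and cells: "\<And>k z. (\<lambda>n. measure (L n) (grid_cell k z)) \<longlonglongrightarrow> c * measure L0 (grid_cell k z)"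
    and balls: "\<And>m::nat. (\<lambda>n. measure (L n) (ball 0 (real m))) \<longlonglongrightarrow> c * measure L0 (ball 0 (real m))"
    and \<psi>: "\<psi> \<in> Cc"
  shows "(\<lambda>n. \<integral>x. \<psi> x \<partial>(L n)) \<longlonglongrightarrow> c * (\<integral>x. \<psi> x \<partial>L0)"
proof -
  let ?N = "real CARD('n)"
  obtain M r where M: "0 < M" "0 < r" "\<And>x. \<bar>\<psi> x\<bar> \<le> M * indicator (ball 0 r) x" using Cc_bound[OF \<psi>] by blast
  have supp: "\<psi> x = 0" if "r \<le> norm x" for x using M(3)[of x] that by simp
  define \<psi>k where "\<psi>k k x = \<psi> (grid_point k (grid_index k x))" for k x
  \<comment> \<open>Finitely many indices, among them all those whose grid points lie in the support.\<close>
  define Z where "Z k = (UNIV :: 'n set) \<rightarrow>\<^sub>E {- \<lceil>real (Suc k) * r\<rceil> .. \<lceil>real (Suc k) * r\<rceil>}" for k :: nat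
  have Zfin: "finite (Z k)" for k unfolding Z_def by (intro finite_PiE) auto
  have \<psi>k_sum: "\<psi>k k x = (\<Sum>z\<in>Z k. \<psi> (grid_point k z) * indicator (grid_cell k z) x)" for k x
  proof (cases "grid_index k x \<in> Z k")
    case True
    have "(\<Sum>z\<in>Z k. \<psi> (grid_point k z) * indicator (grid_cell k z) x)
        = (\<Sum>z\<in>Z k. if grid_index k x = z then \<psi> (grid_point k z) else 0)"
      by (intro sum.cong) (auto simp: grid_cell_def)
    then show ?thesis using True by (simp add: sum.delta'[OF Zfin] \<psi>k_def)
  next
    case False
    then have "\<not> (\<forall>i. grid_index k x i \<in> {- \<lceil>real (Suc k) * r\<rceil> .. \<lceil>real (Suc k) * r\<rceil>})"
      by (simp only: Z_def PiE_iff extensional_UNIV) simp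
    then obtain i where i: "grid_index k x i \<notin> {- \<lceil>real (Suc k) * r\<rceil> .. \<lceil>real (Suc k) * r\<rceil>}" by blast
    then have "\<lceil>real (Suc k) * r\<rceil> < \<bar>grid_index k x i\<bar>" by auto
    then have "real (Suc k) * r \<le> \<bar>real_of_int (grid_index k x i)\<bar>" by linarith
    then have "r \<le> \<bar>grid_point k (grid_index k x) $ i\<bar>"
      by (simp add: grid_point_def abs_divide pos_le_divide_eq mult.commute del: of_nat_Suc)
    then have "\<psi>k k x = 0" unfolding \<psi>k_def
      by (intro supp order_trans[OF _ component_le_norm_cart])
    moreover have "(\<Sum>z\<in>Z k. \<psi> (grid_point k z) * indicator (grid_cell k z) x) = 0"
    proof (intro sum.neutral ballI)
      fix z assume "z \<in> Z k"
      then have "x \<notin> grid_cell k z" using False by (auto simp: grid_cell_def)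
      then show "\<psi> (grid_point k z) * indicator (grid_cell k z) x = 0" by simp
    qed
    ultimately show ?thesis by simp
  qed
  have cell_int: "integrable \<nu> (indicator (grid_cell k z) :: real^'n \<Rightarrow> real)" if \<nu>: "\<nu> \<in> growth_measures" for \<nu> k z
  proof -
    obtain b where "grid_cell k z \<subseteq> ball (0 :: real^'n) b"
      using bounded_subset_ballD[OF grid_cell_bounded] by blast
    then show ?thesis
      by (intro bounded_support_integrable[OF \<nu> borel_measurable_indicator[OF grid_cell_borel], of _ _ 1 b])
         (auto simp: indicator_def)
  qed
  have \<psi>k_integral: "integrable \<nu> (\<psi>k k)" "(\<integral>x. \<psi>k k x \<partial>\<nu>) = (\<Sum>z\<in>Z k. \<psi> (grid_point k z) * measure \<nu> (grid_cell k z))"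
    if \<nu>: "\<nu> \<in> growth_measures" for \<nu> k
  proof -
    have eq: "\<psi>k k = (\<lambda>x. \<Sum>z\<in>Z k. \<psi> (grid_point k z) * indicator (grid_cell k z) x)" by (rule ext) (rule \<psi>k_sum)
    show "integrable \<nu> (\<psi>k k)" unfolding eq using cell_int[OF \<nu>] by auto
    show "(\<integral>x. \<psi>k k x \<partial>\<nu>) = (\<Sum>z\<in>Z k. \<psi> (grid_point k z) * measure \<nu> (grid_cell k z))"
      unfolding eq using cell_int[OF \<nu>] by (simp add: growth_space[OF \<nu>])
  qed
  have \<psi>k_conv: "(\<lambda>n. \<integral>x. \<psi>k k x \<partial>(L n)) \<longlonglongrightarrow> c * (\<integral>x. \<psi>k k x \<partial>L0)" for k
  proof -
    have "(\<lambda>n. \<Sum>z\<in>Z k. \<psi> (grid_point k z) * measure (L n) (grid_cell k z))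
        \<longlonglongrightarrow> (\<Sum>z\<in>Z k. \<psi> (grid_point k z) * (c * measure L0 (grid_cell k z)))"
      by (intro tendsto_sum tendsto_mult tendsto_const cells)
    moreover have "(\<Sum>z\<in>Z k. \<psi> (grid_point k z) * (c * measure L0 (grid_cell k z))) = c * (\<integral>x. \<psi>k k x \<partial>L0)"
      by (simp add: \<psi>k_integral(2)[OF L0] sum_distrib_left mult.left_commute)
    ultimately show ?thesis by (simp only: \<psi>k_integral(2)[OF L])
  qed
  obtain m :: nat where m: "r + ?N < real m" using reals_Archimedean2 by blast
  let ?B = "ball (0 :: real^'n) (real m)"
  have uniform: "\<exists>k. \<forall>x. \<bar>\<psi> x - \<psi>k k x\<bar> \<le> e * indicator ?B x" if e: "e > 0" for e
  proof -
    let ?K = "cball (0 :: real^'n) (r + 2 * ?N)"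
    have uc: "uniformly_continuous_on ?K \<psi>"
      using \<psi> by (intro compact_uniformly_continuous) (auto simp: Cc_def intro: continuous_on_subset)
    obtain d where d: "0 < d" "\<And>x y. x \<in> ?K \<Longrightarrow> y \<in> ?K \<Longrightarrow> dist y x < d \<Longrightarrow> dist (\<psi> y) (\<psi> x) < e"
      using uniformly_continuous_onE[OF uc e] that by metis
    obtain k :: nat where k: "?N / d < real k" using reals_Archimedean2 by blast
    have "?N / d < real (Suc k)" using k by simp
    then have Nk: "?N / real (Suc k) < d" using d(1) by (simp add: field_simps)
    have N1: "?N / real (Suc k) \<le> ?N" by (simp add: field_simps)
    have "\<bar>\<psi> x - \<psi>k k x\<bar> \<le> e * indicator ?B x" for x
    proof -
      let ?p = "grid_point k (grid_index k x)"
      have near: "norm (x - ?p) \<le> ?N / real (Suc k)" by (rule grid_point_near)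
      have tri: "norm ?p \<le> norm x + norm (x - ?p)" "norm x \<le> norm ?p + norm (x - ?p)"
        using norm_triangle_sub[of ?p x] norm_triangle_sub[of x ?p] by (auto simp: norm_minus_commute)
      show ?thesis
      proof (cases "norm x \<le> r + ?N")
        case True
        then have "x \<in> ?K" "?p \<in> ?K" using tri(1) near N1 by auto
        moreover have "dist x ?p < d" using near Nk by (simp add: dist_norm)
        ultimately have "dist (\<psi> x) (\<psi> ?p) < e" using d(2) by blast
        then show ?thesis using True m by (simp add: \<psi>k_def dist_real_def)
      next
        case False
        have "0 \<le> ?N" by simp
        then have "r \<le> norm x" using False by linarith
        moreover have "r \<le> norm ?p" using False tri(2) near N1 by linarith
        ultimately show ?thesis using supp[of x] supp[of ?p] e by (simp add: \<psi>k_def)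
      qed
    qed
    then show ?thesis by blast
  qed
  have close: "\<bar>(\<integral>x. \<psi> x \<partial>\<nu>) - (\<integral>x. \<psi>k k x \<partial>\<nu>)\<bar> \<le> e * measure \<nu> ?B"
    if \<nu>: "\<nu> \<in> growth_measures" and k: "\<And>x. \<bar>\<psi> x - \<psi>k k x\<bar> \<le> e * indicator ?B x" for \<nu> k e
  proof -
    have B_int: "integrable \<nu> (indicator ?B :: real^'n \<Rightarrow> real)"
      by (rule bounded_support_integrable[OF \<nu>, of _ 1 "real m"]) (simp_all add: borel_measurable_indicator)
    have diff: "(\<integral>x. \<psi> x \<partial>\<nu>) - (\<integral>x. \<psi>k k x \<partial>\<nu>) = (\<integral>x. \<psi> x - \<psi>k k x \<partial>\<nu>)"
      using Cc_integrable[OF \<nu> \<psi>] \<psi>k_integral(1)[OF \<nu>] by simp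
    have "norm (\<integral>x. \<psi> x - \<psi>k k x \<partial>\<nu>) \<le> (\<integral>x. e * indicator ?B x \<partial>\<nu>)"
      by (rule Bochner_Integration.integral_norm_bound_integral)
         (use k Cc_integrable[OF \<nu> \<psi>] \<psi>k_integral(1)[OF \<nu>] B_int in auto)
    then show ?thesis unfolding diff by (simp add: growth_space[OF \<nu>])
  qed
  show ?thesis
  proof (rule LIMSEQ_I)
    fix e :: real assume e: "0 < e"
    \<comment> \<open>A bound for the eventual mass of the ball, positive so that it can be divided by.\<close>
    define b where "b = \<bar>c\<bar> * measure L0 ?B + 1"
    have b: "b > 0" unfolding b_def by (intro add_nonneg_pos mult_nonneg_nonneg) auto
    obtain k where k: "\<And>x. \<bar>\<psi> x - \<psi>k k x\<bar> \<le> e / (3 * b) * indicator ?B x"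
      using uniform[of "e / (3 * b)"] e b by auto
    have "\<bar>c * measure L0 ?B\<bar> < b" by (simp add: b_def abs_mult)
    then have "c * measure L0 ?B < b" by simp
    then have "eventually (\<lambda>n. measure (L n) ?B < b) sequentially" by (intro order_tendstoD(2)[OF balls])
    moreover have "eventually (\<lambda>n. dist (\<integral>x. \<psi>k k x \<partial>(L n)) (c * (\<integral>x. \<psi>k k x \<partial>L0)) < e / 3) sequentially"
      using e by (intro tendstoD[OF \<psi>k_conv]) simp
    ultimately have "eventually (\<lambda>n. norm ((\<integral>x. \<psi> x \<partial>(L n)) - c * (\<integral>x. \<psi> x \<partial>L0)) < e) sequentially"
    proof eventually_elim
      case (elim n)
      have eb: "e / (3 * b) * b = e / 3" using b by simp
      have "e / (3 * b) * measure (L n) ?B \<le> e / (3 * b) * b" using elim e b by (intro mult_left_mono) auto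
      then have 1: "\<bar>(\<integral>x. \<psi> x \<partial>(L n)) - (\<integral>x. \<psi>k k x \<partial>(L n))\<bar> \<le> e / 3"
        unfolding eb by (rule order_trans[OF close[OF L k]])
      have "\<bar>c\<bar> * \<bar>(\<integral>x. \<psi> x \<partial>L0) - (\<integral>x. \<psi>k k x \<partial>L0)\<bar> \<le> \<bar>c\<bar> * (e / (3 * b) * measure L0 ?B)"
        by (intro mult_left_mono close[OF L0 k]) simp
      also have "\<dots> = e / (3 * b) * (b - 1)" by (simp add: b_def)
      also have "\<dots> \<le> e / (3 * b) * b" using e b by (intro mult_left_mono) auto
      also note eb
      finally have 2: "\<bar>c * (\<integral>x. \<psi> x \<partial>L0) - c * (\<integral>x. \<psi>k k x \<partial>L0)\<bar> \<le> e / 3"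
        by (simp add: abs_mult right_diff_distrib[symmetric])
      have 3: "\<bar>(\<integral>x. \<psi>k k x \<partial>(L n)) - c * (\<integral>x. \<psi>k k x \<partial>L0)\<bar> < e / 3" using elim by (simp add: dist_real_def)
      show ?case using 1 2 3 unfolding real_norm_def by linarith
    qed
    then show "\<exists>no. \<forall>n\<ge>no. norm ((\<integral>x. \<psi> x \<partial>(L n)) - c * (\<integral>x. \<psi> x \<partial>L0)) < e"
      by (simp add: eventually_sequentially)
  qed
qed

text \<open>The unit ball is squeezed between the continuous functions \<open>h 0 k\<close>, supported in it, and
  \<open>h 1 k\<close>, equal to one on it. Their integrals tend to the volumes of the open and of the closed
  ball, which coincide.\<close>

lemma unit_ball_of_vague_convergence:
  fixes L :: "nat \<Rightarrow> (real^'n::finite) measure"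
  assumes L: "\<And>n. L n \<in> growth_measures"
    and vague: "\<And>\<psi>. \<psi> \<in> Cc \<Longrightarrow> (\<lambda>n. \<integral>x. \<psi> x \<partial>(L n)) \<longlonglongrightarrow> c * (\<integral>x. \<psi> x \<partial>lborel)"
  shows "(\<lambda>n. measure (L n) (ball 0 1)) \<longlonglongrightarrow> c * unit_ball_vol (real CARD('n))"
proof -
  define h where "h s k x = max 0 (min 1 (s + real k * (1 - norm x)))" for s :: real and k :: nat and x :: "real^'n"
  have h01: "0 \<le> h s k x" "h s k x \<le> 1" for s k x by (auto simp: h_def)
  have h_zero: "h s (Suc k) x = 0" if "s \<le> 1" "2 \<le> norm x" for s k x
  proof -
    have "real (Suc k) * (1 - norm x) \<le> 1 * (1 - norm x)" using that by (intro mult_right_mono_neg) auto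
    also have "\<dots> \<le> - s" using that by simp
    finally have "s + real (Suc k) * (1 - norm x) \<le> 0" by (simp del: of_nat_Suc)
    then show ?thesis by (simp add: h_def del: of_nat_Suc)
  qed
  have h_cont: "continuous_on UNIV (h s k)" for s k
    unfolding h_def[abs_def] by (intro continuous_intros)
  have h_bd: "\<bar>h s (Suc k) x\<bar> \<le> 1 * indicator (ball 0 2) x" if "s \<le> 1" for s k x
  proof (cases "norm x < 2")
    case True
    then show ?thesis using h01[of s "Suc k" x] by simp
  next
    case False
    then have "h s (Suc k) x = 0" using that by (intro h_zero) auto
    then show ?thesis using False by simp
  qed
  have h_Cc: "h s (Suc k) \<in> Cc" if s: "s \<le> 1" for s k
  proof -
    have "{x. h s (Suc k) x \<noteq> 0} \<subseteq> cball 0 2"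
      using h_zero[OF s, of _ k] by (force simp: not_less[symmetric])
    then have "bounded {x. h s (Suc k) x \<noteq> 0}" using bounded_subset[OF bounded_cball] by blast
    then show ?thesis unfolding Cc_def using h_cont[of s "Suc k"] by (simp add: compact_eq_bounded_closed bounded_closure)
  qed
  have h_int: "integrable \<nu> (h s (Suc k))" if "s \<le> 1" "\<nu> \<in> growth_measures" for s k \<nu>
    using that by (intro Cc_integrable h_Cc)
  have ball_int: "integrable \<nu> (indicator (ball 0 1) :: real^'n \<Rightarrow> real)" if "\<nu> \<in> growth_measures" for \<nu>
    by (rule bounded_support_integrable[OF that, of _ 1 1]) (simp_all add: borel_measurable_indicator)
  have lower: "(\<integral>x. h 0 (Suc k) x \<partial>(L n)) \<le> measure (L n) (ball 0 1)" for k n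
  proof -
    have "(\<integral>x. h 0 (Suc k) x \<partial>(L n)) \<le> (\<integral>x. indicator (ball 0 1) x \<partial>(L n))"
    proof (rule integral_mono)
      fix x
      show "h 0 (Suc k) x \<le> indicator (ball 0 1) x"
        using h01[of 0 "Suc k" x] mult_nonneg_nonpos[of "real (Suc k)" "1 - norm x"]
        by (cases "norm x < 1") (auto simp: h_def simp del: of_nat_Suc)
    qed (use L ball_int h_int in auto)
    then show ?thesis by (simp add: growth_space[OF L])
  qed
  have upper: "measure (L n) (ball 0 1) \<le> (\<integral>x. h 1 (Suc k) x \<partial>(L n))" for k n
  proof -
    have "(\<integral>x. indicator (ball 0 1) x \<partial>(L n)) \<le> (\<integral>x. h 1 (Suc k) x \<partial>(L n))"
    proof (rule integral_mono)
      fix x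
      show "indicator (ball 0 1) x \<le> h 1 (Suc k) x"
        using h01[of 1 "Suc k" x] mult_nonneg_nonneg[of "real (Suc k)" "1 - norm x"]
        by (cases "norm x < 1") (auto simp: h_def simp del: of_nat_Suc)
    qed (use L ball_int h_int in auto)
    then show ?thesis by (simp add: growth_space[OF L])
  qed
  have small: "eventually (\<lambda>k. a * real (Suc k) \<ge> 1) sequentially" if "a > 0" for a
  proof -
    obtain n where n: "1 / a < real n" using reals_Archimedean2 by blast
    show ?thesis
      using eventually_ge_at_top[of n]
    proof eventually_elim
      case (elim k)
      then have "1 / a \<le> real (Suc k)" using n by linarith
      then show ?case using that by (simp add: divide_le_eq mult.commute del: of_nat_Suc)
    qed
  qed
  have pw0: "(\<lambda>k. h 0 (Suc k) x) \<longlonglongrightarrow> indicator (ball 0 1) x" for x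
  proof (cases "norm x < 1")
    case True
    have "eventually (\<lambda>k. 1 = h 0 (Suc k) x) sequentially"
      using small[of "1 - norm x"] True
      by (auto elim!: eventually_mono simp: h_def mult.commute simp del: of_nat_Suc)
    from Lim_transform_eventually[OF tendsto_const this] show ?thesis using True by simp
  next
    case False
    have "h 0 (Suc k) x = 0" for k
      using False mult_nonneg_nonpos[of "real (Suc k)" "1 - norm x"] by (auto simp: h_def simp del: of_nat_Suc)
    then show ?thesis using False by simp
  qed
  have pw1: "(\<lambda>k. h 1 (Suc k) x) \<longlonglongrightarrow> indicator (cball 0 1) x" for x
  proof (cases "norm x \<le> 1")
    case True
    have "h 1 (Suc k) x = 1" for k
      using True mult_nonneg_nonneg[of "real (Suc k)" "1 - norm x"] by (auto simp: h_def simp del: of_nat_Suc)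
    then show ?thesis using True by simp
  next
    case False
    have "eventually (\<lambda>k. 0 = h 1 (Suc k) x) sequentially"
      using small[of "norm x - 1"] False
      by (auto elim!: eventually_mono simp: h_def algebra_simps simp del: of_nat_Suc)
    from Lim_transform_eventually[OF tendsto_const this] show ?thesis using False by simp
  qed
  have h_lim: "(\<lambda>k. \<integral>x. h s (Suc k) x \<partial>lborel) \<longlonglongrightarrow> (\<integral>x. indicator A x \<partial>lborel)"
    if s: "s \<le> 1" and A: "A \<in> sets borel" and pw: "\<And>x. (\<lambda>k. h s (Suc k) x) \<longlonglongrightarrow> indicator A x" for s A
  proof (rule integral_dominated_convergence[where w = "indicator (ball 0 2)"])
    show "integrable lborel (indicator (ball 0 2) :: real^'n \<Rightarrow> real)"
      by (rule bounded_support_integrable[OF lborel_growth, of _ 1 2]) (simp_all add: borel_measurable_indicator)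
    show "AE x in lborel. norm (h s (Suc k) x) \<le> indicator (ball 0 2) x" for k
      using h_bd[OF s, of k] by (intro AE_I2) simp
    show "h s (Suc k) \<in> borel_measurable lborel" for k
      using borel_measurable_continuous_onI[OF h_cont] by simp
  qed (use A pw in auto)
  let ?w = "unit_ball_vol (real CARD('n))"
  have lim0: "(\<lambda>k. c * (\<integral>x. h 0 (Suc k) x \<partial>lborel)) \<longlonglongrightarrow> c * ?w"
    using tendsto_mult[OF tendsto_const h_lim[OF _ _ pw0]] by (simp add: content_ball)
  have lim1: "(\<lambda>k. c * (\<integral>x. h 1 (Suc k) x \<partial>lborel)) \<longlonglongrightarrow> c * ?w"
    using tendsto_mult[OF tendsto_const h_lim[OF _ _ pw1]] by (simp add: content_cball)
  show ?thesis
  proof (rule order_tendstoI)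
    fix a assume "a < c * ?w"
    from order_tendstoD(1)[OF lim0 this] obtain k where k: "a < c * (\<integral>x. h 0 (Suc k) x \<partial>lborel)"
      using eventually_happens' sequentially_bot by blast
    have "(\<lambda>n. \<integral>x. h 0 (Suc k) x \<partial>(L n)) \<longlonglongrightarrow> c * (\<integral>x. h 0 (Suc k) x \<partial>lborel)" by (intro vague h_Cc) simp
    from order_tendstoD(1)[OF this k] show "eventually (\<lambda>n. a < measure (L n) (ball 0 1)) sequentially"
      by (rule eventually_mono) (rule less_le_trans[OF _ lower])
  next
    fix a assume "c * ?w < a"
    from order_tendstoD(2)[OF lim1 this] obtain k where k: "c * (\<integral>x. h 1 (Suc k) x \<partial>lborel) < a"
      using eventually_happens' sequentially_bot by blast
    have "(\<lambda>n. \<integral>x. h 1 (Suc k) x \<partial>(L n)) \<longlonglongrightarrow> c * (\<integral>x. h 1 (Suc k) x \<partial>lborel)" by (intro vague h_Cc) simp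
    from order_tendstoD(2)[OF this k] show "eventually (\<lambda>n. measure (L n) (ball 0 1) < a) sequentially"
      by (rule eventually_mono) (rule le_less_trans[OF upper])
  qed
qed

lemma surface_area_sphere_cart: "surface_area (sphere (0 :: real^'n::finite) 1) / real CARD('n) = unit_ball_vol (real CARD('n))"
proof -
  let ?N = "real CARD('n)"
  have N: "?N / 2 > 0" by simp
  have G: "Gamma (?N / 2 + 1) = ?N / 2 * Gamma (?N / 2)"
    using N by (intro Gamma_plus1) (metis nonpos_Ints_nonpos not_le)
  show ?thesis by (simp add: surface_area_unit_sphere unit_ball_vol_def G mult.commute)
qed

text \<open>Choose \<open>R n\<close> so large that the deviations of the sets up to index \<open>n\<close> are below \<open>(1/2)\<^sup>n\<close>
  in mean. Then for each set the deviations are summable almost everywhere.\<close>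

lemma (in siegel) scales_exist:
  fixes A :: "nat \<Rightarrow> (real^'n) set"
  assumes A: "\<And>j. A j \<in> sets borel" "\<And>j. emeasure lborel (A j) < \<infinity>"
  shows "\<exists>R :: nat \<Rightarrow> real. (\<forall>n. R n > 0) \<and> filterlim R at_top sequentially \<and>
    (AE \<nu> in \<mu>. \<forall>j. (\<lambda>n. measure (rescale (R n) \<nu>) (A j)) \<longlonglongrightarrow> c * measure lborel (A j))"
proof -
  let ?f = "\<lambda>j. indicator (A j) :: real^'n \<Rightarrow> real"
  have mc: "mean_conv (?f j)" for j by (rule mean_conv_indicator[OF A])
  have fm: "?f j \<in> borel_measurable borel" "integrable lborel (?f j)" for j using mc[of j] by (auto simp: mean_conv_def)
  have "\<exists>R. real n + 1 \<le> R \<and> (\<forall>j\<in>{..n}. dev (?f j) R < ennreal ((1/2) ^ n))" for n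
  proof -
    have "eventually (\<lambda>R. \<forall>j\<in>{..n}. dev (?f j) R < ennreal ((1/2) ^ n)) at_top"
    proof (intro eventually_ball_finite ballI finite_atMost)
      fix j
      have "(dev (?f j) \<longlongrightarrow> 0) at_top" using mc[of j] by (simp add: mean_conv_def)
      then show "eventually (\<lambda>R. dev (?f j) R < ennreal ((1/2) ^ n)) at_top" by (rule order_tendstoD) simp
    qed
    then have "eventually (\<lambda>R. real n + 1 \<le> R \<and> (\<forall>j\<in>{..n}. dev (?f j) R < ennreal ((1/2) ^ n))) at_top"
      using eventually_ge_at_top by (rule eventually_conj[rotated])
    then show ?thesis using eventually_happens' trivial_limit_at_top_linorder by blast
  qed
  then obtain R where R: "\<And>n. real n + 1 \<le> R n" "\<And>n j. j \<le> n \<Longrightarrow> dev (?f j) (R n) < ennreal ((1/2) ^ n)"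
    by (metis atMost_iff)
  have Rpos: "R n > 0" for n using R(1)[of n] by linarith
  have "real n \<le> R n" for n using R(1)[of n] by linarith
  then have Rlim: "filterlim R at_top sequentially"
    by (intro filterlim_at_top_mono[OF filterlim_real_sequentially] always_eventually allI)
  have conv: "AE \<nu> in \<mu>. (\<lambda>n. at_scale (R n) (?f j) \<nu>) \<longlonglongrightarrow> c * measure lborel (A j)" for j
  proof -
    \<comment> \<open>The bound holds for the \<open>j\<close>-th set from index \<open>j\<close> on.\<close>
    define h where "h n \<nu> = at_scale (R (n + j)) (?f j) \<nu> - c * measure lborel (A j)" for n \<nu>
    have h_int: "integrable \<mu> (h n)" for n
      unfolding h_def at_scale_def
      by (intro Bochner_Integration.integrable_diff formula(2) dilate_borel integral_dilate(1) fm Rpos) simp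
    have h_le: "(\<integral>\<nu>. \<bar>h n \<nu>\<bar> \<partial>\<mu>) \<le> (1/2) ^ n" for n
    proof -
      have "ennreal (\<integral>\<nu>. \<bar>h n \<nu>\<bar> \<partial>\<mu>) = (\<integral>\<^sup>+\<nu>. ennreal \<bar>h n \<nu>\<bar> \<partial>\<mu>)"
        by (rule nn_integral_eq_integral[symmetric]) (use h_int[of n] in auto)
      also have "\<dots> = dev (?f j) (R (n + j))" by (simp add: dev_def h_def)
      also have "\<dots> \<le> ennreal ((1/2) ^ (n + j))" using R(2)[of j "n + j"] by simp
      also have "\<dots> \<le> ennreal ((1/2) ^ n)" by (intro ennreal_leI power_decreasing) auto
      finally show ?thesis by simp
    qed
    have "AE \<nu> in \<mu>. summable (\<lambda>n. \<bar>h n \<nu>\<bar>)" by (rule AE_summable_of_L1_geometric[OF h_int h_le])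
    then show ?thesis
    proof eventually_elim
      case (elim \<nu>)
      have "(\<lambda>n. h n \<nu>) \<longlonglongrightarrow> 0" by (rule tendsto_rabs_zero_cancel[OF summable_LIMSEQ_zero[OF elim]])
      then have "(\<lambda>n. at_scale (R (n + j)) (?f j) \<nu>) \<longlonglongrightarrow> c * measure lborel (A j)"
        unfolding h_def by (rule LIM_zero_cancel)
      then show ?case by (rule LIMSEQ_offset)
    qed
  qed
  have "AE \<nu> in \<mu>. \<forall>j. (\<lambda>n. at_scale (R n) (?f j) \<nu>) \<longlonglongrightarrow> c * measure lborel (A j)"
    by (simp only: AE_all_countable) (intro allI conv)
  then have "AE \<nu> in \<mu>. \<forall>j. (\<lambda>n. measure (rescale (R n) \<nu>) (A j)) \<longlonglongrightarrow> c * measure lborel (A j)"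
    using AE_space
  proof eventually_elim
    case (elim \<nu>)
    have "measure (rescale (R n) \<nu>) (A j) = at_scale (R n) (?f j) \<nu>" for n j
    proof -
      have \<nu>: "\<nu> \<in> growth_measures" by (rule growth[OF elim(2)])
      have "measure (rescale (R n) \<nu>) (A j) = (\<integral>x. ?f j x \<partial>(rescale (R n) \<nu>))"
        by (simp add: growth_space[OF rescale_growth[OF \<nu> Rpos]])
      also have "\<dots> = at_scale (R n) (?f j) \<nu>"
        unfolding at_scale_def by (rule integral_rescale[OF \<nu> fm(1) Rpos])
      finally show ?thesis .
    qed
    then show ?case using elim(1) by simp
  qed
  then show ?thesis using Rpos Rlim by blast
qed

theorem theorem10p9:
  fixes \<mu> :: "(real ^ 'n::finite) measure measure"
  assumes "CARD('n) > 1"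
    and "siegel_measure \<mu>"
    and "AE \<nu> in \<mu>. \<nu> \<in> even_growth_measures"
  shows "\<exists>R :: nat \<Rightarrow> real. (\<forall>n. R n > 0) \<and> filterlim R at_top sequentially \<and>
    (AE \<nu> in \<mu>.
       (\<forall>g\<in>SL. (\<lambda>n. measure (act (matrix_inv g) (rescale (R n) \<nu>)) (ball 0 1))
          \<longlonglongrightarrow> siegel_constant \<mu> * (surface_area (sphere (0 :: real ^ 'n) 1) / real CARD('n))) \<and>
       (\<forall>\<psi>\<in>Cc. (\<lambda>n. \<integral>x. \<psi> x \<partial>(rescale (R n) \<nu>))
          \<longlonglongrightarrow> siegel_constant \<mu> * (\<integral>x. \<psi> x \<partial>lborel)))"
proof -
  interpret siegel \<mu> by (rule siegel.intro) (use assms in auto)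
  define A :: "(nat \<times> ('n \<Rightarrow> int)) + nat \<Rightarrow> (real^'n) set"
    where "A = case_sum (\<lambda>(k, z). grid_cell k z) (\<lambda>m. ball 0 (real m))"
  have A: "A j \<in> sets borel" "emeasure lborel (A j) < \<infinity>" for j
  proof -
    have "A j \<in> sets borel \<and> bounded (A j)"
      by (cases j) (simp_all add: A_def grid_cell_borel grid_cell_bounded split: prod.split)
    then show "A j \<in> sets borel" "emeasure lborel (A j) < \<infinity>" using emeasure_bounded_finite by blast+
  qed
  obtain R where R: "\<And>n. R n > 0" "filterlim R at_top sequentially"
    and conv: "AE \<nu> in \<mu>. \<forall>j. (\<lambda>n. measure (rescale (R n) \<nu>) (A (from_nat j))) \<longlonglongrightarrow> c * measure lborel (A (from_nat j))"
    using scales_exist[of "\<lambda>j. A (from_nat j)"] A by blast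
  have "AE \<nu> in \<mu>.
       (\<forall>g\<in>SL. (\<lambda>n. measure (act (matrix_inv g) (rescale (R n) \<nu>)) (ball 0 1))
          \<longlonglongrightarrow> c * (surface_area (sphere (0 :: real ^ 'n) 1) / real CARD('n))) \<and>
       (\<forall>\<psi>\<in>Cc. (\<lambda>n. \<integral>x. \<psi> x \<partial>(rescale (R n) \<nu>)) \<longlonglongrightarrow> c * (\<integral>x. \<psi> x \<partial>lborel))"
    using conv AE_space
  proof eventually_elim
    case (elim \<nu>)
    let ?L = "\<lambda>n. rescale (R n) \<nu>"
    have L: "?L n \<in> growth_measures" for n by (rule rescale_growth[OF growth[OF elim(2)] R(1)])
    have sets: "(\<lambda>n. measure (?L n) (A j)) \<longlonglongrightarrow> c * measure lborel (A j)" for j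
      using spec[OF elim(1), of "to_nat j"] by simp
    have vague: "(\<lambda>n. \<integral>x. \<psi> x \<partial>(?L n)) \<longlonglongrightarrow> c * (\<integral>x. \<psi> x \<partial>lborel)" if "\<psi> \<in> Cc" for \<psi>
      using sets[of "Inl (_, _)"] sets[of "Inr _"]
      by (intro vague_convergence_of_grid[OF L lborel_growth _ _ that]) (simp_all add: A_def)
    have "(\<lambda>n. measure (act (matrix_inv g) (?L n)) (ball 0 1)) \<longlonglongrightarrow> c * unit_ball_vol (real CARD('n))"
      if g: "g \<in> SL" for g
    proof (rule unit_ball_of_vague_convergence)
      have h: "matrix_inv g \<in> SL" by (rule SL_inv(1)[OF g])
      show "act (matrix_inv g) (?L n) \<in> growth_measures" for n by (rule act_growth[OF h L])
      fix \<psi> :: "real^'n \<Rightarrow> real" assume \<psi>: "\<psi> \<in> Cc"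
      have "(\<integral>x. \<psi> (matrix_inv g *v x) \<partial>lborel) = (\<integral>x. \<psi> x \<partial>lborel)"
        using integral_act[OF lborel_growth Cc_borel[OF \<psi>], of "matrix_inv g"] by (simp add: lborel_SL_invariant[OF h])
      then show "(\<lambda>n. \<integral>x. \<psi> x \<partial>(act (matrix_inv g) (?L n))) \<longlonglongrightarrow> c * (\<integral>x. \<psi> x \<partial>lborel)"
        using vague[OF Cc_SL[OF h \<psi>]] by (simp only: integral_act[OF L Cc_borel[OF \<psi>]])
    qed
    then show ?case using vague by (auto simp: surface_area_sphere_cart)
  qed
  then show ?thesis using R by blast
qed

end
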